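(* Let $X$ be a complex manifold and $D\subseteq X$ a smooth divisor. Let $L_{D/X}=T_X(-\log D)_{|D}$ be the restriction to $D$ (as an $\mathcal{O}$-module, i.e. $T_X(-\log D)\otimes_{\mathcal{O}_X}\mathcal{O}_D$) of the logarithmic tangent bundle. Then the $\mathcal{O}_D$-module $L_{D/X}$ inherits from $T_X(-\log D)$ a structure of holomorphic Lie algebroid over $D$: the anchor $L_{D/X}\to T_D$ is induced by restricting to $D$ vector fields tangent to $D$, and the bracket of two local sections is obtained by lifting them to local sections of $T_X(-\log D)$, taking the commutator of vector fields, and restricting to $D$. Moreover, as a Lie algebroid over $D$, $L_{D/X}$ is isomorphic to $\mathrm{At}(N_{D/X})$, the Atiyah algebroid of the normal bundle $N_{D/X}=T_{X|D}/T_D$.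
   Context: All objects are holomorphic; a vector bundle is identified with its sheaf of holomorphic sections. A smooth divisor is a smooth closed complex hypersurface. $T_X(-\log D)\subseteq T_X$ is the sheaf of holomorphic vector fields $v$ with $v(I_D)\subseteq I_D$, where $I_D$ is the ideal sheaf of $D$ (vector fields tangent to $D$). If $x_1,\dots,x_n$ are local coordinates with $D=\{x_1=0\}$, it is locally free with frame $x_1\partial_{x_1},\partial_{x_2},\dots,\partial_{x_n}$. It is closed under commutators. A holomorphic Lie algebroid over a complex manifold $Y$ is a holomorphic vector bundle $\mathcal{L}$ with an $\mathcal{O}_Y$-linear map $\rho:\mathcal{L}\to T_Y$ (the anchor) and a $\mathbb{C}$-Lie bracket on its sheaf of sections satisfying $[u,fv]=f[u,v]+\rho(u)(f)v$. An isomorphism of Lie algebroids over $Y$ is an $\mathcal{O}_Y$-linear isomorphism compatible with anchors and brackets. For a holomorphic vector bundle $E$ on $Y$, the Atiyah algebroid $\mathrm{At}(E)$ is the sheaf of $\mathbb{C}$-linear endomorphisms $\Delta$ of the sheaf $E$ for which there is a vector field $\sigma_\Delta\in T_Y$ with $\Delta(fs)=f\,\Delta s+\sigma_\Delta(f)s$ for all $f\in\mathcal{O}_Y$, $s\in E$; the anchor is $\Delta\mapsto\sigma_\Delta$ and the bracket is the commutator of operators. *)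

theory Defs
  imports "HOL-Analysis.Analysis" "HOL-Algebra.Module"
begin

section \<open>Complex manifolds\<close>

text \<open>
  A complex manifold is presented by its underlying topological space and its sheaf of holomorphic
  functions. A function on an open set \<open>U\<close> is an element of \<open>extensional U\<close>, so that equality of
  sections over \<open>U\<close> is equality in HOL, and restriction is \<open>restrict\<close>.
\<close>

record 'a cspace =
  points :: "'a topology"
  hol :: "'a set \<Rightarrow> ('a \<Rightarrow> complex) set"

definition opens :: "'a cspace \<Rightarrow> 'a set \<Rightarrow> 'a set set" where
  "opens X U = {V. openin (points X) V \<and> V \<subseteq> U}"

definition function_sheaf :: "'a cspace \<Rightarrow> bool" where
  "function_sheaf X \<longleftrightarrow>
     (\<forall>U. openin (points X) U \<longrightarrow> hol X U \<subseteq> extensional U) \<and>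
     (\<forall>U V f. openin (points X) U \<longrightarrow> V \<in> opens X U \<longrightarrow> f \<in> hol X U \<longrightarrow> restrict f V \<in> hol X V) \<and>
     (\<forall>U f. openin (points X) U \<longrightarrow> f \<in> extensional U \<longrightarrow>
        (\<forall>p\<in>U. \<exists>V\<in>opens X U. p \<in> V \<and> restrict f V \<in> hol X V) \<longrightarrow> f \<in> hol X U)"

text \<open>The points of \<open>\<complex>\<^sup>n\<close> are the functions in \<open>extensional {..<n}\<close>; coordinates are numbered from 0.\<close>

definition Cn :: "nat \<Rightarrow> (nat \<Rightarrow> complex) topology" where
  "Cn n = product_topology (\<lambda>_. euclidean) {..<n}"

definition complex_differentiable_at :: "nat \<Rightarrow> ((nat \<Rightarrow> complex) \<Rightarrow> complex) \<Rightarrow> (nat \<Rightarrow> complex) \<Rightarrow> bool" where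
  "complex_differentiable_at n f z \<longleftrightarrow>
     (\<exists>a. \<forall>\<epsilon>>0. \<exists>\<delta>>0. \<forall>w\<in>topspace (Cn n). (\<Sum>i<n. cmod (w i - z i)) < \<delta> \<longrightarrow>
        cmod (f w - f z - (\<Sum>i<n. a i * (w i - z i))) \<le> \<epsilon> * (\<Sum>i<n. cmod (w i - z i)))"

definition chart :: "'a cspace \<Rightarrow> nat \<Rightarrow> 'a set \<Rightarrow> ('a \<Rightarrow> nat \<Rightarrow> complex) \<Rightarrow> bool" where
  "chart X n U \<phi> \<longleftrightarrow>
     openin (points X) U \<and> openin (Cn n) (\<phi> ` U) \<and>
     homeomorphic_map (subtopology (points X) U) (subtopology (Cn n) (\<phi> ` U)) \<phi> \<and>
     (\<forall>V\<in>opens X U. \<forall>f\<in>extensional V.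
        f \<in> hol X V \<longleftrightarrow> (\<forall>z\<in>\<phi> ` V. complex_differentiable_at n (f \<circ> inv_into U \<phi>) z))"

text \<open>The dimension is allowed to differ from one connected component to another.\<close>

definition complex_manifold :: "'a cspace \<Rightarrow> bool" where
  "complex_manifold X \<longleftrightarrow>
     Hausdorff_space (points X) \<and> second_countable (points X) \<and> function_sheaf X \<and>
     (\<forall>p\<in>topspace (points X). \<exists>n U \<phi>. p \<in> U \<and> chart X n U \<phi>)"

definition smooth_divisor :: "'a cspace \<Rightarrow> 'a set \<Rightarrow> bool" where
  "smooth_divisor X D \<longleftrightarrow>
     closedin (points X) D \<and>
     (\<forall>p\<in>D. \<exists>n U \<phi>. 0 < n \<and> p \<in> U \<and> chart X n U \<phi> \<and> U \<inter> D = {x\<in>U. \<phi> x 0 = 0})"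

text \<open>\<open>\<O>\<^sub>D = \<O>\<^sub>X / I\<^sub>D\<close>: the functions on \<open>D\<close> that extend locally to holomorphic functions on \<open>X\<close>.\<close>

definition subspace_of :: "'a cspace \<Rightarrow> 'a set \<Rightarrow> 'a cspace" where
  "subspace_of X D =
     \<lparr>points = subtopology (points X) D,
      hol = (\<lambda>V. {f \<in> extensional V. \<forall>p\<in>V. \<exists>U. openin (points X) U \<and> p \<in> U \<and>
                    (\<exists>g\<in>hol X U. \<forall>x\<in>U \<inter> V. f x = g x)})\<rparr>"


section \<open>Sheaves of modules and vector bundles\<close>

definition hol_ring :: "'a cspace \<Rightarrow> 'a set \<Rightarrow> ('a \<Rightarrow> complex) ring" where
  "hol_ring X U =
     \<lparr>carrier = hol X U, mult = (\<lambda>f g. \<lambda>x\<in>U. f x * g x), one = (\<lambda>x\<in>U. 1),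
      zero = (\<lambda>x\<in>U. 0), add = (\<lambda>f g. \<lambda>x\<in>U. f x + g x)\<rparr>"

text \<open>
  \<open>res F U V\<close> restricts sections from \<open>U\<close> to \<open>V \<subseteq> U\<close>. The library's record of modules extends that
  of rings; the fields \<open>mult\<close> and \<open>one\<close> play no role for modules.
\<close>

record ('a, 's) msheaf =
  sect :: "'a set \<Rightarrow> ('a \<Rightarrow> complex, 's) module"
  res :: "'a set \<Rightarrow> 'a set \<Rightarrow> 's \<Rightarrow> 's"

abbreviation sections :: "('a, 's) msheaf \<Rightarrow> 'a set \<Rightarrow> 's set" where
  "sections F U \<equiv> carrier (sect F U)"

definition mk_module :: "'s set \<Rightarrow> 's \<Rightarrow> ('s \<Rightarrow> 's \<Rightarrow> 's) \<Rightarrow> ('r \<Rightarrow> 's \<Rightarrow> 's) \<Rightarrow> ('r, 's) module" where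
  "mk_module C z a m =
     \<lparr>carrier = C, mult = undefined, one = undefined, zero = z, add = a, smult = m\<rparr>"

definition sheaf_of_modules :: "'a cspace \<Rightarrow> ('a, 's) msheaf \<Rightarrow> bool" where
  "sheaf_of_modules Y F \<longleftrightarrow>
     (\<forall>U. openin (points Y) U \<longrightarrow>
        module (hol_ring Y U) (sect F U) \<and>
        (\<forall>s\<in>sections F U. res F U U s = s) \<and>
        (\<forall>V\<in>opens Y U.
           (\<forall>s\<in>sections F U. res F U V s \<in> sections F V) \<and>
           (\<forall>s\<in>sections F U. \<forall>t\<in>sections F U.
              res F U V (s \<oplus>\<^bsub>sect F U\<^esub> t) = res F U V s \<oplus>\<^bsub>sect F V\<^esub> res F U V t) \<and>
           (\<forall>f\<in>hol Y U. \<forall>s\<in>sections F U.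
              res F U V (f \<odot>\<^bsub>sect F U\<^esub> s) = restrict f V \<odot>\<^bsub>sect F V\<^esub> res F U V s) \<and>
           (\<forall>W\<in>opens Y V. \<forall>s\<in>sections F U. res F V W (res F U V s) = res F U W s))) \<and>
     (\<forall>\<U> s. (\<forall>U\<in>\<U>. openin (points Y) U \<and> s U \<in> sections F U) \<longrightarrow>
        (\<forall>U\<in>\<U>. \<forall>V\<in>\<U>. res F U (U \<inter> V) (s U) = res F V (U \<inter> V) (s V)) \<longrightarrow>
        (\<exists>!t. t \<in> sections F (\<Union>\<U>) \<and> (\<forall>U\<in>\<U>. res F (\<Union>\<U>) U t = s U)))"

definition local_frame :: "'a cspace \<Rightarrow> ('a, 's) msheaf \<Rightarrow> 'a set \<Rightarrow> nat \<Rightarrow> (nat \<Rightarrow> 's) \<Rightarrow> bool" where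
  "local_frame Y F U r e \<longleftrightarrow>
     (\<forall>i<r. e i \<in> sections F U) \<and>
     (\<forall>V\<in>opens Y U. \<forall>s\<in>sections F V.
        \<exists>!c. c \<in> {..<r} \<rightarrow>\<^sub>E hol Y V \<and>
             s = (\<Oplus>\<^bsub>sect F V\<^esub>i\<in>{..<r}. c i \<odot>\<^bsub>sect F V\<^esub> res F U V (e i)))"

definition vector_bundle :: "'a cspace \<Rightarrow> ('a, 's) msheaf \<Rightarrow> bool" where
  "vector_bundle Y F \<longleftrightarrow>
     sheaf_of_modules Y F \<and>
     (\<forall>p\<in>topspace (points Y). \<exists>U r e. openin (points Y) U \<and> p \<in> U \<and> local_frame Y F U r e)"

definition sheaf_hom ::
  "'a cspace \<Rightarrow> ('a, 's) msheaf \<Rightarrow> ('a, 't) msheaf \<Rightarrow> ('a set \<Rightarrow> 's \<Rightarrow> 't) \<Rightarrow> bool" where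
  "sheaf_hom Y F G \<phi> \<longleftrightarrow>
     (\<forall>U. openin (points Y) U \<longrightarrow>
        (\<forall>s\<in>sections F U. \<phi> U s \<in> sections G U) \<and>
        (\<forall>s\<in>sections F U. \<forall>t\<in>sections F U. \<phi> U (s \<oplus>\<^bsub>sect F U\<^esub> t) = \<phi> U s \<oplus>\<^bsub>sect G U\<^esub> \<phi> U t) \<and>
        (\<forall>f\<in>hol Y U. \<forall>s\<in>sections F U. \<phi> U (f \<odot>\<^bsub>sect F U\<^esub> s) = f \<odot>\<^bsub>sect G U\<^esub> \<phi> U s) \<and>
        (\<forall>V\<in>opens Y U. \<forall>s\<in>sections F U. res G U V (\<phi> U s) = \<phi> V (res F U V s)))"

definition structure_sheaf :: "'a cspace \<Rightarrow> ('a, 'a \<Rightarrow> complex) msheaf" where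
  "structure_sheaf X =
     \<lparr>sect = (\<lambda>U. mk_module (hol X U) \<zero>\<^bsub>hol_ring X U\<^esub> (add (hol_ring X U)) (mult (hol_ring X U))),
      res = (\<lambda>U V f. restrict f V)\<rparr>"


section \<open>Sheaves of differential operators: vector fields and the Atiyah algebroid\<close>

text \<open>
  A \<open>\<complex>\<close>-linear endomorphism over \<open>U\<close> of the sheaf \<open>E\<close> is a family of maps \<open>E(V) \<rightarrow> E(V)\<close>, one for each
  open \<open>V \<subseteq> U\<close>, that commutes with restrictions.
\<close>

type_synonym ('a, 's) operator = "'a set \<Rightarrow> 's \<Rightarrow> 's"

definition sheaf_endos :: "'a cspace \<Rightarrow> ('a, 's) msheaf \<Rightarrow> 'a set \<Rightarrow> ('a, 's) operator set" where
  "sheaf_endos Y E U =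
     {\<Delta> \<in> extensional (opens Y U). \<forall>V\<in>opens Y U.
        \<Delta> V \<in> sections E V \<rightarrow>\<^sub>E sections E V \<and>
        (\<forall>s\<in>sections E V. \<forall>t\<in>sections E V. \<Delta> V (s \<oplus>\<^bsub>sect E V\<^esub> t) = \<Delta> V s \<oplus>\<^bsub>sect E V\<^esub> \<Delta> V t) \<and>
        (\<forall>c. \<forall>s\<in>sections E V.
           \<Delta> V ((\<lambda>x\<in>V. c) \<odot>\<^bsub>sect E V\<^esub> s) = (\<lambda>x\<in>V. c) \<odot>\<^bsub>sect E V\<^esub> \<Delta> V s) \<and>
        (\<forall>W\<in>opens Y V. \<forall>s\<in>sections E V. res E V W (\<Delta> V s) = \<Delta> W (res E V W s))}"

text \<open>The sheaf of operators on \<open>E\<close> whose sections over \<open>U\<close> are the elements of \<open>S U\<close>.\<close>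

definition operator_sheaf ::
  "'a cspace \<Rightarrow> ('a, 's) msheaf \<Rightarrow> ('a set \<Rightarrow> ('a, 's) operator set) \<Rightarrow> ('a, ('a, 's) operator) msheaf" where
  "operator_sheaf Y E S =
     \<lparr>sect = (\<lambda>U. mk_module (S U)
        (\<lambda>V\<in>opens Y U. \<lambda>s\<in>sections E V. \<zero>\<^bsub>sect E V\<^esub>)
        (\<lambda>\<Delta> \<Delta>'. \<lambda>V\<in>opens Y U. \<lambda>s\<in>sections E V. \<Delta> V s \<oplus>\<^bsub>sect E V\<^esub> \<Delta>' V s)
        (\<lambda>f \<Delta>. \<lambda>V\<in>opens Y U. \<lambda>s\<in>sections E V. restrict f V \<odot>\<^bsub>sect E V\<^esub> \<Delta> V s)),
      res = (\<lambda>U V \<Delta>. restrict \<Delta> (opens Y V))\<rparr>"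

definition commutator ::
  "'a cspace \<Rightarrow> ('a, 's) msheaf \<Rightarrow> 'a set \<Rightarrow> ('a, 's) operator \<Rightarrow> ('a, 's) operator \<Rightarrow> ('a, 's) operator" where
  "commutator Y E U \<Delta> \<Delta>' =
     (\<lambda>V\<in>opens Y U. \<lambda>s\<in>sections E V. \<Delta> V (\<Delta>' V s) \<ominus>\<^bsub>sect E V\<^esub> \<Delta>' V (\<Delta> V s))"

text \<open>Holomorphic vector fields on \<open>U\<close> are the derivations of the sheaf of holomorphic functions on \<open>U\<close>.\<close>

type_synonym 'a vfield = "('a, 'a \<Rightarrow> complex) operator"

definition vector_fields :: "'a cspace \<Rightarrow> 'a set \<Rightarrow> 'a vfield set" where
  "vector_fields X U =
     {v \<in> sheaf_endos X (structure_sheaf X) U.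
        \<forall>V\<in>opens X U. \<forall>f\<in>hol X V. \<forall>g\<in>hol X V.
          v V (f \<otimes>\<^bsub>hol_ring X V\<^esub> g) =
            f \<otimes>\<^bsub>hol_ring X V\<^esub> v V g \<oplus>\<^bsub>hol_ring X V\<^esub> v V f \<otimes>\<^bsub>hol_ring X V\<^esub> g}"

definition tangent_sheaf :: "'a cspace \<Rightarrow> ('a, 'a vfield) msheaf" where
  "tangent_sheaf X = operator_sheaf X (structure_sheaf X) (vector_fields X)"

abbreviation vf_bracket :: "'a cspace \<Rightarrow> 'a set \<Rightarrow> 'a vfield \<Rightarrow> 'a vfield \<Rightarrow> 'a vfield" where
  "vf_bracket X \<equiv> commutator X (structure_sheaf X)"

definition ideal_sheaf :: "'a cspace \<Rightarrow> 'a set \<Rightarrow> 'a set \<Rightarrow> ('a \<Rightarrow> complex) set" where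
  "ideal_sheaf X D U = {f \<in> hol X U. \<forall>x\<in>U \<inter> D. f x = 0}"

definition log_tangent_sheaf :: "'a cspace \<Rightarrow> 'a set \<Rightarrow> ('a, 'a vfield) msheaf" where
  "log_tangent_sheaf X D = operator_sheaf X (structure_sheaf X)
     (\<lambda>U. {v \<in> vector_fields X U. \<forall>V\<in>opens X U. v V ` ideal_sheaf X D V \<subseteq> ideal_sheaf X D V})"

definition is_symbol ::
  "'a cspace \<Rightarrow> ('a, 's) msheaf \<Rightarrow> 'a set \<Rightarrow> ('a, 's) operator \<Rightarrow> 'a vfield \<Rightarrow> bool" where
  "is_symbol Y E U \<Delta> \<sigma> \<longleftrightarrow>
     \<sigma> \<in> vector_fields Y U \<and>
     (\<forall>V\<in>opens Y U. \<forall>f\<in>hol Y V. \<forall>s\<in>sections E V.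
        \<Delta> V (f \<odot>\<^bsub>sect E V\<^esub> s) = f \<odot>\<^bsub>sect E V\<^esub> \<Delta> V s \<oplus>\<^bsub>sect E V\<^esub> \<sigma> V f \<odot>\<^bsub>sect E V\<^esub> s)"

definition atiyah_sheaf :: "'a cspace \<Rightarrow> ('a, 's) msheaf \<Rightarrow> ('a, ('a, 's) operator) msheaf" where
  "atiyah_sheaf Y E = operator_sheaf Y E (\<lambda>U. {\<Delta> \<in> sheaf_endos Y E U. \<exists>\<sigma>. is_symbol Y E U \<Delta> \<sigma>})"

text \<open>The symbol is unique as soon as \<open>E\<close> has nowhere rank 0, as is the case for a normal line bundle.\<close>

definition atiyah_anchor ::
  "'a cspace \<Rightarrow> ('a, 's) msheaf \<Rightarrow> 'a set \<Rightarrow> ('a, 's) operator \<Rightarrow> 'a vfield" where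
  "atiyah_anchor Y E U \<Delta> = (THE \<sigma>. is_symbol Y E U \<Delta> \<sigma>)"


section \<open>Lie algebroids\<close>

definition lie_algebroid ::
  "'a cspace \<Rightarrow> ('a, 's) msheaf \<Rightarrow> ('a set \<Rightarrow> 's \<Rightarrow> 'a vfield) \<Rightarrow> ('a set \<Rightarrow> 's \<Rightarrow> 's \<Rightarrow> 's) \<Rightarrow> bool" where
  "lie_algebroid Y L \<rho> \<beta> \<longleftrightarrow>
     complex_manifold Y \<and> vector_bundle Y L \<and> sheaf_hom Y L (tangent_sheaf Y) \<rho> \<and>
     (\<forall>U. openin (points Y) U \<longrightarrow>
        (\<forall>u\<in>sections L U. \<forall>v\<in>sections L U.
           \<beta> U u v \<in> sections L U \<and>
           (\<forall>V\<in>opens Y U. res L U V (\<beta> U u v) = \<beta> V (res L U V u) (res L U V v)) \<and>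
           (\<forall>w\<in>sections L U.
              \<beta> U (u \<oplus>\<^bsub>sect L U\<^esub> v) w = \<beta> U u w \<oplus>\<^bsub>sect L U\<^esub> \<beta> U v w \<and>
              \<beta> U w (u \<oplus>\<^bsub>sect L U\<^esub> v) = \<beta> U w u \<oplus>\<^bsub>sect L U\<^esub> \<beta> U w v \<and>
              \<beta> U u (\<beta> U v w) \<oplus>\<^bsub>sect L U\<^esub> \<beta> U v (\<beta> U w u) \<oplus>\<^bsub>sect L U\<^esub> \<beta> U w (\<beta> U u v) = \<zero>\<^bsub>sect L U\<^esub>) \<and>
           (\<forall>c. \<beta> U ((\<lambda>x\<in>U. c) \<odot>\<^bsub>sect L U\<^esub> u) v = (\<lambda>x\<in>U. c) \<odot>\<^bsub>sect L U\<^esub> \<beta> U u v \<and>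
                \<beta> U u ((\<lambda>x\<in>U. c) \<odot>\<^bsub>sect L U\<^esub> v) = (\<lambda>x\<in>U. c) \<odot>\<^bsub>sect L U\<^esub> \<beta> U u v) \<and>
           \<beta> U u u = \<zero>\<^bsub>sect L U\<^esub> \<and>
           (\<forall>f\<in>hol Y U.
              \<beta> U u (f \<odot>\<^bsub>sect L U\<^esub> v) =
                f \<odot>\<^bsub>sect L U\<^esub> \<beta> U u v \<oplus>\<^bsub>sect L U\<^esub> \<rho> U u U f \<odot>\<^bsub>sect L U\<^esub> v)))"

definition lie_algebroid_isomorphic ::
  "'a cspace \<Rightarrow>
   ('a, 's) msheaf \<Rightarrow> ('a set \<Rightarrow> 's \<Rightarrow> 'a vfield) \<Rightarrow> ('a set \<Rightarrow> 's \<Rightarrow> 's \<Rightarrow> 's) \<Rightarrow>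
   ('a, 't) msheaf \<Rightarrow> ('a set \<Rightarrow> 't \<Rightarrow> 'a vfield) \<Rightarrow> ('a set \<Rightarrow> 't \<Rightarrow> 't \<Rightarrow> 't) \<Rightarrow> bool" where
  "lie_algebroid_isomorphic Y L \<rho> \<beta> L' \<rho>' \<beta>' \<longleftrightarrow>
     lie_algebroid Y L \<rho> \<beta> \<and> lie_algebroid Y L' \<rho>' \<beta>' \<and>
     (\<exists>\<phi>. sheaf_hom Y L L' \<phi> \<and>
        (\<forall>U. openin (points Y) U \<longrightarrow>
           bij_betw (\<phi> U) (sections L U) (sections L' U) \<and>
           (\<forall>u\<in>sections L U. \<rho>' U (\<phi> U u) = \<rho> U u) \<and>
           (\<forall>u\<in>sections L U. \<forall>v\<in>sections L U. \<phi> U (\<beta> U u v) = \<beta>' U (\<phi> U u) (\<phi> U v))))"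


section \<open>Quotient sheaves and restriction to a subspace\<close>

text \<open>
  The germ at \<open>p\<close>, modulo \<open>G\<close>, of the section \<open>s\<close> of \<open>F\<close> over \<open>U\<close>: an element of the stalk \<open>F\<^sub>p / G\<^sub>p\<close>,
  represented as the set of all pairs of a neighbourhood of \<open>p\<close> and a section over it with this germ.
\<close>

definition germ_mod ::
  "'a cspace \<Rightarrow> ('a, 's) msheaf \<Rightarrow> ('a set \<Rightarrow> 's set) \<Rightarrow> 'a set \<Rightarrow> 's \<Rightarrow> 'a \<Rightarrow> ('a set \<times> 's) set" where
  "germ_mod X F G U s p =
     {(U', s'). openin (points X) U' \<and> p \<in> U' \<and> s' \<in> sections F U' \<and>
        (\<exists>W\<in>opens X (U \<inter> U'). p \<in> W \<and> res F U W s \<ominus>\<^bsub>sect F W\<^esub> res F U' W s' \<in> G W)}"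

text \<open>
  For \<open>i : D \<rightarrow> X\<close> the inclusion of a subspace and \<open>G \<subseteq> F\<close> with \<open>I\<^sub>D F \<subseteq> G\<close>, the following is the
  sheaf \<open>i\<^sup>-\<^sup>1(F/G)\<close> of \<open>\<O>\<^sub>D\<close>-modules: its sections over an open subset \<open>V\<close> of \<open>D\<close> are the families of
  elements of the stalks \<open>F\<^sub>p / G\<^sub>p\<close>, \<open>p \<in> V\<close>, that are locally induced by sections of \<open>F\<close> on open
  subsets of \<open>X\<close>. Sums and products are those of representatives (the unions below are unions of
  equal sets); a function on \<open>V\<close> acts through its local holomorphic extensions \<open>h\<close> to \<open>X\<close>.
\<close>

type_synonym ('a, 's) qsection = "'a \<Rightarrow> ('a set \<times> 's) set"

definition germ_sheaf ::
  "'a cspace \<Rightarrow> ('a, 's) msheaf \<Rightarrow> ('a set \<Rightarrow> 's set) \<Rightarrow> ('a, ('a, 's) qsection) msheaf" where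
  "germ_sheaf X F G =
     \<lparr>sect = (\<lambda>V. mk_module
        {t \<in> extensional V. \<forall>p\<in>V. \<exists>U. openin (points X) U \<and> p \<in> U \<and>
           (\<exists>s\<in>sections F U. \<forall>q\<in>U \<inter> V. t q = germ_mod X F G U s q)}
        (\<lambda>p\<in>V. germ_mod X F G (topspace (points X)) \<zero>\<^bsub>sect F (topspace (points X))\<^esub> p)
        (\<lambda>t t'. \<lambda>p\<in>V. \<Union>(U, s)\<in>t p. \<Union>(U', s')\<in>t' p.
           germ_mod X F G (U \<inter> U') (res F U (U \<inter> U') s \<oplus>\<^bsub>sect F (U \<inter> U')\<^esub> res F U' (U \<inter> U') s') p)
        (\<lambda>f t. \<lambda>p\<in>V.
           \<Union>(W, h)\<in>{(W, h). openin (points X) W \<and> p \<in> W \<and> h \<in> hol X W \<and> (\<forall>x\<in>W \<inter> V. h x = f x)}.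
           \<Union>(U, s)\<in>t p.
           germ_mod X F G (W \<inter> U) (restrict h (W \<inter> U) \<odot>\<^bsub>sect F (W \<inter> U)\<^esub> res F U (W \<inter> U) s) p)),
      res = (\<lambda>V V' t. restrict t V')\<rparr>"

definition ideal_times :: "'a cspace \<Rightarrow> 'a set \<Rightarrow> ('a, 's) msheaf \<Rightarrow> 'a set \<Rightarrow> 's set" where
  "ideal_times X D F U =
     {\<Oplus>\<^bsub>sect F U\<^esub>i\<in>{..<k}. f i \<odot>\<^bsub>sect F U\<^esub> s i | (k::nat) f s.
        f \<in> {..<k} \<rightarrow> ideal_sheaf X D U \<and> s \<in> {..<k} \<rightarrow> sections F U}"

text \<open>\<open>F\<^bsub>|D\<^esub> = F \<otimes> \<O>\<^sub>D = F / I\<^sub>D F\<close>, since \<open>\<O>\<^sub>D = \<O>\<^sub>X / I\<^sub>D\<close>.\<close>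

definition restrict_sheaf ::
  "'a cspace \<Rightarrow> 'a set \<Rightarrow> ('a, 's) msheaf \<Rightarrow> ('a, ('a, 's) qsection) msheaf" where
  "restrict_sheaf X D F = germ_sheaf X F (ideal_times X D F)"

definition restrict_section ::
  "'a cspace \<Rightarrow> 'a set \<Rightarrow> ('a, 's) msheaf \<Rightarrow> 'a set \<Rightarrow> 's \<Rightarrow> ('a, 's) qsection" where
  "restrict_section X D F U s = (\<lambda>p\<in>U \<inter> D. germ_mod X F (ideal_times X D F) U s p)"


section \<open>The normal bundle and the algebroid of a smooth divisor\<close>

text \<open>
  The vector field \<open>v\<close> on the open subset \<open>U\<close> of \<open>X\<close> is tangent to \<open>D\<close> and the vector field \<open>w\<close> on
  \<open>U \<inter> D\<close> is its restriction: \<open>v(f)\<^bsub>|D\<^esub> = w(f\<^bsub>|D\<^esub>)\<close> for all local functions \<open>f\<close>.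
\<close>

definition restricts_to :: "'a cspace \<Rightarrow> 'a set \<Rightarrow> 'a set \<Rightarrow> 'a vfield \<Rightarrow> 'a vfield \<Rightarrow> bool" where
  "restricts_to X D U v w \<longleftrightarrow>
     (\<forall>V\<in>opens X U. \<forall>f\<in>hol X V. restrict (v V f) (V \<inter> D) = w (V \<inter> D) (restrict f (V \<inter> D)))"

text \<open>
  The image of the differential \<open>T\<^sub>D \<rightarrow> T\<^bsub>X|D\<^esub>\<close> of the inclusion: it maps \<open>w\<close> to the section \<open>t\<close> whose
  local representatives \<open>v\<close> satisfy \<open>v(f)\<^bsub>|D\<^esub> = w(f\<^bsub>|D\<^esub>)\<close>.
\<close>

definition tangent_image :: "'a cspace \<Rightarrow> 'a set \<Rightarrow> 'a set \<Rightarrow> ('a, 'a vfield) qsection set" where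
  "tangent_image X D V =
     {t \<in> sections (restrict_sheaf X D (tangent_sheaf X)) V.
        \<exists>w\<in>vector_fields (subspace_of X D) V.
          \<forall>U v. openin (points X) U \<longrightarrow> U \<inter> D \<subseteq> V \<longrightarrow> v \<in> vector_fields X U \<longrightarrow>
            restrict t (U \<inter> D) = restrict_section X D (tangent_sheaf X) U v \<longrightarrow>
            restricts_to X D U v w}"

definition normal_bundle :: "'a cspace \<Rightarrow> 'a set \<Rightarrow> ('a, ('a, ('a, 'a vfield) qsection) qsection) msheaf" where
  "normal_bundle X D =
     germ_sheaf (subspace_of X D) (restrict_sheaf X D (tangent_sheaf X)) (tangent_image X D)"

definition log_restriction :: "'a cspace \<Rightarrow> 'a set \<Rightarrow> ('a, ('a, 'a vfield) qsection) msheaf" where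
  "log_restriction X D = restrict_sheaf X D (log_tangent_sheaf X D)"

text \<open>
  Every section of \<open>log_restriction X D\<close> is locally of the form \<open>u\<^bsub>|D\<^esub>\<close>, so that an anchor and a bracket
  that commute with restrictions are determined by the following two conditions.
\<close>

definition anchor_by_restriction ::
  "'a cspace \<Rightarrow> 'a set \<Rightarrow> ('a set \<Rightarrow> ('a, 'a vfield) qsection \<Rightarrow> 'a vfield) \<Rightarrow> bool" where
  "anchor_by_restriction X D \<rho> \<longleftrightarrow>
     (\<forall>U. openin (points X) U \<longrightarrow> (\<forall>u\<in>sections (log_tangent_sheaf X D) U.
        restricts_to X D U u (\<rho> (U \<inter> D) (restrict_section X D (log_tangent_sheaf X D) U u))))"

definition bracket_by_lifting ::
  "'a cspace \<Rightarrow> 'a set \<Rightarrow>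
   ('a set \<Rightarrow> ('a, 'a vfield) qsection \<Rightarrow> ('a, 'a vfield) qsection \<Rightarrow> ('a, 'a vfield) qsection) \<Rightarrow> bool" where
  "bracket_by_lifting X D \<beta> \<longleftrightarrow>
     (\<forall>U. openin (points X) U \<longrightarrow>
        (\<forall>u\<in>sections (log_tangent_sheaf X D) U. \<forall>v\<in>sections (log_tangent_sheaf X D) U.
           \<beta> (U \<inter> D) (restrict_section X D (log_tangent_sheaf X D) U u)
                     (restrict_section X D (log_tangent_sheaf X D) U v) =
             restrict_section X D (log_tangent_sheaf X D) U (vf_bracket X U u v)))"

end

theory Submission
  imports Defs "HOL-Complex_Analysis.Complex_Analysis"
begin

text \<open>
  A vector field \<open>u\<close> tangent to \<open>D\<close> acts on all vector fields by \<open>v \<mapsto> [u, v]\<close> and preserves those tangent to \<open>D\<close>,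
  hence acts on \<open>N = T\<^bsub>X|D\<^esub> / T\<^sub>D\<close>. If \<open>f \<in> I\<^sub>D\<close>, then \<open>[f u, v] = f [u, v] - v(f) u\<close> is tangent to \<open>D\<close> along \<open>D\<close>, so the action only
  depends on \<open>u\<^bsub>|D\<^esub>\<close>; by the Leibniz rule its symbol is the restriction of \<open>u\<close> to \<open>D\<close>, and by the Jacobi identity it respects
  brackets. In coordinates with \<open>D = {x\<^sub>0 = 0}\<close>, the field \<open>c\<^sub>0 x\<^sub>0 \<partial>\<^sub>0 + \<Sum>\<^sub>i c\<^sub>i \<partial>\<^sub>i\<close> maps the generator \<open>\<partial>\<^sub>0\<close> of \<open>N\<close> to \<open>-c\<^sub>0 \<partial>\<^sub>0\<close>
  and has symbol \<open>\<Sum>\<^sub>i c\<^sub>i \<partial>\<^sub>i\<close>. These data determine the operator and can be prescribed, so the action is an isomorphism onto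
  the Atiyah algebroid. That functions on \<open>D\<close> have coordinate derivatives, and fields coordinate expressions, rests on
  Osgood's lemma and on dividing a function by a coordinate on whose zero locus it vanishes.
\<close>

section \<open>Holomorphic functions of several variables\<close>

text \<open>Two obstacles shape the proof. Functions are holomorphic by being complex differentiable
  at each point and vector fields are abstract derivations, so there are neither derivatives nor
  components to start from. \<open>holo\<close>, continuity plus holomorphy in each variable, is the
  working notion; division by a coordinate then plays the role of Taylor's formula and yields the
  components of a derivation as well as a local frame of the restriction of
  \<open>T\<^sub>X(-log D)\<close>. Secondly, \<open>I\<^sub>D T\<^sub>X(-log D)\<close> is smaller
  than the module of tangent fields that vanish on \<open>D\<close>: the field
  \<open>x\<^sub>0 \<partial>\<^sub>0\<close> vanishes there, is nonzero in the restriction, and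
  spans the kernel of the anchor. Its coefficient is therefore read off from a derivative,
  \<open>\<partial>\<^sub>0 (u x\<^sub>0)\<close> on \<open>D\<close>, and not from a value.
  Sections of all quotients are families of germs, so identities are checked on common local lifts
  (\<open>lft\<close>, \<open>nlft\<close>), and each operation needs one proof that it does not
  depend on the lift. The Atiyah sheaf receives its bundle and algebroid structure last, by
  transport along the bijection.\<close>

definition box_Cn :: "nat \<Rightarrow> (nat \<Rightarrow> complex) \<Rightarrow> real \<Rightarrow> (nat \<Rightarrow> complex) set" where
  "box_Cn n z r = {w \<in> extensional {..<n}. \<forall>i<n. cmod (w i - z i) < r}"

lemma topspace_Cn: "topspace (Cn n) = extensional {..<n}"
  by (auto simp: Cn_def PiE_def)

text \<open>Finitely many coordinates admit a common radius, so polydiscs form a basis. From here on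
  the topology of \<open>Cn n\<close> is handled by radii.\<close>

lemma openin_Cn:
  "openin (Cn n) S \<longleftrightarrow> S \<subseteq> extensional {..<n} \<and> (\<forall>z\<in>S. \<exists>r>0. box_Cn n z r \<subseteq> S)"
proof (intro iffI conjI ballI)
  assume S: "openin (Cn n) S"
  then show "S \<subseteq> extensional {..<n}" using openin_subset[OF S] by (simp add: topspace_Cn)
  fix z assume z: "z \<in> S"
  obtain U where U: "\<forall>i\<in>{..<n}. openin euclidean (U i :: complex set)" "z \<in> Pi\<^sub>E {..<n} U" "Pi\<^sub>E {..<n} U \<subseteq> S"
    using S z unfolding Cn_def openin_product_topology_alt by metis
  have U': "open (U i)" if "i < n" for i using U(1) that by simp
  have "\<forall>i<n. \<exists>e>0. ball (z i) e \<subseteq> U i"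
    using U(2) U' by (auto simp: PiE_def Pi_def open_contains_ball)
  then obtain e where e: "\<And>i. i < n \<Longrightarrow> e i > 0 \<and> ball (z i) (e i) \<subseteq> U i" by metis
  \<comment> \<open>\<open>insert 1\<close> keeps the set nonempty when
    \<open>n = 0\<close>.\<close>
  define r where "r = Min (insert 1 (e ` {..<n}))"
  have r: "r > 0" unfolding r_def using e by (subst Min_gr_iff) auto
  have re: "r \<le> e i" if "i < n" for i unfolding r_def using that by (intro Min_le) auto
  have "box_Cn n z r \<subseteq> Pi\<^sub>E {..<n} U"
  proof
    fix w assume w: "w \<in> box_Cn n z r"
    have "w i \<in> U i" if i: "i < n" for i
    proof -
      have "cmod (w i - z i) < e i" using w i re[OF i] by (auto simp: box_Cn_def intro: less_le_trans)
      then show ?thesis using e[OF i] by (auto simp: dist_norm norm_minus_commute subset_iff)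
    qed
    then show "w \<in> Pi\<^sub>E {..<n} U" using w by (auto simp: box_Cn_def PiE_def)
  qed
  then show "\<exists>r>0. box_Cn n z r \<subseteq> S" using U r by blast
next
  assume *: "S \<subseteq> extensional {..<n} \<and> (\<forall>z\<in>S. \<exists>r>0. box_Cn n z r \<subseteq> S)"
  show "openin (Cn n) S" unfolding Cn_def openin_product_topology_alt
  proof
    fix z assume z: "z \<in> S"
    then obtain r where r: "r > 0" "box_Cn n z r \<subseteq> S" using * by blast
    show "\<exists>U. finite {i \<in> {..<n}. U i \<noteq> topspace euclidean} \<and> (\<forall>i\<in>{..<n}. openin euclidean (U i)) \<and> z \<in> Pi\<^sub>E {..<n} U \<and> Pi\<^sub>E {..<n} U \<subseteq> S"
    proof (intro exI conjI)
      show "z \<in> Pi\<^sub>E {..<n} (\<lambda>i. ball (z i) r)" using z r * by (auto simp: PiE_def)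
      show "Pi\<^sub>E {..<n} (\<lambda>i. ball (z i) r) \<subseteq> S"
        using r by (auto simp: PiE_def Pi_def box_Cn_def dist_norm norm_minus_commute subset_iff)
    qed auto
  qed
qed

lemma box_Cn_mono: "r \<le> s \<Longrightarrow> box_Cn n z r \<subseteq> box_Cn n z s"
  by (auto simp: box_Cn_def)

lemma centre_in_box_Cn: "z \<in> extensional {..<n} \<Longrightarrow> r > 0 \<Longrightarrow> z \<in> box_Cn n z r"
  by (auto simp: box_Cn_def)

lemma openin_box_Cn: "openin (Cn n) (box_Cn n z r)"
  unfolding openin_Cn
proof (intro conjI ballI)
  fix w assume w: "w \<in> box_Cn n z r"
  define s where "s = Min (insert 1 ((\<lambda>i. r - cmod (w i - z i)) ` {..<n}))"
  have "s > 0" unfolding s_def using w by (subst Min_gr_iff) (auto simp: box_Cn_def)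
  moreover have s: "s \<le> r - cmod (w i - z i)" if "i < n" for i
    unfolding s_def using that by (intro Min_le) auto
  have "box_Cn n w s \<subseteq> box_Cn n z r"
  proof (intro subsetI)
    fix x assume x: "x \<in> box_Cn n w s"
    have "cmod (x i - z i) < r" if i: "i < n" for i
    proof -
      have "cmod (x i - w i) < r - cmod (w i - z i)" using x s[OF i] i by (auto simp: box_Cn_def intro: less_le_trans)
      then show ?thesis using norm_triangle_ineq[of "x i - w i" "w i - z i"] by simp
    qed
    then show "x \<in> box_Cn n z r" using x by (auto simp: box_Cn_def)
  qed
  ultimately show "\<exists>s>0. box_Cn n w s \<subseteq> box_Cn n z r" by blast
qed (auto simp: box_Cn_def)

lemma sum_lt_in_box_Cn:
  "w \<in> extensional {..<n} \<Longrightarrow> (\<Sum>i<n. cmod (w i - z i)) < r \<Longrightarrow> w \<in> box_Cn n z r"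
  unfolding box_Cn_def
  by (auto intro: le_less_trans[OF member_le_sum[of _ "{..<n}" "\<lambda>i. cmod (w i - z i)"]])

lemma continuous_map_Cn:
  fixes f :: "(nat \<Rightarrow> complex) \<Rightarrow> complex"
  assumes S: "openin (Cn n) S"
  shows "continuous_map (subtopology (Cn n) S) euclidean f \<longleftrightarrow>
    (\<forall>z\<in>S. \<forall>\<epsilon>>0. \<exists>\<delta>>0. \<forall>w\<in>S \<inter> box_Cn n z \<delta>. cmod (f w - f z) < \<epsilon>)" (is "?L \<longleftrightarrow> ?R")
proof
  assume L: ?L
  show ?R
  proof (intro ballI allI impI)
    fix z and \<epsilon> :: real assume z: "z \<in> S" and e: "\<epsilon> > 0"
    have ts: "topspace (Cn n) \<inter> S = S" using openin_subset[OF S] by blast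
    have "openin (subtopology (Cn n) S) {x \<in> S. f x \<in> ball (f z) \<epsilon>}"
      using L unfolding continuous_map by (auto simp: ts)
    then have "openin (Cn n) {x \<in> S. f x \<in> ball (f z) \<epsilon>}"
      using S by (simp add: openin_open_subtopology)
    then obtain \<delta> where "\<delta> > 0" "box_Cn n z \<delta> \<subseteq> {x \<in> S. f x \<in> ball (f z) \<epsilon>}"
      using z e unfolding openin_Cn by fastforce
    then show "\<exists>\<delta>>0. \<forall>w\<in>S \<inter> box_Cn n z \<delta>. cmod (f w - f z) < \<epsilon>"
      by (auto simp: dist_norm norm_minus_commute subset_iff)
  qed
next
  assume R: ?R
  have ts: "topspace (Cn n) \<inter> S = S" using openin_subset[OF S] by blast
  show ?L unfolding continuous_map
  proof (intro conjI allI impI)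
    fix U :: "complex set" assume U: "openin euclidean U"
    have "openin (Cn n) {x \<in> S. f x \<in> U}" unfolding openin_Cn
    proof (intro conjI ballI)
      show "{x \<in> S. f x \<in> U} \<subseteq> extensional {..<n}" using S by (auto simp: openin_Cn)
      fix z assume z: "z \<in> {x \<in> S. f x \<in> U}"
      then obtain e where e: "e > 0" "ball (f z) e \<subseteq> U" using U by (auto simp: open_contains_ball)
      obtain d where d: "d > 0" "\<forall>w\<in>S \<inter> box_Cn n z d. cmod (f w - f z) < e" using R z e by blast
      obtain r where r: "r > 0" "box_Cn n z r \<subseteq> S" using S z unfolding openin_Cn by blast
      have "box_Cn n z (min r d) \<subseteq> {x \<in> S. f x \<in> U}"
      proof
        fix x assume x: "x \<in> box_Cn n z (min r d)"
        then have "x \<in> S" "x \<in> box_Cn n z d" using r by (auto simp: box_Cn_def)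
        then have "cmod (f x - f z) < e" using d by blast
        then show "x \<in> {x \<in> S. f x \<in> U}" using e \<open>x \<in> S\<close> by (auto simp: dist_norm norm_minus_commute subset_iff)
      qed
      then show "\<exists>r>0. box_Cn n z r \<subseteq> {x \<in> S. f x \<in> U}" using r d by (intro exI[of _ "min r d"]) auto
    qed
    then show "openin (subtopology (Cn n) S) {x \<in> topspace (subtopology (Cn n) S). f x \<in> U}"
      using S by (simp add: openin_open_subtopology ts)
  qed auto
qed

text \<open>Both conditions pass to sums, products and inverses by one-variable facts, which is why
  this notion is preferred to complex differentiability; that the two agree on open sets is Osgood's
  lemma, \<open>holo_iff\<close>.\<close>

definition holo :: "nat \<Rightarrow> (nat \<Rightarrow> complex) set \<Rightarrow> ((nat \<Rightarrow> complex) \<Rightarrow> complex) \<Rightarrow> bool" where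
  "holo n S f \<longleftrightarrow> continuous_map (subtopology (Cn n) S) euclidean f \<and>
     (\<forall>z\<in>S. \<forall>i<n. (\<lambda>\<zeta>. f (z(i := \<zeta>))) field_differentiable at (z i))"

definition pdiff :: "nat \<Rightarrow> ((nat \<Rightarrow> complex) \<Rightarrow> complex) \<Rightarrow> (nat \<Rightarrow> complex) \<Rightarrow> complex" where
  "pdiff i f z = deriv (\<lambda>\<zeta>. f (z(i := \<zeta>))) (z i)"

text \<open>About each point of \<open>ball a R\<close> the closed disc of radius
  \<open>R / 2\<close> lies in \<open>ball a (2 * R)\<close>, so the Cauchy inequalities bound the
  first derivative by \<open>2 * M / R\<close> and the second by \<open>8 * M / R\<^sup>2\<close>.
  The mean value inequality and Taylor's formula of order one turn these into the two
  increments.\<close>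

lemma cauchy_bounds:
  fixes h :: "complex \<Rightarrow> complex"
  assumes h: "h holomorphic_on ball a (2 * R)" and R: "R > 0"
    and M: "\<And>x. x \<in> ball a (2 * R) \<Longrightarrow> cmod (h x) \<le> M" and b: "b \<in> ball a R"
  shows "cmod (deriv h b) \<le> 2 * M / R"
    and "c \<in> ball a R \<Longrightarrow> cmod (h c - h b) \<le> 2 * M / R * cmod (c - b)"
    and "c \<in> ball a R \<Longrightarrow> cmod (h c - h b - deriv h b * (c - b)) \<le> 8 * M / R\<^sup>2 * (cmod (c - b))\<^sup>2"
proof -
  have sub: "cball x (R / 2) \<subseteq> ball a (2 * R)" if "x \<in> ball a R" for x
  proof
    fix y assume "y \<in> cball x (R/2)"
    then have "dist x y \<le> R / 2" by simp
    moreover have "dist a x < R" using that by simp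
    ultimately show "y \<in> ball a (2 * R)" using R dist_triangle[of a y x] by simp
  qed
  have D: "cmod ((deriv ^^ k) h x) \<le> fact k * M / (R / 2) ^ k" if x: "x \<in> ball a R" for x k
  proof (rule Cauchy_inequality)
    show "h holomorphic_on ball x (R / 2)"
      using h sub[OF x] ball_subset_cball holomorphic_on_subset by blast
    show "continuous_on (cball x (R / 2)) h"
      using h sub[OF x] holomorphic_on_imp_continuous_on continuous_on_subset by blast
    show "cmod (h y) \<le> M" if "cmod (x - y) = R / 2" for y
      using that sub[OF x] by (intro M) (auto simp: dist_norm)
  qed (use R in auto)
  have d1: "(h has_field_derivative deriv h x) (at x within ball a R)" if "x \<in> ball a R" for x
    by (rule has_field_derivative_at_within, rule holomorphic_derivI[OF h]) (use that R in auto)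
  have d2: "(deriv h has_field_derivative (deriv ^^ 2) h x) (at x within ball a R)" if "x \<in> ball a R" for x
    unfolding numeral_2_eq_2 funpow.simps o_def id_def
    by (rule has_field_derivative_at_within, rule holomorphic_derivI[OF holomorphic_deriv[OF h]]) (use that R in auto)
  have B1: "cmod (deriv h x) \<le> 2 * M / R" if "x \<in> ball a R" for x
    using D[OF that, of 1] by (simp add: field_simps)
  show "cmod (deriv h b) \<le> 2 * M / R" by (rule B1[OF b])
  show "cmod (h c - h b) \<le> 2 * M / R * cmod (c - b)" if c: "c \<in> ball a R"
    by (rule field_differentiable_bound[OF convex_ball d1 B1 c b])
  show "cmod (h c - h b - deriv h b * (c - b)) \<le> 8 * M / R\<^sup>2 * (cmod (c - b))\<^sup>2" if c: "c \<in> ball a R"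
  proof -
    have "cmod ((\<lambda>i. (deriv ^^ i) h) 0 c - (\<Sum>i\<le>1. (\<lambda>i. (deriv ^^ i) h) i b * (c - b) ^ i / fact i)) \<le> (8 * M / R\<^sup>2) * cmod (c - b) ^ Suc 1 / fact 1"
    proof (rule complex_Taylor[OF convex_ball _ _ b c])
      show "((deriv ^^ i) h has_field_derivative (deriv ^^ Suc i) h x) (at x within ball a R)" if "x \<in> ball a R" "i \<le> 1" for i x
        using d1 d2 that by (cases "i = 0") (auto simp: numeral_2_eq_2 le_Suc_eq)
      show "cmod ((deriv ^^ Suc 1) h x) \<le> 8 * M / R\<^sup>2" if "x \<in> ball a R" for x
        using D[OF that, of 2] R by (simp add: field_simps numeral_2_eq_2 power2_eq_square)
    qed
    then show ?thesis by (simp add: power2_eq_square algebra_simps)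
  qed
qed

section \<open>Osgood's lemma, by moving one coordinate at a time\<close>

lemma extensional_upd: "q \<in> extensional {..<n} \<Longrightarrow> i < n \<Longrightarrow> q(i := c) \<in> extensional {..<n}"
  by (auto simp: extensional_def)

text \<open>A path of \<open>n\<close> steps from \<open>z\<close> to \<open>q\<close>: consecutive
  points differ in one coordinate, so a difference of values telescopes into increments along
  coordinate lines, where one-variable estimates apply.\<close>

definition mix :: "nat \<Rightarrow> (nat \<Rightarrow> complex) \<Rightarrow> (nat \<Rightarrow> complex) \<Rightarrow> (nat \<Rightarrow> complex)" where
  "mix k q z = (\<lambda>i. if i < k then q i else z i)"

lemma mix_0: "mix 0 q z = z" by (auto simp: mix_def)
lemma mix_Suc: "mix (Suc k) q z = (mix k q z)(k := q k)" by (auto simp: mix_def)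
lemma mix_self: "mix k q z k = z k" by (auto simp: mix_def)
lemma mix_top: "q \<in> extensional {..<n} \<Longrightarrow> z \<in> extensional {..<n} \<Longrightarrow> mix n q z = q"
  by (auto simp: mix_def extensional_def)
lemma mix_ext: "q \<in> extensional {..<n} \<Longrightarrow> z \<in> extensional {..<n} \<Longrightarrow> k \<le> n \<Longrightarrow> mix k q z \<in> extensional {..<n}"
  by (auto simp: mix_def extensional_def)
lemma mix_box: "q \<in> box_Cn n z0 r \<Longrightarrow> z \<in> box_Cn n z0 r \<Longrightarrow> k \<le> n \<Longrightarrow> mix k q z \<in> box_Cn n z0 r"
  by (auto simp: box_Cn_def mix_ext) (auto simp: mix_def)

lemma holo_line:
  assumes "holo n S f" "box_Cn n z r \<subseteq> S" "q \<in> box_Cn n z r" "i < n"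
  shows "(\<lambda>\<zeta>. f (q(i := \<zeta>))) holomorphic_on ball (z i) r"
  unfolding holomorphic_on_def
proof
  fix \<zeta> assume \<zeta>: "\<zeta> \<in> ball (z i) r"
  have "q(i := \<zeta>) \<in> box_Cn n z r"
    using assms(3,4) \<zeta> by (auto simp: box_Cn_def extensional_upd dist_norm norm_minus_commute)
  then have "(\<lambda>\<xi>. f ((q(i := \<zeta>))(i := \<xi>))) field_differentiable at ((q(i := \<zeta>)) i)"
    using assms unfolding holo_def by blast
  then show "(\<lambda>\<zeta>. f (q(i := \<zeta>))) field_differentiable at \<zeta> within ball (z i) r"
    by (simp add: field_differentiable_at_within)
qed

text \<open>
  Osgood's lemma, made quantitative: a bounded separately holomorphic function is Lipschitz and has
  Lipschitz partial derivatives on a smaller polydisc, because the Cauchy estimates apply to the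
  difference of two parallel coordinate lines.
\<close>

locale holo_box =
  fixes n S f z R M
  assumes holo: "holo n S f" and sub: "box_Cn n z (2 * R) \<subseteq> S" and R: "R > 0"
    and M: "\<And>w. w \<in> box_Cn n z (2 * R) \<Longrightarrow> cmod (f w) \<le> M" and z: "z \<in> extensional {..<n}"
begin

lemma M_nonneg: "M \<ge> 0"
  using M[OF centre_in_box_Cn[OF z]] R by (meson norm_ge_zero order_trans zero_less_mult_iff zero_less_numeral)

lemma line:
  assumes "q \<in> box_Cn n z (2 * R)" "i < n"
  shows "(\<lambda>\<zeta>. f (q(i := \<zeta>))) holomorphic_on ball (z i) (2 * R)"
    and "\<And>\<zeta>. \<zeta> \<in> ball (z i) (2 * R) \<Longrightarrow> cmod (f (q(i := \<zeta>))) \<le> M"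
  subgoal by (rule holo_line[OF holo sub assms])
  subgoal for \<zeta> using assms
    by (intro M) (auto simp: box_Cn_def extensional_upd dist_norm norm_minus_commute)
  done

lemma box_half: "q \<in> box_Cn n z R \<Longrightarrow> q \<in> box_Cn n z (2 * R)"
  using R by (auto simp: box_Cn_def)

lemma in_ball: "q \<in> box_Cn n z R \<Longrightarrow> i < n \<Longrightarrow> q i \<in> ball (z i) R"
  by (auto simp: box_Cn_def dist_norm norm_minus_commute)

lemma line_step:
  assumes "q \<in> box_Cn n z R" "i < n" "c \<in> ball (z i) R"
  shows "cmod (f (q(i := c)) - f q) \<le> 2 * M / R * cmod (c - q i)"
    and "cmod (f (q(i := c)) - f q - pdiff i f q * (c - q i)) \<le> 8 * M / R\<^sup>2 * (cmod (c - q i))\<^sup>2"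
  using cauchy_bounds(2,3)[OF line(1)[OF box_half[OF assms(1)] assms(2)] R line(2)[OF box_half[OF assms(1)] assms(2)] in_ball[OF assms(1,2)] assms(3)]
  by (auto simp: pdiff_def)

text \<open>Telescoping along \<open>mix\<close>; all intermediate points stay in the polydisc, so
  each step is an instance of \<open>line_step\<close>.\<close>

lemma lipschitz:
  assumes q: "q \<in> box_Cn n z R" and w: "w \<in> box_Cn n z R"
  shows "cmod (f w - f q) \<le> 2 * M / R * (\<Sum>i<n. cmod (w i - q i))"
proof -
  have e: "w \<in> extensional {..<n}" "q \<in> extensional {..<n}" using q w by (auto simp: box_Cn_def)
  have "f w - f q = (\<Sum>k<n. f (mix (Suc k) w q) - f (mix k w q))"
    using sum_lessThan_telescope[of "\<lambda>k. f (mix k w q)" n] mix_top[OF e] by (simp add: mix_0)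
  also have "cmod \<dots> \<le> (\<Sum>k<n. 2 * M / R * cmod (w k - q k))"
  proof (rule sum_norm_le)
    fix k assume k: "k \<in> {..<n}"
    then show "cmod (f (mix (Suc k) w q) - f (mix k w q)) \<le> 2 * M / R * cmod (w k - q k)"
      using line_step(1)[of "mix k w q" k "w k"] mix_box[OF w q, of k] in_ball[OF w]
      by (simp add: mix_Suc mix_self)
  qed
  finally show ?thesis by (simp add: sum_distrib_left)
qed

lemma pdiff_lipschitz:
  assumes q: "q \<in> box_Cn n z (R / 2)" and w: "w \<in> box_Cn n z (R / 2)" and i: "i < n"
  shows "cmod (pdiff i f w - pdiff i f q) \<le> 16 * M / R\<^sup>2 * (\<Sum>i<n. cmod (w i - q i))"
proof -
  have half: "p(i := p i + \<zeta>) \<in> box_Cn n z R" if "p \<in> box_Cn n z (R/2)" "\<zeta> \<in> ball 0 (R/2)" for p \<zeta>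
    unfolding box_Cn_def
  proof (intro CollectI conjI allI impI)
    show "p(i := p i + \<zeta>) \<in> extensional {..<n}" using that i by (auto simp: box_Cn_def extensional_upd)
    fix j assume j: "j < n"
    have "cmod (p j - z j) < R / 2" using that j by (auto simp: box_Cn_def)
    moreover have "cmod \<zeta> < R / 2" using that by simp
    moreover have "cmod (p j + \<zeta> - z j) \<le> cmod (p j - z j) + cmod \<zeta>"
      using norm_triangle_ineq[of "p j - z j" \<zeta>] by (simp add: algebra_simps)
    ultimately have "cmod (p j + \<zeta> - z j) < R" "cmod (p j - z j) < R" using norm_ge_zero[of \<zeta>] by linarith+
    then show "cmod ((p(i := p i + \<zeta>)) j - z j) < R" by auto
  qed
  \<comment> \<open>The increment of \<open>f\<close> between two parallel lines;
    \<open>lipschitz\<close> bounds it by \<open>B\<close> on a whole disc, since shifting both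
    points by the same amount leaves their difference alone. Its derivative at 0 is the increment of
    the partial derivative.\<close>
  define h where "h = (\<lambda>\<zeta>. f (w(i := w i + \<zeta>)) - f (q(i := q i + \<zeta>)))"
  define B where "B = 2 * M / R * (\<Sum>i<n. cmod (w i - q i))"
  have hol1: "(\<lambda>\<zeta>. f (p(i := p i + \<zeta>))) holomorphic_on ball 0 (R / 2)" if p: "p \<in> box_Cn n z (R/2)" for p
  proof -
    have p2: "p \<in> box_Cn n z (2 * R)" using p R box_Cn_mono[of "R/2" "2 * R" n z] by auto
    have "(\<lambda>\<zeta>. f (p(i := \<zeta>))) \<circ> (\<lambda>\<zeta>. p i + \<zeta>) holomorphic_on ball 0 (R / 2)"
    proof (rule holomorphic_on_compose_gen[OF _ line(1)[OF p2 i]])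
      have "p i + \<zeta> \<in> ball (z i) (2 * R)" if "\<zeta> \<in> ball 0 (R/2)" for \<zeta>
        using in_ball[OF half[OF p that] i] R by simp
      then show "(\<lambda>\<zeta>. p i + \<zeta>) ` ball 0 (R/2) \<subseteq> ball (z i) (2 * R)" by blast
    qed (intro holomorphic_intros)
    then show ?thesis by (simp add: o_def)
  qed
  have h: "h holomorphic_on ball 0 (R / 2)"
    unfolding h_def by (intro holomorphic_intros hol1 w q)
  have hB: "cmod (h \<zeta>) \<le> B" if "\<zeta> \<in> ball 0 (R/2)" for \<zeta>
  proof -
    have "cmod (h \<zeta>) \<le> 2 * M / R * (\<Sum>j<n. cmod ((w(i := w i + \<zeta>)) j - (q(i := q i + \<zeta>)) j))"
      unfolding h_def by (intro lipschitz half q w that)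
    also have "(\<Sum>j<n. cmod ((w(i := w i + \<zeta>)) j - (q(i := q i + \<zeta>)) j)) = (\<Sum>j<n. cmod (w j - q j))"
      by (intro sum.cong) auto
    finally show ?thesis by (simp add: B_def)
  qed
  have pd: "((\<lambda>\<zeta>. f (p(i := p i + \<zeta>))) has_field_derivative pdiff i f p) (at 0)" if p: "p \<in> box_Cn n z (R/2)" for p
  proof -
    have p2: "p \<in> box_Cn n z R" using p R box_Cn_mono[of "R/2" R n z] by auto
    have "p i \<in> ball (z i) (2 * R)" using in_ball[OF p2 i] R by auto
    then have "((\<lambda>\<zeta>. f (p(i := \<zeta>))) has_field_derivative pdiff i f p) (at (p i + 0))"
      using holomorphic_derivI[OF line(1)[OF box_half[OF p2] i]] unfolding pdiff_def by simp
    then show ?thesis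
      using DERIV_shift[of "\<lambda>\<zeta>. f (p(i := \<zeta>))" _ 0 "p i"] by (simp add: add.commute)
  qed
  have "(h has_field_derivative pdiff i f w - pdiff i f q) (at 0)"
    unfolding h_def by (intro DERIV_diff pd w q)
  then have "deriv h 0 = pdiff i f w - pdiff i f q" by (rule DERIV_imp_deriv)
  \<comment> \<open>The disc of radius \<open>R / 2\<close> is twice one of radius
    \<open>R / 4\<close>. The resulting bound \<open>8 * B / R\<close> is
    \<open>16 * M / R\<^sup>2\<close> times the distance.\<close>
  moreover have "cmod (deriv h 0) \<le> 2 * B / (R / 4)"
  proof (rule cauchy_bounds(1)[of h 0 "R/4"])
    show "h holomorphic_on ball 0 (2 * (R/4))" using h by simp
  qed (use R hB in auto)
  ultimately show ?thesis using R by (simp add: B_def power2_eq_square)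
qed

text \<open>The constant 24 is 8 from the remainder along each coordinate line plus 16 from
  replacing the partial derivative at the intermediate point by the one at \<open>z\<close>.\<close>

lemma taylor:
  assumes w: "w \<in> box_Cn n z (R / 2)"
  shows "cmod (f w - f z - (\<Sum>i<n. pdiff i f z * (w i - z i))) \<le> 24 * M / R\<^sup>2 * (\<Sum>i<n. cmod (w i - z i))\<^sup>2"
proof -
  define N where "N = (\<Sum>i<n. cmod (w i - z i))"
  have zR: "z \<in> box_Cn n z (R/2)" using R z by (simp add: centre_in_box_Cn)
  have up: "q \<in> box_Cn n z (R/2) \<Longrightarrow> q \<in> box_Cn n z R" for q
    using R box_Cn_mono[of "R/2" R n z] by auto
  have e: "w \<in> extensional {..<n}" using w by (auto simp: box_Cn_def)
  have le: "cmod (w k - z k) \<le> N" if "k < n" for k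
    unfolding N_def using that by (intro member_le_sum) auto
  have N0: "N \<ge> 0" unfolding N_def by (simp add: sum_nonneg)
  have "f w - f z - (\<Sum>i<n. pdiff i f z * (w i - z i)) =
     (\<Sum>k<n. f (mix (Suc k) w z) - f (mix k w z) - pdiff k f z * (w k - z k))"
    using sum_lessThan_telescope[of "\<lambda>k. f (mix k w z)" n] mix_top[OF e z]
    by (simp add: mix_0 sum_subtractf)
  also have "cmod \<dots> \<le> (\<Sum>k<n. 24 * M / R\<^sup>2 * N * cmod (w k - z k))"
  proof (rule sum_norm_le)
    fix k assume "k \<in> {..<n}"
    then have k: "k < n" by simp
    define q where "q = mix k w z"
    have q: "q \<in> box_Cn n z (R/2)" unfolding q_def using mix_box[OF w zR] k by simp
    have qk: "q k = z k" by (simp add: q_def mix_self)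
    have a: "cmod (f (q(k := w k)) - f q - pdiff k f q * (w k - z k)) \<le> 8 * M / R\<^sup>2 * (cmod (w k - z k))\<^sup>2"
      using line_step(2)[OF up[OF q] k in_ball[OF up[OF w] k]] qk by simp
    have "(cmod (w k - z k))\<^sup>2 \<le> N * cmod (w k - z k)"
      using le[OF k] by (simp add: power2_eq_square mult_right_mono)
    then have a': "8 * M / R\<^sup>2 * (cmod (w k - z k))\<^sup>2 \<le> 8 * M / R\<^sup>2 * (N * cmod (w k - z k))"
      using M_nonneg by (intro mult_left_mono) auto
    have "(\<Sum>i<n. cmod (q i - z i)) \<le> N"
      unfolding N_def q_def by (intro sum_mono) (auto simp: mix_def)
    then have "16 * M / R\<^sup>2 * (\<Sum>i<n. cmod (q i - z i)) \<le> 16 * M / R\<^sup>2 * N"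
      using M_nonneg by (intro mult_left_mono) auto
    then have b: "cmod (pdiff k f q - pdiff k f z) \<le> 16 * M / R\<^sup>2 * N"
      using pdiff_lipschitz[OF zR q k] by linarith
    have b': "cmod ((pdiff k f q - pdiff k f z) * (w k - z k)) \<le> 16 * M / R\<^sup>2 * N * cmod (w k - z k)"
      unfolding norm_mult by (intro mult_right_mono b) auto
    have "f (mix (Suc k) w z) - f (mix k w z) - pdiff k f z * (w k - z k) =
       (f (q(k := w k)) - f q - pdiff k f q * (w k - z k)) + (pdiff k f q - pdiff k f z) * (w k - z k)"
      by (simp add: mix_Suc q_def algebra_simps)
    then have "cmod (f (mix (Suc k) w z) - f (mix k w z) - pdiff k f z * (w k - z k)) \<le>
        8 * M / R\<^sup>2 * (N * cmod (w k - z k)) + 16 * M / R\<^sup>2 * N * cmod (w k - z k)"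
      using norm_triangle_le[of "f (q(k := w k)) - f q - pdiff k f q * (w k - z k)"] a a' b' by (smt (verit))
    also have "\<dots> = 24 * M / R\<^sup>2 * N * cmod (w k - z k)" by (simp add: field_simps)
    finally show "cmod (f (mix (Suc k) w z) - f (mix k w z) - pdiff k f z * (w k - z k)) \<le> 24 * M / R\<^sup>2 * N * cmod (w k - z k)" .
  qed
  also have "\<dots> = 24 * M / R\<^sup>2 * N\<^sup>2"
    by (simp only: sum_distrib_left[symmetric] N_def[symmetric] power2_eq_square mult.assoc)
  finally show ?thesis by (simp add: N_def)
qed

end

lemma holo_boxE:
  assumes h: "holo n S f" and S: "openin (Cn n) S" and z: "z \<in> S"
  obtains R M where "holo_box n S f z R M"
proof -
  obtain d where d: "d > 0" "\<forall>w\<in>S \<inter> box_Cn n z d. cmod (f w - f z) < 1"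
    using h z continuous_map_Cn[OF S] unfolding holo_def by (meson zero_less_one)
  obtain r where r: "r > 0" "box_Cn n z r \<subseteq> S" using S z unfolding openin_Cn by blast
  define R where "R = min r d / 2"
  have R: "2 * R \<le> r" "2 * R \<le> d" "R > 0" using r d by (auto simp: R_def)
  have sub: "box_Cn n z (2 * R) \<subseteq> S \<inter> box_Cn n z d"
    using box_Cn_mono[OF R(1), of n z] box_Cn_mono[OF R(2), of n z] r by blast
  \<comment> \<open>Continuity enters here: it provides the local bound on \<open>f\<close> from
    which all Cauchy estimates start.\<close>
  have "holo_box n S f z R (cmod (f z) + 1)"
  proof
    show "cmod (f w) \<le> cmod (f z) + 1" if "w \<in> box_Cn n z (2 * R)" for w
    proof -
      have "cmod (f w - f z) < 1" using that sub d by blast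
      then show ?thesis using norm_triangle_sub[of "f w" "f z"] by linarith
    qed
    show "z \<in> extensional {..<n}" using S z openin_Cn by blast
  qed (use h sub R in auto)
  then show ?thesis using that by blast
qed

text \<open>Forward, the quadratic error of \<open>taylor\<close> beats every multiple of the
  distance. Backward, the linear approximation with error factor 1 gives continuity, and restricted
  to a coordinate line it is a one-variable derivative.\<close>

lemma holo_iff:
  assumes S: "openin (Cn n) S"
  shows "holo n S f \<longleftrightarrow> (\<forall>z\<in>S. complex_differentiable_at n f z)"
proof
  assume h: "holo n S f"
  show "\<forall>z\<in>S. complex_differentiable_at n f z"
  proof
    fix z assume z: "z \<in> S"
    obtain R M where "holo_box n S f z R M" using holo_boxE[OF h S z] .
    then interpret holo_box n S f z R M .
    have K: "24 * M / R\<^sup>2 \<ge> 0" using M_nonneg by simp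
    show "complex_differentiable_at n f z" unfolding complex_differentiable_at_def
    proof (intro exI[of _ "\<lambda>i. pdiff i f z"] allI impI)
      fix \<epsilon> :: real assume e: "\<epsilon> > 0"
      \<comment> \<open>Adding 1 makes the divisor of \<open>\<epsilon>\<close> positive even if
        \<open>M = 0\<close>.\<close>
      let ?K = "24 * M / R\<^sup>2 + 1"
      show "\<exists>\<delta>>0. \<forall>w\<in>topspace (Cn n). (\<Sum>i<n. cmod (w i - z i)) < \<delta> \<longrightarrow>
        cmod (f w - f z - (\<Sum>i<n. pdiff i f z * (w i - z i))) \<le> \<epsilon> * (\<Sum>i<n. cmod (w i - z i))"
      proof (intro exI[of _ "min (R/2) (\<epsilon> / ?K)"] conjI ballI impI)
        show "0 < min (R/2) (\<epsilon> / ?K)" using R e K by (auto intro!: divide_pos_pos)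
        fix w assume w: "w \<in> topspace (Cn n)" and lt: "(\<Sum>i<n. cmod (w i - z i)) < min (R/2) (\<epsilon> / ?K)"
        let ?N = "\<Sum>i<n. cmod (w i - z i)"
        have N0: "?N \<ge> 0" by (simp add: sum_nonneg)
        have "w \<in> box_Cn n z (R/2)" using w lt by (intro sum_lt_in_box_Cn) (auto simp: topspace_Cn)
        then have "cmod (f w - f z - (\<Sum>i<n. pdiff i f z * (w i - z i))) \<le> 24 * M / R\<^sup>2 * ?N\<^sup>2" by (rule taylor)
        also have "\<dots> \<le> ?K * ?N\<^sup>2" by (intro mult_right_mono) auto
        also have "\<dots> = (?K * ?N) * ?N" by (simp add: power2_eq_square)
        also have "\<dots> \<le> \<epsilon> * ?N"
        proof (rule mult_right_mono[OF _ N0])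
          have "?N \<le> \<epsilon> / ?K" using lt by simp
          then show "?K * ?N \<le> \<epsilon>" using K by (subst (asm) pos_le_divide_eq) (auto simp: mult.commute)
        qed
        finally show "cmod (f w - f z - (\<Sum>i<n. pdiff i f z * (w i - z i))) \<le> \<epsilon> * ?N" .
      qed
    qed
  qed
next
  assume H: "\<forall>z\<in>S. complex_differentiable_at n f z"
  show "holo n S f" unfolding holo_def continuous_map_Cn[OF S]
  proof (intro conjI ballI allI impI)
    fix z and \<epsilon> :: real assume z: "z \<in> S" and e: "\<epsilon> > 0"
    obtain a where a: "\<forall>\<epsilon>>0. \<exists>\<delta>>0. \<forall>w\<in>topspace (Cn n). (\<Sum>i<n. cmod (w i - z i)) < \<delta> \<longrightarrow>
        cmod (f w - f z - (\<Sum>i<n. a i * (w i - z i))) \<le> \<epsilon> * (\<Sum>i<n. cmod (w i - z i))"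
      using H z unfolding complex_differentiable_at_def by blast
    obtain d where d: "d > 0" "\<And>w. w\<in>extensional {..<n} \<Longrightarrow> (\<Sum>i<n. cmod (w i - z i)) < d \<Longrightarrow>
        cmod (f w - f z - (\<Sum>i<n. a i * (w i - z i))) \<le> 1 * (\<Sum>i<n. cmod (w i - z i))"
      using a[rule_format, of 1] by (auto simp: topspace_Cn)
    define A where "A = (\<Sum>i<n. cmod (a i)) + 2"
    have A: "A > 0" unfolding A_def by (smt (verit) sum_nonneg norm_ge_zero)
    \<comment> \<open>In the polydisc of radius \<open>\<delta>\<close> the sum of the
      \<open>n\<close> distances is at most \<open>n * \<delta>\<close>; dividing by
      \<open>n + 1\<close> makes the final inequality strict and covers
      \<open>n = 0\<close>.\<close>
    define \<delta> where "\<delta> = min d (\<epsilon> / A) / (n + 1)"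
    have "\<delta> > 0" unfolding \<delta>_def using d e A by auto
    moreover have "cmod (f w - f z) < \<epsilon>" if w: "w \<in> S \<inter> box_Cn n z \<delta>" for w
    proof -
      let ?N = "\<Sum>i<n. cmod (w i - z i)"
      have "?N \<le> (\<Sum>i<n. \<delta>)" using w by (intro sum_mono) (auto simp: box_Cn_def intro: less_imp_le)
      also have "\<dots> < (n + 1) * \<delta>" using \<open>\<delta> > 0\<close> by (simp add: algebra_simps)
      also have "\<dots> = min d (\<epsilon> / A)" unfolding \<delta>_def by (simp add: field_simps)
      finally have N: "?N < d" "?N < \<epsilon> / A" by auto
      have "cmod (\<Sum>i<n. a i * (w i - z i)) \<le> (\<Sum>i<n. (\<Sum>i<n. cmod (a i)) * cmod (w i - z i))"
        by (intro sum_norm_le) (auto simp: norm_mult intro!: mult_right_mono member_le_sum)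
      then have "cmod (\<Sum>i<n. a i * (w i - z i)) \<le> (\<Sum>i<n. cmod (a i)) * ?N" by (simp add: sum_distrib_left)
      moreover have "cmod (f w - f z - (\<Sum>i<n. a i * (w i - z i))) \<le> 1 * ?N"
        using w N by (intro d) (auto simp: box_Cn_def)
      ultimately have "cmod (f w - f z) \<le> (\<Sum>i<n. cmod (a i)) * ?N + ?N"
        using norm_triangle_sub[of "f w - f z" "\<Sum>i<n. a i * (w i - z i)"] by simp
      also have "\<dots> \<le> A * ?N" unfolding A_def by (simp add: algebra_simps sum_nonneg)
      also have "\<dots> < \<epsilon>" using N A by (simp add: pos_less_divide_eq mult.commute)
      finally show ?thesis .
    qed
    ultimately show "\<exists>\<delta>>0. \<forall>w\<in>S \<inter> box_Cn n z \<delta>. cmod (f w - f z) < \<epsilon>" by blast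
  next
    fix z i assume z: "z \<in> S" and i: "i < n"
    have ze: "z \<in> extensional {..<n}" using S z openin_Cn by blast
    obtain a where a: "\<forall>\<epsilon>>0. \<exists>\<delta>>0. \<forall>w\<in>topspace (Cn n). (\<Sum>i<n. cmod (w i - z i)) < \<delta> \<longrightarrow>
        cmod (f w - f z - (\<Sum>i<n. a i * (w i - z i))) \<le> \<epsilon> * (\<Sum>i<n. cmod (w i - z i))"
      using H z unfolding complex_differentiable_at_def by blast
    have N: "(\<Sum>j<n. cmod ((z(i := \<zeta>)) j - z j)) = cmod (\<zeta> - z i)" for \<zeta>
      using i by (subst sum.remove[of _ i]) auto
    have L: "(\<Sum>j<n. a j * ((z(i := \<zeta>)) j - z j)) = a i * (\<zeta> - z i)" for \<zeta>
      using i by (subst sum.remove[of _ i]) auto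
    have "((\<lambda>\<zeta>. f (z(i := \<zeta>))) has_field_derivative a i) (at (z i))"
      unfolding has_field_derivative_def has_derivative_within_alt
    proof (intro conjI allI impI)
      fix e :: real assume "e > 0"
      then obtain d where d: "d > 0" "\<And>w. w\<in>extensional {..<n} \<Longrightarrow> (\<Sum>i<n. cmod (w i - z i)) < d \<Longrightarrow>
        cmod (f w - f z - (\<Sum>i<n. a i * (w i - z i))) \<le> e * (\<Sum>i<n. cmod (w i - z i))"
        using a by (auto simp: topspace_Cn)
      have "cmod (f (z(i := \<zeta>)) - f z - a i * (\<zeta> - z i)) \<le> e * cmod (\<zeta> - z i)" if "cmod (\<zeta> - z i) < d" for \<zeta>
        using d(2)[of "z(i := \<zeta>)"] that ze i unfolding N L by (simp add: extensional_upd)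
      then show "\<exists>d>0. \<forall>y\<in>UNIV. norm (y - z i) < d \<longrightarrow>
          norm (f (z(i := y)) - f (z(i := z i)) - a i * (y - z i)) \<le> e * norm (y - z i)"
        using d(1) by auto
    qed (rule bounded_linear_mult_right)
    then show "(\<lambda>\<zeta>. f (z(i := \<zeta>))) field_differentiable at (z i)"
      unfolding field_differentiable_def by blast
  qed
qed

section \<open>Locality of \<open>holo\<close> and its closure properties\<close>

lemma Cn_line_nhds:
  assumes S: "openin (Cn n) S" and z: "z \<in> S" and i: "i < n"
  shows "\<forall>\<^sub>F \<zeta> in nhds (z i). z(i := \<zeta>) \<in> S"
proof -
  obtain r where r: "r > 0" "box_Cn n z r \<subseteq> S" using S z unfolding openin_Cn by blast
  have ze: "z \<in> extensional {..<n}" using S z openin_Cn by blast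
  have "z(i := \<zeta>) \<in> S" if "dist \<zeta> (z i) < r" for \<zeta>
    using that r i ze by (auto intro!: subsetD[OF r(2)] simp: box_Cn_def extensional_upd dist_norm)
  then show ?thesis using r(1) by (auto simp: eventually_nhds_metric)
qed

lemma field_differentiable_cong_ev:
  assumes "\<forall>\<^sub>F x in nhds a. f x = g x"
  shows "f field_differentiable at a \<longleftrightarrow> g field_differentiable at a"
  unfolding field_differentiable_def using DERIV_cong_ev[OF refl assms refl] by simp

text \<open>Near a point of an open \<open>S\<close> the coordinate lines stay in \<open>S\<close>,
  so only values on \<open>S\<close> matter. Functions read in a chart are arbitrary outside its
  image, hence the many uses.\<close>

lemma holo_cong:
  assumes S: "openin (Cn n) S" and eq: "\<And>z. z \<in> S \<Longrightarrow> f z = g z"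
  shows "holo n S f \<longleftrightarrow> holo n S g"
proof -
  have "(\<lambda>\<zeta>. f (z(i := \<zeta>))) field_differentiable at (z i) \<longleftrightarrow> (\<lambda>\<zeta>. g (z(i := \<zeta>))) field_differentiable at (z i)"
    if "z \<in> S" "i < n" for z i
    by (intro field_differentiable_cong_ev eventually_mono[OF Cn_line_nhds[OF S that]] eq)
  moreover have "continuous_map (subtopology (Cn n) S) euclidean f \<longleftrightarrow> continuous_map (subtopology (Cn n) S) euclidean g"
    unfolding continuous_map_Cn[OF S] using eq by simp
  ultimately show ?thesis unfolding holo_def by blast
qed

lemma pdiff_cong:
  assumes "openin (Cn n) S" "\<And>z. z \<in> S \<Longrightarrow> f z = g z" "z \<in> S" "i < n"
  shows "pdiff i f z = pdiff i g z"
  unfolding pdiff_def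
  by (intro deriv_cong_ev refl eventually_mono[OF Cn_line_nhds[OF assms(1,3,4)]] assms(2))

lemma holo_subset: "holo n S f \<Longrightarrow> T \<subseteq> S \<Longrightarrow> holo n T f"
  unfolding holo_def by (blast intro: continuous_map_from_subtopology_mono)

text \<open>Complex differentiability is a condition at single points, so through
  \<open>holo_iff\<close> the property is local.\<close>

lemma holo_locally:
  assumes S: "openin (Cn n) S"
    and loc: "\<And>z. z \<in> S \<Longrightarrow> \<exists>T. openin (Cn n) T \<and> z \<in> T \<and> holo n T f"
  shows "holo n S f"
  using loc unfolding holo_iff[OF S] by (metis holo_iff)

lemma holo_const: "holo n S (\<lambda>_. c)"
  unfolding holo_def by simp

lemma holo_add: "holo n S f \<Longrightarrow> holo n S g \<Longrightarrow> holo n S (\<lambda>z. f z + g z)"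
  unfolding holo_def by (auto intro: continuous_map_add field_differentiable_add)

lemma continuous_map_mult_complex:
  fixes f g :: "'b \<Rightarrow> complex"
  shows "continuous_map T euclidean f \<Longrightarrow> continuous_map T euclidean g \<Longrightarrow> continuous_map T euclidean (\<lambda>x. f x * g x)"
  by (simp add: continuous_map_atin tendsto_mult)

lemma continuous_map_inverse_complex:
  fixes f :: "'b \<Rightarrow> complex"
  shows "continuous_map T euclidean f \<Longrightarrow> (\<And>x. x \<in> topspace T \<Longrightarrow> f x \<noteq> 0) \<Longrightarrow> continuous_map T euclidean (\<lambda>x. inverse (f x))"
  by (simp add: continuous_map_atin tendsto_inverse)

lemma holo_mult: "holo n S f \<Longrightarrow> holo n S g \<Longrightarrow> holo n S (\<lambda>z. f z * g z)"
  unfolding holo_def by (auto intro: continuous_map_mult_complex field_differentiable_mult)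

lemma holo_inverse: "holo n S f \<Longrightarrow> (\<And>z. z \<in> S \<Longrightarrow> f z \<noteq> 0) \<Longrightarrow> holo n S (\<lambda>z. inverse (f z))"
  unfolding holo_def by (auto intro!: continuous_map_inverse_complex field_differentiable_inverse)

lemma holo_coord:
  assumes "i < n" shows "holo n S (\<lambda>z. z i)"
proof -
  have "continuous_map (Cn n) euclidean (\<lambda>z. z i)"
    unfolding Cn_def using assms by (intro continuous_map_product_projection) auto
  then have "continuous_map (subtopology (Cn n) S) euclidean (\<lambda>z. z i)"
    by (rule continuous_map_from_subtopology)
  moreover have "(\<lambda>\<zeta>. (z(j := \<zeta>)) i) field_differentiable at (z j)" for z :: "nat \<Rightarrow> complex" and j
    by (cases "i = j") auto
  ultimately show ?thesis unfolding holo_def by blast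
qed

text \<open>Composition with maps that only copy or freeze coordinates, as \<open>mix\<close>,
  \<open>zcons\<close> and \<open>tail\<close> do. A coordinate line is then sent to a coordinate
  line or to a point, so no chain rule in several variables is called for.\<close>

lemma holo_comp:
  assumes f: "holo n S f" and S: "openin (Cn n) S" and T: "openin (Cn m) T"
    and h: "\<And>w. w \<in> T \<Longrightarrow> h w \<in> S"
    and cont: "\<And>w w' \<delta>. w \<in> T \<Longrightarrow> w' \<in> T \<Longrightarrow> \<delta> > 0 \<Longrightarrow> w' \<in> box_Cn m w \<delta> \<Longrightarrow> h w' \<in> box_Cn n (h w) \<delta>"
    and coords: "\<And>j. j < m \<Longrightarrow> (\<exists>i<n. \<forall>w\<in>T. h w i = w j \<and> (\<forall>\<zeta>. h (w(j := \<zeta>)) = (h w)(i := \<zeta>)))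
        \<or> (\<forall>w\<in>T. \<forall>\<zeta>. h (w(j := \<zeta>)) = h w)"
  shows "holo m T (\<lambda>w. f (h w))"
  unfolding holo_def
proof (intro conjI ballI allI impI)
  show "continuous_map (subtopology (Cn m) T) euclidean (\<lambda>w. f (h w))"
    unfolding continuous_map_Cn[OF T]
  proof (intro ballI allI impI)
    fix w and \<epsilon> :: real assume w: "w \<in> T" and e: "\<epsilon> > 0"
    obtain \<delta> where \<delta>: "\<delta> > 0" "\<forall>v\<in>S \<inter> box_Cn n (h w) \<delta>. cmod (f v - f (h w)) < \<epsilon>"
      using f h[OF w] e unfolding holo_def continuous_map_Cn[OF S] by blast
    have "cmod (f (h w') - f (h w)) < \<epsilon>" if "w' \<in> T \<inter> box_Cn m w \<delta>" for w'
      using \<delta> h cont[OF w _ \<delta>(1)] that by blast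
    then show "\<exists>\<delta>>0. \<forall>w'\<in>T \<inter> box_Cn m w \<delta>. cmod (f (h w') - f (h w)) < \<epsilon>" using \<delta>(1) by blast
  qed
  fix w j assume w: "w \<in> T" and j: "j < m"
  from coords[OF j] show "(\<lambda>\<zeta>. f (h (w(j := \<zeta>)))) field_differentiable at (w j)"
  proof
    assume "\<exists>i<n. \<forall>w\<in>T. h w i = w j \<and> (\<forall>\<zeta>. h (w(j := \<zeta>)) = (h w)(i := \<zeta>))"
    then obtain i where i: "i < n" "h w i = w j" "\<And>\<zeta>. h (w(j := \<zeta>)) = (h w)(i := \<zeta>)" using w by blast
    then show ?thesis using f h[OF w] unfolding holo_def by (metis (no_types, lifting) ext)
  next
    assume "\<forall>w\<in>T. \<forall>\<zeta>. h (w(j := \<zeta>)) = h w"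
    then show ?thesis using w by simp
  qed
qed

section \<open>Partial derivatives are holomorphic again\<close>

lemma lipschitz_at_continuous_Cn:
  fixes f :: "(nat \<Rightarrow> complex) \<Rightarrow> complex"
  assumes r: "r > 0" and e: "\<epsilon> > 0"
    and lip: "\<And>w. w \<in> box_Cn n z r \<Longrightarrow> cmod (f w - f z) \<le> K * (\<Sum>i<n. cmod (w i - z i))"
  shows "\<exists>\<delta>>0. \<forall>w\<in>box_Cn n z \<delta>. cmod (f w - f z) < \<epsilon>"
proof -
  define L where "L = \<bar>K\<bar> + 1"
  have L: "L > 0" "K \<le> L" by (auto simp: L_def)
  define \<delta> where "\<delta> = min r (\<epsilon> / (L * (n + 1)))"
  have \<delta>: "\<delta> > 0" unfolding \<delta>_def using r e L by auto
  have "cmod (f w - f z) < \<epsilon>" if w: "w \<in> box_Cn n z \<delta>" for w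
  proof -
    let ?N = "\<Sum>i<n. cmod (w i - z i)"
    have N0: "?N \<ge> 0" by (simp add: sum_nonneg)
    have "?N \<le> (\<Sum>i<n. \<delta>)" using w by (intro sum_mono) (auto simp: box_Cn_def intro: less_imp_le)
    also have "\<dots> < (n + 1) * \<delta>" using \<delta> by (simp add: algebra_simps)
    also have "\<dots> \<le> (n + 1) * (\<epsilon> / (L * (n + 1)))" unfolding \<delta>_def by (intro mult_left_mono) auto
    also have "\<dots> = \<epsilon> / L" by (simp add: add_pos_nonneg)
    finally have N: "L * ?N < \<epsilon>" using L by (simp add: pos_less_divide_eq mult.commute)
    have "w \<in> box_Cn n z r" using w box_Cn_mono[of \<delta> r n z] by (auto simp: \<delta>_def)
    then have "cmod (f w - f z) \<le> K * ?N" by (rule lip)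
    also have "\<dots> \<le> L * ?N" by (intro mult_right_mono L N0)
    finally show ?thesis using N by simp
  qed
  then show ?thesis using \<delta> by blast
qed

lemma (in holo_box) centre: "z \<in> box_Cn n z (R / 2)"
  using R z by (simp add: centre_in_box_Cn)

text \<open>For \<open>j = i\<close> this is the second derivative on one line. For
  \<open>j \<noteq> i\<close> the derivative in direction \<open>i\<close> is a uniform limit of
  difference quotients, each holomorphic in direction \<open>j\<close>, and Weierstrass' theorem
  applies; \<open>line_step\<close> gives a rate of convergence that is uniform in
  \<open>\<zeta>\<close>.\<close>

lemma (in holo_box) pdiff_line_differentiable:
  assumes i: "i < n" and j: "j < n"
  shows "(\<lambda>\<zeta>. pdiff i f (z(j := \<zeta>))) field_differentiable at (z j)"
proof (cases "j = i")
  case True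
  have "(\<lambda>\<zeta>. f (z(i := \<zeta>))) holomorphic_on ball (z i) (2 * R)"
    using z R i by (intro line centre_in_box_Cn) auto
  then have "deriv (\<lambda>\<zeta>. f (z(i := \<zeta>))) field_differentiable at (z i)"
    using R by (intro holomorphic_on_imp_differentiable_at[OF holomorphic_deriv, of _ "ball (z i) (2 * R)"]) auto
  moreover have "(\<lambda>\<zeta>. pdiff i f (z(i := \<zeta>))) = deriv (\<lambda>\<zeta>. f (z(i := \<zeta>)))"
    by (auto simp: pdiff_def)
  ultimately show ?thesis using True by simp
next
  case False
  \<comment> \<open>Steps tending to 0 that lie strictly between 0 and \<open>R\<close> from
    \<open>k = 0\<close> on.\<close>
  define c where "c = (\<lambda>k. R / (of_nat k + 2))"
  have c: "c k > 0" "c k < R" for k using R by (auto simp: c_def field_simps add_strict_increasing)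
  define F where "F = (\<lambda>k \<zeta>. (f (z(j := \<zeta>, i := z i + of_real (c k))) - f (z(j := \<zeta>))) / of_real (c k))"
  define g where "g = (\<lambda>\<zeta>. pdiff i f (z(j := \<zeta>)))"
  have zR: "z \<in> box_Cn n z R" "z \<in> box_Cn n z (2 * R)" using R z by (auto intro: centre_in_box_Cn)
  have holF: "F k holomorphic_on ball (z j) R" for k
  proof -
    have "z(i := z i + of_real (c k)) \<in> box_Cn n z (2 * R)"
      using z i R c[of k] by (auto simp: box_Cn_def extensional_upd)
    then have "(\<lambda>\<zeta>. f (z(i := z i + of_real (c k), j := \<zeta>))) holomorphic_on ball (z j) (2 * R)"
      by (rule line(1)[OF _ j])
    then have "(\<lambda>\<zeta>. f (z(j := \<zeta>, i := z i + of_real (c k)))) holomorphic_on ball (z j) (2 * R)"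
      using False by (simp add: fun_upd_twist)
    then have "F k holomorphic_on ball (z j) (2 * R)"
      unfolding F_def using c[of k] line(1)[OF zR(2) j] by (intro holomorphic_intros) auto
    then show ?thesis by (rule holomorphic_on_subset) (use R in auto)
  qed
  have est: "cmod (F k \<zeta> - g \<zeta>) \<le> 8 * M / R\<^sup>2 * c k" if "\<zeta> \<in> ball (z j) R" for k \<zeta>
  proof -
    define q where "q = z(j := \<zeta>)"
    have q: "q \<in> box_Cn n z R" using that z j R
      by (auto simp: box_Cn_def q_def extensional_upd dist_norm norm_minus_commute)
    have qi: "q i = z i" using False by (simp add: q_def)
    have "z i + of_real (c k) \<in> ball (z i) R" using c[of k] by (simp add: dist_norm)
    from line_step(2)[OF q i this]
    have *: "cmod (f (q(i := z i + of_real (c k))) - f q - pdiff i f q * of_real (c k)) \<le> 8 * M / R\<^sup>2 * (c k)\<^sup>2"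
      using c[of k] qi by simp
    have "F k \<zeta> - g \<zeta> = (f (q(i := z i + of_real (c k))) - f q - pdiff i f q * of_real (c k)) / of_real (c k)"
      unfolding F_def g_def q_def[symmetric] using c[of k] by (simp add: diff_divide_distrib)
    then have "cmod (F k \<zeta> - g \<zeta>) \<le> 8 * M / R\<^sup>2 * (c k)\<^sup>2 / c k"
      using divide_right_mono[OF *, of "c k"] c[of k] by (simp add: norm_divide)
    then show ?thesis using c[of k] by (simp add: power2_eq_square)
  qed
  have clim: "(\<lambda>k. 8 * M / R\<^sup>2 * c k) \<longlonglongrightarrow> 0"
  proof -
    have "(\<lambda>k. R / (of_nat k + 2)) \<longlonglongrightarrow> 0" by real_asymp
    then show ?thesis unfolding c_def by (intro tendsto_mult_right_zero)
  qed
  have "g holomorphic_on ball (z j) R"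
  proof (rule holomorphic_uniform_sequence[OF open_ball holF])
    fix x assume x: "x \<in> ball (z j) R"
    then obtain d where d: "d > 0" "cball x d \<subseteq> ball (z j) R" using open_ball open_contains_cball by metis
    have "uniform_limit (cball x d) F g sequentially"
    proof (rule uniform_limitI)
      fix e :: real assume "e > 0"
      then have "\<forall>\<^sub>F k in sequentially. 8 * M / R\<^sup>2 * c k < e" using clim order_tendstoD(2) by blast
      then show "\<forall>\<^sub>F k in sequentially. \<forall>x\<in>cball x d. dist (F k x) (g x) < e"
      proof eventually_elim
        case (elim k)
        have "dist (F k y) (g y) < e" if "y \<in> cball x d" for y
          using est[OF subsetD[OF d(2) that], of k] elim unfolding dist_norm by (rule le_less_trans)
        then show ?case by blast
      qed
    qed
    then show "\<exists>d>0. cball x d \<subseteq> ball (z j) R \<and> uniform_limit (cball x d) F g sequentially" using d by blast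
  qed
  then show ?thesis unfolding g_def using R
    by (intro holomorphic_on_imp_differentiable_at[of _ "ball (z j) R"]) auto
qed

lemma holo_pdiff:
  assumes f: "holo n S f" and S: "openin (Cn n) S" and i: "i < n"
  shows "holo n S (pdiff i f)"
  unfolding holo_def
proof (intro conjI ballI allI impI)
  show "continuous_map (subtopology (Cn n) S) euclidean (pdiff i f)"
    unfolding continuous_map_Cn[OF S]
  proof (intro ballI allI impI)
    fix z and \<epsilon> :: real assume z: "z \<in> S" and e: "\<epsilon> > 0"
    obtain R M where "holo_box n S f z R M" using holo_boxE[OF f S z] .
    then interpret holo_box n S f z R M .
    show "\<exists>\<delta>>0. \<forall>w\<in>S \<inter> box_Cn n z \<delta>. cmod (pdiff i f w - pdiff i f z) < \<epsilon>"
      using lipschitz_at_continuous_Cn[OF _ e pdiff_lipschitz[OF centre _ i]] R by (metis IntD2 half_gt_zero)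
  qed
  fix z j assume z: "z \<in> S" and j: "j < n"
  obtain R M where "holo_box n S f z R M" using holo_boxE[OF f S z] .
  then interpret holo_box n S f z R M .
  show "(\<lambda>\<zeta>. pdiff i f (z(j := \<zeta>))) field_differentiable at (z j)"
    by (rule pdiff_line_differentiable[OF i j])
qed

text \<open>The quotient extends over the hyperplane by the transverse derivative of
  \<open>f\<close>. Away from it this is the rule for quotients; on it, continuity follows from the
  first-order expansion transverse to the hyperplane, and differentiability is tested on coordinate
  lines inside and across it.\<close>

lemma holo_divide_hyperplane:
  assumes f: "holo n S f" and S: "openin (Cn n) S" and i: "i < n"
    and zero: "\<And>z. z \<in> S \<Longrightarrow> z i = c \<Longrightarrow> f z = 0"
  shows "holo n S (\<lambda>z. if z i = c then pdiff i f z else f z / (z i - c))" (is "holo n S ?g")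
  unfolding holo_def
proof (intro conjI ballI allI impI)
  define S' where "S' = {z \<in> S. z i \<noteq> c}"
  have S': "openin (Cn n) S'"
  proof -
    have "continuous_map (Cn n) euclidean (\<lambda>z. z i)"
      unfolding Cn_def using i by (intro continuous_map_product_projection) auto
    then have o: "openin (Cn n) {z \<in> topspace (Cn n). z i \<in> - {c}}"
      by (rule openin_continuous_map_preimage) auto
    have "S' = S \<inter> {z \<in> topspace (Cn n). z i \<in> - {c}}"
      using openin_subset[OF S] by (auto simp: S'_def)
    then show ?thesis using openin_Int[OF S o] by (rule ssubst)
  qed
  have "holo n S' (\<lambda>z. f z * inverse (z i + - c))"
  proof (rule holo_mult)
    show "holo n S' f" by (rule holo_subset[OF f]) (auto simp: S'_def)
    show "holo n S' (\<lambda>z. inverse (z i + - c))"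
      by (rule holo_inverse[OF holo_add[OF holo_coord[OF i] holo_const]]) (auto simp: S'_def)
  qed
  then have g': "holo n S' ?g"
    by (rule holo_cong[OF S', THEN iffD1, rotated]) (simp add: S'_def divide_inverse)
  show "continuous_map (subtopology (Cn n) S) euclidean ?g"
    unfolding continuous_map_Cn[OF S]
  proof (intro ballI allI impI)
    fix z and \<epsilon> :: real assume z: "z \<in> S" and e: "\<epsilon> > 0"
    show "\<exists>\<delta>>0. \<forall>w\<in>S \<inter> box_Cn n z \<delta>. cmod (?g w - ?g z) < \<epsilon>"
    proof (cases "z i = c")
      case False
      then have z': "z \<in> S'" using z by (simp add: S'_def)
      obtain d where d: "d > 0" "\<forall>w\<in>S' \<inter> box_Cn n z d. cmod (?g w - ?g z) < \<epsilon>"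
        using g' z' e unfolding holo_def continuous_map_Cn[OF S'] by blast
      obtain r where r: "r > 0" "box_Cn n z r \<subseteq> S'" using S' z' unfolding openin_Cn by blast
      have "S \<inter> box_Cn n z (min d r) \<subseteq> S' \<inter> box_Cn n z d"
        using r box_Cn_mono[of "min d r" d n z] box_Cn_mono[of "min d r" r n z] by auto
      then have "\<forall>w\<in>S \<inter> box_Cn n z (min d r). cmod (?g w - ?g z) < \<epsilon>" using d(2) by blast
      moreover have "min d r > 0" using d(1) r(1) by simp
      ultimately show ?thesis by blast
    next
      case True
      obtain R M where hb: "holo_box n S f z R M" using holo_boxE[OF f S z] .
      then interpret holo_box n S f z R M .
      let ?K = "24 * M / R\<^sup>2"
      have up: "q \<in> box_Cn n z (R/2) \<Longrightarrow> q \<in> box_Cn n z R" for q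
        using R box_Cn_mono[of "R/2" R n z] by auto
      have *: "cmod (?g w - ?g z) \<le> ?K * (\<Sum>i<n. cmod (w i - z i))" if w: "w \<in> box_Cn n z (R/2)" for w
      proof -
        define N where "N = (\<Sum>i<n. cmod (w i - z i))"
        have N0: "N \<ge> 0" by (simp add: N_def sum_nonneg)
        \<comment> \<open>The projection of \<open>w\<close> to the hyperplane. As
          \<open>f q = 0\<close>, the quotient at \<open>w\<close> is close to
          \<open>pdiff i f q\<close>, and this is close to \<open>pdiff i f z\<close>.\<close>
        define q where "q = w(i := c)"
        have q: "q \<in> box_Cn n z (R/2)" using w i R True by (auto simp: box_Cn_def q_def extensional_upd)
        have qS: "q \<in> S" using q up box_half sub by blast
        have "(\<Sum>i<n. cmod (q i - z i)) \<le> N"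
          unfolding N_def q_def using True by (intro sum_mono) auto
        then have "16 * M / R\<^sup>2 * (\<Sum>i<n. cmod (q i - z i)) \<le> 16 * M / R\<^sup>2 * N"
          using M_nonneg by (intro mult_left_mono) auto
        then have b: "cmod (pdiff i f q - pdiff i f z) \<le> 16 * M / R\<^sup>2 * N"
          using pdiff_lipschitz[OF centre q i] by linarith
        show ?thesis
        proof (cases "w i = c")
          case wc: True
          then have "q = w" by (auto simp: q_def)
          moreover have "16 * M / R\<^sup>2 * N \<le> ?K * N"
            using M_nonneg N0 by (intro mult_right_mono divide_right_mono) auto
          ultimately show ?thesis using b wc True by (simp add: N_def)
        next
          case False
          have qw: "q(i := w i) = w" "q i = c" by (auto simp: q_def)
          have "cmod (f w - f q - pdiff i f q * (w i - c)) \<le> 8 * M / R\<^sup>2 * (cmod (w i - c))\<^sup>2"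
            using line_step(2)[OF up[OF q] i in_ball[OF up[OF w] i]] qw by simp
          moreover have "f q = 0" by (rule zero[OF qS qw(2)])
          moreover have "?g w - pdiff i f q = (f w - 0 - pdiff i f q * (w i - c)) / (w i - c)"
            using False by (simp add: diff_divide_distrib)
          ultimately have "cmod (?g w - pdiff i f q) \<le> 8 * M / R\<^sup>2 * (cmod (w i - c))\<^sup>2 / cmod (w i - c)"
            unfolding norm_divide by (metis divide_right_mono norm_divide norm_ge_zero)
          also have "\<dots> = 8 * M / R\<^sup>2 * cmod (w i - c)" using False by (simp add: power2_eq_square)
          also have "\<dots> \<le> 8 * M / R\<^sup>2 * N"
          proof (rule mult_left_mono)
            show "cmod (w i - c) \<le> N"
              using member_le_sum[of i "{..<n}" "\<lambda>i. cmod (w i - z i)"] i True by (simp add: N_def)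
          qed (use M_nonneg in simp)
          finally have a: "cmod (?g w - pdiff i f q) \<le> 8 * M / R\<^sup>2 * N" .
          have "cmod (?g w - ?g z) \<le> cmod (?g w - pdiff i f q) + cmod (pdiff i f q - pdiff i f z)"
            using True norm_triangle_ineq[of "?g w - pdiff i f q" "pdiff i f q - pdiff i f z"] by simp
          then have "cmod (?g w - ?g z) \<le> 8 * M / R\<^sup>2 * N + 16 * M / R\<^sup>2 * N" using a b by linarith
          also have "\<dots> = ?K * N" by (simp add: field_simps)
          finally show ?thesis by (simp add: N_def)
        qed
      qed
      show ?thesis using lipschitz_at_continuous_Cn[OF _ e *] R by (metis (no_types, lifting) IntD2 half_gt_zero)
    qed
  qed
  fix z j assume z: "z \<in> S" and j: "j < n"
  show "(\<lambda>\<zeta>. ?g (z(j := \<zeta>))) field_differentiable at (z j)"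
  proof (cases "z i = c")
    case False
    then have "z \<in> S'" using z by (simp add: S'_def)
    then show ?thesis using g' j unfolding holo_def by blast
  next
    case True
    show ?thesis
    proof (cases "j = i")
      case False
      \<comment> \<open>This line lies inside the hyperplane, where \<open>?g\<close> is the partial
        derivative of \<open>f\<close>. The transverse line is left to the removable singularity
        theorem \<open>pole_lemma\<close>.\<close>
      then have "(\<lambda>\<zeta>. ?g (z(j := \<zeta>))) = (\<lambda>\<zeta>. pdiff i f (z(j := \<zeta>)))" using True by auto
      moreover have "(\<lambda>\<zeta>. pdiff i f (z(j := \<zeta>))) field_differentiable at (z j)"
        using holo_pdiff[OF f S i] z j unfolding holo_def by blast
      ultimately show ?thesis by simp
    next
      case ji: True
      obtain R M where hb: "holo_box n S f z R M" using holo_boxE[OF f S z] .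
      then interpret holo_box n S f z R M .
      define L where "L = (\<lambda>\<zeta>. f (z(i := \<zeta>)))"
      have "L holomorphic_on ball (z i) (2 * R)"
        unfolding L_def using z R i S by (intro line(1) centre_in_box_Cn) (auto simp: openin_Cn)
      then have "(\<lambda>x. if x = c then deriv L c else (L x - L c) / (x - c)) holomorphic_on ball (z i) (2 * R)"
        using R True by (intro pole_lemma) auto
      then have "(\<lambda>x. if x = c then deriv L c else (L x - L c) / (x - c)) field_differentiable at (z i)"
        using R by (intro holomorphic_on_imp_differentiable_at[of _ "ball (z i) (2 * R)"]) auto
      moreover have "L c = 0" using zero[OF \<open>z \<in> S\<close> True] True fun_upd_triv[of z i] by (simp add: L_def)
      then have "(\<lambda>x. if x = c then deriv L c else (L x - L c) / (x - c)) = (\<lambda>\<zeta>. ?g (z(i := \<zeta>)))"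
        by (auto simp: L_def pdiff_def)
      ultimately show ?thesis unfolding ji by (simp only:)
    qed
  qed
qed

section \<open>Rules of differentiation\<close>

lemma pdiff_has_derivative:
  "holo n S f \<Longrightarrow> z \<in> S \<Longrightarrow> i < n \<Longrightarrow> ((\<lambda>\<zeta>. f (z(i := \<zeta>))) has_field_derivative pdiff i f z) (at (z i))"
  unfolding holo_def pdiff_def by (blast intro: field_differentiable_derivI)

lemma pdiff_const: "pdiff i (\<lambda>_. c) z = 0"
  by (simp add: pdiff_def)

lemma pdiff_coord: "pdiff i (\<lambda>z. z j) z = (if i = j then 1 else 0)"
  by (simp add: pdiff_def)

lemma pdiff_add:
  assumes "holo n S f" "holo n S g" "z \<in> S" "i < n"
  shows "pdiff i (\<lambda>z. f z + g z) z = pdiff i f z + pdiff i g z"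
  using DERIV_add[OF pdiff_has_derivative[OF assms(1,3,4)] pdiff_has_derivative[OF assms(2,3,4)]]
  unfolding pdiff_def[of i "\<lambda>z. f z + g z"] by (rule DERIV_imp_deriv)

lemma pdiff_mult:
  assumes "holo n S f" "holo n S g" "z \<in> S" "i < n"
  shows "pdiff i (\<lambda>z. f z * g z) z = f z * pdiff i g z + pdiff i f z * g z"
proof -
  have "((\<lambda>\<zeta>. f (z(i := \<zeta>)) * g (z(i := \<zeta>))) has_field_derivative
      pdiff i f z * g (z(i := z i)) + pdiff i g z * f (z(i := z i))) (at (z i))"
    by (rule DERIV_mult[OF pdiff_has_derivative[OF assms(1,3,4)] pdiff_has_derivative[OF assms(2,3,4)]])
  from DERIV_imp_deriv[OF this] show ?thesis
    unfolding pdiff_def[of i "\<lambda>z. f z * g z"] by (simp add: mult.commute)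
qed

section \<open>Manifolds and vector fields\<close>

lemma opensD: "V \<in> opens X U \<Longrightarrow> openin (points X) V" "V \<in> opens X U \<Longrightarrow> V \<subseteq> U"
  by (auto simp: opens_def)

lemma opens_trans: "W \<in> opens X V \<Longrightarrow> V \<in> opens X U \<Longrightarrow> W \<in> opens X U"
  by (auto simp: opens_def)

lemma opens_refl: "openin (points X) U \<Longrightarrow> U \<in> opens X U"
  by (auto simp: opens_def)

lemma opens_Int: "openin (points X) U \<Longrightarrow> openin (points X) V \<Longrightarrow> U \<inter> V \<in> opens X U"
  "openin (points X) U \<Longrightarrow> openin (points X) V \<Longrightarrow> U \<inter> V \<in> opens X V"
  by (auto simp: opens_def)

lemma function_sheaf_restrict:
  "function_sheaf X \<Longrightarrow> openin (points X) U \<Longrightarrow> V \<in> opens X U \<Longrightarrow> f \<in> hol X U \<Longrightarrow> restrict f V \<in> hol X V"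
  unfolding function_sheaf_def by blast

lemma function_sheaf_local:
  assumes X: "function_sheaf X" and U: "openin (points X) U" and f: "f \<in> extensional U"
    and loc: "\<And>p. p \<in> U \<Longrightarrow> \<exists>V\<in>opens X U. p \<in> V \<and> restrict f V \<in> hol X V"
  shows "f \<in> hol X U"
proof -
  have "\<forall>U f. openin (points X) U \<longrightarrow> f \<in> extensional U \<longrightarrow>
        (\<forall>p\<in>U. \<exists>V\<in>opens X U. p \<in> V \<and> restrict f V \<in> hol X V) \<longrightarrow> f \<in> hol X U"
    using X unfolding function_sheaf_def by (elim conjE)
  then show ?thesis using U f loc by blast
qed

text \<open>Only the algebra of functions, without charts. It can be verified for \<open>D\<close>
  directly from \<open>X\<close>, so derivations on \<open>X\<close> and on \<open>D\<close> are
  treated together.\<close>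

locale ringed_space =
  fixes X :: "'a cspace"
  assumes fs: "function_sheaf X"
    and hol_const: "openin (points X) U \<Longrightarrow> (\<lambda>x\<in>U. c) \<in> hol X U"
    and hol_add: "openin (points X) U \<Longrightarrow> f \<in> hol X U \<Longrightarrow> g \<in> hol X U \<Longrightarrow> (\<lambda>x\<in>U. f x + g x) \<in> hol X U"
    and hol_mult: "openin (points X) U \<Longrightarrow> f \<in> hol X U \<Longrightarrow> g \<in> hol X U \<Longrightarrow> (\<lambda>x\<in>U. f x * g x) \<in> hol X U"
begin

abbreviation "opX \<equiv> openin (points X)"
abbreviation "VX \<equiv> vector_fields X"
abbreviation "brk \<equiv> vf_bracket X"

lemma hol_ext: "opX U \<Longrightarrow> f \<in> hol X U \<Longrightarrow> f \<in> extensional U"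
  using fs by (auto simp: function_sheaf_def)

lemmas hol_restrict = function_sheaf_restrict[OF fs]
lemmas hol_local = function_sheaf_local[OF fs]

lemma hol_eqI:
  "opX U \<Longrightarrow> f \<in> hol X U \<Longrightarrow> g \<in> hol X U \<Longrightarrow> (\<And>x. x \<in> U \<Longrightarrow> f x = g x) \<Longrightarrow> f = g"
  by (rule extensionalityI[OF hol_ext hol_ext])

lemma hol_restrict_self: "opX U \<Longrightarrow> f \<in> hol X U \<Longrightarrow> restrict f U = f"
  by (rule extensional_restrict[OF hol_ext])

lemma hol_scale: "opX U \<Longrightarrow> f \<in> hol X U \<Longrightarrow> (\<lambda>x\<in>U. c * f x) \<in> hol X U"
  using hol_mult[OF _ hol_const, of U f c] by (simp cong: restrict_cong)

lemma hol_diff: "opX U \<Longrightarrow> f \<in> hol X U \<Longrightarrow> g \<in> hol X U \<Longrightarrow> (\<lambda>x\<in>U. f x - g x) \<in> hol X U"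
  using hol_add[OF _ _ hol_scale, of U f g "-1"] by (simp cong: restrict_cong)

lemma cring_hol: assumes U: "opX U" shows "cring (hol_ring X U)"
proof (intro cringI abelian_groupI comm_monoidI)
  fix f assume f: "f \<in> carrier (hol_ring X U)"
  show "\<exists>g\<in>carrier (hol_ring X U). g \<oplus>\<^bsub>hol_ring X U\<^esub> f = \<zero>\<^bsub>hol_ring X U\<^esub>"
    using hol_scale[OF U, of f "-1"] f by (intro bexI[of _ "\<lambda>x\<in>U. -1 * f x"]) (auto simp: hol_ring_def)
  show "\<zero>\<^bsub>hol_ring X U\<^esub> \<oplus>\<^bsub>hol_ring X U\<^esub> f = f" "\<one>\<^bsub>hol_ring X U\<^esub> \<otimes>\<^bsub>hol_ring X U\<^esub> f = f"
    using f hol_restrict_self[OF U, of f] by (simp_all add: hol_ring_def cong: restrict_cong)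
qed (auto simp: hol_ring_def hol_add[OF U, unfolded restrict_def] hol_mult[OF U, unfolded restrict_def]
    hol_const[OF U, unfolded restrict_def] fun_eq_iff restrict_def algebra_simps)

end

lemma structure_sheaf_simps [simp]:
  "sections (structure_sheaf X) U = hol X U"
  "\<zero>\<^bsub>sect (structure_sheaf X) U\<^esub> = (\<lambda>x\<in>U. 0)"
  "f \<oplus>\<^bsub>sect (structure_sheaf X) U\<^esub> g = (\<lambda>x\<in>U. f x + g x)"
  "f \<odot>\<^bsub>sect (structure_sheaf X) U\<^esub> g = (\<lambda>x\<in>U. f x * g x)"
  "res (structure_sheaf X) U V f = restrict f V"
  by (auto simp: structure_sheaf_def mk_module_def hol_ring_def)

lemma hol_ring_simps [simp]:
  "carrier (hol_ring X U) = hol X U"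
  "\<zero>\<^bsub>hol_ring X U\<^esub> = (\<lambda>x\<in>U. 0)" "\<one>\<^bsub>hol_ring X U\<^esub> = (\<lambda>x\<in>U. 1)"
  "f \<oplus>\<^bsub>hol_ring X U\<^esub> g = (\<lambda>x\<in>U. f x + g x)"
  "f \<otimes>\<^bsub>hol_ring X U\<^esub> g = (\<lambda>x\<in>U. f x * g x)"
  by (auto simp: hol_ring_def)

text \<open>\<open>commutator\<close> subtracts by means of the additive inverse of the module; this
  makes the bracket a pointwise difference.\<close>

lemma (in ringed_space) structure_sheaf_minus:
  assumes U: "opX U" and f: "f \<in> hol X U" and g: "g \<in> hol X U"
  shows "f \<ominus>\<^bsub>sect (structure_sheaf X) U\<^esub> g = (\<lambda>x\<in>U. f x - g x)"
proof -
  interpret cring "hol_ring X U" by (rule cring_hol[OF U])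
  have "(\<lambda>x\<in>U. (\<lambda>x\<in>U. -1 * g x) x + g x) = (\<lambda>x\<in>U. 0)" by (rule restrict_ext) simp
  then have "\<ominus>\<^bsub>hol_ring X U\<^esub> g = (\<lambda>x\<in>U. -1 * g x)"
    using hol_scale[OF U g, of "-1"] g by (intro minus_equality) simp_all
  moreover have "\<ominus>\<^bsub>sect (structure_sheaf X) U\<^esub> g = \<ominus>\<^bsub>hol_ring X U\<^esub> g"
    by (simp add: a_inv_def m_inv_def)
  ultimately have "f \<ominus>\<^bsub>sect (structure_sheaf X) U\<^esub> g = (\<lambda>x\<in>U. f x + (\<lambda>x\<in>U. -1 * g x) x)"
    by (simp only: a_minus_def structure_sheaf_simps)
  also have "\<dots> = (\<lambda>x\<in>U. f x - g x)" by (rule restrict_ext) simp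
  finally show ?thesis .
qed

lemma vector_fields_iff:
  "v \<in> vector_fields X U \<longleftrightarrow> v \<in> extensional (opens X U) \<and> (\<forall>V\<in>opens X U.
     v V \<in> hol X V \<rightarrow>\<^sub>E hol X V \<and>
     (\<forall>f\<in>hol X V. \<forall>g\<in>hol X V. v V (\<lambda>x\<in>V. f x + g x) = (\<lambda>x\<in>V. v V f x + v V g x)) \<and>
     (\<forall>c. \<forall>f\<in>hol X V. v V (\<lambda>x\<in>V. c * f x) = (\<lambda>x\<in>V. c * v V f x)) \<and>
     (\<forall>W\<in>opens X V. \<forall>f\<in>hol X V. restrict (v V f) W = v W (restrict f W)) \<and>
     (\<forall>f\<in>hol X V. \<forall>g\<in>hol X V. v V (\<lambda>x\<in>V. f x * g x) = (\<lambda>x\<in>V. f x * v V g x + v V f x * g x)))"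
proof -
  have c: "(\<lambda>x\<in>V. (\<lambda>x\<in>V. c) x * f x) = (\<lambda>x\<in>V. c * f x)" for V c and f :: "'a \<Rightarrow> complex"
    by (rule restrict_ext) simp
  have l: "(\<lambda>x\<in>V. (\<lambda>x\<in>V. f x * h x) x + (\<lambda>x\<in>V. k x * g x) x) = (\<lambda>x\<in>V. f x * h x + k x * g x)"
    for V and f g h k :: "'a \<Rightarrow> complex"
    by (rule restrict_ext) simp
  show ?thesis
    unfolding vector_fields_def sheaf_endos_def mem_Collect_eq structure_sheaf_simps hol_ring_simps c l
    by blast
qed

context ringed_space
begin

text \<open>Sections are extensional functions, so every condition on a derivation can be tested at
  points. All vector fields below are built with this rule.\<close>

lemma vfI:
  assumes ext: "v \<in> extensional (opens X U)"
    and "\<And>V. V \<in> opens X U \<Longrightarrow> v V \<in> extensional (hol X V)"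
    and vh: "\<And>V f. V \<in> opens X U \<Longrightarrow> f \<in> hol X V \<Longrightarrow> v V f \<in> hol X V"
    and "\<And>V f g x. V \<in> opens X U \<Longrightarrow> f \<in> hol X V \<Longrightarrow> g \<in> hol X V \<Longrightarrow> x \<in> V \<Longrightarrow>
       v V (\<lambda>x\<in>V. f x + g x) x = v V f x + v V g x"
    and "\<And>V f c x. V \<in> opens X U \<Longrightarrow> f \<in> hol X V \<Longrightarrow> x \<in> V \<Longrightarrow> v V (\<lambda>x\<in>V. c * f x) x = c * v V f x"
    and "\<And>V W f x. V \<in> opens X U \<Longrightarrow> W \<in> opens X V \<Longrightarrow> f \<in> hol X V \<Longrightarrow> x \<in> W \<Longrightarrow> v V f x = v W (restrict f W) x"
    and "\<And>V f g x. V \<in> opens X U \<Longrightarrow> f \<in> hol X V \<Longrightarrow> g \<in> hol X V \<Longrightarrow> x \<in> V \<Longrightarrow>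
       v V (\<lambda>x\<in>V. f x * g x) x = f x * v V g x + v V f x * g x"
  shows "v \<in> VX U"
  unfolding vector_fields_iff
proof (intro conjI ballI allI)
  fix V assume V: "V \<in> opens X U"
  note o = opensD(1)[OF V]
  show "v V \<in> hol X V \<rightarrow>\<^sub>E hol X V" using assms(2,3)[OF V] by (auto simp: PiE_def)
  have e: "\<And>f. f \<in> hol X V \<Longrightarrow> v V f \<in> extensional V" using vh[OF V] hol_ext[OF o] by blast
  show "v V (\<lambda>x\<in>V. f x + g x) = (\<lambda>x\<in>V. v V f x + v V g x)" if "f \<in> hol X V" "g \<in> hol X V" for f g
    using that V by (intro extensionalityI[of _ V] e hol_add o) (auto simp: assms)
  show "v V (\<lambda>x\<in>V. c * f x) = (\<lambda>x\<in>V. c * v V f x)" if "f \<in> hol X V" for f c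
    using that V by (intro extensionalityI[of _ V] e hol_scale o) (auto simp: assms)
  show "v V (\<lambda>x\<in>V. f x * g x) = (\<lambda>x\<in>V. f x * v V g x + v V f x * g x)" if "f \<in> hol X V" "g \<in> hol X V" for f g
    using that V by (intro extensionalityI[of _ V] e hol_mult o) (auto simp: assms)
  show "restrict (v V f) W = v W (restrict f W)" if "W \<in> opens X V" "f \<in> hol X V" for W f
  proof (rule extensionalityI[of _ W])
    have W: "W \<in> opens X U" using that V opens_trans by blast
    show "v W (restrict f W) \<in> extensional W"
      using vh[OF W hol_restrict[OF o that]] hol_ext opensD(1)[OF W] by blast
  qed (use that V assms in auto)
qed (rule ext)

lemma vfD:
  assumes v: "v \<in> VX U" and V: "V \<in> opens X U"
  shows vf_ext: "v V \<in> extensional (hol X V)"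
    and vf_hol: "\<And>f. f \<in> hol X V \<Longrightarrow> v V f \<in> hol X V"
    and vf_add: "\<And>f g x. f \<in> hol X V \<Longrightarrow> g \<in> hol X V \<Longrightarrow> x \<in> V \<Longrightarrow> v V (\<lambda>x\<in>V. f x + g x) x = v V f x + v V g x"
    and vf_scale: "\<And>f c x. f \<in> hol X V \<Longrightarrow> x \<in> V \<Longrightarrow> v V (\<lambda>x\<in>V. c * f x) x = c * v V f x"
    and vf_res: "\<And>f W x. f \<in> hol X V \<Longrightarrow> W \<in> opens X V \<Longrightarrow> x \<in> W \<Longrightarrow> v W (restrict f W) x = v V f x"
    and vf_mult: "\<And>f g x. f \<in> hol X V \<Longrightarrow> g \<in> hol X V \<Longrightarrow> x \<in> V \<Longrightarrow>
       v V (\<lambda>x\<in>V. f x * g x) x = f x * v V g x + v V f x * g x"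
proof -
  note * = v[unfolded vector_fields_iff, THEN conjunct2, rule_format, OF V]
  show "v V \<in> extensional (hol X V)" "\<And>f. f \<in> hol X V \<Longrightarrow> v V f \<in> hol X V" using * by (auto simp: PiE_def)
  show "v V (\<lambda>x\<in>V. f x + g x) x = v V f x + v V g x" if "f \<in> hol X V" "g \<in> hol X V" "x \<in> V" for f g x
    using * that by simp
  show "v V (\<lambda>x\<in>V. c * f x) x = c * v V f x" if "f \<in> hol X V" "x \<in> V" for f c x
    using * that by simp
  show "v V (\<lambda>x\<in>V. f x * g x) x = f x * v V g x + v V f x * g x" if "f \<in> hol X V" "g \<in> hol X V" "x \<in> V" for f g x
    using * that by simp
  show "v W (restrict f W) x = v V f x" if "f \<in> hol X V" "W \<in> opens X V" "x \<in> W" for f W x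
  proof -
    have "restrict (v V f) W = v W (restrict f W)" using * that by blast
    then show ?thesis using that(3) by (metis restrict_apply')
  qed
qed

lemma vf_diff:
  assumes v: "v \<in> VX U" and V: "V \<in> opens X U" and f: "f \<in> hol X V" "g \<in> hol X V" "x \<in> V"
  shows "v V (\<lambda>x\<in>V. f x - g x) x = v V f x - v V g x"
proof -
  have e: "(\<lambda>x\<in>V. f x + (\<lambda>x\<in>V. -1 * g x) x) = (\<lambda>x\<in>V. f x - g x)" by (rule restrict_ext) simp
  show ?thesis
    using vf_add[OF v V f(1) hol_scale[OF opensD(1)[OF V] f(2)] f(3), of "-1", unfolded e]
      vf_scale[OF v V f(2,3), of "-1"] by simp
qed

lemma vf_const:
  assumes v: "v \<in> VX U" and V: "V \<in> opens X U" and x: "x \<in> V"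
  shows "v V (\<lambda>x\<in>V. c) x = 0"
proof -
  have o: "(\<lambda>x\<in>V. 1) \<in> hol X V" using opensD(1)[OF V] by (rule hol_const)
  have e: "(\<lambda>x\<in>V. (\<lambda>x\<in>V. 1) x * (\<lambda>x\<in>V. 1) x) = (\<lambda>x\<in>V. 1 :: complex)" by (rule restrict_ext) simp
  have "v V (\<lambda>x\<in>V. 1) x = 0" using vf_mult[OF v V o o x, unfolded e] x by simp
  moreover have "(\<lambda>x\<in>V. c * (\<lambda>x\<in>V. 1) x) = (\<lambda>x\<in>V. c)" by (rule restrict_ext) simp
  ultimately show ?thesis using vf_scale[OF v V o x, of c] by simp
qed

lemma vf_local:
  assumes v: "v \<in> VX U" and V: "V \<in> opens X U" "V' \<in> opens X U"
    and f: "f \<in> hol X V" "g \<in> hol X V'" and W: "opX W" "x \<in> W" "W \<subseteq> V" "W \<subseteq> V'"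
    and eq: "\<And>y. y \<in> W \<Longrightarrow> f y = g y"
  shows "v V f x = v V' g x"
proof -
  have "restrict f W = restrict g W" using eq by (auto cong: restrict_cong)
  then show ?thesis
    using vf_res[OF v V(1) f(1) _ W(2)] vf_res[OF v V(2) f(2) _ W(2)] W by (simp add: opens_def)
qed

lemma vf_eqI:
  assumes v: "v \<in> VX U" and w: "w \<in> VX U"
    and eq: "\<And>V f x. V \<in> opens X U \<Longrightarrow> f \<in> hol X V \<Longrightarrow> x \<in> V \<Longrightarrow> v V f x = w V f x"
  shows "v = w"
proof (rule extensionalityI[of _ "opens X U"])
  fix V assume V: "V \<in> opens X U"
  show "v V = w V"
  proof (rule extensionalityI[OF vf_ext[OF v V] vf_ext[OF w V]])
    fix f assume f: "f \<in> hol X V"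
    show "v V f = w V f"
      by (rule hol_eqI[OF opensD(1)[OF V] vf_hol[OF v V f] vf_hol[OF w V f] eq[OF V f]])
  qed
qed (rule v[unfolded vector_fields_iff, THEN conjunct1] w[unfolded vector_fields_iff, THEN conjunct1])+

end

section \<open>Charts, coordinate fields and the coordinate expression of a derivation\<close>

locale complex_chart =
  fixes X :: "'a cspace" and n U \<phi>
  assumes ch: "chart X n U \<phi>"
begin

abbreviation "\<psi> \<equiv> inv_into U \<phi>"

lemma openU: "openin (points X) U" and openI: "openin (Cn n) (\<phi> ` U)"
  using ch by (auto simp: chart_def)

lemma homeo: "homeomorphic_map (subtopology (points X) U) (subtopology (Cn n) (\<phi> ` U)) \<phi>"
  using ch by (auto simp: chart_def)

lemma top_sub: "topspace (subtopology (points X) U) = U"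
  using openin_subset[OF openU] by auto

lemma inj: "inj_on \<phi> U"
  using homeomorphic_imp_injective_map[OF homeo] unfolding top_sub .

lemma psi_phi [simp]: "x \<in> U \<Longrightarrow> \<psi> (\<phi> x) = x"
  by (rule inv_into_f_f[OF inj])

lemma open_image: "V \<in> opens X U \<Longrightarrow> openin (Cn n) (\<phi> ` V)"
proof -
  assume V: "V \<in> opens X U"
  have "openin (subtopology (points X) U) V" using V openU by (simp add: opens_def openin_open_subtopology)
  then have "openin (subtopology (Cn n) (\<phi> ` U)) (\<phi> ` V)"
    using homeomorphic_imp_open_map[OF homeo] unfolding open_map_def by blast
  then show ?thesis using openI by (simp add: openin_open_subtopology)
qed

lemma open_preimage: "openin (Cn n) T \<Longrightarrow> openin (points X) {x \<in> U. \<phi> x \<in> T}"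
proof -
  assume T: "openin (Cn n) T"
  have "openin (subtopology (Cn n) (\<phi> ` U)) (T \<inter> \<phi> ` U)" using T by (rule openin_subtopology_Int)
  then have "openin (subtopology (points X) U) {x \<in> topspace (subtopology (points X) U). \<phi> x \<in> T \<inter> \<phi> ` U}"
    using homeomorphic_imp_continuous_map[OF homeo] openin_continuous_map_preimage by blast
  moreover have "{x \<in> topspace (subtopology (points X) U). \<phi> x \<in> T \<inter> \<phi> ` U} = {x \<in> U. \<phi> x \<in> T}"
    using openin_subset[OF openU] by auto
  ultimately show ?thesis using openU by (metis openin_open_subtopology)
qed

lemma phi_ext: "x \<in> U \<Longrightarrow> \<phi> x \<in> extensional {..<n}"
  using openI unfolding openin_Cn by blast

lemma hol_iff:
  assumes V: "V \<in> opens X U" and f: "f \<in> extensional V"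
  shows "f \<in> hol X V \<longleftrightarrow> holo n (\<phi> ` V) (f \<circ> \<psi>)"
proof -
  have "\<forall>V\<in>opens X U. \<forall>f\<in>extensional V.
        f \<in> hol X V \<longleftrightarrow> (\<forall>z\<in>\<phi> ` V. complex_differentiable_at n (f \<circ> \<psi>) z)"
    using ch unfolding chart_def by (elim conjE)
  from this[rule_format, OF V f] show ?thesis unfolding holo_iff[OF open_image[OF V]] .
qed

lemma hol_from: "V \<in> opens X U \<Longrightarrow> holo n (\<phi> ` V) F \<Longrightarrow> (\<lambda>x\<in>V. F (\<phi> x)) \<in> hol X V"
proof -
  assume V: "V \<in> opens X U" and F: "holo n (\<phi> ` V) F"
  have "holo n (\<phi> ` V) ((\<lambda>x\<in>V. F (\<phi> x)) \<circ> \<psi>)"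
    by (rule holo_cong[OF open_image[OF V], THEN iffD1, OF _ F])
      (use opensD(2)[OF V] in \<open>auto simp: subset_iff\<close>)
  then show ?thesis using hol_iff[OF V] by simp
qed

end

locale complex_mfd =
  fixes X :: "'a cspace"
  assumes mfd: "complex_manifold X"
begin

lemma chart_at:
  assumes "p \<in> topspace (points X)"
  obtains n U \<phi> where "p \<in> U" "complex_chart X n U \<phi>"
proof -
  have "\<exists>n U \<phi>. p \<in> U \<and> chart X n U \<phi>"
    using mfd assms by (simp add: complex_manifold_def)
  then obtain n U \<phi> where "p \<in> U" "chart X n U \<phi>" by blast
  then show ?thesis using that[of U n \<phi>] by (simp add: complex_chart_def)
qed

end

sublocale complex_mfd \<subseteq> ringed_space
proof
  show fs: "function_sheaf X" using mfd by (simp add: complex_manifold_def)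
  fix U assume U: "openin (points X) U"
  \<comment> \<open>It suffices that \<open>h\<close> agrees with a \<open>holo\<close> function in
    each chart, which reduces the three closure properties to those of \<open>holo\<close>.\<close>
  have *: "h \<in> hol X U" if h: "h \<in> extensional U"
    and hF: "\<And>n V \<phi>. complex_chart X n V \<phi> \<Longrightarrow> \<exists>F. holo n (\<phi> ` (U \<inter> V)) F \<and> (\<forall>x\<in>U \<inter> V. h x = F (\<phi> x))" for h
  proof -
    have "\<exists>V\<in>opens X U. p \<in> V \<and> restrict h V \<in> hol X V" if "p \<in> U" for p
    proof -
      have "p \<in> topspace (points X)" using that openin_subset[OF U] by blast
      then obtain n V \<phi> where p: "p \<in> V" and c: "complex_chart X n V \<phi>" by (rule chart_at)
      interpret complex_chart X n V \<phi> by (rule c)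
      have UV: "U \<inter> V \<in> opens X V" "U \<inter> V \<in> opens X U" using opens_Int[OF U openU] by auto
      obtain F where F: "holo n (\<phi> ` (U \<inter> V)) F" "\<forall>x\<in>U \<inter> V. h x = F (\<phi> x)"
        using hF[OF c] by blast
      have "restrict h (U \<inter> V) = (\<lambda>x\<in>U \<inter> V. F (\<phi> x))" using F(2) by (auto cong: restrict_cong)
      then have "restrict h (U \<inter> V) \<in> hol X (U \<inter> V)" using hol_from[OF UV(1) F(1)] by simp
      then show ?thesis using UV(2) p that by blast
    qed
    then show ?thesis by (rule function_sheaf_local[OF fs U h])
  qed
  show "(\<lambda>x\<in>U. c) \<in> hol X U" for c
  proof (rule *)
    show "\<exists>F. holo n (\<phi> ` (U \<inter> V)) F \<and> (\<forall>x\<in>U \<inter> V. (\<lambda>x\<in>U. c) x = F (\<phi> x))" for n V \<phi>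
      by (rule exI, rule conjI[OF holo_const[of _ _ c]]) simp
  qed simp
  fix f g assume f: "f \<in> hol X U" and g: "g \<in> hol X U"
  have **: "holo n (\<phi> ` (U \<inter> V)) (h \<circ> inv_into V \<phi>)" if h: "h \<in> hol X U" and c: "complex_chart X n V \<phi>" for h n V \<phi>
  proof -
    interpret complex_chart X n V \<phi> by (rule c)
    have UV: "U \<inter> V \<in> opens X V" "U \<inter> V \<in> opens X U" using opens_Int[OF U openU] by auto
    have "restrict h (U \<inter> V) \<in> hol X (U \<inter> V)" by (rule function_sheaf_restrict[OF fs U UV(2) h])
    then have "holo n (\<phi> ` (U \<inter> V)) (restrict h (U \<inter> V) \<circ> \<psi>)" using hol_iff[OF UV(1)] by simp
    then show ?thesis by (rule holo_cong[OF open_image[OF UV(1)], THEN iffD1, rotated]) auto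
  qed
  show "(\<lambda>x\<in>U. f x + g x) \<in> hol X U"
  proof (rule *)
    fix n V \<phi> assume c: "complex_chart X n V \<phi>"
    interpret complex_chart X n V \<phi> by (rule c)
    show "\<exists>F. holo n (\<phi> ` (U \<inter> V)) F \<and> (\<forall>x\<in>U \<inter> V. (\<lambda>x\<in>U. f x + g x) x = F (\<phi> x))"
      by (rule exI, rule conjI[OF holo_add[OF **[OF f c] **[OF g c]]]) simp
  qed simp
  show "(\<lambda>x\<in>U. f x * g x) \<in> hol X U"
  proof (rule *)
    fix n V \<phi> assume c: "complex_chart X n V \<phi>"
    interpret complex_chart X n V \<phi> by (rule c)
    show "\<exists>F. holo n (\<phi> ` (U \<inter> V)) F \<and> (\<forall>x\<in>U \<inter> V. (\<lambda>x\<in>U. f x * g x) x = F (\<phi> x))"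
      by (rule exI, rule conjI[OF holo_mult[OF **[OF f c] **[OF g c]]]) simp
  qed simp
qed

locale mfd_chart = complex_mfd X + complex_chart X n U \<phi> for X :: "'a cspace" and n U \<phi>
begin

definition crd :: "nat \<Rightarrow> 'a set \<Rightarrow> 'a \<Rightarrow> complex" where
  "crd i V = (\<lambda>x\<in>V. \<phi> x i)"

definition pd :: "nat \<Rightarrow> 'a set \<Rightarrow> ('a \<Rightarrow> complex) \<Rightarrow> 'a \<Rightarrow> complex" where
  "pd i V f = (\<lambda>x\<in>V. pdiff i (f \<circ> \<psi>) (\<phi> x))"

lemma hol_to: "V \<in> opens X U \<Longrightarrow> f \<in> hol X V \<Longrightarrow> holo n (\<phi> ` V) (f \<circ> \<psi>)"
  using hol_iff[OF _ hol_ext[OF opensD(1)]] by blast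

lemma crd_hol: "V \<in> opens X U \<Longrightarrow> i < n \<Longrightarrow> crd i V \<in> hol X V"
  unfolding crd_def by (rule hol_from[OF _ holo_coord])

lemma pd_hol: "V \<in> opens X U \<Longrightarrow> i < n \<Longrightarrow> f \<in> hol X V \<Longrightarrow> pd i V f \<in> hol X V"
  unfolding pd_def by (rule hol_from[OF _ holo_pdiff[OF hol_to open_image]])

lemma crd_apply: "x \<in> V \<Longrightarrow> crd i V x = \<phi> x i"
  by (simp add: crd_def)

lemma pd_crd:
  assumes V: "V \<in> opens X U" and "i < n" "x \<in> V"
  shows "pd i V (crd j V) x = (if i = j then 1 else 0)"
proof -
  have "pdiff i (crd j V \<circ> \<psi>) (\<phi> x) = pdiff i (\<lambda>z. z j) (\<phi> x)"
    using assms opensD(2)[OF V]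
    by (intro pdiff_cong[OF open_image[OF V]]) (auto simp: crd_def subset_iff)
  then show ?thesis using assms by (simp add: pd_def pdiff_coord)
qed

lemma pd_res:
  assumes V: "V \<in> opens X U" and i: "i < n" and W: "W \<in> opens X V" and x: "x \<in> W"
  shows "pd i W (restrict f W) x = pd i V f x"
proof -
  have WU: "W \<in> opens X U" using V W opens_trans by blast
  have "pdiff i (restrict f W \<circ> \<psi>) (\<phi> x) = pdiff i (f \<circ> \<psi>) (\<phi> x)"
    using assms opensD(2)[OF WU]
    by (intro pdiff_cong[OF open_image[OF WU]]) (auto simp: subset_iff)
  then show ?thesis using x opensD(2)[OF W] by (auto simp: pd_def)
qed

lemma pd_add:
  assumes V: "V \<in> opens X U" and i: "i < n" and f: "f \<in> hol X V" "g \<in> hol X V" and x: "x \<in> V"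
  shows "pd i V (\<lambda>x\<in>V. f x + g x) x = pd i V f x + pd i V g x"
proof -
  have "pdiff i ((\<lambda>x\<in>V. f x + g x) \<circ> \<psi>) (\<phi> x) = pdiff i (\<lambda>z. (f \<circ> \<psi>) z + (g \<circ> \<psi>) z) (\<phi> x)"
    using assms opensD(2)[OF V]
    by (intro pdiff_cong[OF open_image[OF V]]) (auto simp: subset_iff)
  also have "\<dots> = pdiff i (f \<circ> \<psi>) (\<phi> x) + pdiff i (g \<circ> \<psi>) (\<phi> x)"
    by (rule pdiff_add[OF hol_to[OF V f(1)] hol_to[OF V f(2)] _ i]) (use x in auto)
  finally show ?thesis using x by (simp add: pd_def)
qed

lemma pd_mult:
  assumes V: "V \<in> opens X U" and i: "i < n" and f: "f \<in> hol X V" "g \<in> hol X V" and x: "x \<in> V"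
  shows "pd i V (\<lambda>x\<in>V. f x * g x) x = f x * pd i V g x + pd i V f x * g x"
proof -
  have xU: "x \<in> U" using x opensD(2)[OF V] by blast
  have "pdiff i ((\<lambda>x\<in>V. f x * g x) \<circ> \<psi>) (\<phi> x) = pdiff i (\<lambda>z. (f \<circ> \<psi>) z * (g \<circ> \<psi>) z) (\<phi> x)"
    using assms opensD(2)[OF V]
    by (intro pdiff_cong[OF open_image[OF V]]) (auto simp: subset_iff)
  also have "\<dots> = (f \<circ> \<psi>) (\<phi> x) * pdiff i (g \<circ> \<psi>) (\<phi> x) + pdiff i (f \<circ> \<psi>) (\<phi> x) * (g \<circ> \<psi>) (\<phi> x)"
    by (rule pdiff_mult[OF hol_to[OF V f(1)] hol_to[OF V f(2)] _ i]) (use x in auto)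
  finally show ?thesis using x xU by (simp add: pd_def)
qed

lemma pd_const:
  assumes V: "V \<in> opens X U" and i: "i < n" and x: "x \<in> V"
  shows "pd i V (\<lambda>x\<in>V. c) x = 0"
proof -
  have "pdiff i ((\<lambda>x\<in>V. c) \<circ> \<psi>) (\<phi> x) = pdiff i (\<lambda>_. c) (\<phi> x)"
    using assms opensD(2)[OF V]
    by (intro pdiff_cong[OF open_image[OF V]]) (auto simp: subset_iff)
  then show ?thesis using x by (simp add: pd_def pdiff_const)
qed

definition dd :: "nat \<Rightarrow> 'a vfield" where
  "dd i = (\<lambda>V\<in>opens X U. \<lambda>f\<in>hol X V. pd i V f)"

lemma dd_apply: "V \<in> opens X U \<Longrightarrow> f \<in> hol X V \<Longrightarrow> dd i V f = pd i V f"
  by (simp add: dd_def)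

lemma dd_vf: assumes i: "i < n" shows "dd i \<in> VX U"
proof (rule vfI)
  fix V assume V: "V \<in> opens X U"
  note o = opensD(1)[OF V]
  show "dd i V \<in> extensional (hol X V)" using V by (simp add: dd_def)
  fix f assume f: "f \<in> hol X V"
  show "dd i V f \<in> hol X V" using V f i by (simp add: dd_apply pd_hol)
  show "dd i V (\<lambda>x\<in>V. c * f x) x = c * dd i V f x" if x: "x \<in> V" for c x
  proof -
    have e: "(\<lambda>x\<in>V. (\<lambda>x\<in>V. c) x * f x) = (\<lambda>x\<in>V. c * f x)" by (rule restrict_ext) simp
    show ?thesis
      using V f x pd_mult[OF V i hol_const[OF o] f x, of c, unfolded e] pd_const[OF V i x, of c] hol_scale[OF o f]
      by (simp add: dd_apply)
  qed
  show "dd i V f x = dd i W (restrict f W) x" if "W \<in> opens X V" "x \<in> W" for W x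
    using that V f i pd_res[OF V i that] hol_restrict[OF o that(1) f] opens_trans[OF that(1) V]
    by (simp add: dd_apply)
  fix g assume g: "g \<in> hol X V"
  show "dd i V (\<lambda>x\<in>V. f x + g x) x = dd i V f x + dd i V g x" if x: "x \<in> V" for x
    using V f g x pd_add[OF V i f g x] hol_add[OF o f g] by (simp add: dd_apply)
  show "dd i V (\<lambda>x\<in>V. f x * g x) x = f x * dd i V g x + dd i V f x * g x" if x: "x \<in> V" for x
    using V f g x pd_mult[OF V i f g x] hol_mult[OF o f g] by (simp add: dd_apply)
qed (simp add: dd_def)

text \<open>The value of the quotient on the locus \<open>\<phi> x i = c\<close> is recorded because
  there it identifies a component of a vector field, both in \<open>vf_coordinates\<close> and in
  \<open>coef_inj\<close>.\<close>

lemma divide_crd: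
  assumes V: "V \<in> opens X U" and i: "i < n" and f: "f \<in> hol X V"
    and zero: "\<And>x. x \<in> V \<Longrightarrow> \<phi> x i = c \<Longrightarrow> f x = 0"
  shows "\<exists>g\<in>hol X V. (\<forall>x\<in>V. f x = (\<phi> x i - c) * g x) \<and> (\<forall>x\<in>V. \<phi> x i = c \<longrightarrow> g x = pd i V f x)"
proof -
  define F where "F = (\<lambda>z. if z i = c then pdiff i (f \<circ> \<psi>) z else (f \<circ> \<psi>) z / (z i - c))"
  have "holo n (\<phi> ` V) F" unfolding F_def
    by (rule holo_divide_hyperplane[OF hol_to[OF V f] open_image[OF V] i])
      (use opensD(2)[OF V] zero in \<open>auto simp: subset_iff\<close>)
  then have "(\<lambda>x\<in>V. F (\<phi> x)) \<in> hol X V" by (rule hol_from[OF V])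
  moreover have "f x = (\<phi> x i - c) * (\<lambda>x\<in>V. F (\<phi> x)) x" if "x \<in> V" for x
    using that zero opensD(2)[OF V] by (auto simp: F_def subset_iff)
  moreover have "(\<lambda>x\<in>V. F (\<phi> x)) x = pd i V f x" if "x \<in> V" "\<phi> x i = c" for x
    using that by (simp add: F_def pd_def)
  ultimately show ?thesis by blast
qed

text \<open>
  Freezing the coordinates one after the other at \<open>p\<close> deforms \<open>f\<close> into a constant; each step changes
  \<open>f\<close> by a multiple of one coordinate function, to which the Leibniz rule applies.
\<close>

theorem vf_coordinates:
  assumes v: "v \<in> VX U0" and V0: "V \<in> opens X U0" and V: "V \<in> opens X U"
    and f: "f \<in> hol X V" and p: "p \<in> V"
  shows "v V f p = (\<Sum>i<n. v V (crd i V) p * pd i V f p)"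
proof -
  have pU: "p \<in> U" using p opensD(2)[OF V] by blast
  define F where "F = f \<circ> \<psi>"
  have F: "holo n (\<phi> ` V) F" unfolding F_def by (rule hol_to[OF V f])
  obtain r where r: "r > 0" "box_Cn n (\<phi> p) r \<subseteq> \<phi> ` V"
    using open_image[OF V] p unfolding openin_Cn by blast
  define B where "B = box_Cn n (\<phi> p) r"
  have B: "openin (Cn n) B" unfolding B_def by (rule openin_box_Cn)
  have pB: "\<phi> p \<in> B" unfolding B_def by (rule centre_in_box_Cn[OF phi_ext[OF pU] r(1)])
  \<comment> \<open>The neighbourhood is shrunk until its image is a polydisc; a point of it then
    stays in the domain when some coordinates are replaced by those of \<open>p\<close>.\<close>
  define W where "W = V \<inter> {x \<in> U. \<phi> x \<in> B}"
  have oW: "opX W" unfolding W_def using opensD(1)[OF V] open_preimage[OF B] by blast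
  have WV: "W \<in> opens X V" and WU: "W \<in> opens X U" and WU0: "W \<in> opens X U0"
    using oW opensD(2)[OF V] opensD(2)[OF V0] by (auto simp: W_def opens_def)
  have pW: "p \<in> W" using p pU pB by (simp add: W_def)
  have phiW: "\<phi> ` W = B"
  proof
    show "\<phi> ` W \<subseteq> B" by (auto simp: W_def)
    show "B \<subseteq> \<phi> ` W"
    proof
      fix z assume z: "z \<in> B"
      then obtain x where x: "x \<in> V" "z = \<phi> x" using r by (auto simp: B_def)
      then show "z \<in> \<phi> ` W" using z opensD(2)[OF V] by (auto simp: W_def)
    qed
  qed
  \<comment> \<open>The first \<open>k\<close> coordinates are frozen at those of \<open>p\<close>:
    \<open>G 0\<close> is \<open>F\<close>, and \<open>G n\<close> is constant on
    \<open>B\<close>.\<close>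
  define G where "G = (\<lambda>k z. F (mix k (\<phi> p) z))"
  have G: "holo n B (G k)" if k: "k \<le> n" for k
    unfolding G_def
  proof (rule holo_comp[OF F open_image[OF V] B])
    show "mix k (\<phi> p) w \<in> \<phi> ` V" if "w \<in> B" for w
      using mix_box[of "\<phi> p" n "\<phi> p" r w k] pB that k r unfolding B_def by blast
    show "mix k (\<phi> p) w' \<in> box_Cn n (mix k (\<phi> p) w) \<delta>" if "w \<in> B" "w' \<in> B" "\<delta> > 0" "w' \<in> box_Cn n w \<delta>" for w w' \<delta>
      using that mix_ext[of "\<phi> p" n w' k] phi_ext[OF pU] k by (auto simp: box_Cn_def) (auto simp: mix_def)
    show "(\<exists>i<n. \<forall>w\<in>B. mix k (\<phi> p) w i = w j \<and> (\<forall>\<zeta>. mix k (\<phi> p) (w(j := \<zeta>)) = (mix k (\<phi> p) w)(i := \<zeta>)))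
        \<or> (\<forall>w\<in>B. \<forall>\<zeta>. mix k (\<phi> p) (w(j := \<zeta>)) = mix k (\<phi> p) w)" if j: "j < n" for j
    proof (cases "j < k")
      case True
      then show ?thesis by (auto simp: mix_def fun_eq_iff)
    next
      case False
      then show ?thesis using j by (intro disjI1 exI[of _ j]) (auto simp: mix_def fun_eq_iff)
    qed
  qed
  define h where "h = (\<lambda>k. \<lambda>x\<in>W. G k (\<phi> x))"
  have h: "h k \<in> hol X W" if "k \<le> n" for k
    unfolding h_def using G[OF that] phiW by (intro hol_from[OF WU]) simp
  have pdG: "pd k W (h k) p = pd k V f p" if k: "k < n" for k
  proof -
    have "pdiff k (h k \<circ> \<psi>) (\<phi> p) = pdiff k (G k) (\<phi> p)"
    proof (rule pdiff_cong[OF open_image[OF WU] _ _ k])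
      show "(h k \<circ> \<psi>) z = G k z" if "z \<in> \<phi> ` W" for z
        using that opensD(2)[OF WU] by (auto simp: h_def subset_iff)
    qed (use pW in auto)
    also have "\<dots> = pdiff k F (\<phi> p)"
    proof -
      have "mix k (\<phi> p) ((\<phi> p)(k := \<zeta>)) = (\<phi> p)(k := \<zeta>)" for \<zeta> by (auto simp: mix_def)
      then show ?thesis by (simp add: pdiff_def G_def)
    qed
    finally show ?thesis using p pW by (simp add: pd_def F_def)
  qed
  have step: "v W (h k) p - v W (h (Suc k)) p = v V (crd k V) p * pd k V f p" if k: "k < n" for k
  proof -
    have hk: "h k \<in> hol X W" "h (Suc k) \<in> hol X W" using h k by auto
    let ?d = "\<lambda>x\<in>W. h k x - h (Suc k) x"
    have d: "?d \<in> hol X W" by (rule hol_diff[OF oW hk])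
    have d0: "?d x = 0" if "x \<in> W" "\<phi> x k = \<phi> p k" for x
    proof -
      have "mix (Suc k) (\<phi> p) (\<phi> x) = mix k (\<phi> p) (\<phi> x)" using that(2) by (auto simp: mix_def less_Suc_eq)
      then show ?thesis using that(1) by (simp add: h_def G_def)
    qed
    obtain g where g: "g \<in> hol X W"
      "\<And>x. x \<in> W \<Longrightarrow> ?d x = (\<phi> x k - \<phi> p k) * g x" "\<And>x. x \<in> W \<Longrightarrow> \<phi> x k = \<phi> p k \<Longrightarrow> g x = pd k W ?d x"
      using divide_crd[OF WU k d d0] by blast
    have c: "crd k W \<in> hol X W" by (rule crd_hol[OF WU k])
    let ?c = "\<lambda>x\<in>W. crd k W x - (\<lambda>x\<in>W. \<phi> p k) x"
    have c': "?c \<in> hol X W" by (rule hol_diff[OF oW c hol_const[OF oW]])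
    have "?d = (\<lambda>x\<in>W. ?c x * g x)"
    proof
      show "?d x = (\<lambda>x\<in>W. ?c x * g x) x" for x
        using g(2)[of x] by (cases "x \<in> W") (simp_all add: crd_def)
    qed
    \<comment> \<open>The factor \<open>?c\<close> vanishes at \<open>p\<close>, so of the two
      Leibniz terms only \<open>v(x\<^sub>k)(p) * g p\<close> survives.\<close>
    then have "v W ?d p = ?c p * v W g p + v W ?c p * g p"
      using vf_mult[OF v WU0 c' g(1) pW] by simp
    also have "?c p = 0" using pW by (simp add: crd_def)
    also have "v W ?c p = v W (crd k W) p"
      using vf_diff[OF v WU0 c hol_const[OF oW, of "\<phi> p k"] pW] vf_const[OF v WU0 pW] by simp
    also have "crd k W = restrict (crd k V) W"
      using opensD(2)[OF WV] by (auto simp: crd_def fun_eq_iff)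
    also have "v W (restrict (crd k V) W) p = v V (crd k V) p"
      by (rule vf_res[OF v V0 crd_hol[OF V k] WV pW])
    also have "g p = pd k V f p"
    proof -
      have "pd k W (\<lambda>x\<in>W. ?d x + h (Suc k) x) p = pd k W ?d p + pd k W (h (Suc k)) p"
        by (rule pd_add[OF WU k d hk(2) pW])
      moreover have "(\<lambda>x\<in>W. ?d x + h (Suc k) x) = h k"
        by (rule hol_eqI[OF oW hol_add[OF oW d hk(2)] hk(1)]) simp
      \<comment> \<open>The coordinate \<open>k\<close> is already frozen in
        \<open>h (Suc k)\<close>, so \<open>?d\<close> and \<open>h k\<close> have the same
        derivative in that direction.\<close>
      moreover have "pd k W (h (Suc k)) p = 0"
      proof -
        have "pdiff k (h (Suc k) \<circ> \<psi>) (\<phi> p) = pdiff k (G (Suc k)) (\<phi> p)"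
        proof (rule pdiff_cong[OF open_image[OF WU] _ _ k])
          show "(h (Suc k) \<circ> \<psi>) z = G (Suc k) z" if "z \<in> \<phi> ` W" for z
            using that opensD(2)[OF WU] by (auto simp: h_def subset_iff)
        qed (use pW in auto)
        also have "\<dots> = 0"
        proof -
          have "mix (Suc k) (\<phi> p) ((\<phi> p)(k := \<zeta>)) = \<phi> p" for \<zeta> by (auto simp: mix_def)
          then show ?thesis by (simp add: pdiff_def G_def)
        qed
        finally show ?thesis using pW by (simp add: pd_def)
      qed
      ultimately show ?thesis using g(3)[OF pW] pdG[OF k] by simp
    qed
    finally have fin: "v W ?d p = 0 * v W g p + v V (crd k V) p * pd k V f p" .
    show ?thesis using vf_diff[OF v WU0 hk pW] fin by simp
  qed
  have "v W (h 0) p - v W (h n) p = (\<Sum>k<n. v W (h k) p - v W (h (Suc k)) p)"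
    using sum_lessThan_telescope'[of "\<lambda>k. v W (h k) p" n] by simp
  also have "\<dots> = (\<Sum>i<n. v V (crd i V) p * pd i V f p)" using step by simp
  also have "h 0 = restrict f W"
    using opensD(2)[OF WU] by (auto simp: h_def G_def mix_0 F_def fun_eq_iff)
  also have "v W (restrict f W) p = v V f p" by (rule vf_res[OF v V0 f WV pW])
  also have "h n = (\<lambda>x\<in>W. f p)"
  proof
    fix x show "h n x = (\<lambda>x\<in>W. f p) x"
      using mix_top[OF phi_ext[OF pU], of "\<phi> x"] phi_ext[of x] opensD(2)[OF WU] pU
      by (auto simp: h_def G_def F_def)
  qed
  also have "v W (\<lambda>x\<in>W. f p) p = 0" by (rule vf_const[OF v WU0 pW])
  finally show ?thesis by simp
qed

end

section \<open>Quotients by germs\<close>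

text \<open>The conditions of \<open>sheaf_of_modules\<close> without gluing. Germs only see
  restrictions, and sections of the quotient glue because they are functions into stalks.\<close>

locale module_presheaf = ringed_space X for X :: "'a cspace" +
  fixes F :: "('a, 's) msheaf"
  assumes md: "openin (points X) U \<Longrightarrow> module (hol_ring X U) (sect F U)"
    and res_closed: "V \<in> opens X U \<Longrightarrow> openin (points X) U \<Longrightarrow> s \<in> sections F U \<Longrightarrow> res F U V s \<in> sections F V"
    and res_self: "openin (points X) U \<Longrightarrow> s \<in> sections F U \<Longrightarrow> res F U U s = s"
    and res_add: "V \<in> opens X U \<Longrightarrow> openin (points X) U \<Longrightarrow> s \<in> sections F U \<Longrightarrow> t \<in> sections F U \<Longrightarrow>
      res F U V (s \<oplus>\<^bsub>sect F U\<^esub> t) = res F U V s \<oplus>\<^bsub>sect F V\<^esub> res F U V t"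
    and res_smult: "V \<in> opens X U \<Longrightarrow> openin (points X) U \<Longrightarrow> f \<in> hol X U \<Longrightarrow> s \<in> sections F U \<Longrightarrow>
      res F U V (f \<odot>\<^bsub>sect F U\<^esub> s) = restrict f V \<odot>\<^bsub>sect F V\<^esub> res F U V s"
    and res_res: "W \<in> opens X V \<Longrightarrow> V \<in> opens X U \<Longrightarrow> openin (points X) U \<Longrightarrow> s \<in> sections F U \<Longrightarrow>
      res F V W (res F U V s) = res F U W s"
begin

lemma ag: "opX U \<Longrightarrow> abelian_group (sect F U)"
  using md module.axioms(2) by blast

lemma res_zero:
  assumes V: "V \<in> opens X U" and U: "opX U"
  shows "res F U V \<zero>\<^bsub>sect F U\<^esub> = \<zero>\<^bsub>sect F V\<^esub>"
proof -
  interpret A: abelian_group "sect F U" by (rule ag[OF U])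
  interpret B: abelian_group "sect F V" by (rule ag[OF opensD(1)[OF V]])
  have "res F U V (\<zero>\<^bsub>sect F U\<^esub> \<oplus>\<^bsub>sect F U\<^esub> \<zero>\<^bsub>sect F U\<^esub>) = res F U V \<zero>\<^bsub>sect F U\<^esub> \<oplus>\<^bsub>sect F V\<^esub> res F U V \<zero>\<^bsub>sect F U\<^esub>"
    by (rule res_add[OF V U]) auto
  then have "res F U V \<zero>\<^bsub>sect F U\<^esub> = res F U V \<zero>\<^bsub>sect F U\<^esub> \<oplus>\<^bsub>sect F V\<^esub> res F U V \<zero>\<^bsub>sect F U\<^esub>" by simp
  then show ?thesis using res_closed[OF V U A.zero_closed]
    by (metis B.add.r_cancel_one' B.zero_closed)
qed

lemma res_minus:
  assumes V: "V \<in> opens X U" and U: "opX U" and s: "s \<in> sections F U" and t: "t \<in> sections F U"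
  shows "res F U V (s \<ominus>\<^bsub>sect F U\<^esub> t) = res F U V s \<ominus>\<^bsub>sect F V\<^esub> res F U V t"
proof -
  interpret A: abelian_group "sect F U" by (rule ag[OF U])
  interpret B: abelian_group "sect F V" by (rule ag[OF opensD(1)[OF V]])
  have c: "\<ominus>\<^bsub>sect F U\<^esub> t \<in> sections F U" using t by simp
  have "res F U V (\<ominus>\<^bsub>sect F U\<^esub> t) \<oplus>\<^bsub>sect F V\<^esub> res F U V t = \<zero>\<^bsub>sect F V\<^esub>"
    using res_add[OF V U c t] A.l_neg[OF t] res_zero[OF V U] by simp
  then have "res F U V (\<ominus>\<^bsub>sect F U\<^esub> t) = \<ominus>\<^bsub>sect F V\<^esub> res F U V t"
    using B.minus_equality[OF _ res_closed[OF V U t] res_closed[OF V U c]] by simp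
  then show ?thesis using res_add[OF V U s c] by (simp add: a_minus_def)
qed

end

lemma (in abelian_group) minus_sum:
  "a \<in> carrier G \<Longrightarrow> b \<in> carrier G \<Longrightarrow> c \<in> carrier G \<Longrightarrow> d \<in> carrier G \<Longrightarrow>
    (a \<oplus> b) \<ominus> (c \<oplus> d) = (a \<ominus> c) \<oplus> (b \<ominus> d)"
  by (simp add: a_minus_def minus_add a_ac)

lemma (in abelian_group) minus_chain:
  "a \<in> carrier G \<Longrightarrow> b \<in> carrier G \<Longrightarrow> c \<in> carrier G \<Longrightarrow> (a \<ominus> b) \<oplus> (b \<ominus> c) = a \<ominus> c"
  by (simp add: a_minus_def a_assoc r_neg1)

lemma (in abelian_group) minus_plus_cancel:
  "a \<in> carrier G \<Longrightarrow> b \<in> carrier G \<Longrightarrow> (a \<ominus> b) \<oplus> b = a"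
  by (simp add: a_minus_def a_assoc l_neg)

lemma (in module) smult_minus:
  "f \<in> carrier R \<Longrightarrow> x \<in> carrier M \<Longrightarrow> y \<in> carrier M \<Longrightarrow>
    f \<odot>\<^bsub>M\<^esub> (x \<ominus>\<^bsub>M\<^esub> y) = f \<odot>\<^bsub>M\<^esub> x \<ominus>\<^bsub>M\<^esub> f \<odot>\<^bsub>M\<^esub> y"
  by (simp add: a_minus_def smult_r_distr smult_r_minus)

text \<open>Instantiated three times: for the logarithmic fields and for all fields, each modulo its
  multiples by \<open>I\<^sub>D\<close>, and for the normal bundle. In the last case the ambient
  space is already \<open>D\<close>, so the ideal of \<open>D\<close> in it is zero.\<close>

locale germ_quotient = module_presheaf X F for X :: "'a cspace" and F :: "('a, 's) msheaf" +
  fixes Y :: "'a cspace" and D :: "'a set" and G :: "'a set \<Rightarrow> 's set"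
  assumes pts: "points Y = subtopology (points X) D"
    and D_sub: "D \<subseteq> topspace (points X)"
    and rY: "ringed_space Y"
    and holY: "\<And>V f. openin (points Y) V \<Longrightarrow> f \<in> hol Y V \<longleftrightarrow> f \<in> extensional V \<and>
        (\<forall>p\<in>V. \<exists>U. openin (points X) U \<and> p \<in> U \<and> (\<exists>g\<in>hol X U. \<forall>x\<in>U \<inter> V. f x = g x))"
    and G_sub: "\<And>U. openin (points X) U \<Longrightarrow> G U \<subseteq> sections F U"
    and G_zero: "\<And>U. openin (points X) U \<Longrightarrow> \<zero>\<^bsub>sect F U\<^esub> \<in> G U"
    and G_add: "\<And>U s t. openin (points X) U \<Longrightarrow> s \<in> G U \<Longrightarrow> t \<in> G U \<Longrightarrow> s \<oplus>\<^bsub>sect F U\<^esub> t \<in> G U"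
    and G_smult: "\<And>U f s. openin (points X) U \<Longrightarrow> f \<in> hol X U \<Longrightarrow> s \<in> G U \<Longrightarrow> f \<odot>\<^bsub>sect F U\<^esub> s \<in> G U"
    and G_ideal: "\<And>U f s. openin (points X) U \<Longrightarrow> f \<in> ideal_sheaf X D U \<Longrightarrow> s \<in> sections F U \<Longrightarrow> f \<odot>\<^bsub>sect F U\<^esub> s \<in> G U"
    and G_res: "\<And>U V s. openin (points X) U \<Longrightarrow> V \<in> opens X U \<Longrightarrow> s \<in> G U \<Longrightarrow> res F U V s \<in> G V"
begin

abbreviation "opY \<equiv> openin (points Y)"

lemma openY: "opY V \<longleftrightarrow> (\<exists>U. opX U \<and> V = U \<inter> D)"
  by (simp add: pts openin_subtopology)

lemma openY_Int: "opX U \<Longrightarrow> opY (U \<inter> D)"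
  using openY by blast

lemma openY_sub: "opY V \<Longrightarrow> V \<subseteq> D"
  using openY by blast

lemma G_neg: "opX U \<Longrightarrow> s \<in> G U \<Longrightarrow> \<ominus>\<^bsub>sect F U\<^esub> s \<in> G U"
proof -
  assume U: "opX U" and s: "s \<in> G U"
  interpret module "hol_ring X U" "sect F U" by (rule md[OF U])
  have s': "s \<in> sections F U" using s G_sub[OF U] by blast
  have "(\<ominus>\<^bsub>hol_ring X U\<^esub> \<one>\<^bsub>hol_ring X U\<^esub>) \<odot>\<^bsub>sect F U\<^esub> s = \<ominus>\<^bsub>sect F U\<^esub> s"
    using s' smult_l_minus[OF R.one_closed s'] smult_one[OF s'] by simp
  then show ?thesis using G_smult[OF U _ s, of "\<ominus>\<^bsub>hol_ring X U\<^esub> \<one>\<^bsub>hol_ring X U\<^esub>"] R.a_inv_closed[OF R.one_closed] by simp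
qed

abbreviation gm :: "'a set \<Rightarrow> 's \<Rightarrow> 'a \<Rightarrow> ('a set \<times> 's) set" where
  "gm \<equiv> germ_mod X F G"

text \<open>Equality in the stalk \<open>F\<^sub>p / G\<^sub>p\<close> of two representatives with
  different domains.\<close>

definition grel :: "'a set \<Rightarrow> 's \<Rightarrow> 'a set \<Rightarrow> 's \<Rightarrow> 'a \<Rightarrow> bool" where
  "grel U s U' s' p \<longleftrightarrow> (\<exists>W\<in>opens X (U \<inter> U'). p \<in> W \<and> res F U W s \<ominus>\<^bsub>sect F W\<^esub> res F U' W s' \<in> G W)"

lemma gm_mem: "(U', s') \<in> gm U s p \<longleftrightarrow> opX U' \<and> p \<in> U' \<and> s' \<in> sections F U' \<and> grel U s U' s' p"
  by (simp add: germ_mod_def grel_def)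

lemma grel_refl:
  assumes U: "opX U" and s: "s \<in> sections F U" and p: "p \<in> U"
  shows "grel U s U s p"
proof -
  interpret abelian_group "sect F U" by (rule ag[OF U])
  show ?thesis unfolding grel_def
    using U s p G_zero[OF U] by (intro bexI[of _ U]) (simp_all add: res_self a_minus_def r_neg opens_def)
qed

lemma grel_sym:
  assumes U: "opX U" "opX U'" and s: "s \<in> sections F U" "s' \<in> sections F U'"
    and r: "grel U s U' s' p"
  shows "grel U' s' U s p"
proof -
  obtain W where W: "W \<in> opens X (U \<inter> U')" "p \<in> W" "res F U W s \<ominus>\<^bsub>sect F W\<^esub> res F U' W s' \<in> G W"
    using r unfolding grel_def by blast
  note oW = opensD(1)[OF W(1)]
  interpret abelian_group "sect F W" by (rule ag[OF oW])
  have "W \<in> opens X U" "W \<in> opens X U'" "W \<in> opens X (U' \<inter> U)" using W(1) by (auto simp: opens_def)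
  moreover have c: "res F U W s \<in> sections F W" "res F U' W s' \<in> sections F W"
    using calculation res_closed U s by auto
  then have "\<ominus>\<^bsub>sect F W\<^esub> (res F U W s \<ominus>\<^bsub>sect F W\<^esub> res F U' W s') = res F U' W s' \<ominus>\<^bsub>sect F W\<^esub> res F U W s"
    by (simp add: a_minus_def minus_add a_comm)
  ultimately show ?thesis unfolding grel_def using G_neg[OF oW W(3)] W(2) by metis
qed

lemma grel_trans:
  assumes U: "opX U" "opX U'" "opX U''"
    and s: "s \<in> sections F U" "s' \<in> sections F U'" "s'' \<in> sections F U''"
    and r: "grel U s U' s' p" "grel U' s' U'' s'' p"
  shows "grel U s U'' s'' p"
proof -
  obtain W where W: "W \<in> opens X (U \<inter> U')" "p \<in> W" "res F U W s \<ominus>\<^bsub>sect F W\<^esub> res F U' W s' \<in> G W"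
    using r(1) unfolding grel_def by blast
  obtain W' where W': "W' \<in> opens X (U' \<inter> U'')" "p \<in> W'" "res F U' W' s' \<ominus>\<^bsub>sect F W'\<^esub> res F U'' W' s'' \<in> G W'"
    using r(2) unfolding grel_def by blast
  define V where "V = W \<inter> W'"
  have oW: "opX W" "opX W'" using W(1) W'(1) opensD(1) by blast+
  have V: "V \<in> opens X W" "V \<in> opens X W'" "V \<in> opens X (U \<inter> U'')" and oV: "opX V"
    using W(1) W'(1) unfolding V_def by (auto simp: opens_def)
  have WU: "W \<in> opens X U" "W \<in> opens X U'" "W' \<in> opens X U'" "W' \<in> opens X U''"
    "V \<in> opens X U" "V \<in> opens X U'" "V \<in> opens X U''"
    using W(1) W'(1) oV unfolding V_def by (auto simp: opens_def)
  interpret abelian_group "sect F V" by (rule ag[OF oV])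
  have c: "res F U V s \<in> sections F V" "res F U' V s' \<in> sections F V" "res F U'' V s'' \<in> sections F V"
    using res_closed WU U s by auto
  have "res F U V s \<ominus>\<^bsub>sect F V\<^esub> res F U' V s' \<in> G V"
    using G_res[OF oW(1) V(1) W(3)] res_minus[OF V(1) oW(1) res_closed[OF WU(1) U(1) s(1)] res_closed[OF WU(2) U(2) s(2)]]
      res_res[OF V(1) WU(1) U(1) s(1)] res_res[OF V(1) WU(2) U(2) s(2)] by simp
  moreover have "res F U' V s' \<ominus>\<^bsub>sect F V\<^esub> res F U'' V s'' \<in> G V"
    using G_res[OF oW(2) V(2) W'(3)] res_minus[OF V(2) oW(2) res_closed[OF WU(3) U(2) s(2)] res_closed[OF WU(4) U(3) s(3)]]
      res_res[OF V(2) WU(3) U(2) s(2)] res_res[OF V(2) WU(4) U(3) s(3)] by simp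
  ultimately have "res F U V s \<ominus>\<^bsub>sect F V\<^esub> res F U'' V s'' \<in> G V"
    using G_add[OF oV] minus_chain[OF c] by metis
  then show ?thesis unfolding grel_def using V(3) W(2) W'(2) unfolding V_def by blast
qed

text \<open>\<open>grel\<close> is an equivalence relation on representatives and
  \<open>gm U s p\<close> is the class of \<open>(U, s)\<close>.\<close>

lemma gm_eq_iff:
  assumes U: "opX U" "opX U'" and s: "s \<in> sections F U" "s' \<in> sections F U'"
    and p: "p \<in> U" "p \<in> U'"
  shows "gm U s p = gm U' s' p \<longleftrightarrow> grel U s U' s' p"
proof
  assume "gm U s p = gm U' s' p"
  moreover have "(U', s') \<in> gm U' s' p" using U s p grel_refl by (simp add: gm_mem)
  ultimately show "grel U s U' s' p" using gm_mem by blast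
next
  assume r: "grel U s U' s' p"
  show "gm U s p = gm U' s' p"
  proof -
    have "(U'', s'') \<in> gm U s p \<longleftrightarrow> (U'', s'') \<in> gm U' s' p" for U'' s''
      unfolding gm_mem
      using grel_trans[OF U(1,2) _ s _ r, of U'' s''] grel_trans[OF U(2,1) _ s(2,1) _ grel_sym[OF U s r], of U'' s'']
      by blast
    then show ?thesis by auto
  qed
qed

lemma gm_res:
  assumes U: "opX U" and s: "s \<in> sections F U" and W: "W \<in> opens X U" and p: "p \<in> W"
  shows "gm W (res F U W s) p = gm U s p"
proof -
  note oW = opensD(1)[OF W]
  interpret abelian_group "sect F W" by (rule ag[OF oW])
  have c: "res F U W s \<in> sections F W" by (rule res_closed[OF W U s])
  have "grel W (res F U W s) U s p" unfolding grel_def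
    using W p c G_zero[OF oW] res_self[OF oW c]
    by (intro bexI[of _ W]) (auto simp: a_minus_def r_neg opens_def)
  then show ?thesis using gm_eq_iff[OF oW U c s p] W p by (auto simp: opens_def)
qed

section \<open>Sections of the quotient and their local lifts\<close>

abbreviation Q :: "('a, ('a, 's) qsection) msheaf" where
  "Q \<equiv> germ_sheaf X F G"

text \<open>The central relation: \<open>s\<close> induces \<open>t\<close> on all of
  \<open>U \<inter> D\<close>. Since lifts can be shrunk, finitely many sections have lifts over one
  neighbourhood, and an identity of sections holds once both sides have a common lift near each
  point (\<open>Q_eqI\<close>).\<close>

definition lft :: "'a set \<Rightarrow> ('a, 's) qsection \<Rightarrow> 'a set \<Rightarrow> 's \<Rightarrow> bool" where
  "lft V t U s \<longleftrightarrow> opX U \<and> U \<inter> D \<subseteq> V \<and> s \<in> sections F U \<and> (\<forall>q\<in>U \<inter> D. t q = gm U s q)"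

lemma lftD:
  assumes "lft V t U s"
  shows "opX U" "U \<inter> D \<subseteq> V" "s \<in> sections F U" "\<And>q. q \<in> U \<Longrightarrow> q \<in> D \<Longrightarrow> t q = gm U s q"
  using assms by (auto simp: lft_def)

lemma lft_res: "lft V t U s \<Longrightarrow> W \<in> opens X U \<Longrightarrow> lft V t W (res F U W s)"
  unfolding lft_def using res_closed gm_res by (auto simp: opens_def subset_iff)

lemma sections_Q:
  "t \<in> sections Q V \<longleftrightarrow> t \<in> extensional V \<and> (\<forall>p\<in>V. \<exists>U. opX U \<and> p \<in> U \<and>
     (\<exists>s\<in>sections F U. \<forall>q\<in>U \<inter> V. t q = gm U s q))"
  by (simp add: germ_sheaf_def mk_module_def)

lemma Q_ext: "t \<in> sections Q V \<Longrightarrow> t \<in> extensional V"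
  by (simp add: sections_Q)

lemma ex_lft:
  assumes t: "t \<in> sections Q V" and V: "opY V" and p: "p \<in> V"
    and N: "opX N" "p \<in> N"
  shows "\<exists>U s. p \<in> U \<and> U \<subseteq> N \<and> lft V t U s"
proof -
  obtain U s where U: "opX U" "p \<in> U" "s \<in> sections F U" "\<forall>q\<in>U \<inter> V. t q = gm U s q"
    using t p unfolding sections_Q by blast
  obtain N' where N': "opX N'" "V = N' \<inter> D" using V openY by blast
  define W where "W = U \<inter> N \<inter> N'"
  have W: "W \<in> opens X U" "p \<in> W" "W \<subseteq> N" "W \<inter> D \<subseteq> V"
    using U N N' p by (auto simp: W_def opens_def)
  have "t q = gm W (res F U W s) q" if "q \<in> W \<inter> D" for q
    using gm_res[OF U(1,3) W(1), of q] U(4) that W by (auto simp: W_def)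
  then have "lft V t W (res F U W s)"
    unfolding lft_def using W res_closed[OF W(1) U(1,3)] by (auto simp: opens_def)
  then show ?thesis using W by blast
qed

lemma ex_lft2:
  assumes t: "t \<in> sections Q V" "t' \<in> sections Q V" and V: "opY V" and p: "p \<in> V"
    and N: "opX N" "p \<in> N"
  shows "\<exists>U s s'. p \<in> U \<and> U \<subseteq> N \<and> lft V t U s \<and> lft V t' U s'"
proof -
  obtain U s where U: "p \<in> U" "U \<subseteq> N" "lft V t U s" using ex_lft[OF t(1) V p N] by blast
  obtain U' s' where U': "p \<in> U'" "U' \<subseteq> U" "lft V t' U' s'" using ex_lft[OF t(2) V p lftD(1)[OF U(3)] U(1)] by blast
  have "U' \<in> opens X U" using U' lftD(1) by (auto simp: opens_def)
  then show ?thesis using lft_res[OF U(3)] U U' by blast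
qed

lemma ex_lft3:
  assumes t: "t \<in> sections Q V" "t' \<in> sections Q V" "t'' \<in> sections Q V" and V: "opY V" and p: "p \<in> V"
    and N: "opX N" "p \<in> N"
  shows "\<exists>U s s' s''. p \<in> U \<and> U \<subseteq> N \<and> lft V t U s \<and> lft V t' U s' \<and> lft V t'' U s''"
proof -
  obtain U s where U: "p \<in> U" "U \<subseteq> N" "lft V t U s" using ex_lft[OF t(1) V p N] by blast
  obtain U' s' s'' where U': "p \<in> U'" "U' \<subseteq> U" "lft V t' U' s'" "lft V t'' U' s''"
    using ex_lft2[OF t(2,3) V p lftD(1)[OF U(3)] U(1)] by blast
  have "U' \<in> opens X U" using U' lftD(1) by (auto simp: opens_def)
  then show ?thesis using lft_res[OF U(3)] U U' by blast
qed

text \<open>For functions on \<open>D\<close> what \<open>lft\<close> is for sections.\<close>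

definition ext_to :: "'a set \<Rightarrow> ('a \<Rightarrow> complex) \<Rightarrow> 'a set \<Rightarrow> ('a \<Rightarrow> complex) \<Rightarrow> bool" where
  "ext_to V f U h \<longleftrightarrow> opX U \<and> U \<inter> D \<subseteq> V \<and> h \<in> hol X U \<and> (\<forall>x\<in>U \<inter> D. f x = h x)"

lemma ext_toD:
  assumes "ext_to V f U h"
  shows "opX U" "U \<inter> D \<subseteq> V" "h \<in> hol X U" "\<And>x. x \<in> U \<Longrightarrow> x \<in> D \<Longrightarrow> f x = h x"
  using assms by (auto simp: ext_to_def)

lemma ext_to_res: "ext_to V f U h \<Longrightarrow> W \<in> opens X U \<Longrightarrow> ext_to V f W (restrict h W)"
  unfolding ext_to_def using hol_restrict by (auto simp: opens_def subset_iff)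

lemma ex_ext:
  assumes f: "f \<in> hol Y V" and V: "opY V" and p: "p \<in> V"
    and N: "opX N" "p \<in> N"
  shows "\<exists>U h. p \<in> U \<and> U \<subseteq> N \<and> ext_to V f U h"
proof -
  obtain U g where U: "opX U" "p \<in> U" "g \<in> hol X U" "\<forall>x\<in>U \<inter> V. f x = g x"
    using f p unfolding holY[OF V] by blast
  obtain N' where N': "opX N'" "V = N' \<inter> D" using V openY by blast
  define W where "W = U \<inter> N \<inter> N'"
  have W: "W \<in> opens X U" "p \<in> W" "W \<subseteq> N" "W \<inter> D \<subseteq> V"
    using U N N' p by (auto simp: W_def opens_def)
  have "ext_to V f W (restrict g W)"
    unfolding ext_to_def using W U hol_restrict[OF U(1) W(1) U(3)] by (auto simp: opens_def)
  then show ?thesis using W by blast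
qed

lemma holY_I:
  assumes "opY V" "f \<in> extensional V" "\<And>p. p \<in> V \<Longrightarrow> \<exists>U h. p \<in> U \<and> ext_to V f U h"
  shows "f \<in> hol Y V"
  unfolding holY[OF assms(1)]
proof (intro conjI ballI assms(2))
  fix p assume "p \<in> V"
  then obtain U h where U: "p \<in> U" "ext_to V f U h" using assms(3) by blast
  show "\<exists>U. opX U \<and> p \<in> U \<and> (\<exists>g\<in>hol X U. \<forall>x\<in>U \<inter> V. f x = g x)"
    using U ext_toD[OF U(2)] openY_sub[OF assms(1)] by (intro exI[of _ U]) blast
qed

lemma hol_restrict_Y:
  assumes U: "opX U" and h: "h \<in> hol X U"
  shows "restrict h (U \<inter> D) \<in> hol Y (U \<inter> D)"
  by (rule holY_I[OF openY_Int[OF U]]) (use U h in \<open>auto simp: ext_to_def\<close>)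

lemma Q_I:
  assumes "t \<in> extensional V" "\<And>p. p \<in> V \<Longrightarrow> \<exists>U s. p \<in> U \<and> lft V t U s" and V: "opY V"
  shows "t \<in> sections Q V"
  unfolding sections_Q
proof (intro conjI ballI assms(1))
  fix p assume "p \<in> V"
  then obtain U s where U: "p \<in> U" "lft V t U s" using assms(2) by blast
  then show "\<exists>U. opX U \<and> p \<in> U \<and> (\<exists>s\<in>sections F U. \<forall>q\<in>U \<inter> V. t q = gm U s q)"
    using lftD[OF U(2)] openY_sub[OF V] by (intro exI[of _ U]) blast
qed

lemma Q_eqI:
  assumes t: "t \<in> extensional V" "t' \<in> extensional V" and V: "opY V"
    and eq: "\<And>p. p \<in> V \<Longrightarrow> \<exists>U s. p \<in> U \<and> lft V t U s \<and> lft V t' U s"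
  shows "t = t'"
proof (rule extensionalityI[OF t])
  fix p assume p: "p \<in> V"
  then obtain U s where U: "p \<in> U" "lft V t U s" "lft V t' U s" using eq by blast
  have "p \<in> D" using openY_sub[OF V] p by blast
  then show "t p = t' p" using lftD(4)[OF U(2,1)] lftD(4)[OF U(3,1)] by simp
qed

section \<open>The module operations computed on lifts\<close>

lemma rep:
  assumes t: "lft V t U s" and q: "q \<in> U" "q \<in> D" and r: "(U', s') \<in> t q"
  shows "opX U'" "q \<in> U'" "s' \<in> sections F U'" "grel U s U' s' q" "gm U' s' q = t q"
proof -
  have "(U', s') \<in> gm U s q" using r lftD(4)[OF t q] by simp
  then show *: "opX U'" "q \<in> U'" "s' \<in> sections F U'" "grel U s U' s' q" by (auto simp: gm_mem)
  show "gm U' s' q = t q"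
    using gm_eq_iff[OF lftD(1)[OF t] *(1) lftD(3)[OF t] *(3) q(1) *(2)] *(4) lftD(4)[OF t q] by simp
qed

lemma rep_self: assumes t: "lft V t U s" and q: "q \<in> U" "q \<in> D" shows "(U, s) \<in> t q"
  using lftD[OF t] grel_refl[OF lftD(1,3)[OF t] q(1)] q by (simp add: gm_mem)

text \<open>The sum of two germs does not depend on representatives: on a common neighbourhood both
  differences lie in \<open>G\<close>, hence so does their sum.\<close>

lemma gm_add:
  assumes U: "opX U" "opX U'" "opX W" "opX W'"
    and s: "s \<in> sections F U" "s' \<in> sections F U'" "r \<in> sections F W" "r' \<in> sections F W'"
    and eq: "gm U s p = gm W r p" "gm U' s' p = gm W' r' p" and p: "p \<in> U" "p \<in> U'" "p \<in> W" "p \<in> W'"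
  shows "gm (U \<inter> U') (res F U (U \<inter> U') s \<oplus>\<^bsub>sect F (U \<inter> U')\<^esub> res F U' (U \<inter> U') s') p =
    gm (W \<inter> W') (res F W (W \<inter> W') r \<oplus>\<^bsub>sect F (W \<inter> W')\<^esub> res F W' (W \<inter> W') r') p"
proof -
  obtain A where A: "A \<in> opens X (U \<inter> W)" "p \<in> A" "res F U A s \<ominus>\<^bsub>sect F A\<^esub> res F W A r \<in> G A"
    using eq(1) unfolding gm_eq_iff[OF U(1,3) s(1,3) p(1,3)] grel_def by blast
  obtain B where B: "B \<in> opens X (U' \<inter> W')" "p \<in> B" "res F U' B s' \<ominus>\<^bsub>sect F B\<^esub> res F W' B r' \<in> G B"
    using eq(2) unfolding gm_eq_iff[OF U(2,4) s(2,4) p(2,4)] grel_def by blast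
  define C where "C = A \<inter> B"
  have o: "opX A" "opX B" "opX C" "opX (U \<inter> U')" "opX (W \<inter> W')"
    using A(1) B(1) U by (auto simp: opens_def C_def)
  have sub: "C \<in> opens X A" "C \<in> opens X B" "A \<in> opens X U" "A \<in> opens X W" "B \<in> opens X U'" "B \<in> opens X W'"
    "C \<in> opens X U" "C \<in> opens X U'" "C \<in> opens X W" "C \<in> opens X W'" "C \<in> opens X (U \<inter> U')" "C \<in> opens X (W \<inter> W')"
    "U \<inter> U' \<in> opens X U" "U \<inter> U' \<in> opens X U'" "W \<inter> W' \<in> opens X W" "W \<inter> W' \<in> opens X W'"
    "C \<in> opens X ((U \<inter> U') \<inter> (W \<inter> W'))"
    using A(1) B(1) o unfolding C_def by (auto simp: opens_def)
  interpret abelian_group "sect F C" by (rule ag[OF o(3)])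
  have c: "res F U C s \<in> sections F C" "res F W C r \<in> sections F C" "res F U' C s' \<in> sections F C" "res F W' C r' \<in> sections F C"
    using res_closed sub U s by auto
  have "res F U C s \<ominus>\<^bsub>sect F C\<^esub> res F W C r \<in> G C"
    using G_res[OF o(1) sub(1) A(3)] res_minus[OF sub(1) o(1) res_closed[OF sub(3) U(1) s(1)] res_closed[OF sub(4) U(3) s(3)]]
      res_res[OF sub(1,3) U(1) s(1)] res_res[OF sub(1,4) U(3) s(3)] by simp
  moreover have "res F U' C s' \<ominus>\<^bsub>sect F C\<^esub> res F W' C r' \<in> G C"
    using G_res[OF o(2) sub(2) B(3)] res_minus[OF sub(2) o(2) res_closed[OF sub(5) U(2) s(2)] res_closed[OF sub(6) U(4) s(4)]]
      res_res[OF sub(2,5) U(2) s(2)] res_res[OF sub(2,6) U(4) s(4)] by simp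
  ultimately have g: "(res F U C s \<oplus>\<^bsub>sect F C\<^esub> res F U' C s') \<ominus>\<^bsub>sect F C\<^esub> (res F W C r \<oplus>\<^bsub>sect F C\<^esub> res F W' C r') \<in> G C"
    using minus_sum[OF c(1,3,2,4)] G_add[OF o(3)] by simp
  interpret S: abelian_group "sect F (U \<inter> U')" by (rule ag[OF o(4)])
  interpret T: abelian_group "sect F (W \<inter> W')" by (rule ag[OF o(5)])
  have c1: "res F U (U \<inter> U') s \<in> sections F (U \<inter> U')" "res F U' (U \<inter> U') s' \<in> sections F (U \<inter> U')"
    "res F W (W \<inter> W') r \<in> sections F (W \<inter> W')" "res F W' (W \<inter> W') r' \<in> sections F (W \<inter> W')"
    using res_closed sub U s by auto
  have "res F (U \<inter> U') C (res F U (U \<inter> U') s \<oplus>\<^bsub>sect F (U \<inter> U')\<^esub> res F U' (U \<inter> U') s') = res F U C s \<oplus>\<^bsub>sect F C\<^esub> res F U' C s'"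
    using res_add[OF sub(11) o(4) c1(1,2)] res_res[OF sub(11,13) U(1) s(1)] res_res[OF sub(11,14) U(2) s(2)] by simp
  moreover have "res F (W \<inter> W') C (res F W (W \<inter> W') r \<oplus>\<^bsub>sect F (W \<inter> W')\<^esub> res F W' (W \<inter> W') r') = res F W C r \<oplus>\<^bsub>sect F C\<^esub> res F W' C r'"
    using res_add[OF sub(12) o(5) c1(3,4)] res_res[OF sub(12,15) U(3) s(3)] res_res[OF sub(12,16) U(4) s(4)] by simp
  ultimately have "grel (U \<inter> U') (res F U (U \<inter> U') s \<oplus>\<^bsub>sect F (U \<inter> U')\<^esub> res F U' (U \<inter> U') s')
     (W \<inter> W') (res F W (W \<inter> W') r \<oplus>\<^bsub>sect F (W \<inter> W')\<^esub> res F W' (W \<inter> W') r') p"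
    unfolding grel_def using g sub(17) A(2) B(2) by (intro bexI[of _ C]) (auto simp: C_def)
  then show ?thesis using gm_eq_iff[OF o(4,5)] c1 p by simp
qed

text \<open>Independence of representatives rests on
  \<open>h a - k b = (h - k) a + k (a - b)\<close>: the first term lies in \<open>G\<close> because
  \<open>h - k\<close> vanishes on \<open>D\<close>, the second because \<open>G\<close> is a
  submodule. The set \<open>N\<close> is where the two extensions are known to agree on
  \<open>D\<close>.\<close>

lemma gm_smult:
  assumes U: "opX U" "opX U'" "opX W" "opX W'"
    and s: "s \<in> sections F U" "s' \<in> sections F U'" and h: "h \<in> hol X W" "h' \<in> hol X W'"
    and eq: "gm U s p = gm U' s' p" and p: "p \<in> U" "p \<in> U'" "p \<in> W" "p \<in> W'"
    and N: "opX N" "p \<in> N" "\<And>x. x \<in> N \<Longrightarrow> x \<in> W \<Longrightarrow> x \<in> W' \<Longrightarrow> x \<in> D \<Longrightarrow> h x = h' x"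
  shows "gm (W \<inter> U) (restrict h (W \<inter> U) \<odot>\<^bsub>sect F (W \<inter> U)\<^esub> res F U (W \<inter> U) s) p =
    gm (W' \<inter> U') (restrict h' (W' \<inter> U') \<odot>\<^bsub>sect F (W' \<inter> U')\<^esub> res F U' (W' \<inter> U') s') p"
proof -
  obtain A where A: "A \<in> opens X (U \<inter> U')" "p \<in> A" "res F U A s \<ominus>\<^bsub>sect F A\<^esub> res F U' A s' \<in> G A"
    using eq unfolding gm_eq_iff[OF U(1,2) s p(1,2)] grel_def by blast
  define C where "C = A \<inter> W \<inter> W' \<inter> N"
  have o: "opX A" "opX C" "opX (W \<inter> U)" "opX (W' \<inter> U')"
    using A(1) U N by (auto simp: opens_def C_def)
  have sub: "C \<in> opens X A" "A \<in> opens X U" "A \<in> opens X U'" "C \<in> opens X U" "C \<in> opens X U'"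
    "C \<in> opens X (W \<inter> U)" "C \<in> opens X (W' \<inter> U')" "W \<inter> U \<in> opens X U" "W' \<inter> U' \<in> opens X U'"
    "W \<inter> U \<in> opens X W" "W' \<inter> U' \<in> opens X W'" "C \<in> opens X W" "C \<in> opens X W'" "C \<in> opens X ((W \<inter> U) \<inter> (W' \<inter> U'))"
    using A(1) o unfolding C_def by (auto simp: opens_def)
  interpret module "hol_ring X C" "sect F C" by (rule md[OF o(2)])
  let ?a = "res F U C s" and ?b = "res F U' C s'" and ?h = "restrict h C" and ?k = "restrict h' C"
  have c: "?a \<in> sections F C" "?b \<in> sections F C" "?h \<in> hol X C" "?k \<in> hol X C"
    using res_closed sub U s h hol_restrict by auto
  have g1: "?a \<ominus>\<^bsub>sect F C\<^esub> ?b \<in> G C"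
    using G_res[OF o(1) sub(1) A(3)] res_minus[OF sub(1) o(1) res_closed[OF sub(2) U(1) s(1)] res_closed[OF sub(3) U(2) s(2)]]
      res_res[OF sub(1,2) U(1) s(1)] res_res[OF sub(1,3) U(2) s(2)] by simp
  define d where "d = ?h \<ominus>\<^bsub>hol_ring X C\<^esub> ?k"
  have d: "d \<in> hol X C" unfolding d_def using c by (metis R.minus_closed hol_ring_simps(1))
  have "d \<oplus>\<^bsub>hol_ring X C\<^esub> ?k = ?h"
    unfolding d_def using c by (intro R.minus_plus_cancel) simp_all
  then have dx: "d x = 0" if "x \<in> C" "x \<in> D" for x
    using that N(3)[of x] unfolding C_def by (auto simp: fun_eq_iff split: if_splits)
  have dI: "d \<in> ideal_sheaf X D C" using d dx by (simp add: ideal_sheaf_def)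
  have "?h \<odot>\<^bsub>sect F C\<^esub> ?a = d \<odot>\<^bsub>sect F C\<^esub> ?a \<oplus>\<^bsub>sect F C\<^esub> ?k \<odot>\<^bsub>sect F C\<^esub> ?a"
    using smult_l_distr[of d ?k ?a] \<open>d \<oplus>\<^bsub>hol_ring X C\<^esub> ?k = ?h\<close> d c by simp
  then have "?h \<odot>\<^bsub>sect F C\<^esub> ?a \<ominus>\<^bsub>sect F C\<^esub> ?k \<odot>\<^bsub>sect F C\<^esub> ?b =
     d \<odot>\<^bsub>sect F C\<^esub> ?a \<oplus>\<^bsub>sect F C\<^esub> (?k \<odot>\<^bsub>sect F C\<^esub> (?a \<ominus>\<^bsub>sect F C\<^esub> ?b))"
    using smult_minus[of ?k ?a ?b] d c by (simp add: M.minus_eq M.a_assoc)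
  moreover have "\<dots> \<in> G C"
    by (intro G_add[OF o(2)] G_ideal[OF o(2) dI] G_smult[OF o(2)] c g1)
  ultimately have g: "?h \<odot>\<^bsub>sect F C\<^esub> ?a \<ominus>\<^bsub>sect F C\<^esub> ?k \<odot>\<^bsub>sect F C\<^esub> ?b \<in> G C" by simp
  have c1: "res F U (W \<inter> U) s \<in> sections F (W \<inter> U)" "res F U' (W' \<inter> U') s' \<in> sections F (W' \<inter> U')"
    "restrict h (W \<inter> U) \<in> hol X (W \<inter> U)" "restrict h' (W' \<inter> U') \<in> hol X (W' \<inter> U')"
    using res_closed sub U s h hol_restrict by auto
  have rr: "restrict (restrict h (W \<inter> U)) C = ?h" "restrict (restrict h' (W' \<inter> U')) C = ?k"
    using sub(6,7) by (auto simp: opens_def fun_eq_iff)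
  have "res F (W \<inter> U) C (restrict h (W \<inter> U) \<odot>\<^bsub>sect F (W \<inter> U)\<^esub> res F U (W \<inter> U) s) = ?h \<odot>\<^bsub>sect F C\<^esub> ?a"
    using res_smult[OF sub(6) o(3) c1(3,1)] res_res[OF sub(6,8) U(1) s(1)] rr by simp
  moreover have "res F (W' \<inter> U') C (restrict h' (W' \<inter> U') \<odot>\<^bsub>sect F (W' \<inter> U')\<^esub> res F U' (W' \<inter> U') s') = ?k \<odot>\<^bsub>sect F C\<^esub> ?b"
    using res_smult[OF sub(7) o(4) c1(4,2)] res_res[OF sub(7,9) U(2) s(2)] rr by simp
  ultimately have r: "grel (W \<inter> U) (restrict h (W \<inter> U) \<odot>\<^bsub>sect F (W \<inter> U)\<^esub> res F U (W \<inter> U) s)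
     (W' \<inter> U') (restrict h' (W' \<inter> U') \<odot>\<^bsub>sect F (W' \<inter> U')\<^esub> res F U' (W' \<inter> U') s') p"
    unfolding grel_def using g sub(14) A(2) p N(2) by (intro bexI[of _ C]) (auto simp: C_def)
  have c2: "restrict h (W \<inter> U) \<odot>\<^bsub>sect F (W \<inter> U)\<^esub> res F U (W \<inter> U) s \<in> sections F (W \<inter> U)"
    "restrict h' (W' \<inter> U') \<odot>\<^bsub>sect F (W' \<inter> U')\<^esub> res F U' (W' \<inter> U') s' \<in> sections F (W' \<inter> U')"
    using module.smult_closed[OF md[OF o(3)]] module.smult_closed[OF md[OF o(4)]] c1 by auto
  show ?thesis using gm_eq_iff[OF o(3,4) c2] r p by simp
qed

lemma Q_ops:
  "\<zero>\<^bsub>sect Q V\<^esub> = (\<lambda>p\<in>V. gm (topspace (points X)) \<zero>\<^bsub>sect F (topspace (points X))\<^esub> p)"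
  "t \<oplus>\<^bsub>sect Q V\<^esub> t' = (\<lambda>p\<in>V. \<Union>(U, s)\<in>t p. \<Union>(U', s')\<in>t' p.
           gm (U \<inter> U') (res F U (U \<inter> U') s \<oplus>\<^bsub>sect F (U \<inter> U')\<^esub> res F U' (U \<inter> U') s') p)"
  "f \<odot>\<^bsub>sect Q V\<^esub> t = (\<lambda>p\<in>V.
           \<Union>(W, h)\<in>{(W, h). opX W \<and> p \<in> W \<and> h \<in> hol X W \<and> (\<forall>x\<in>W \<inter> V. h x = f x)}.
           \<Union>(U, s)\<in>t p.
           gm (W \<inter> U) (restrict h (W \<inter> U) \<odot>\<^bsub>sect F (W \<inter> U)\<^esub> res F U (W \<inter> U) s) p)"
  "res Q V V' t = restrict t V'"
  by (auto simp: germ_sheaf_def mk_module_def)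

lemma lft_zero:
  assumes U: "opX U" "U \<inter> D \<subseteq> V"
  shows "lft V \<zero>\<^bsub>sect Q V\<^esub> U \<zero>\<^bsub>sect F U\<^esub>"
proof -
  let ?T = "topspace (points X)"
  have T: "opX ?T" and UT: "U \<in> opens X ?T"
    using U(1) openin_subset[OF U(1)] by (auto simp: opens_def)
  interpret T: abelian_group "sect F ?T" by (rule ag[OF T])
  interpret U: abelian_group "sect F U" by (rule ag[OF U(1)])
  show ?thesis unfolding lft_def Q_ops
    using U gm_res[OF T T.zero_closed UT] res_zero[OF UT T] by auto
qed

text \<open>By \<open>gm_add\<close> the unions in the definition of the sum are unions of equal
  sets, and they are nonempty since \<open>(U, s)\<close> and \<open>(U, s')\<close> are
  representatives; so they collapse to the germ of the sum of the lifts.\<close>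

lemma lft_add:
  assumes t: "lft V t U s" "lft V t' U s'"
  shows "lft V (t \<oplus>\<^bsub>sect Q V\<^esub> t') U (s \<oplus>\<^bsub>sect F U\<^esub> s')"
proof -
  note U = lftD(1)[OF t(1)] and s = lftD(3)[OF t(1)] lftD(3)[OF t(2)]
  interpret U: abelian_group "sect F U" by (rule ag[OF U])
  have "(t \<oplus>\<^bsub>sect Q V\<^esub> t') q = gm U (s \<oplus>\<^bsub>sect F U\<^esub> s') q" if q: "q \<in> U" "q \<in> D" for q
  proof -
    have *: "gm (A \<inter> B) (res F A (A \<inter> B) a \<oplus>\<^bsub>sect F (A \<inter> B)\<^esub> res F B (A \<inter> B) b) q = gm U (s \<oplus>\<^bsub>sect F U\<^esub> s') q"
      if ab: "(A, a) \<in> t q" "(B, b) \<in> t' q" for A a B b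
    proof -
      note A = rep[OF t(1) q ab(1)] and B = rep[OF t(2) q ab(2)]
      have "gm A a q = gm U s q" "gm B b q = gm U s' q" using A(5) B(5) lftD(4)[OF t(1) q] lftD(4)[OF t(2) q] by simp_all
      from gm_add[OF A(1) B(1) U U A(3) B(3) s this A(2) B(2) q(1) q(1)]
      show ?thesis using res_self[OF U s(1)] res_self[OF U s(2)] by simp
    qed
    have qV: "q \<in> V" using q lftD(2)[OF t(1)] by blast
    have "(\<Union>(A, a)\<in>t q. \<Union>(B, b)\<in>t' q. gm (A \<inter> B) (res F A (A \<inter> B) a \<oplus>\<^bsub>sect F (A \<inter> B)\<^esub> res F B (A \<inter> B) b) q)
        = (\<Union>x\<in>t q. \<Union>y\<in>t' q. gm U (s \<oplus>\<^bsub>sect F U\<^esub> s') q)"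
      by (intro SUP_cong refl) (use * in \<open>auto split: prod.splits\<close>)
    also have "\<dots> = gm U (s \<oplus>\<^bsub>sect F U\<^esub> s') q"
      using rep_self[OF t(1) q] rep_self[OF t(2) q] by auto
    finally show ?thesis using qV by (simp add: Q_ops)
  qed
  then show ?thesis unfolding lft_def using lftD(2)[OF t(1)] U s by auto
qed

lemma lft_smult:
  assumes t: "lft V t U s" and f: "ext_to V f U h" and V: "opY V"
  shows "lft V (f \<odot>\<^bsub>sect Q V\<^esub> t) U (h \<odot>\<^bsub>sect F U\<^esub> s)"
proof -
  note U = lftD(1)[OF t] and s = lftD(3)[OF t] and h = ext_toD(3)[OF f]
  interpret U: module "hol_ring X U" "sect F U" by (rule md[OF U])
  have "(f \<odot>\<^bsub>sect Q V\<^esub> t) q = gm U (h \<odot>\<^bsub>sect F U\<^esub> s) q" if q: "q \<in> U" "q \<in> D" for q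
  proof -
    have qV: "q \<in> V" using q lftD(2)[OF t] by blast
    define E where "E = {(W, k). opX W \<and> q \<in> W \<and> k \<in> hol X W \<and> (\<forall>x\<in>W \<inter> V. k x = f x)}"
    have *: "gm (W \<inter> A) (restrict k (W \<inter> A) \<odot>\<^bsub>sect F (W \<inter> A)\<^esub> res F A (W \<inter> A) a) q = gm U (h \<odot>\<^bsub>sect F U\<^esub> s) q"
      if ab: "(W, k) \<in> E" "(A, a) \<in> t q" for W k A a
    proof -
      note A = rep[OF t q ab(2)]
      have W: "opX W" "q \<in> W" "k \<in> hol X W" "\<forall>x\<in>W \<inter> V. k x = f x" using ab(1) by (auto simp: E_def)
      have e: "gm A a q = gm U s q" using A(5) lftD(4)[OF t q] by simp
      have n: "k x = h x" if "x \<in> U" "x \<in> W" "x \<in> D" for x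
        using W(4) ext_toD(4)[OF f that(1,3)] lftD(2)[OF t] that by auto
      from gm_smult[OF A(1) U W(1) U A(3) s W(3) h e A(2) q(1) W(2) q(1) U q(1) n]
      show ?thesis using res_self[OF U s] hol_restrict_self[OF U h] by simp
    qed
    have Eh: "(U, h) \<in> E" unfolding E_def using U q h ext_toD(4)[OF f] openY_sub[OF V] by auto
    have "(\<Union>(W, k)\<in>E. \<Union>(A, a)\<in>t q. gm (W \<inter> A) (restrict k (W \<inter> A) \<odot>\<^bsub>sect F (W \<inter> A)\<^esub> res F A (W \<inter> A) a) q)
        = (\<Union>x\<in>E. \<Union>y\<in>t q. gm U (h \<odot>\<^bsub>sect F U\<^esub> s) q)"
      by (intro SUP_cong refl) (use * in \<open>auto split: prod.splits\<close>)
    also have "\<dots> = gm U (h \<odot>\<^bsub>sect F U\<^esub> s) q"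
      using rep_self[OF t q] Eh by auto
    finally show ?thesis using qV by (simp add: Q_ops E_def)
  qed
  then show ?thesis unfolding lft_def using lftD(2)[OF t] U s h by auto
qed

end

context germ_quotient
begin

lemma Q_op_ext:
  "\<zero>\<^bsub>sect Q V\<^esub> \<in> extensional V" "t \<oplus>\<^bsub>sect Q V\<^esub> t' \<in> extensional V" "f \<odot>\<^bsub>sect Q V\<^esub> t \<in> extensional V"
  by (simp_all add: Q_ops)

lemma ex_zero:
  assumes V: "opY V" and p: "p \<in> V"
  shows "\<exists>U. opX U \<and> p \<in> U \<and> U \<inter> D \<subseteq> V"
proof -
  obtain U where "opX U" "V = U \<inter> D" using V unfolding openY by blast
  then show ?thesis using p by blast
qed

lemma ex_lft_ext:
  assumes t: "t \<in> sections Q V" and f: "f \<in> hol Y V" and V: "opY V" and p: "p \<in> V"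
    and N: "opX N" "p \<in> N"
  shows "\<exists>U s h. p \<in> U \<and> U \<subseteq> N \<and> lft V t U s \<and> ext_to V f U h"
proof -
  obtain U s where U: "p \<in> U" "U \<subseteq> N" "lft V t U s" using ex_lft[OF t V p N] by blast
  obtain U' h where U': "p \<in> U'" "U' \<subseteq> U" "ext_to V f U' h" using ex_ext[OF f V p lftD(1)[OF U(3)] U(1)] by blast
  have "U' \<in> opens X U" using U' ext_toD(1) by (auto simp: opens_def)
  then show ?thesis using lft_res[OF U(3)] U U' by blast
qed

lemma Q_zero_closed:
  assumes V: "opY V" shows "\<zero>\<^bsub>sect Q V\<^esub> \<in> sections Q V"
proof (rule Q_I[OF Q_op_ext(1) _ V])
  fix p assume "p \<in> V"
  then obtain U where "opX U" "p \<in> U" "U \<inter> D \<subseteq> V" using ex_zero[OF V] by blast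
  then show "\<exists>U s. p \<in> U \<and> lft V \<zero>\<^bsub>sect Q V\<^esub> U s" using lft_zero by blast
qed

lemma Q_add_closed:
  assumes V: "opY V" and t: "t \<in> sections Q V" "t' \<in> sections Q V"
  shows "t \<oplus>\<^bsub>sect Q V\<^esub> t' \<in> sections Q V"
proof (rule Q_I[OF Q_op_ext(2) _ V])
  fix p assume p: "p \<in> V"
  obtain U s s' where U: "p \<in> U" "lft V t U s" "lft V t' U s'"
    using ex_lft2[OF t V p, of "topspace (points X)"] D_sub openY_sub[OF V] p by blast
  show "\<exists>U s. p \<in> U \<and> lft V (t \<oplus>\<^bsub>sect Q V\<^esub> t') U s" using U(1) lft_add[OF U(2,3)] by blast
qed

lemma Q_smult_closed:
  assumes V: "opY V" and t: "t \<in> sections Q V" and f: "f \<in> hol Y V"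
  shows "f \<odot>\<^bsub>sect Q V\<^esub> t \<in> sections Q V"
proof (rule Q_I[OF Q_op_ext(3) _ V])
  fix p assume p: "p \<in> V"
  obtain U s h where U: "p \<in> U" "lft V t U s" "ext_to V f U h"
    using ex_lft_ext[OF t f V p, of "topspace (points X)"] D_sub openY_sub[OF V] p by blast
  show "\<exists>U s. p \<in> U \<and> lft V (f \<odot>\<^bsub>sect Q V\<^esub> t) U s" using U(1) lft_smult[OF U(2,3) V] by blast
qed

lemma ext_to_add:
  "ext_to V f U h \<Longrightarrow> ext_to V g U k \<Longrightarrow> ext_to V (\<lambda>x\<in>V. f x + g x) U (\<lambda>x\<in>U. h x + k x)"
  unfolding ext_to_def using hol_add by auto

lemma ext_to_mult:
  "ext_to V f U h \<Longrightarrow> ext_to V g U k \<Longrightarrow> ext_to V (\<lambda>x\<in>V. f x * g x) U (\<lambda>x\<in>U. h x * k x)"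
  unfolding ext_to_def using hol_mult by auto

lemma ext_to_const:
  "opX U \<Longrightarrow> U \<inter> D \<subseteq> V \<Longrightarrow> ext_to V (\<lambda>x\<in>V. c) U (\<lambda>x\<in>U. c)"
  unfolding ext_to_def using hol_const by auto

lemma lft_ext_common:
  assumes V: "opY V" and t: "t \<in> sections Q V" "t' \<in> sections Q V" and f: "f \<in> hol Y V" "g \<in> hol Y V"
    and p: "p \<in> V" and N: "opX N" "p \<in> N"
  shows "\<exists>U s s' h k. p \<in> U \<and> U \<subseteq> N \<and> lft V t U s \<and> lft V t' U s' \<and> ext_to V f U h \<and> ext_to V g U k"
proof -
  obtain U s h where U: "p \<in> U" "U \<subseteq> N" "lft V t U s" "ext_to V f U h" using ex_lft_ext[OF t(1) f(1) V p N] by blast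
  obtain U' s' k where U': "p \<in> U'" "U' \<subseteq> U" "lft V t' U' s'" "ext_to V g U' k"
    using ex_lft_ext[OF t(2) f(2) V p lftD(1)[OF U(3)] U(1)] by blast
  have "U' \<in> opens X U" using U' ext_toD(1) by (auto simp: opens_def)
  then show ?thesis using lft_res[OF U(3)] ext_to_res[OF U(4)] U U' by blast
qed

lemma Q_abelian_group:
  assumes V: "opY V"
  shows "abelian_group (sect Q V)"
proof (rule abelian_groupI)
  note pT = openin_topspace[of "points X"]
  have top: "p \<in> topspace (points X)" if "p \<in> V" for p using that D_sub openY_sub[OF V] by blast
  show "\<zero>\<^bsub>sect Q V\<^esub> \<in> sections Q V" by (rule Q_zero_closed[OF V])
  fix t assume t: "t \<in> sections Q V"
  show "\<zero>\<^bsub>sect Q V\<^esub> \<oplus>\<^bsub>sect Q V\<^esub> t = t"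
  proof (rule Q_eqI[OF Q_op_ext(2) Q_ext[OF t] V])
    fix p assume p: "p \<in> V"
    obtain U s where U: "p \<in> U" "lft V t U s" using ex_lft[OF t V p pT top[OF p]] by blast
    interpret U: abelian_group "sect F U" by (rule ag[OF lftD(1)[OF U(2)]])
    show "\<exists>U s. p \<in> U \<and> lft V (\<zero>\<^bsub>sect Q V\<^esub> \<oplus>\<^bsub>sect Q V\<^esub> t) U s \<and> lft V t U s"
      using lft_add[OF lft_zero[OF lftD(1,2)[OF U(2)]] U(2)] U lftD(3)[OF U(2)] by (metis U.l_zero)
  qed
  \<comment> \<open>No negation comes with the quotient; the inverse is multiplication by the
    constant -1.\<close>
  let ?m = "\<lambda>x\<in>V. -1 :: complex"
  have m: "?m \<in> hol Y V" by (rule ringed_space.hol_const[OF rY V])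
  show "\<exists>y\<in>sections Q V. y \<oplus>\<^bsub>sect Q V\<^esub> t = \<zero>\<^bsub>sect Q V\<^esub>"
  proof (rule bexI[OF _ Q_smult_closed[OF V t m]], rule Q_eqI[OF Q_op_ext(2,1) V])
    fix p assume p: "p \<in> V"
    obtain U s where U: "p \<in> U" "lft V t U s" using ex_lft[OF t V p pT top[OF p]] by blast
    note o = lftD(1)[OF U(2)] and s = lftD(3)[OF U(2)]
    interpret U: module "hol_ring X U" "sect F U" by (rule md[OF o])
    let ?h = "\<lambda>x\<in>U. -1 :: complex"
    have h: "?h \<in> carrier (hol_ring X U)" using hol_const[OF o] by simp
    have "?h \<oplus>\<^bsub>hol_ring X U\<^esub> \<one>\<^bsub>hol_ring X U\<^esub> = \<zero>\<^bsub>hol_ring X U\<^esub>"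
      unfolding hol_ring_simps by (rule restrict_ext) simp
    then have "?h \<odot>\<^bsub>sect F U\<^esub> s \<oplus>\<^bsub>sect F U\<^esub> \<one>\<^bsub>hol_ring X U\<^esub> \<odot>\<^bsub>sect F U\<^esub> s = \<zero>\<^bsub>sect F U\<^esub>"
      using U.smult_l_distr[OF h U.R.one_closed s] U.smult_l_null[OF s] by metis
    then have e: "?h \<odot>\<^bsub>sect F U\<^esub> s \<oplus>\<^bsub>sect F U\<^esub> s = \<zero>\<^bsub>sect F U\<^esub>"
      using U.smult_one[OF s] by metis
    have "lft V (?m \<odot>\<^bsub>sect Q V\<^esub> t \<oplus>\<^bsub>sect Q V\<^esub> t) U (?h \<odot>\<^bsub>sect F U\<^esub> s \<oplus>\<^bsub>sect F U\<^esub> s)"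
      by (rule lft_add[OF lft_smult[OF U(2) ext_to_const[OF lftD(1,2)[OF U(2)]] V] U(2)])
    then show "\<exists>U s. p \<in> U \<and> lft V (?m \<odot>\<^bsub>sect Q V\<^esub> t \<oplus>\<^bsub>sect Q V\<^esub> t) U s \<and> lft V \<zero>\<^bsub>sect Q V\<^esub> U s"
      unfolding e using lft_zero[OF lftD(1,2)[OF U(2)]] U(1) by blast
  qed
  fix t' assume t': "t' \<in> sections Q V"
  show "t \<oplus>\<^bsub>sect Q V\<^esub> t' \<in> sections Q V" by (rule Q_add_closed[OF V t t'])
  show "t \<oplus>\<^bsub>sect Q V\<^esub> t' = t' \<oplus>\<^bsub>sect Q V\<^esub> t"
  proof (rule Q_eqI[OF Q_op_ext(2,2) V])
    fix p assume p: "p \<in> V"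
    obtain U s s' where U: "p \<in> U" "lft V t U s" "lft V t' U s'" using ex_lft2[OF t t' V p pT top[OF p]] by blast
    interpret U: abelian_group "sect F U" by (rule ag[OF lftD(1)[OF U(2)]])
    show "\<exists>U s. p \<in> U \<and> lft V (t \<oplus>\<^bsub>sect Q V\<^esub> t') U s \<and> lft V (t' \<oplus>\<^bsub>sect Q V\<^esub> t) U s"
      using lft_add[OF U(2,3)] lft_add[OF U(3,2)] U(1) U.a_comm[OF lftD(3)[OF U(2)] lftD(3)[OF U(3)]] by metis
  qed
  fix t'' assume t'': "t'' \<in> sections Q V"
  show "t \<oplus>\<^bsub>sect Q V\<^esub> t' \<oplus>\<^bsub>sect Q V\<^esub> t'' = t \<oplus>\<^bsub>sect Q V\<^esub> (t' \<oplus>\<^bsub>sect Q V\<^esub> t'')"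
  proof (rule Q_eqI[OF Q_op_ext(2,2) V])
    fix p assume p: "p \<in> V"
    obtain U s s' s'' where U: "p \<in> U" "lft V t U s" "lft V t' U s'" "lft V t'' U s''"
      using ex_lft3[OF t t' t'' V p pT top[OF p]] by blast
    interpret U: abelian_group "sect F U" by (rule ag[OF lftD(1)[OF U(2)]])
    show "\<exists>U s. p \<in> U \<and> lft V (t \<oplus>\<^bsub>sect Q V\<^esub> t' \<oplus>\<^bsub>sect Q V\<^esub> t'') U s \<and> lft V (t \<oplus>\<^bsub>sect Q V\<^esub> (t' \<oplus>\<^bsub>sect Q V\<^esub> t'')) U s"
      using lft_add[OF lft_add[OF U(2,3)] U(4)] lft_add[OF U(2) lft_add[OF U(3,4)]] U(1)
        U.a_assoc[OF lftD(3)[OF U(2)] lftD(3)[OF U(3)] lftD(3)[OF U(4)]] by metis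
  qed
qed

lemma Q_module:
  assumes V: "opY V"
  shows "module (hol_ring Y V) (sect Q V)"
proof (rule moduleI[OF ringed_space.cring_hol[OF rY V] Q_abelian_group[OF V]])
  note pT = openin_topspace[of "points X"]
  have top: "p \<in> topspace (points X)" if "p \<in> V" for p using that D_sub openY_sub[OF V] by blast
  fix t assume t: "t \<in> sections Q V"
  show "\<one>\<^bsub>hol_ring Y V\<^esub> \<odot>\<^bsub>sect Q V\<^esub> t = t"
  proof (rule Q_eqI[OF Q_op_ext(3) Q_ext[OF t] V])
    fix p assume p: "p \<in> V"
    obtain U s where U: "p \<in> U" "lft V t U s" using ex_lft[OF t V p pT top[OF p]] by blast
    interpret U: module "hol_ring X U" "sect F U" by (rule md[OF lftD(1)[OF U(2)]])
    have "lft V (\<one>\<^bsub>hol_ring Y V\<^esub> \<odot>\<^bsub>sect Q V\<^esub> t) U (\<one>\<^bsub>hol_ring X U\<^esub> \<odot>\<^bsub>sect F U\<^esub> s)"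
      unfolding hol_ring_simps by (rule lft_smult[OF U(2) ext_to_const[OF lftD(1,2)[OF U(2)]] V])
    then show "\<exists>U s. p \<in> U \<and> lft V (\<one>\<^bsub>hol_ring Y V\<^esub> \<odot>\<^bsub>sect Q V\<^esub> t) U s \<and> lft V t U s"
      unfolding U.smult_one[OF lftD(3)[OF U(2)]] using U by blast
  qed
  fix f assume "f \<in> carrier (hol_ring Y V)"
  then have f: "f \<in> hol Y V" by simp
  show "f \<odot>\<^bsub>sect Q V\<^esub> t \<in> sections Q V" by (rule Q_smult_closed[OF V t f])
  show "f \<odot>\<^bsub>sect Q V\<^esub> (t \<oplus>\<^bsub>sect Q V\<^esub> t') = f \<odot>\<^bsub>sect Q V\<^esub> t \<oplus>\<^bsub>sect Q V\<^esub> f \<odot>\<^bsub>sect Q V\<^esub> t'"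
    if t': "t' \<in> sections Q V" for t'
  proof (rule Q_eqI[OF Q_op_ext(3,2) V])
    fix p assume p: "p \<in> V"
    obtain U s s' h k where U: "p \<in> U" "lft V t U s" "lft V t' U s'" "ext_to V f U h" "ext_to V f U k"
      using lft_ext_common[OF V t t' f f p pT top[OF p]] by blast
    interpret U: module "hol_ring X U" "sect F U" by (rule md[OF lftD(1)[OF U(2)]])
    have "h \<odot>\<^bsub>sect F U\<^esub> (s \<oplus>\<^bsub>sect F U\<^esub> s') = h \<odot>\<^bsub>sect F U\<^esub> s \<oplus>\<^bsub>sect F U\<^esub> h \<odot>\<^bsub>sect F U\<^esub> s'"
      using U.smult_r_distr[of h s s'] lftD(3)[OF U(2)] lftD(3)[OF U(3)] ext_toD(3)[OF U(4)] by simp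
    then show "\<exists>U s. p \<in> U \<and> lft V (f \<odot>\<^bsub>sect Q V\<^esub> (t \<oplus>\<^bsub>sect Q V\<^esub> t')) U s \<and> lft V (f \<odot>\<^bsub>sect Q V\<^esub> t \<oplus>\<^bsub>sect Q V\<^esub> f \<odot>\<^bsub>sect Q V\<^esub> t') U s"
      using lft_smult[OF lft_add[OF U(2,3)] U(4) V] lft_add[OF lft_smult[OF U(2,4) V] lft_smult[OF U(3,4) V]] U(1) by metis
  qed
  fix g assume "g \<in> carrier (hol_ring Y V)"
  then have g: "g \<in> hol Y V" by simp
  show "(f \<oplus>\<^bsub>hol_ring Y V\<^esub> g) \<odot>\<^bsub>sect Q V\<^esub> t = f \<odot>\<^bsub>sect Q V\<^esub> t \<oplus>\<^bsub>sect Q V\<^esub> g \<odot>\<^bsub>sect Q V\<^esub> t"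
  proof (rule Q_eqI[OF Q_op_ext(3,2) V])
    fix p assume p: "p \<in> V"
    obtain U s s' h k where U: "p \<in> U" "lft V t U s" "lft V t U s'" "ext_to V f U h" "ext_to V g U k"
      using lft_ext_common[OF V t t f g p pT top[OF p]] by blast
    interpret U: module "hol_ring X U" "sect F U" by (rule md[OF lftD(1)[OF U(2)]])
    have e: "(h \<oplus>\<^bsub>hol_ring X U\<^esub> k) \<odot>\<^bsub>sect F U\<^esub> s = h \<odot>\<^bsub>sect F U\<^esub> s \<oplus>\<^bsub>sect F U\<^esub> k \<odot>\<^bsub>sect F U\<^esub> s"
      using U.smult_l_distr[of h k s] lftD(3)[OF U(2)] ext_toD(3)[OF U(4)] ext_toD(3)[OF U(5)] by simp
    have "lft V ((f \<oplus>\<^bsub>hol_ring Y V\<^esub> g) \<odot>\<^bsub>sect Q V\<^esub> t) U (h \<odot>\<^bsub>sect F U\<^esub> s \<oplus>\<^bsub>sect F U\<^esub> k \<odot>\<^bsub>sect F U\<^esub> s)"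
      unfolding e[symmetric] hol_ring_simps by (rule lft_smult[OF U(2) ext_to_add[OF U(4,5)] V])
    then show "\<exists>U s. p \<in> U \<and> lft V ((f \<oplus>\<^bsub>hol_ring Y V\<^esub> g) \<odot>\<^bsub>sect Q V\<^esub> t) U s \<and> lft V (f \<odot>\<^bsub>sect Q V\<^esub> t \<oplus>\<^bsub>sect Q V\<^esub> g \<odot>\<^bsub>sect Q V\<^esub> t) U s"
      using lft_add[OF lft_smult[OF U(2,4) V] lft_smult[OF U(2,5) V]] U(1) by blast
  qed
  show "(f \<otimes>\<^bsub>hol_ring Y V\<^esub> g) \<odot>\<^bsub>sect Q V\<^esub> t = f \<odot>\<^bsub>sect Q V\<^esub> (g \<odot>\<^bsub>sect Q V\<^esub> t)"
  proof (rule Q_eqI[OF Q_op_ext(3,3) V])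
    fix p assume p: "p \<in> V"
    obtain U s s' h k where U: "p \<in> U" "lft V t U s" "lft V t U s'" "ext_to V f U h" "ext_to V g U k"
      using lft_ext_common[OF V t t f g p pT top[OF p]] by blast
    interpret U: module "hol_ring X U" "sect F U" by (rule md[OF lftD(1)[OF U(2)]])
    have e: "(h \<otimes>\<^bsub>hol_ring X U\<^esub> k) \<odot>\<^bsub>sect F U\<^esub> s = h \<odot>\<^bsub>sect F U\<^esub> (k \<odot>\<^bsub>sect F U\<^esub> s)"
      using U.smult_assoc1[of h k s] lftD(3)[OF U(2)] ext_toD(3)[OF U(4)] ext_toD(3)[OF U(5)] by simp
    have "lft V ((f \<otimes>\<^bsub>hol_ring Y V\<^esub> g) \<odot>\<^bsub>sect Q V\<^esub> t) U (h \<odot>\<^bsub>sect F U\<^esub> (k \<odot>\<^bsub>sect F U\<^esub> s))"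
      unfolding e[symmetric] hol_ring_simps by (rule lft_smult[OF U(2) ext_to_mult[OF U(4,5)] V])
    then show "\<exists>U s. p \<in> U \<and> lft V ((f \<otimes>\<^bsub>hol_ring Y V\<^esub> g) \<odot>\<^bsub>sect Q V\<^esub> t) U s \<and> lft V (f \<odot>\<^bsub>sect Q V\<^esub> (g \<odot>\<^bsub>sect Q V\<^esub> t)) U s"
      using lft_smult[OF lft_smult[OF U(2,5) V] U(4) V] U(1) by blast
  qed
qed

section \<open>Restriction and gluing of sections of the quotient\<close>

lemma lft_restrict:
  assumes "lft V t U s" "U \<inter> D \<subseteq> W" shows "lft W (restrict t W) U s"
  using assms unfolding lft_def by auto

lemma ext_to_restrict:
  assumes "ext_to V f U h" "U \<inter> D \<subseteq> W" shows "ext_to W (restrict f W) U h"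
  using assms unfolding ext_to_def by auto

lemma openY_trans: "W \<in> opens Y V \<Longrightarrow> p \<in> W \<Longrightarrow> \<exists>N. opX N \<and> p \<in> N \<and> N \<inter> D \<subseteq> W"
  using ex_zero[OF opensD(1)] by blast

lemma Q_restrict_closed:
  assumes V: "opY V" and W: "W \<in> opens Y V" and t: "t \<in> sections Q V"
  shows "restrict t W \<in> sections Q W"
proof (rule Q_I[OF _ _ opensD(1)[OF W]])
  fix p assume p: "p \<in> W"
  obtain N where N: "opX N" "p \<in> N" "N \<inter> D \<subseteq> W" using openY_trans[OF W p] by blast
  obtain U s where U: "p \<in> U" "U \<subseteq> N" "lft V t U s" using ex_lft[OF t V _ N(1,2)] p opensD(2)[OF W] by blast
  show "\<exists>U s. p \<in> U \<and> lft W (restrict t W) U s" using lft_restrict[OF U(3)] U N by blast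
qed simp

lemma Q_restrict_add:
  assumes V: "opY V" and W: "W \<in> opens Y V" and t: "t \<in> sections Q V" "t' \<in> sections Q V"
  shows "restrict (t \<oplus>\<^bsub>sect Q V\<^esub> t') W = restrict t W \<oplus>\<^bsub>sect Q W\<^esub> restrict t' W"
proof (rule Q_eqI[OF _ Q_op_ext(2) opensD(1)[OF W]])
  fix p assume p: "p \<in> W"
  obtain N where N: "opX N" "p \<in> N" "N \<inter> D \<subseteq> W" using openY_trans[OF W p] by blast
  obtain U s s' where U: "p \<in> U" "U \<subseteq> N" "lft V t U s" "lft V t' U s'" using ex_lft2[OF t V _ N(1,2)] p opensD(2)[OF W] by blast
  have uw: "U \<inter> D \<subseteq> W" using U N by blast
  show "\<exists>U s. p \<in> U \<and> lft W (restrict (t \<oplus>\<^bsub>sect Q V\<^esub> t') W) U s \<and> lft W (restrict t W \<oplus>\<^bsub>sect Q W\<^esub> restrict t' W) U s"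
    using lft_restrict[OF lft_add[OF U(3,4)] uw] lft_add[OF lft_restrict[OF U(3) uw] lft_restrict[OF U(4) uw]] U(1) by blast
qed simp

lemma Q_restrict_smult:
  assumes V: "opY V" and W: "W \<in> opens Y V" and t: "t \<in> sections Q V" and f: "f \<in> hol Y V"
  shows "restrict (f \<odot>\<^bsub>sect Q V\<^esub> t) W = restrict f W \<odot>\<^bsub>sect Q W\<^esub> restrict t W"
proof (rule Q_eqI[OF _ Q_op_ext(3) opensD(1)[OF W]])
  fix p assume p: "p \<in> W"
  obtain N where N: "opX N" "p \<in> N" "N \<inter> D \<subseteq> W" using openY_trans[OF W p] by blast
  obtain U s h where U: "p \<in> U" "U \<subseteq> N" "lft V t U s" "ext_to V f U h" using ex_lft_ext[OF t f V _ N(1,2)] p opensD(2)[OF W] by blast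
  have uw: "U \<inter> D \<subseteq> W" using U N by blast
  show "\<exists>U s. p \<in> U \<and> lft W (restrict (f \<odot>\<^bsub>sect Q V\<^esub> t) W) U s \<and> lft W (restrict f W \<odot>\<^bsub>sect Q W\<^esub> restrict t W) U s"
    using lft_restrict[OF lft_smult[OF U(3,4) V] uw]
      lft_smult[OF lft_restrict[OF U(3) uw] ext_to_restrict[OF U(4) uw] opensD(1)[OF W]] U(1) by blast
qed simp

lemma Q_glue:
  assumes U: "\<And>U. U \<in> \<U> \<Longrightarrow> opY U \<and> s U \<in> sections Q U"
    and comp: "\<And>U V. U \<in> \<U> \<Longrightarrow> V \<in> \<U> \<Longrightarrow> restrict (s U) (U \<inter> V) = restrict (s V) (U \<inter> V)"
  shows "\<exists>!t. t \<in> sections Q (\<Union>\<U>) \<and> (\<forall>U\<in>\<U>. restrict t U = s U)"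
proof (rule ex1I)
  define t where "t = (\<lambda>x\<in>\<Union>\<U>. s (SOME U. U \<in> \<U> \<and> x \<in> U) x)"
  have oU: "opY (\<Union>\<U>)" using U by (intro openin_Union) auto
  have tx: "t x = s U x" if "U \<in> \<U>" "x \<in> U" for U x
  proof -
    define V where "V = (SOME U. U \<in> \<U> \<and> x \<in> U)"
    have V: "V \<in> \<U> \<and> x \<in> V" unfolding V_def by (rule someI[of _ U]) (use that in simp)
    have "x \<in> \<Union>\<U>" using that by blast
    then have "t x = s V x" by (simp add: t_def V_def)
    also have "\<dots> = s U x"
      using fun_cong[OF comp[of V U], of x] V that by simp
    finally show ?thesis .
  qed
  have "t \<in> sections Q (\<Union>\<U>)"
  proof (rule Q_I[OF _ _ oU])
    show "t \<in> extensional (\<Union>\<U>)" by (simp add: t_def)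
    fix p assume "p \<in> \<Union>\<U>"
    then obtain U where p: "U \<in> \<U>" "p \<in> U" by blast
    have o: "opY U" "s U \<in> sections Q U" using U p by auto
    have "p \<in> topspace (points X)" using p openY_sub[OF o(1)] D_sub by blast
    then obtain W r where W: "p \<in> W" "lft U (s U) W r" using ex_lft[OF o(2,1) p(2) openin_topspace] by blast
    have "lft (\<Union>\<U>) t W r" using lftD[OF W(2)] p(1) tx[OF p(1)] unfolding lft_def by auto
    then show "\<exists>U s. p \<in> U \<and> lft (\<Union>\<U>) t U s" using W(1) by blast
  qed
  moreover have "\<forall>U\<in>\<U>. restrict t U = s U"
  proof
    fix W assume W: "W \<in> \<U>"
    show "restrict t W = s W"
      by (rule extensionalityI[of _ W]) (use W U tx[OF W] Q_ext in auto)
  qed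
  ultimately show "t \<in> sections Q (\<Union>\<U>) \<and> (\<forall>U\<in>\<U>. restrict t U = s U)" by blast
  fix t' assume t': "t' \<in> sections Q (\<Union>\<U>) \<and> (\<forall>U\<in>\<U>. restrict t' U = s U)"
  show "t' = t"
  proof (rule extensionalityI[of _ "\<Union>\<U>"])
    show "t' \<in> extensional (\<Union>\<U>)" using t' Q_ext by blast
    fix x assume "x \<in> \<Union>\<U>"
    then obtain W where W: "W \<in> \<U>" "x \<in> W" by blast
    have "restrict t' W x = s W x" using t' W(1) by simp
    then show "t' x = t x" using W(2) tx[OF W] by simp
  qed (simp add: t_def)
qed

lemma Q_sheaf: "sheaf_of_modules Y Q"
  unfolding sheaf_of_modules_def Q_ops(4)
proof (intro conjI allI impI ballI)
  fix V assume V: "opY V"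
  show "module (hol_ring Y V) (sect Q V)" by (rule Q_module[OF V])
  show "restrict t V = t" if "t \<in> sections Q V" for t by (rule extensional_restrict[OF Q_ext[OF that]])
  fix W assume W: "W \<in> opens Y V"
  show "restrict t W \<in> sections Q W" if "t \<in> sections Q V" for t by (rule Q_restrict_closed[OF V W that])
  show "restrict (t \<oplus>\<^bsub>sect Q V\<^esub> t') W = restrict t W \<oplus>\<^bsub>sect Q W\<^esub> restrict t' W"
    if "t \<in> sections Q V" "t' \<in> sections Q V" for t t' by (rule Q_restrict_add[OF V W that])
  show "restrict (f \<odot>\<^bsub>sect Q V\<^esub> t) W = restrict f W \<odot>\<^bsub>sect Q W\<^esub> restrict t W"
    if "f \<in> hol Y V" "t \<in> sections Q V" for f t by (rule Q_restrict_smult[OF V W that(2,1)])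
  show "restrict (restrict t W) W' = restrict t W'" if "W' \<in> opens Y W" "t \<in> sections Q V" for W' t
    using opensD(2)[OF that(1)] by (simp add: Int_absorb1)
next
  fix \<U> s assume "\<forall>U\<in>\<U>. opY U \<and> s U \<in> sections Q U"
    "\<forall>U\<in>\<U>. \<forall>V\<in>\<U>. restrict (s U) (U \<inter> V) = restrict (s V) (U \<inter> V)"
  then show "\<exists>!t. t \<in> sections Q (\<Union>\<U>) \<and> (\<forall>U\<in>\<U>. restrict t U = s U)" by (intro Q_glue) auto
qed

text \<open>Lets the construction be iterated: the normal bundle is a quotient of the quotient
  \<open>T.Q\<close>.\<close>

lemma Q_presheaf: "module_presheaf Y Q"
proof (intro module_presheaf.intro module_presheaf_axioms.intro rY)
qed (simp_all add: Q_module Q_ops(4) Q_restrict_closed Q_restrict_add Q_restrict_smult extensional_restrict[OF Q_ext] opens_def Int_absorb1)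

text \<open>When \<open>G\<close> is \<open>ideal_times X D F\<close>, this is
  \<open>restrict_section\<close>.\<close>

definition cls :: "'a set \<Rightarrow> 's \<Rightarrow> ('a, 's) qsection" where
  "cls U s = (\<lambda>q\<in>U \<inter> D. gm U s q)"

lemma lft_cls: "opX U \<Longrightarrow> s \<in> sections F U \<Longrightarrow> lft (U \<inter> D) (cls U s) U s"
  by (simp add: lft_def cls_def)

lemma cls_section: "opX U \<Longrightarrow> s \<in> sections F U \<Longrightarrow> cls U s \<in> sections Q (U \<inter> D)"
  by (rule Q_I[OF _ _ openY_Int]) (use lft_cls in \<open>auto simp: cls_def\<close>)

lemma cls_add:
  assumes U: "opX U" and s: "s \<in> sections F U" "s' \<in> sections F U"
  shows "cls U (s \<oplus>\<^bsub>sect F U\<^esub> s') = cls U s \<oplus>\<^bsub>sect Q (U \<inter> D)\<^esub> cls U s'"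
proof -
  interpret abelian_group "sect F U" by (rule ag[OF U])
  show ?thesis
    by (rule Q_eqI[OF Q_ext[OF cls_section[OF U]] Q_op_ext(2) openY_Int[OF U]])
      (use lft_add[OF lft_cls[OF U s(1)] lft_cls[OF U s(2)]] lft_cls[OF U a_closed[OF s]] s in auto)
qed

lemma cls_smult:
  assumes U: "opX U" and s: "s \<in> sections F U" and h: "h \<in> hol X U"
  shows "cls U (h \<odot>\<^bsub>sect F U\<^esub> s) = restrict h (U \<inter> D) \<odot>\<^bsub>sect Q (U \<inter> D)\<^esub> cls U s"
proof -
  interpret module "hol_ring X U" "sect F U" by (rule md[OF U])
  have c: "h \<odot>\<^bsub>sect F U\<^esub> s \<in> sections F U" using h s by simp
  have e: "ext_to (U \<inter> D) (restrict h (U \<inter> D)) U h" using U h by (simp add: ext_to_def)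
  show ?thesis
    by (rule Q_eqI[OF Q_ext[OF cls_section[OF U c]] Q_op_ext(3) openY_Int[OF U]])
      (use lft_smult[OF lft_cls[OF U s] e openY_Int[OF U]] lft_cls[OF U c] in auto)
qed

lemma cls_restrict:
  assumes U: "opX U" and s: "s \<in> sections F U" and W: "W \<in> opens X U"
  shows "restrict (cls U s) (W \<inter> D) = cls W (res F U W s)"
  using gm_res[OF U s W] opensD(2)[OF W] by (auto simp: cls_def fun_eq_iff)

lemma lft_eq_cls: "lft V t U s \<Longrightarrow> restrict t (U \<inter> D) = cls U s"
  by (auto simp: lft_def cls_def fun_eq_iff)

lemma lft_iff_cls: "opX U \<Longrightarrow> U \<inter> D \<subseteq> V \<Longrightarrow> s \<in> sections F U \<Longrightarrow> restrict t (U \<inter> D) = cls U s \<Longrightarrow> lft V t U s"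
  unfolding lft_def cls_def by (auto simp: fun_eq_iff split: if_splits)

lemma lft_unique:
  assumes "lft V t U s" "lft V t U' s'" "q \<in> U" "q \<in> U'" "q \<in> D"
  shows "grel U s U' s' q"
  using gm_eq_iff[OF lftD(1)[OF assms(1)] lftD(1)[OF assms(2)] lftD(3)[OF assms(1)] lftD(3)[OF assms(2)] assms(3,4)]
    lftD(4)[OF assms(1,3,5)] lftD(4)[OF assms(2,4,5)] by simp

lemma some_rep:
  assumes "lft V t U s" "q \<in> U" "q \<in> D"
  obtains U' s' where "(SOME r. r \<in> t q) = (U', s')" "opX U'" "q \<in> U'" "s' \<in> sections F U'" "grel U s U' s' q"
proof -
  obtain U' s' where e: "(SOME r. r \<in> t q) = (U', s')" by fastforce
  have "(SOME r. r \<in> t q) \<in> t q" using rep_self[OF assms] by (rule someI)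
  then have "(U', s') \<in> t q" using e by simp
  from rep[OF assms this] show ?thesis using that[OF e] by blast
qed

end

section \<open>Sheaves of vector fields\<close>

definition vplus :: "'a cspace \<Rightarrow> 'a set \<Rightarrow> 'a vfield \<Rightarrow> 'a vfield \<Rightarrow> 'a vfield" where
  "vplus X U v w = (\<lambda>V\<in>opens X U. \<lambda>f\<in>hol X V. \<lambda>x\<in>V. v V f x + w V f x)"

definition vscale :: "'a cspace \<Rightarrow> 'a set \<Rightarrow> ('a \<Rightarrow> complex) \<Rightarrow> 'a vfield \<Rightarrow> 'a vfield" where
  "vscale X U h v = (\<lambda>V\<in>opens X U. \<lambda>f\<in>hol X V. \<lambda>x\<in>V. restrict h V x * v V f x)"

definition vzero :: "'a cspace \<Rightarrow> 'a set \<Rightarrow> 'a vfield" where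
  "vzero X U = (\<lambda>V\<in>opens X U. \<lambda>f\<in>hol X V. \<lambda>x\<in>V. 0)"

lemma op_simps:
  "sections (operator_sheaf X E S) U = S U"
  "\<zero>\<^bsub>sect (operator_sheaf X (structure_sheaf X) S) U\<^esub> = vzero X U"
  "v \<oplus>\<^bsub>sect (operator_sheaf X (structure_sheaf X) S) U\<^esub> w = vplus X U v w"
  "h \<odot>\<^bsub>sect (operator_sheaf X (structure_sheaf X) S) U\<^esub> v = vscale X U h v"
  "res (operator_sheaf X E S) U V v = restrict v (opens X V)"
  by (simp_all add: operator_sheaf_def mk_module_def vzero_def vplus_def vscale_def)

lemma vplus_apply: "V \<in> opens X U \<Longrightarrow> f \<in> hol X V \<Longrightarrow> x \<in> V \<Longrightarrow> vplus X U v w V f x = v V f x + w V f x"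
  by (simp add: vplus_def)

lemma vscale_apply: "V \<in> opens X U \<Longrightarrow> f \<in> hol X V \<Longrightarrow> x \<in> V \<Longrightarrow> vscale X U h v V f x = h x * v V f x"
  by (simp add: vscale_def)

lemma vzero_apply: "V \<in> opens X U \<Longrightarrow> f \<in> hol X V \<Longrightarrow> x \<in> V \<Longrightarrow> vzero X U V f x = 0"
  by (simp add: vzero_def)

lemma vres_apply: "V \<in> opens X W \<Longrightarrow> restrict v (opens X W) V = v V"
  by simp

context ringed_space
begin

lemma vplus_vf:
  assumes v: "v \<in> VX U" and w: "w \<in> VX U"
  shows "vplus X U v w \<in> VX U"
proof (rule vfI)
  fix V assume V: "V \<in> opens X U"
  note o = opensD(1)[OF V]
  show "vplus X U v w V \<in> extensional (hol X V)" using V by (simp add: vplus_def)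
  fix f assume f: "f \<in> hol X V"
  show "vplus X U v w V f \<in> hol X V"
    using V f hol_add[OF o vf_hol[OF v V f] vf_hol[OF w V f]] by (simp add: vplus_def)
  show "vplus X U v w V (\<lambda>x\<in>V. c * f x) x = c * vplus X U v w V f x" if "x \<in> V" for c x
    using vf_scale[OF v V f that] vf_scale[OF w V f that] hol_scale[OF o f]
    by (simp add: vplus_apply[OF V _ that] f algebra_simps)
  show "vplus X U v w V f x = vplus X U v w W (restrict f W) x" if W: "W \<in> opens X V" and x: "x \<in> W" for W x
    using vf_res[OF v V f W x] vf_res[OF w V f W x] hol_restrict[OF o W f] opensD(2)[OF W] x
    by (simp add: vplus_apply[OF V f] vplus_apply[OF opens_trans[OF W V]] subset_iff)
  fix g assume g: "g \<in> hol X V"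
  show "vplus X U v w V (\<lambda>x\<in>V. f x + g x) x = vplus X U v w V f x + vplus X U v w V g x" if "x \<in> V" for x
    using vf_add[OF v V f g that] vf_add[OF w V f g that] hol_add[OF o f g]
    by (simp add: vplus_apply[OF V _ that] f g algebra_simps)
  show "vplus X U v w V (\<lambda>x\<in>V. f x * g x) x = f x * vplus X U v w V g x + vplus X U v w V f x * g x" if "x \<in> V" for x
    using vf_mult[OF v V f g that] vf_mult[OF w V f g that] hol_mult[OF o f g]
    by (simp add: vplus_apply[OF V _ that] f g algebra_simps)
qed (simp add: vplus_def)

lemma vscale_vf:
  assumes U: "opX U" and h: "h \<in> hol X U" and v: "v \<in> VX U"
  shows "vscale X U h v \<in> VX U"
proof (rule vfI)
  fix V assume V: "V \<in> opens X U"
  note o = opensD(1)[OF V]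
  show "vscale X U h v V \<in> extensional (hol X V)" using V by (simp add: vscale_def)
  fix f assume f: "f \<in> hol X V"
  show "vscale X U h v V f \<in> hol X V"
    using V f hol_mult[OF o hol_restrict[OF U V h] vf_hol[OF v V f]] by (simp add: vscale_def)
  show "vscale X U h v V (\<lambda>x\<in>V. c * f x) x = c * vscale X U h v V f x" if "x \<in> V" for c x
    using vf_scale[OF v V f that] hol_scale[OF o f] by (simp add: vscale_apply[OF V _ that] f)
  show "vscale X U h v V f x = vscale X U h v W (restrict f W) x" if W: "W \<in> opens X V" and x: "x \<in> W" for W x
    using vf_res[OF v V f W x] hol_restrict[OF o W f] opensD(2)[OF W] x
    by (simp add: vscale_apply[OF V f] vscale_apply[OF opens_trans[OF W V]] subset_iff)
  fix g assume g: "g \<in> hol X V"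
  show "vscale X U h v V (\<lambda>x\<in>V. f x + g x) x = vscale X U h v V f x + vscale X U h v V g x" if "x \<in> V" for x
    using vf_add[OF v V f g that] hol_add[OF o f g]
    by (simp add: vscale_apply[OF V _ that] f g algebra_simps)
  show "vscale X U h v V (\<lambda>x\<in>V. f x * g x) x = f x * vscale X U h v V g x + vscale X U h v V f x * g x" if "x \<in> V" for x
    using vf_mult[OF v V f g that] hol_mult[OF o f g]
    by (simp add: vscale_apply[OF V _ that] f g algebra_simps)
qed (simp add: vscale_def)

lemma vzero_vf: "opX U \<Longrightarrow> vzero X U \<in> VX U"
proof (rule vfI)
  fix V assume V: "V \<in> opens X U"
  note o = opensD(1)[OF V]
  show "vzero X U V \<in> extensional (hol X V)" using V by (simp add: vzero_def)
  fix f assume f: "f \<in> hol X V"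
  show "vzero X U V f \<in> hol X V" using V f hol_const[OF o] by (simp add: vzero_def)
  show "vzero X U V (\<lambda>x\<in>V. c * f x) x = c * vzero X U V f x" if "x \<in> V" for c x
    using hol_scale[OF o f] by (simp add: vzero_apply[OF V _ that] f)
  show "vzero X U V f x = vzero X U W (restrict f W) x" if W: "W \<in> opens X V" and x: "x \<in> W" for W x
    using hol_restrict[OF o W f] opensD(2)[OF W] x
    by (simp add: vzero_apply[OF V f] vzero_apply[OF opens_trans[OF W V]] subset_iff)
  fix g assume g: "g \<in> hol X V"
  show "vzero X U V (\<lambda>x\<in>V. f x + g x) x = vzero X U V f x + vzero X U V g x" if "x \<in> V" for x
    using hol_add[OF o f g] by (simp add: vzero_apply[OF V _ that] f g)
  show "vzero X U V (\<lambda>x\<in>V. f x * g x) x = f x * vzero X U V g x + vzero X U V f x * g x" if "x \<in> V" for x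
    using hol_mult[OF o f g] by (simp add: vzero_apply[OF V _ that] f g)
qed (simp add: vzero_def)

lemma vres_vf:
  assumes v: "v \<in> VX U" and W: "W \<in> opens X U"
  shows "restrict v (opens X W) \<in> VX W"
proof (rule vfI)
  fix V assume V': "V \<in> opens X W"
  note V = opens_trans[OF V' W]
  note o = opensD(1)[OF V] and [simp] = V'
  show "restrict v (opens X W) V \<in> extensional (hol X V)" using vf_ext[OF v V] by simp
  fix f assume f: "f \<in> hol X V"
  show "restrict v (opens X W) V f \<in> hol X V" using vf_hol[OF v V f] by simp
  show "restrict v (opens X W) V (\<lambda>x\<in>V. c * f x) x = c * restrict v (opens X W) V f x" if "x \<in> V" for c x
    using vf_scale[OF v V f that] by simp
  show "restrict v (opens X W) V f x = restrict v (opens X W) W' (restrict f W') x" if W': "W' \<in> opens X V" and x: "x \<in> W'" for W' x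
    using vf_res[OF v V f W' x] opens_trans[OF W' V'] by simp
  fix g assume g: "g \<in> hol X V"
  show "restrict v (opens X W) V (\<lambda>x\<in>V. f x + g x) x = restrict v (opens X W) V f x + restrict v (opens X W) V g x" if "x \<in> V" for x
    using vf_add[OF v V f g that] by simp
  show "restrict v (opens X W) V (\<lambda>x\<in>V. f x * g x) x = f x * restrict v (opens X W) V g x + restrict v (opens X W) V f x * g x" if "x \<in> V" for x
    using vf_mult[OF v V f g that] by simp
qed simp

lemma bracket_apply:
  assumes v: "v \<in> VX U" and w: "w \<in> VX U"
    and V: "V \<in> opens X U" and f: "f \<in> hol X V" and x: "x \<in> V"
  shows "brk U v w V f x = v V (w V f) x - w V (v V f) x"
  using structure_sheaf_minus[OF opensD(1)[OF V] vf_hol[OF v V vf_hol[OF w V f]] vf_hol[OF w V vf_hol[OF v V f]]] V f x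
  by (simp add: commutator_def)

lemma bracket_vf:
  assumes v: "v \<in> VX U" and w: "w \<in> VX U"
  shows "brk U v w \<in> VX U"
proof (rule vfI)
  fix V assume V: "V \<in> opens X U"
  note o = opensD(1)[OF V]
  note ba = bracket_apply[OF v w V]
  have e: "u V f \<in> extensional V" if "u \<in> VX U" "f \<in> hol X V" for u f
    using vf_hol[OF that(1) V that(2)] hol_ext[OF o] by blast
  show "brk U v w V \<in> extensional (hol X V)" using V by (simp add: commutator_def)
  fix f assume f: "f \<in> hol X V"
  note vf = vf_hol[OF v V f] and wf = vf_hol[OF w V f]
  show "brk U v w V f \<in> hol X V"
    using hol_diff[OF o vf_hol[OF v V wf] vf_hol[OF w V vf]]
      structure_sheaf_minus[OF o vf_hol[OF v V wf] vf_hol[OF w V vf]] V f by (simp add: commutator_def)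
  show "brk U v w V (\<lambda>x\<in>V. c * f x) x = c * brk U v w V f x" if x: "x \<in> V" for c x
  proof -
    have "v V (\<lambda>x\<in>V. c * f x) = (\<lambda>x\<in>V. c * v V f x)" "w V (\<lambda>x\<in>V. c * f x) = (\<lambda>x\<in>V. c * w V f x)"
      by (rule extensionalityI[of _ V]; simp add: e v w hol_scale[OF o f] vf_scale[OF v V f] vf_scale[OF w V f])+
    then show ?thesis
      by (simp only: ba[OF f x] ba[OF hol_scale[OF o f] x] vf_scale[OF v V wf x] vf_scale[OF w V vf x] right_diff_distrib)
  qed
  show "brk U v w V f x = brk U v w W (restrict f W) x" if W: "W \<in> opens X V" and x: "x \<in> W" for W x
  proof -
    note WU = opens_trans[OF W V]
    have r: "u W (restrict f W) = restrict (u V f) W" if u: "u \<in> VX U" for u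
      by (rule extensionalityI[of _ W])
        (use vf_hol[OF u WU hol_restrict[OF o W f]] hol_ext[OF opensD(1)[OF W]] vf_res[OF u V f W] in auto)
    have xV: "x \<in> V" using x opensD(2)[OF W] by blast
    show ?thesis
      using ba[OF f xV] bracket_apply[OF v w WU hol_restrict[OF o W f] x] r[OF v] r[OF w]
        vf_res[OF v V wf W x] vf_res[OF w V vf W x] by simp
  qed
  fix g assume g: "g \<in> hol X V"
  note vg = vf_hol[OF v V g] and wg = vf_hol[OF w V g]
  show "brk U v w V (\<lambda>x\<in>V. f x + g x) x = brk U v w V f x + brk U v w V g x" if x: "x \<in> V" for x
  proof -
    have "v V (\<lambda>x\<in>V. f x + g x) = (\<lambda>x\<in>V. v V f x + v V g x)" "w V (\<lambda>x\<in>V. f x + g x) = (\<lambda>x\<in>V. w V f x + w V g x)"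
      by (rule extensionalityI[of _ V]; simp add: e v w hol_add[OF o f g] vf_add[OF v V f g] vf_add[OF w V f g])+
    then show ?thesis
      using ba[OF f x] ba[OF g x] ba[OF hol_add[OF o f g] x] vf_add[OF v V wf wg x] vf_add[OF w V vf vg x] by simp
  qed
  show "brk U v w V (\<lambda>x\<in>V. f x * g x) x = f x * brk U v w V g x + brk U v w V f x * g x" if x: "x \<in> V" for x
  proof -
    have p: "u V (\<lambda>x\<in>V. f x * g x) = (\<lambda>x\<in>V. (\<lambda>x\<in>V. f x * u V g x) x + (\<lambda>x\<in>V. u V f x * g x) x)" if u: "u \<in> VX U" for u
      by (rule extensionalityI[of _ V]) (use e[OF u hol_mult[OF o f g]] vf_mult[OF u V f g] in auto)
    \<comment> \<open>The two mixed terms are exchanged when \<open>u\<close> and \<open>u'\<close>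
      are, so they cancel in the commutator.\<close>
    have q: "u V (u' V (\<lambda>x\<in>V. f x * g x)) x = f x * u V (u' V g) x + u V f x * u' V g x + u' V f x * u V g x + u V (u' V f) x * g x"
      if u: "u \<in> VX U" "u' \<in> VX U" for u u'
    proof -
      note hf = vf_hol[OF u(2) V f] and hg = vf_hol[OF u(2) V g]
      show ?thesis unfolding p[OF u(2)]
        using vf_add[OF u(1) V hol_mult[OF o f hg] hol_mult[OF o hf g] x]
          vf_mult[OF u(1) V f hg x] vf_mult[OF u(1) V hf g x] by simp
    qed
    show ?thesis
      by (simp only: ba[OF f x] ba[OF g x] ba[OF hol_mult[OF o f g] x] q[OF v w] q[OF w v]) (simp add: algebra_simps)
  qed
qed (simp add: commutator_def)

lemma bracket_res:
  assumes v: "v \<in> VX U" and w: "w \<in> VX U" and W: "W \<in> opens X U"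
  shows "restrict (brk U v w) (opens X W) = brk W (restrict v (opens X W)) (restrict w (opens X W))"
proof (rule vf_eqI[OF vres_vf[OF bracket_vf[OF v w] W] bracket_vf[OF vres_vf[OF v W] vres_vf[OF w W]]])
  fix V f x assume V: "V \<in> opens X W" and f: "f \<in> hol X V" and x: "x \<in> V"
  show "restrict (brk U v w) (opens X W) V f x = brk W (restrict v (opens X W)) (restrict w (opens X W)) V f x"
    using bracket_apply[OF v w opens_trans[OF V W] f x] bracket_apply[OF vres_vf[OF v W] vres_vf[OF w W] V f x] V
    by simp
qed

end

lemma opens_mem: "V \<in> opens X U \<Longrightarrow> x \<in> V \<Longrightarrow> x \<in> U"
  by (auto simp: opens_def)

text \<open>Closure under the operations is all that the quotient construction asks of a class of
  fields; it is applied to all fields and to those tangent to \<open>D\<close>.\<close>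

locale vf_subsheaf = ringed_space X for X :: "'a cspace" +
  fixes S :: "'a set \<Rightarrow> 'a vfield set"
  assumes S_vf: "openin (points X) U \<Longrightarrow> v \<in> S U \<Longrightarrow> v \<in> vector_fields X U"
    and S_zero: "openin (points X) U \<Longrightarrow> vzero X U \<in> S U"
    and S_plus: "openin (points X) U \<Longrightarrow> v \<in> S U \<Longrightarrow> w \<in> S U \<Longrightarrow> vplus X U v w \<in> S U"
    and S_scale: "openin (points X) U \<Longrightarrow> h \<in> hol X U \<Longrightarrow> v \<in> S U \<Longrightarrow> vscale X U h v \<in> S U"
    and S_res: "openin (points X) U \<Longrightarrow> V \<in> opens X U \<Longrightarrow> v \<in> S U \<Longrightarrow> restrict v (opens X V) \<in> S V"
begin

abbreviation "FS \<equiv> operator_sheaf X (structure_sheaf X) S"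

lemma S_eqI:
  "opX U \<Longrightarrow> v \<in> S U \<Longrightarrow> w \<in> S U \<Longrightarrow>
    (\<And>V f x. V \<in> opens X U \<Longrightarrow> f \<in> hol X V \<Longrightarrow> x \<in> V \<Longrightarrow> v V f x = w V f x) \<Longrightarrow> v = w"
  by (rule vf_eqI[OF S_vf S_vf])

lemma FS_module: assumes U: "opX U" shows "module (hol_ring X U) (sect FS U)"
proof (rule moduleI[OF cring_hol[OF U]])
  show "abelian_group (sect FS U)"
  proof (rule abelian_groupI, unfold op_simps)
    show "vzero X U \<in> S U" by (rule S_zero[OF U])
    fix v assume v: "v \<in> S U"
    show "vplus X U v w \<in> S U" if w: "w \<in> S U" for w by (rule S_plus[OF U v w])
    show "vplus X U (vplus X U v w) u = vplus X U v (vplus X U w u)" if w: "w \<in> S U" and u: "u \<in> S U" for w u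
      by (rule S_eqI[OF U]) (simp_all add: S_plus U v w u vplus_apply algebra_simps)
    show "vplus X U v w = vplus X U w v" if w: "w \<in> S U" for w
      by (rule S_eqI[OF U]) (simp_all add: S_plus U v w vplus_apply algebra_simps)
    show "vplus X U (vzero X U) v = v"
      by (rule S_eqI[OF U]) (simp_all add: S_plus S_zero U v vplus_apply vzero_apply)
    show "\<exists>y\<in>S U. vplus X U y v = vzero X U"
    proof
      show c: "vscale X U (\<lambda>x\<in>U. -1) v \<in> S U" by (rule S_scale[OF U hol_const[OF U] v])
      show "vplus X U (vscale X U (\<lambda>x\<in>U. -1) v) v = vzero X U"
        by (rule S_eqI[OF U]) (auto simp: S_plus S_zero U v c vplus_apply vscale_apply vzero_apply dest: opens_mem)
    qed
  qed
next
  fix v assume "v \<in> sections FS U"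
  then have v: "v \<in> S U" by (simp add: op_simps)
  note a = vplus_apply vscale_apply algebra_simps
  note c = S_scale[OF U] S_plus[OF U] hol_add[OF U] hol_mult[OF U] hol_const[OF U] v
  show "\<one>\<^bsub>hol_ring X U\<^esub> \<odot>\<^bsub>sect FS U\<^esub> v = v"
    unfolding op_simps hol_ring_simps by (rule S_eqI[OF U]) (auto simp: c a dest: opens_mem)
  fix h assume "h \<in> carrier (hol_ring X U)"
  then have h: "h \<in> hol X U" by simp
  show "h \<odot>\<^bsub>sect FS U\<^esub> v \<in> sections FS U" by (simp add: op_simps c h)
  show "(h \<oplus>\<^bsub>hol_ring X U\<^esub> k) \<odot>\<^bsub>sect FS U\<^esub> v = h \<odot>\<^bsub>sect FS U\<^esub> v \<oplus>\<^bsub>sect FS U\<^esub> k \<odot>\<^bsub>sect FS U\<^esub> v"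
    "(h \<otimes>\<^bsub>hol_ring X U\<^esub> k) \<odot>\<^bsub>sect FS U\<^esub> v = h \<odot>\<^bsub>sect FS U\<^esub> (k \<odot>\<^bsub>sect FS U\<^esub> v)"
    if "k \<in> carrier (hol_ring X U)" for k
    using that unfolding op_simps hol_ring_simps by (rule_tac S_eqI[OF U], auto simp: c h a dest: opens_mem)+
  show "h \<odot>\<^bsub>sect FS U\<^esub> (v \<oplus>\<^bsub>sect FS U\<^esub> w) = h \<odot>\<^bsub>sect FS U\<^esub> v \<oplus>\<^bsub>sect FS U\<^esub> h \<odot>\<^bsub>sect FS U\<^esub> w"
    if "w \<in> sections FS U" for w
    using that unfolding op_simps hol_ring_simps by (rule_tac S_eqI[OF U]) (auto simp: c h a dest: opens_mem)
qed

lemma FS_presheaf: "module_presheaf X FS"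
proof (intro module_presheaf.intro module_presheaf_axioms.intro, unfold op_simps)
  show "ringed_space X" by unfold_locales
  fix U assume U: "opX U"
  show "module (hol_ring X U) (sect FS U)" by (rule FS_module[OF U])
  fix v assume v: "v \<in> S U"
  show "restrict v (opens X U) = v" using S_vf[OF U v] unfolding vector_fields_iff by (simp add: extensional_restrict)
next
  fix V U assume V: "V \<in> opens X U" and U: "opX U"
  fix v assume v: "v \<in> S U"
  show rv: "restrict v (opens X V) \<in> S V" by (rule S_res[OF U V v])
  show "restrict (restrict v (opens X V)) (opens X W) = restrict v (opens X W)" if "W \<in> opens X V" for W
    using opens_trans[OF _ that] by (auto simp: fun_eq_iff)
  show "restrict (vplus X U v w) (opens X V) = vplus X V (restrict v (opens X V)) (restrict w (opens X V))" if w: "w \<in> S U" for w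
    using opens_trans[OF _ V] by (auto simp: vplus_def fun_eq_iff)
  show "restrict (vscale X U h v) (opens X V) = vscale X V (restrict h V) (restrict v (opens X V))" if h: "h \<in> hol X U" for h
    using opens_trans[OF _ V] opensD(2) by (fastforce simp: vscale_def fun_eq_iff)
qed

end

sublocale vf_subsheaf \<subseteq> module_presheaf X FS by (rule FS_presheaf)

lemma (in vf_subsheaf) minus_apply:
  assumes U: "opX U" and v: "v \<in> S U" and w: "w \<in> S U"
    and V: "V \<in> opens X U" and f: "f \<in> hol X V" and x: "x \<in> V"
  shows "(v \<ominus>\<^bsub>sect FS U\<^esub> w) V f x = v V f x - w V f x"
proof -
  interpret abelian_group "sect FS U" by (rule ag[OF U])
  have "vplus X U (v \<ominus>\<^bsub>sect FS U\<^esub> w) w = v"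
    using minus_plus_cancel[of v w] v w by (simp add: op_simps)
  then show ?thesis using vplus_apply[OF V f x, of "v \<ominus>\<^bsub>sect FS U\<^esub> w" w] by (metis add_diff_cancel)
qed

lemma (in ringed_space) vf_subsheaf_vf: "vf_subsheaf X (VX)"
  by unfold_locales (simp_all add: vzero_vf vplus_vf vscale_vf vres_vf)

definition log_fields :: "'a cspace \<Rightarrow> 'a set \<Rightarrow> 'a set \<Rightarrow> 'a vfield set" where
  "log_fields X D U = {v \<in> vector_fields X U. \<forall>V\<in>opens X U. v V ` ideal_sheaf X D V \<subseteq> ideal_sheaf X D V}"

lemma log_tangent_sheaf_eq: "log_tangent_sheaf X D = operator_sheaf X (structure_sheaf X) (log_fields X D)"
  by (simp add: log_tangent_sheaf_def log_fields_def[abs_def])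

context ringed_space
begin

lemma log_fields_iff:
  "v \<in> log_fields X D U \<longleftrightarrow> v \<in> VX U \<and>
    (\<forall>V\<in>opens X U. \<forall>f\<in>hol X V. (\<forall>x\<in>V \<inter> D. f x = 0) \<longrightarrow> (\<forall>x\<in>V \<inter> D. v V f x = 0))"
proof -
  have "v V ` ideal_sheaf X D V \<subseteq> ideal_sheaf X D V \<longleftrightarrow>
     (\<forall>f\<in>hol X V. (\<forall>x\<in>V \<inter> D. f x = 0) \<longrightarrow> (\<forall>x\<in>V \<inter> D. v V f x = 0))"
    if "v \<in> VX U" "V \<in> opens X U" for V
    using vf_hol[OF that] by (auto simp: ideal_sheaf_def)
  then show ?thesis unfolding log_fields_def mem_Collect_eq by blast
qed

lemma log_vf: "v \<in> log_fields X D U \<Longrightarrow> v \<in> VX U"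
  by (simp add: log_fields_def)

lemma logD:
  "v \<in> log_fields X D U \<Longrightarrow> V \<in> opens X U \<Longrightarrow> f \<in> hol X V \<Longrightarrow> (\<And>x. x \<in> V \<Longrightarrow> x \<in> D \<Longrightarrow> f x = 0) \<Longrightarrow>
    x \<in> V \<Longrightarrow> x \<in> D \<Longrightarrow> v V f x = 0"
  unfolding log_fields_iff by blast

lemma logI:
  "v \<in> VX U \<Longrightarrow>
   (\<And>V f x. V \<in> opens X U \<Longrightarrow> f \<in> hol X V \<Longrightarrow> (\<And>x. x \<in> V \<Longrightarrow> x \<in> D \<Longrightarrow> f x = 0) \<Longrightarrow> x \<in> V \<Longrightarrow> x \<in> D \<Longrightarrow> v V f x = 0) \<Longrightarrow>
   v \<in> log_fields X D U"
  unfolding log_fields_iff by (simp add: Ball_def)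

lemma log_res: "v \<in> log_fields X D U \<Longrightarrow> W \<in> opens X U \<Longrightarrow> restrict v (opens X W) \<in> log_fields X D W"
proof (rule logI[OF vres_vf[OF log_vf]])
  fix V f x assume v: "v \<in> log_fields X D U" and W: "W \<in> opens X U" and V: "V \<in> opens X W" and f: "f \<in> hol X V"
    and z: "\<And>x. x \<in> V \<Longrightarrow> x \<in> D \<Longrightarrow> f x = 0" and x: "x \<in> V" "x \<in> D"
  show "restrict v (opens X W) V f x = 0"
    using logD[OF v opens_trans[OF V W] f z x] vres_apply[OF V, of v] by simp
qed

lemma vf_subsheaf_log: "vf_subsheaf X (log_fields X D)"
proof unfold_locales
  fix U v assume U: "opX U"
  show "vzero X U \<in> log_fields X D U" by (rule logI[OF vzero_vf[OF U]]) (simp add: vzero_apply)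
  assume v: "v \<in> log_fields X D U"
  then show v': "v \<in> VX U" by (rule log_vf)
  show "restrict v (opens X V) \<in> log_fields X D V" if "V \<in> opens X U" for V by (rule log_res[OF v that])
  show "vscale X U h v \<in> log_fields X D U" if h: "h \<in> hol X U" for h
    by (rule logI[OF vscale_vf[OF U h v']]) (simp add: vscale_apply logD[OF v])
  fix w assume w: "w \<in> log_fields X D U"
  show "vplus X U v w \<in> log_fields X D U"
    by (rule logI[OF vplus_vf[OF v' log_vf[OF w]]]) (simp add: vplus_apply logD[OF v] logD[OF w])
qed

text \<open>If \<open>v\<close> and \<open>w\<close> map \<open>I\<^sub>D\<close> to itself, so do
  both compositions.\<close>

lemma log_bracket:
  assumes v: "v \<in> log_fields X D U" and w: "w \<in> log_fields X D U"
  shows "brk U v w \<in> log_fields X D U"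
proof (rule logI[OF bracket_vf[OF log_vf[OF v] log_vf[OF w]]])
  fix V f x assume V: "V \<in> opens X U" and f: "f \<in> hol X V"
    and z: "\<And>x. x \<in> V \<Longrightarrow> x \<in> D \<Longrightarrow> f x = 0" and x: "x \<in> V" "x \<in> D"
  show "brk U v w V f x = 0"
    using bracket_apply[OF log_vf[OF v] log_vf[OF w] V f x(1)]
      logD[OF v V vf_hol[OF log_vf[OF w] V f] logD[OF w V f z] x]
      logD[OF w V vf_hol[OF log_vf[OF v] V f] logD[OF v V f z] x] by simp
qed

end

section \<open>The submodule generated by \<open>I\<^sub>D\<close>\<close>

context module_presheaf
begin

lemma ideal_times_zero: "opX U \<Longrightarrow> \<zero>\<^bsub>sect F U\<^esub> \<in> ideal_times X D F U"
proof -
  assume U: "opX U"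
  interpret abelian_group "sect F U" by (rule ag[OF U])
  have "\<zero>\<^bsub>sect F U\<^esub> = (\<Oplus>\<^bsub>sect F U\<^esub>i\<in>{..<0::nat}. (\<lambda>_. undefined) i \<odot>\<^bsub>sect F U\<^esub> (\<lambda>_. undefined) i)" by simp
  then show ?thesis unfolding ideal_times_def
    by (intro CollectI exI[of _ 0] exI[of _ "\<lambda>_. undefined"] conjI) auto
qed

lemma ideal_smult_closed:
  "opX U \<Longrightarrow> f \<in> ideal_sheaf X D U \<Longrightarrow> s \<in> sections F U \<Longrightarrow> f \<odot>\<^bsub>sect F U\<^esub> s \<in> sections F U"
  using module.smult_closed[OF md] by (simp add: ideal_sheaf_def)

lemma ideal_times_step:
  assumes U: "opX U" and x: "x \<in> ideal_times X D F U"
    and f: "f \<in> ideal_sheaf X D U" and s: "s \<in> sections F U"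
  shows "x \<oplus>\<^bsub>sect F U\<^esub> f \<odot>\<^bsub>sect F U\<^esub> s \<in> ideal_times X D F U"
proof -
  interpret abelian_group "sect F U" by (rule ag[OF U])
  obtain k :: nat and g t where x: "x = (\<Oplus>\<^bsub>sect F U\<^esub>i\<in>{..<k}. g i \<odot>\<^bsub>sect F U\<^esub> t i)"
    and g: "g \<in> {..<k} \<rightarrow> ideal_sheaf X D U" and t: "t \<in> {..<k} \<rightarrow> sections F U"
    using x unfolding ideal_times_def by blast
  let ?g = "g(k := f)" and ?t = "t(k := s)"
  have c: "(\<lambda>i. ?g i \<odot>\<^bsub>sect F U\<^esub> ?t i) \<in> {..<k} \<rightarrow> sections F U"
    by (intro Pi_I ideal_smult_closed[OF U]) (use g t in auto)
  have e: "(\<Oplus>\<^bsub>sect F U\<^esub>i\<in>{..<Suc k}. ?g i \<odot>\<^bsub>sect F U\<^esub> ?t i) = f \<odot>\<^bsub>sect F U\<^esub> s \<oplus>\<^bsub>sect F U\<^esub> (\<Oplus>\<^bsub>sect F U\<^esub>i\<in>{..<k}. ?g i \<odot>\<^bsub>sect F U\<^esub> ?t i)"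
    unfolding lessThan_Suc using c ideal_smult_closed[OF U f s] by (subst finsum_insert) auto
  have gt: "(\<lambda>i. g i \<odot>\<^bsub>sect F U\<^esub> t i) \<in> {..<k} \<rightarrow> sections F U"
    by (intro Pi_I ideal_smult_closed[OF U]) (use g t in auto)
  have "(\<Oplus>\<^bsub>sect F U\<^esub>i\<in>{..<k}. ?g i \<odot>\<^bsub>sect F U\<^esub> ?t i) = x"
    unfolding x by (rule finsum_cong') (use gt in auto)
  moreover have "x \<in> sections F U" unfolding x by (rule finsum_closed[OF gt])
  ultimately have "x \<oplus>\<^bsub>sect F U\<^esub> f \<odot>\<^bsub>sect F U\<^esub> s = (\<Oplus>\<^bsub>sect F U\<^esub>i\<in>{..<Suc k}. ?g i \<odot>\<^bsub>sect F U\<^esub> ?t i)"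
    using e a_comm[OF _ ideal_smult_closed[OF U f s]] by simp
  moreover have "?g \<in> {..<Suc k} \<rightarrow> ideal_sheaf X D U" "?t \<in> {..<Suc k} \<rightarrow> sections F U"
    using g t f s by (auto simp: Pi_def less_Suc_eq)
  ultimately show ?thesis unfolding ideal_times_def by blast
qed

text \<open>Elements are finite sums of products; by induction on the number of terms a property is
  checked for adding a single product.\<close>

lemma ideal_times_induct [consumes 2, case_names zero step]:
  assumes U: "opX U" and x: "x \<in> ideal_times X D F U"
    and zero: "P \<zero>\<^bsub>sect F U\<^esub>"
    and step: "\<And>x f s. x \<in> ideal_times X D F U \<Longrightarrow> x \<in> sections F U \<Longrightarrow> P x \<Longrightarrow> f \<in> ideal_sheaf X D U \<Longrightarrow> s \<in> sections F U \<Longrightarrow>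
       P (x \<oplus>\<^bsub>sect F U\<^esub> f \<odot>\<^bsub>sect F U\<^esub> s)"
  shows "P x"
proof -
  interpret abelian_group "sect F U" by (rule ag[OF U])
  obtain k :: nat and g t where x: "x = (\<Oplus>\<^bsub>sect F U\<^esub>i\<in>{..<k}. g i \<odot>\<^bsub>sect F U\<^esub> t i)"
    and g: "\<And>i. i < k \<Longrightarrow> g i \<in> ideal_sheaf X D U" and t: "\<And>i. i < k \<Longrightarrow> t i \<in> sections F U"
    using x unfolding ideal_times_def by (auto simp: Pi_def)
  have "P (\<Oplus>\<^bsub>sect F U\<^esub>i\<in>{..<m}. g i \<odot>\<^bsub>sect F U\<^esub> t i)" if "m \<le> k" for m
    using that
  proof (induction m)
    case 0 then show ?case using zero by simp
  next
    case (Suc m)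
    let ?y = "\<Oplus>\<^bsub>sect F U\<^esub>i\<in>{..<m}. g i \<odot>\<^bsub>sect F U\<^esub> t i"
    have c: "(\<lambda>i. g i \<odot>\<^bsub>sect F U\<^esub> t i) \<in> {..<m} \<rightarrow> sections F U"
      by (intro Pi_I ideal_smult_closed[OF U, where D=D] g t) (use Suc.prems in auto)
    have m: "g m \<in> ideal_sheaf X D U" "t m \<in> sections F U" using g t Suc.prems by auto
    have y: "?y \<in> sections F U" by (rule finsum_closed[OF c])
    have "?y \<in> ideal_times X D F U" unfolding ideal_times_def using g t Suc.prems by (intro CollectI exI[of _ m] exI[of _ g] exI[of _ t]) auto
    from step[OF this y Suc.IH m] Suc.prems have "P (?y \<oplus>\<^bsub>sect F U\<^esub> g m \<odot>\<^bsub>sect F U\<^esub> t m)" by simp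
    moreover have "(\<Oplus>\<^bsub>sect F U\<^esub>i\<in>{..<Suc m}. g i \<odot>\<^bsub>sect F U\<^esub> t i) = g m \<odot>\<^bsub>sect F U\<^esub> t m \<oplus>\<^bsub>sect F U\<^esub> ?y"
      unfolding lessThan_Suc using c ideal_smult_closed[OF U m] by (subst finsum_insert) auto
    ultimately show ?case using a_comm[OF y ideal_smult_closed[OF U m]] by simp
  qed
  then show ?thesis unfolding x by simp
qed

lemma ideal_times_closed:
  assumes U: "opX U" and x: "x \<in> ideal_times X D F U"
  shows "x \<in> sections F U"
  using U x
proof (induction rule: ideal_times_induct)
  case zero
  interpret abelian_group "sect F U" by (rule ag[OF U])
  show ?case by simp
next
  case (step x f s)
  interpret abelian_group "sect F U" by (rule ag[OF U])
  show ?case using step(2) ideal_smult_closed[OF U step(3,4)] by simp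
qed

lemma ideal_times_ideal:
  assumes U: "opX U" and f: "f \<in> ideal_sheaf X D U" and s: "s \<in> sections F U"
  shows "f \<odot>\<^bsub>sect F U\<^esub> s \<in> ideal_times X D F U"
proof -
  interpret abelian_group "sect F U" by (rule ag[OF U])
  show ?thesis using ideal_times_step[OF U ideal_times_zero[OF U] f s] ideal_smult_closed[OF U f s] by simp
qed

lemma ideal_times_add:
  assumes U: "opX U" and x: "x \<in> ideal_times X D F U" and y: "y \<in> ideal_times X D F U"
  shows "x \<oplus>\<^bsub>sect F U\<^esub> y \<in> ideal_times X D F U"
  using U y
proof (induction rule: ideal_times_induct)
  case zero
  interpret abelian_group "sect F U" by (rule ag[OF U])
  show ?case using x ideal_times_closed[OF U x] by simp
next
  case (step y f s)
  interpret abelian_group "sect F U" by (rule ag[OF U])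
  show ?case using ideal_times_step[OF U step(5,3,4)]
    a_assoc[OF ideal_times_closed[OF U x] step(2) ideal_smult_closed[OF U step(3,4)]] by simp
qed

lemma ideal_times_smult:
  assumes U: "opX U" and h: "h \<in> hol X U" and x: "x \<in> ideal_times X D F U"
  shows "h \<odot>\<^bsub>sect F U\<^esub> x \<in> ideal_times X D F U"
  using U x
proof (induction rule: ideal_times_induct)
  case zero
  interpret module "hol_ring X U" "sect F U" by (rule md[OF U])
  show ?case using h ideal_times_zero[OF U] by simp
next
  case (step x f s)
  interpret module "hol_ring X U" "sect F U" by (rule md[OF U])
  have f: "f \<in> hol X U" using step(3) by (simp add: ideal_sheaf_def)
  have "(\<lambda>x\<in>U. h x * f x) \<in> ideal_sheaf X D U"
    using hol_mult[OF U h f] step(3) by (simp add: ideal_sheaf_def)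
  from ideal_times_step[OF U step(5) this step(4)]
  show ?case using smult_r_distr[of h x "f \<odot>\<^bsub>sect F U\<^esub> s"] smult_assoc1[of h f s] h f step(2,4) by simp
qed

lemma ideal_times_res:
  assumes U: "opX U" and V: "V \<in> opens X U" and x: "x \<in> ideal_times X D F U"
  shows "res F U V x \<in> ideal_times X D F V"
  using U x
proof (induction rule: ideal_times_induct)
  case zero
  show ?case using res_zero[OF V U] ideal_times_zero[OF opensD(1)[OF V]] by simp
next
  case (step x f s)
  have f: "f \<in> hol X U" using step(3) by (simp add: ideal_sheaf_def)
  have fV: "restrict f V \<in> ideal_sheaf X D V"
    using hol_restrict[OF U V f] step(3) opensD(2)[OF V] by (auto simp: ideal_sheaf_def)
  from ideal_times_step[OF opensD(1)[OF V] step(5) fV res_closed[OF V U step(4)]]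
  show ?case using res_add[OF V U step(2) ideal_smult_closed[OF U step(3,4)]] res_smult[OF V U f step(4)] by simp
qed

lemma germ_quotient_ideal_times:
  assumes "points Y = subtopology (points X) D" "D \<subseteq> topspace (points X)" "ringed_space Y"
    "\<And>V f. openin (points Y) V \<Longrightarrow> f \<in> hol Y V \<longleftrightarrow> f \<in> extensional V \<and>
        (\<forall>p\<in>V. \<exists>U. opX U \<and> p \<in> U \<and> (\<exists>g\<in>hol X U. \<forall>x\<in>U \<inter> V. f x = g x))"
  shows "germ_quotient X F Y D (ideal_times X D F)"
proof (intro germ_quotient.intro germ_quotient_axioms.intro assms)
  show "module_presheaf X F" by unfold_locales
qed (use ideal_times_closed in \<open>auto intro: ideal_times_zero ideal_times_add ideal_times_smult ideal_times_ideal ideal_times_res\<close>)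

end

section \<open>The divisor as a manifold\<close>

lemma points_subspace: "points (subspace_of X D) = subtopology (points X) D"
  by (simp add: subspace_of_def)

lemma hol_subspace:
  "f \<in> hol (subspace_of X D) V \<longleftrightarrow> f \<in> extensional V \<and>
    (\<forall>p\<in>V. \<exists>U. openin (points X) U \<and> p \<in> U \<and> (\<exists>g\<in>hol X U. \<forall>x\<in>U \<inter> V. f x = g x))"
  by (simp add: subspace_of_def)

lemma open_subspace: "openin (points (subspace_of X D)) V \<longleftrightarrow> (\<exists>U. openin (points X) U \<and> V = U \<inter> D)"
  by (simp add: points_subspace openin_subtopology)

lemma (in ringed_space) subspace_ext2:
  assumes f: "f \<in> hol (subspace_of X D) V" "g \<in> hol (subspace_of X D) V" and p: "p \<in> V"
  shows "\<exists>U h k. opX U \<and> p \<in> U \<and> h \<in> hol X U \<and> k \<in> hol X U \<and>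
    (\<forall>x\<in>U \<inter> V. f x = h x \<and> g x = k x)"
proof -
  obtain U h where U: "opX U" "p \<in> U" "h \<in> hol X U" "\<forall>x\<in>U \<inter> V. f x = h x"
    using f(1) p unfolding hol_subspace by blast
  obtain U' k where U': "opX U'" "p \<in> U'" "k \<in> hol X U'" "\<forall>x\<in>U' \<inter> V. g x = k x"
    using f(2) p unfolding hol_subspace by blast
  show ?thesis
    by (intro exI[of _ "U \<inter> U'"] exI[of _ "restrict h (U \<inter> U')"] exI[of _ "restrict k (U \<inter> U')"])
      (use U U' hol_restrict[OF U(1) opens_Int(1)[OF U(1) U'(1)] U(3)] hol_restrict[OF U'(1) opens_Int(2)[OF U(1) U'(1)] U'(3)] in auto)
qed

lemma (in ringed_space) subspace_ringed: "ringed_space (subspace_of X D)"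
proof
  let ?Y = "subspace_of X D"
  show "function_sheaf ?Y" unfolding function_sheaf_def
  proof (intro conjI allI impI)
    fix U assume U: "openin (points ?Y) U"
    show "hol ?Y U \<subseteq> extensional U" by (auto simp: hol_subspace)
    fix f
    show "restrict f V \<in> hol ?Y V" if V: "V \<in> opens ?Y U" and f: "f \<in> hol ?Y U" for V
      unfolding hol_subspace
    proof (intro conjI ballI)
      fix p assume p: "p \<in> V"
      obtain U' g where U': "opX U'" "p \<in> U'" "g \<in> hol X U'" "\<forall>x\<in>U' \<inter> U. f x = g x"
        using f p opensD(2)[OF V] unfolding hol_subspace by blast
      then show "\<exists>U. opX U \<and> p \<in> U \<and> (\<exists>g\<in>hol X U. \<forall>x\<in>U \<inter> V. restrict f V x = g x)"
        using opensD(2)[OF V] by (intro exI[of _ U'] conjI bexI[of _ g]) auto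
    qed simp
    show "f \<in> hol ?Y U" if f: "f \<in> extensional U" and loc: "\<forall>p\<in>U. \<exists>V\<in>opens ?Y U. p \<in> V \<and> restrict f V \<in> hol ?Y V"
      unfolding hol_subspace
    proof (intro conjI ballI f)
      fix p assume p: "p \<in> U"
      obtain V where V: "V \<in> opens ?Y U" "p \<in> V" "restrict f V \<in> hol ?Y V" using loc p by blast
      obtain U' g where U': "opX U'" "p \<in> U'" "g \<in> hol X U'" "\<forall>x\<in>U' \<inter> V. restrict f V x = g x"
        using V unfolding hol_subspace by blast
      obtain N where N: "opX N" "V = N \<inter> D" using opensD(1)[OF V(1)] unfolding open_subspace by blast
      have UD: "U \<subseteq> D" using U unfolding open_subspace by blast
      show "\<exists>U'. opX U' \<and> p \<in> U' \<and> (\<exists>g\<in>hol X U'. \<forall>x\<in>U' \<inter> U. f x = g x)"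
      proof (intro exI conjI bexI ballI)
        \<comment> \<open>Cutting down by \<open>N\<close> keeps the points of \<open>U\<close>
          inside \<open>V\<close>, where \<open>g\<close> is known to agree with
          \<open>f\<close>.\<close>
        show "opX (U' \<inter> N)" using U' N by blast
        show "p \<in> U' \<inter> N" using U' V N by blast
        show "restrict g (U' \<inter> N) \<in> hol X (U' \<inter> N)"
          by (rule hol_restrict[OF U'(1) opens_Int(1)[OF U'(1) N(1)] U'(3)])
        show "f x = restrict g (U' \<inter> N) x" if "x \<in> U' \<inter> N \<inter> U" for x
          using that U'(4) UD N(2) by auto
      qed
    qed
  qed
  fix U assume U: "openin (points ?Y) U"
  have top: "p \<in> topspace (points X)" if "p \<in> U" for p
    using that openin_subset[OF U] by (auto simp: points_subspace)
  show "(\<lambda>x\<in>U. c) \<in> hol ?Y U" for c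
    unfolding hol_subspace using top hol_const[OF openin_topspace, of c]
    by (auto intro!: exI[of _ "topspace (points X)"] bexI[of _ "\<lambda>x\<in>topspace (points X). c"])
  fix f g assume f: "f \<in> hol ?Y U" and g: "g \<in> hol ?Y U"
  show "(\<lambda>x\<in>U. f x + g x) \<in> hol ?Y U" unfolding hol_subspace
  proof (intro conjI ballI)
    fix p assume p: "p \<in> U"
    obtain W h k where W: "opX W" "p \<in> W" "h \<in> hol X W" "k \<in> hol X W"
      "\<forall>x\<in>W \<inter> U. f x = h x \<and> g x = k x"
      using subspace_ext2[OF f g p] by blast
    then show "\<exists>W. opX W \<and> p \<in> W \<and> (\<exists>h\<in>hol X W. \<forall>x\<in>W \<inter> U. (\<lambda>x\<in>U. f x + g x) x = h x)"
      using hol_add[OF W(1,3,4)] by (intro exI[of _ W] conjI bexI[of _ "\<lambda>x\<in>W. h x + k x"]) auto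
  qed simp
  show "(\<lambda>x\<in>U. f x * g x) \<in> hol ?Y U" unfolding hol_subspace
  proof (intro conjI ballI)
    fix p assume p: "p \<in> U"
    obtain W h k where W: "opX W" "p \<in> W" "h \<in> hol X W" "k \<in> hol X W"
      "\<forall>x\<in>W \<inter> U. f x = h x \<and> g x = k x"
      using subspace_ext2[OF f g p] by blast
    then show "\<exists>W. opX W \<and> p \<in> W \<and> (\<exists>h\<in>hol X W. \<forall>x\<in>W \<inter> U. (\<lambda>x\<in>U. f x * g x) x = h x)"
      using hol_mult[OF W(1,3,4)] by (intro exI[of _ W] conjI bexI[of _ "\<lambda>x\<in>W. h x * k x"]) auto
  qed simp
qed

locale adapted_chart = mfd_chart X n U \<phi> for X :: "'a cspace" and n U \<phi> +
  fixes D :: "'a set"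
  assumes n_pos: "0 < n" and UD: "U \<inter> D = {x \<in> U. \<phi> x 0 = 0}"
begin

lemma in_D: "x \<in> U \<Longrightarrow> x \<in> D \<longleftrightarrow> \<phi> x 0 = 0"
  using UD by blast

text \<open>The projection of the chart along the coordinate that vanishes on \<open>D\<close>. The
  map \<open>zcons\<close> includes the hyperplane, so coordinate \<open>i\<close> on
  \<open>D\<close> is coordinate \<open>Suc i\<close> on \<open>X\<close>.\<close>

definition tail :: "(nat \<Rightarrow> complex) \<Rightarrow> nat \<Rightarrow> complex" where
  "tail z = (\<lambda>i\<in>{..<n - 1}. z (Suc i))"

definition zcons :: "(nat \<Rightarrow> complex) \<Rightarrow> nat \<Rightarrow> complex" where
  "zcons w = (\<lambda>i\<in>{..<n}. if i = 0 then 0 else w (i - 1))"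

definition \<phi>D :: "'a \<Rightarrow> nat \<Rightarrow> complex" where
  "\<phi>D x = tail (\<phi> x)"

lemma tail_ext: "tail z \<in> extensional {..<n - 1}" by (simp add: tail_def)

lemma tail_zcons: "w \<in> extensional {..<n - 1} \<Longrightarrow> tail (zcons w) = w"
  by (auto simp: tail_def zcons_def extensional_def fun_eq_iff)

lemma zcons_tail: "z \<in> extensional {..<n} \<Longrightarrow> z 0 = 0 \<Longrightarrow> zcons (tail z) = z"
  by (auto simp: tail_def zcons_def extensional_def fun_eq_iff)

lemma zcons_phiD: "x \<in> U \<Longrightarrow> x \<in> D \<Longrightarrow> zcons (\<phi>D x) = \<phi> x"
  unfolding \<phi>D_def using zcons_tail phi_ext in_D by simp

lemma tail_box: "z' \<in> box_Cn n z r \<Longrightarrow> tail z' \<in> box_Cn (n - 1) (tail z) r"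
  by (auto simp: box_Cn_def tail_def)

lemma zcons_box: "w' \<in> box_Cn (n - 1) w r \<Longrightarrow> r > 0 \<Longrightarrow> zcons w' \<in> box_Cn n (zcons w) r"
  by (auto simp: box_Cn_def zcons_def)

lemma inj_phiD: "inj_on \<phi>D (U \<inter> D)"
  using inj by (auto simp: inj_on_def) (metis zcons_phiD)

text \<open>\<open>zcons\<close> carries a polydisc of one dimension less into a polydisc of the
  same radius around a point of the hyperplane, and there the chart of \<open>X\<close> is
  onto.\<close>

lemma open_image_phiD:
  assumes V: "opX V" "V \<subseteq> U"
  shows "openin (Cn (n - 1)) (\<phi>D ` (V \<inter> D))"
  unfolding openin_Cn
proof (intro conjI ballI)
  show "\<phi>D ` (V \<inter> D) \<subseteq> extensional {..<n - 1}" using tail_ext by (auto simp: \<phi>D_def simp del: One_nat_def)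
  fix w assume "w \<in> \<phi>D ` (V \<inter> D)"
  then obtain x where x: "x \<in> V" "x \<in> D" "w = \<phi>D x" by blast
  have xU: "x \<in> U" using x V by blast
  obtain r where r: "r > 0" "box_Cn n (\<phi> x) r \<subseteq> \<phi> ` V"
    using open_image[of V] V x(1) unfolding openin_Cn opens_def by blast
  have "box_Cn (n - 1) w r \<subseteq> \<phi>D ` (V \<inter> D)"
  proof
    fix w' assume w': "w' \<in> box_Cn (n - 1) w r"
    have "zcons w' \<in> box_Cn n (\<phi> x) r" using zcons_box[OF w' r(1)] x zcons_phiD[OF xU x(2)] by simp
    then obtain y where y: "y \<in> V" "zcons w' = \<phi> y" using r by blast
    have "\<phi> y 0 = 0" using y(2)[symmetric] n_pos by (simp add: zcons_def)
    then have "y \<in> D" using in_D y V by blast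
    moreover have "\<phi>D y = w'" unfolding \<phi>D_def y(2)[symmetric] using w' by (simp add: tail_zcons box_Cn_def)
    ultimately show "w' \<in> \<phi>D ` (V \<inter> D)" using y(1) by blast
  qed
  then show "\<exists>r>0. box_Cn (n - 1) w r \<subseteq> \<phi>D ` (V \<inter> D)" using r by blast
qed

lemma open_tail_preimage:
  assumes T: "openin (Cn (n - 1)) T"
  shows "opX {x \<in> U. \<phi>D x \<in> T}"
proof -
  have "openin (Cn n) {z \<in> extensional {..<n}. tail z \<in> T}"
    unfolding openin_Cn
  proof (intro conjI ballI)
    fix z assume z: "z \<in> {z \<in> extensional {..<n}. tail z \<in> T}"
    then obtain r where r: "r > 0" "box_Cn (n - 1) (tail z) r \<subseteq> T" using T unfolding openin_Cn by blast
    then have "box_Cn n z r \<subseteq> {z \<in> extensional {..<n}. tail z \<in> T}"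
      using tail_box by (auto simp: box_Cn_def[of n])
    then show "\<exists>r>0. box_Cn n z r \<subseteq> {z \<in> extensional {..<n}. tail z \<in> T}" using r(1) by blast
  qed blast
  from open_preimage[OF this] show ?thesis
    by (rule back_subst[of "opX"]) (auto simp: \<phi>D_def phi_ext)
qed

lemma psiD: "x \<in> U \<Longrightarrow> x \<in> D \<Longrightarrow> inv_into (U \<inter> D) \<phi>D (\<phi>D x) = x"
  by (rule inv_into_f_f[OF inj_phiD]) simp

text \<open>For the functions: an extension to \<open>X\<close> composed with \<open>zcons\<close>
  is \<open>holo\<close> on the hyperplane; conversely, a \<open>holo\<close> function of the
  coordinates on \<open>D\<close> extends to \<open>X\<close> by composing with \<open>tail\<close>,
  that is, constantly in the coordinate 0.\<close>

lemma chart_D: "chart (subspace_of X D) (n - 1) (U \<inter> D) \<phi>D"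
proof -
  let ?Y = "subspace_of X D"
  have UDsub: "topspace (subtopology (points ?Y) (U \<inter> D)) = U \<inter> D"
    using openin_subset[OF openU] by (auto simp: points_subspace)
  have o: "openin (points ?Y) (U \<inter> D)" using openU unfolding open_subspace by blast
  have o2: "openin (Cn (n - 1)) (\<phi>D ` (U \<inter> D))" by (rule open_image_phiD[OF openU]) simp
  have sub: "\<exists>N. opX N \<and> N \<subseteq> U \<and> V = N \<inter> D" if VU: "openin (points ?Y) V" "V \<subseteq> U" for V
  proof -
    obtain N where N: "opX N \<and> V = N \<inter> D"
      using open_subspace[THEN iffD1, OF VU(1)] by (rule exE)
    have "V = (N \<inter> U) \<inter> D" using N VU(2) by auto
    moreover have "opX (N \<inter> U)" using N openU by (intro openin_Int) auto
    ultimately show ?thesis by (intro exI[of _ "N \<inter> U"]) simp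
  qed
  have "homeomorphic_map (subtopology (points ?Y) (U \<inter> D)) (subtopology (Cn (n - 1)) (\<phi>D ` (U \<inter> D))) \<phi>D"
  proof (rule bijective_open_imp_homeomorphic_map)
    have t: "\<phi>D ` (U \<inter> D) \<subseteq> topspace (Cn (n - 1))" "\<phi>D \<in> U \<inter> D \<rightarrow> \<phi>D ` (U \<inter> D)"
      using tail_ext by (auto simp: topspace_Cn \<phi>D_def simp del: One_nat_def)
    have pre: "openin (subtopology (points ?Y) (U \<inter> D)) {x \<in> U \<inter> D. \<phi>D x \<in> T}" if T: "openin (Cn (n - 1)) T" for T
    proof -
      have "openin (points ?Y) ({x \<in> U. \<phi>D x \<in> T} \<inter> D)" using open_tail_preimage[OF T] unfolding open_subspace by blast
      moreover have "{x \<in> U. \<phi>D x \<in> T} \<inter> D = {x \<in> U \<inter> D. \<phi>D x \<in> T}" by blast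
      ultimately show ?thesis using openin_open_subtopology[OF o] by auto
    qed
    show "continuous_map (subtopology (points ?Y) (U \<inter> D)) (subtopology (Cn (n - 1)) (\<phi>D ` (U \<inter> D))) \<phi>D"
    proof -
      have "continuous_map (subtopology (points ?Y) (U \<inter> D)) (Cn (n - 1)) \<phi>D"
        unfolding continuous_map UDsub by (intro conjI allI impI t(1) pre)
      then show ?thesis by (rule continuous_map_into_subtopology) (simp only: UDsub t(2))
    qed
    show "open_map (subtopology (points ?Y) (U \<inter> D)) (subtopology (Cn (n - 1)) (\<phi>D ` (U \<inter> D))) \<phi>D"
      unfolding open_map_def
    proof (intro allI impI)
      fix V assume "openin (subtopology (points ?Y) (U \<inter> D)) V"
      then have V: "openin (points ?Y) V" "V \<subseteq> U \<inter> D" using openin_open_subtopology[OF o] by auto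
      then obtain N where "opX N" "N \<subseteq> U" "V = N \<inter> D" using sub by blast
      then show "openin (subtopology (Cn (n - 1)) (\<phi>D ` (U \<inter> D))) (\<phi>D ` V)"
        using open_image_phiD openin_open_subtopology[OF o2] V(2) by auto
    qed
    show "\<phi>D ` topspace (subtopology (points ?Y) (U \<inter> D)) = topspace (subtopology (Cn (n - 1)) (\<phi>D ` (U \<inter> D)))"
      unfolding UDsub using openin_subset[OF o2] by auto
    show "inj_on \<phi>D (topspace (subtopology (points ?Y) (U \<inter> D)))" unfolding UDsub by (rule inj_phiD)
  qed
  moreover have "f \<in> hol ?Y V \<longleftrightarrow> (\<forall>z\<in>\<phi>D ` V. complex_differentiable_at (n - 1) (f \<circ> inv_into (U \<inter> D) \<phi>D) z)"
    if V: "V \<in> opens ?Y (U \<inter> D)" and f: "f \<in> extensional V" for V f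
  proof -
    obtain N where N: "opX N" "N \<subseteq> U" "V = N \<inter> D" using sub opensD[OF V] by blast
    have oV: "openin (Cn (n - 1)) (\<phi>D ` V)" unfolding N(3) by (rule open_image_phiD[OF N(1,2)])
    let ?g = "f \<circ> inv_into (U \<inter> D) \<phi>D"
    have "f \<in> hol ?Y V \<longleftrightarrow> holo (n - 1) (\<phi>D ` V) ?g"
    proof
      assume fh: "f \<in> hol ?Y V"
      show "holo (n - 1) (\<phi>D ` V) ?g"
      proof (rule holo_locally[OF oV])
        fix z assume "z \<in> \<phi>D ` V"
        then obtain p where p: "p \<in> V" "z = \<phi>D p" by blast
        obtain W h where W: "opX W" "p \<in> W" "h \<in> hol X W" "\<forall>x\<in>W \<inter> V. f x = h x"
          using fh p(1) unfolding hol_subspace by blast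
        define A where "A = W \<inter> N"
        have A: "A \<in> opens X W" "A \<in> opens X U" "opX A" "A \<subseteq> U" "A \<inter> D \<subseteq> V" "p \<in> A"
          using W N p by (auto simp: A_def opens_def)
        have hA: "holo n (\<phi> ` A) (restrict h A \<circ> \<psi>)" by (rule hol_to[OF A(2) hol_restrict[OF W(1) A(1) W(3)]])
        have oA: "openin (Cn (n - 1)) (\<phi>D ` (A \<inter> D))" by (rule open_image_phiD[OF A(3,4)])
        have h1: "holo (n - 1) (\<phi>D ` (A \<inter> D)) (\<lambda>w. (restrict h A \<circ> \<psi>) (zcons w))"
        proof (rule holo_comp[OF hA open_image[OF A(2)] oA])
          show "zcons w \<in> \<phi> ` A" if "w \<in> \<phi>D ` (A \<inter> D)" for w
            using that A(4) zcons_phiD by auto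
          show "zcons w' \<in> box_Cn n (zcons w) \<delta>" if "\<delta> > 0" "w' \<in> box_Cn (n - 1) w \<delta>" for w w' \<delta>
            using zcons_box that by blast
          show "(\<exists>i<n. \<forall>w\<in>\<phi>D ` (A \<inter> D). zcons w i = w j \<and> (\<forall>\<zeta>. zcons (w(j := \<zeta>)) = (zcons w)(i := \<zeta>))) \<or>
              (\<forall>w\<in>\<phi>D ` (A \<inter> D). \<forall>\<zeta>. zcons (w(j := \<zeta>)) = zcons w)" if "j < n - 1" for j
            using that by (intro disjI1 exI[of _ "Suc j"]) (auto simp: zcons_def fun_eq_iff)
        qed
        have e: "(restrict h A \<circ> \<psi>) (zcons w) = ?g w" if w: "w \<in> \<phi>D ` (A \<inter> D)" for w
        proof -
          obtain x where x: "x \<in> A" "x \<in> D" "w = \<phi>D x" using w by blast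
          have "x \<in> U" "x \<in> W" "x \<in> V" using x A by (auto simp: A_def)
          then show ?thesis using x psiD[OF \<open>x \<in> U\<close> x(2)] zcons_phiD[OF \<open>x \<in> U\<close> x(2)] W(4) by simp
        qed
        have "holo (n - 1) (\<phi>D ` (A \<inter> D)) ?g" by (rule holo_cong[OF oA, THEN iffD1, OF e h1])
        then show "\<exists>T. openin (Cn (n - 1)) T \<and> z \<in> T \<and> holo (n - 1) T ?g"
          using oA p A(6) N(3) by (intro exI[of _ "\<phi>D ` (A \<inter> D)"]) auto
      qed
    next
      assume h: "holo (n - 1) (\<phi>D ` V) ?g"
      define A where "A = {x \<in> U. \<phi>D x \<in> \<phi>D ` V}"
      have A: "opX A" unfolding A_def by (rule open_tail_preimage[OF oV])
      have AU: "A \<in> opens X U" using A by (auto simp: opens_def A_def)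
      have "holo n (\<phi> ` A) (\<lambda>z. ?g (tail z))"
      proof (rule holo_comp[OF h oV open_image[OF AU]])
        show "tail w \<in> \<phi>D ` V" if "w \<in> \<phi> ` A" for w using that by (auto simp: A_def \<phi>D_def)
        show "tail w' \<in> box_Cn (n - 1) (tail w) \<delta>" if "w' \<in> box_Cn n w \<delta>" for w w' \<delta> by (rule tail_box[OF that])
        show "(\<exists>i<n - 1. \<forall>w\<in>\<phi> ` A. tail w i = w j \<and> (\<forall>\<zeta>. tail (w(j := \<zeta>)) = (tail w)(i := \<zeta>))) \<or>
            (\<forall>w\<in>\<phi> ` A. \<forall>\<zeta>. tail (w(j := \<zeta>)) = tail w)" if "j < n" for j
        proof (cases j)
          case 0
          have "tail (w(0 := \<zeta>)) = tail w" for w \<zeta> by (simp add: tail_def)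
          then show ?thesis using 0 by blast
        next
          case (Suc i) then show ?thesis using that by (intro disjI1 exI[of _ i]) (auto simp: tail_def fun_eq_iff)
        qed
      qed
      then have g: "(\<lambda>x\<in>A. ?g (tail (\<phi> x))) \<in> hol X A" by (rule hol_from[OF AU])
      have eq: "f x = (\<lambda>x\<in>A. ?g (tail (\<phi> x))) x" if "x \<in> V" for x
      proof -
        have x: "x \<in> U" "x \<in> D" "x \<in> A" using that N by (auto simp: A_def)
        then show ?thesis using psiD[OF x(1,2)] by (simp add: \<phi>D_def[symmetric])
      qed
      show "f \<in> hol ?Y V" unfolding hol_subspace
      proof (intro conjI ballI f)
        fix p assume "p \<in> V"
        then have "p \<in> A" using N by (auto simp: A_def)
        then show "\<exists>W. opX W \<and> p \<in> W \<and> (\<exists>g\<in>hol X W. \<forall>x\<in>W \<inter> V. f x = g x)"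
          using A eq by (intro exI[of _ A] conjI bexI[OF _ g]) auto
      qed
    qed
    then show ?thesis unfolding holo_iff[OF oV] .
  qed
  ultimately show ?thesis unfolding chart_def using o o2 by blast
qed

end

locale divisor = complex_mfd X for X :: "'a cspace" +
  fixes D :: "'a set"
  assumes sd: "smooth_divisor X D"
begin

abbreviation "Y \<equiv> subspace_of X D"

lemma D_sub: "D \<subseteq> topspace (points X)"
  using sd closedin_subset unfolding smooth_divisor_def by blast

lemma top_Y: "topspace (points Y) = D"
  using D_sub by (auto simp: points_subspace)

lemma adapted_at:
  assumes "p \<in> D"
  obtains n U \<phi> where "p \<in> U" "adapted_chart X n U \<phi> D"
proof -
  have "\<exists>n U \<phi>. 0 < n \<and> p \<in> U \<and> chart X n U \<phi> \<and> U \<inter> D = {x\<in>U. \<phi> x 0 = 0}"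
    using sd assms by (simp add: smooth_divisor_def)
  then obtain n U \<phi> where *: "0 < n" "p \<in> U" "chart X n U \<phi>" "U \<inter> D = {x\<in>U. \<phi> x 0 = 0}" by blast
  have "adapted_chart X n U \<phi> D"
    using * mfd by (intro adapted_chart.intro mfd_chart.intro complex_mfd.intro complex_chart.intro adapted_chart_axioms.intro)
  then show ?thesis using that *(2) by blast
qed

lemma mfd_Y: "complex_manifold Y"
  unfolding complex_manifold_def
proof (intro conjI ballI)
  show "Hausdorff_space (points Y)" "second_countable (points Y)"
    using mfd by (simp_all add: complex_manifold_def points_subspace Hausdorff_space_subtopology second_countable_subtopology)
  show "function_sheaf Y" by (rule ringed_space.fs[OF subspace_ringed])
  fix p assume "p \<in> topspace (points Y)"
  then have p: "p \<in> D" by (simp add: top_Y)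
  obtain n U \<phi> where U: "p \<in> U" "adapted_chart X n U \<phi> D" by (rule adapted_at[OF p])
  show "\<exists>n U \<phi>. p \<in> U \<and> chart Y n U \<phi>" using adapted_chart.chart_D[OF U(2)] U(1) p by blast
qed

lemma cmfd_Y: "complex_mfd Y" by (rule complex_mfd.intro[OF mfd_Y])

end

locale vf_quotient = vf_subsheaf X S for X :: "'a cspace" and S +
  fixes D :: "'a set"
  assumes D_sub': "D \<subseteq> topspace (points X)"

sublocale vf_quotient \<subseteq> germ_quotient X FS "subspace_of X D" D "ideal_times X D FS"
  by (rule germ_quotient_ideal_times[OF points_subspace D_sub' subspace_ringed hol_subspace])

context vf_quotient
begin

text \<open>Each product \<open>h s\<close> with \<open>h\<close> in \<open>I\<^sub>D\<close> has
  value 0 on \<open>D\<close>. Hence the values of a field at points of \<open>D\<close> depend only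
  on its class, as \<open>lft_values\<close> says.\<close>

lemma ideal_times_kills:
  assumes W: "opX W" and x: "x \<in> ideal_times X D FS W"
    and V: "V \<in> opens X W" and f: "f \<in> hol X V" and q: "q \<in> V" "q \<in> D"
  shows "x V f q = 0"
  using W x
proof (induction rule: ideal_times_induct)
  case zero then show ?case by (simp add: op_simps vzero_apply[OF V f q(1)])
next
  case (step x h s)
  have "h q = 0" using step(3) q opens_mem[OF V] by (auto simp: ideal_sheaf_def)
  then show ?case using step(5) by (simp add: op_simps vplus_apply[OF V f q(1)] vscale_apply[OF V f q(1)])
qed

lemma grel_values:
  assumes U: "opX U" "opX U'" and u: "u \<in> S U" "u' \<in> S U'"
    and r: "grel U u U' u' q" and V: "V \<in> opens X (U \<inter> U')" and f: "f \<in> hol X V" and q: "q \<in> V" "q \<in> D"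
  shows "u V f q = u' V f q"
proof -
  obtain W where W: "W \<in> opens X (U \<inter> U')" "q \<in> W"
    "restrict u (opens X W) \<ominus>\<^bsub>sect FS W\<^esub> restrict u' (opens X W) \<in> ideal_times X D FS W"
    using r unfolding grel_def op_simps by blast
  define A where "A = V \<inter> W"
  have o: "opX V" "opX W" using V W(1) opensD(1) by auto
  have A: "A \<in> opens X V" "A \<in> opens X W" "q \<in> A" unfolding A_def using opens_Int[OF o] q W(2) by auto
  have VU: "V \<in> opens X U" "V \<in> opens X U'" "W \<in> opens X U" "W \<in> opens X U'" using V W(1) by (auto simp: opens_def)
  have fA: "restrict f A \<in> hol X A" by (rule hol_restrict[OF o(1) A(1) f])
  have "(restrict u (opens X W) \<ominus>\<^bsub>sect FS W\<^esub> restrict u' (opens X W)) A (restrict f A) q = 0"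
    by (rule ideal_times_kills[OF o(2) W(3) A(2) fA A(3) q(2)])
  then have "u A (restrict f A) q = u' A (restrict f A) q"
    using minus_apply[OF o(2) S_res[OF U(1) VU(3) u(1)] S_res[OF U(2) VU(4) u(2)] A(2) fA A(3)] A(2) by simp
  then show ?thesis
    using vf_res[OF S_vf[OF U(1) u(1)] VU(1) f A(1,3)] vf_res[OF S_vf[OF U(2) u(2)] VU(2) f A(1,3)] by simp
qed

lemma lft_values:
  assumes "lft V t U u" "lft V t U' u'" and W: "W \<in> opens X (U \<inter> U')" and f: "f \<in> hol X W" and q: "q \<in> W" "q \<in> D"
  shows "u W f q = u' W f q"
proof (rule grel_values[OF _ _ _ _ _ W f q])
  show "grel U u U' u' q" by (rule lft_unique[OF assms(1,2)]) (use opens_mem[OF W q(1)] q in auto)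
qed (use lftD[OF assms(1)] lftD[OF assms(2)] in \<open>auto simp: op_simps\<close>)

end

context divisor
begin

lemma vfq_T: "vf_quotient X (VX) D"
  by (intro vf_quotient.intro vf_subsheaf_vf vf_quotient_axioms.intro D_sub)

lemma vfq_L: "vf_quotient X (log_fields X D) D"
  by (intro vf_quotient.intro vf_subsheaf_log vf_quotient_axioms.intro D_sub)

end

sublocale divisor \<subseteq> T: vf_quotient X "vector_fields X" D by (rule vfq_T)
sublocale divisor \<subseteq> L: vf_quotient X "log_fields X D" D by (rule vfq_L)
sublocale divisor \<subseteq> Y: complex_mfd "subspace_of X D" by (rule cmfd_Y)

context divisor
begin
lemma log_restriction_eq: "log_restriction X D = L.Q"
  by (simp add: log_restriction_def restrict_sheaf_def log_tangent_sheaf_eq)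
lemma T_restrict_eq: "restrict_sheaf X D (tangent_sheaf X) = T.Q"
  by (simp add: tangent_sheaf_def restrict_sheaf_def)
end

section \<open>The algebroid of a divisor\<close>

context divisor
begin

abbreviation "opY \<equiv> openin (points Y)"
abbreviation "VY \<equiv> vector_fields Y"
abbreviation "LogX \<equiv> log_fields X D"
abbreviation "\<Gamma>L \<equiv> sections L.Q"

lemmas logvf = log_vf[where D = D]

lemma open_Y: "opY V \<longleftrightarrow> (\<exists>U. opX U \<and> V = U \<inter> D)"
  by (rule open_subspace)

lemma opens_Y_Int: "opX W \<Longrightarrow> W \<inter> D \<subseteq> V \<Longrightarrow> W \<inter> D \<in> opens Y V"
  using L.openY_Int by (simp add: opens_def)

text \<open>The difference of the two functions lies in \<open>I\<^sub>D\<close> near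
  \<open>q\<close> and \<open>u\<close> preserves \<open>I\<^sub>D\<close>. So a tangent field acts
  on functions on \<open>D\<close>.\<close>

lemma log_agree:
  assumes u: "u \<in> LogX U" and W: "W \<in> opens X U" "W' \<in> opens X U"
    and h: "h \<in> hol X W" "h' \<in> hol X W'" and q: "q \<in> W" "q \<in> W'" "q \<in> D"
    and N: "opX N" "q \<in> N" and eq: "\<And>x. x \<in> N \<Longrightarrow> x \<in> W \<Longrightarrow> x \<in> W' \<Longrightarrow> x \<in> D \<Longrightarrow> h x = h' x"
  shows "u W h q = u W' h' q"
proof -
  note v = logvf[OF u]
  note o = opensD(1)[OF W(1)] opensD(1)[OF W(2)]
  define A where "A = W \<inter> W' \<inter> N"
  have A: "A \<in> opens X W" "A \<in> opens X W'" "A \<in> opens X U" "q \<in> A"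
    using W N q by (auto simp: A_def opens_def)
  note r = hol_restrict[OF o(1) A(1) h(1)] hol_restrict[OF o(2) A(2) h(2)]
  have "u A (\<lambda>x\<in>A. restrict h A x - restrict h' A x) q = 0"
    by (rule logD[OF u A(3) hol_diff[OF opensD(1)[OF A(3)] r] _ A(4) q(3)]) (use eq in \<open>auto simp: A_def\<close>)
  then have "u A (restrict h A) q = u A (restrict h' A) q" using vf_diff[OF v A(3) r A(4)] by simp
  then show ?thesis using vf_res[OF v W(1) h(1) A(1,4)] vf_res[OF v W(2) h(2) A(2,4)] by simp
qed

text \<open>Frees \<open>restricts_to\<close> from domains of the form \<open>W \<inter> D\<close>:
  by locality of derivations it is enough that \<open>h\<close> and \<open>f\<close> agree on the
  overlap.\<close>

lemma restricts_toD:
  assumes r: "restricts_to X D U u w" and w: "w \<in> VY V" and UV: "U \<inter> D \<subseteq> V"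
    and W: "W \<in> opens X U" and h: "h \<in> hol X W" and V': "V' \<in> opens Y V" and f: "f \<in> hol Y V'"
    and q: "q \<in> W" "q \<in> V'" and eq: "\<And>x. x \<in> W \<Longrightarrow> x \<in> V' \<Longrightarrow> f x = h x"
  shows "w V' f q = u W h q"
proof -
  have qD: "q \<in> D" using q(2) opensD(1)[OF V'] L.openY_sub by blast
  have e: "restrict (u W h) (W \<inter> D) = w (W \<inter> D) (restrict h (W \<inter> D))"
    using r W h unfolding restricts_to_def by blast
  have WD: "W \<inter> D \<in> opens Y V" by (rule opens_Y_Int[OF opensD(1)[OF W]]) (use UV opensD(2)[OF W] in blast)
  have "w V' f q = w (W \<inter> D) (restrict h (W \<inter> D)) q"
  proof (rule Y.vf_local[OF w V' WD f L.hol_restrict_Y[OF opensD(1)[OF W] h]])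
    show "opY (V' \<inter> (W \<inter> D))" using opensD(1)[OF V'] opensD(1)[OF WD] by blast
  qed (use q qD eq in auto)
  then show ?thesis using fun_cong[OF e, of q] q qD by simp
qed

lemma descend:
  fixes P :: "'a set \<Rightarrow> 'a vfield \<Rightarrow> bool"
  assumes V: "opY V"
    and cover: "\<And>p. p \<in> V \<Longrightarrow> \<exists>U u. P U u \<and> p \<in> U"
    and P: "\<And>U u. P U u \<Longrightarrow> opX U \<and> U \<inter> D \<subseteq> V \<and> u \<in> LogX U"
    and cons: "\<And>U u U' u' W f q. P U u \<Longrightarrow> P U' u' \<Longrightarrow> W \<in> opens X (U \<inter> U') \<Longrightarrow> f \<in> hol X W \<Longrightarrow> q \<in> W \<Longrightarrow> q \<in> D \<Longrightarrow>
        u W f q = u' W f q"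
  shows "\<exists>w\<in>VY V. \<forall>U u. P U u \<longrightarrow> restricts_to X D U u w"
proof -
  have Plog: "u \<in> VX U" if "P U u" for U u using P[OF that] logvf by blast
  \<comment> \<open>The number \<open>y\<close> is a value of \<open>w(f)\<close> at
    \<open>q\<close> as computed from some representative field and some local extension of
    \<open>f\<close>. Uniqueness combines \<open>cons\<close>, which changes the field, with
    \<open>log_agree\<close>, which changes the extension.\<close>
  define C where "C = (\<lambda>V' f q y. \<exists>U u W h. P U u \<and> q \<in> W \<and> W \<subseteq> U \<and> L.ext_to V' f W h \<and> y = u W h q)"
  have C_unique: "y = y'" if c: "C V' f q y" "C V' f q y'" and qD: "q \<in> D" for V' f q y y'
  proof -
    obtain U u W h where 1: "P U u" "q \<in> W" "W \<subseteq> U" "L.ext_to V' f W h" "y = u W h q" using c(1) unfolding C_def by blast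
    obtain U' u' W' h' where 2: "P U' u'" "q \<in> W'" "W' \<subseteq> U'" "L.ext_to V' f W' h'" "y' = u' W' h' q" using c(2) unfolding C_def by blast
    note e = L.ext_toD[OF 1(4)] L.ext_toD[OF 2(4)]
    have o: "W \<inter> W' \<in> opens X W" "W \<inter> W' \<in> opens X W'" using opens_Int[OF e(1) e(5)] .
    have o': "W \<in> opens X U" "W' \<in> opens X U'" "W \<inter> W' \<in> opens X (U \<inter> U')" "W \<inter> W' \<in> opens X U'"
      using e(1,5) 1(3) 2(3) by (auto simp: opens_def)
    have r: "restrict h (W \<inter> W') \<in> hol X (W \<inter> W')" by (rule hol_restrict[OF e(1) o(1) e(3)])
    have "y = u (W \<inter> W') (restrict h (W \<inter> W')) q"
      using vf_res[OF Plog[OF 1(1)] o'(1) e(3) o(1)] 1(2,5) 2(2) by simp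
    also have "\<dots> = u' (W \<inter> W') (restrict h (W \<inter> W')) q" by (rule cons[OF 1(1) 2(1) o'(3) r]) (use 1 2 qD in auto)
    also have "\<dots> = u' W' h' q"
    proof (rule log_agree[OF _ o'(4,2) r e(7) _ 2(2) qD e(5) 2(2)])
      show "restrict h (W \<inter> W') x = h' x" if "x \<in> W \<inter> W'" "x \<in> D" for x using e(4)[of x] e(8)[of x] that by simp
    qed (use P[OF 2(1)] 1 2 in auto)
    finally show ?thesis using 2(5) by simp
  qed
  have C_ex: "\<exists>y. C V' f q y" if V': "V' \<in> opens Y V" and f: "f \<in> hol Y V'" and q: "q \<in> V'" for V' f q
  proof -
    obtain U u where U: "P U u" "q \<in> U" using cover opens_mem[OF V' q] by blast
    obtain W h where "q \<in> W" "W \<subseteq> U" "L.ext_to V' f W h"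
      using L.ex_ext[OF f opensD(1)[OF V'] q _ U(2)] P[OF U(1)] by blast
    then show ?thesis unfolding C_def using U(1) by blast
  qed
  define w :: "'a vfield" where "w = (\<lambda>V'\<in>opens Y V. \<lambda>f\<in>hol Y V'. \<lambda>q\<in>V'. THE y. C V' f q y)"
  have wC: "w V' f q = y" if V': "V' \<in> opens Y V" and f: "f \<in> hol Y V'" and q: "q \<in> V'" and c: "C V' f q y" for V' f q y
  proof -
    have qD: "q \<in> D" using q L.openY_sub[OF opensD(1)[OF V']] by blast
    have "(THE y. C V' f q y) = y" using c C_unique[OF _ c qD] by (intro the_equality)
    then show ?thesis using V' f q by (simp add: w_def)
  qed
  have key: "w V' f q = u W h q" if U: "P U u" and q: "q \<in> W" "q \<in> D" and W: "W \<in> opens X U"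
    and h: "h \<in> hol X W" and V': "V' \<in> opens Y V" and f: "f \<in> hol Y V'" and qV: "q \<in> V'"
    and eq: "\<And>x. x \<in> W \<Longrightarrow> x \<in> V' \<Longrightarrow> f x = h x" for U u q W h V' f
  proof -
    obtain N where N: "opX N" "V' = N \<inter> D" using opensD(1)[OF V'] unfolding open_Y by blast
    define A where "A = W \<inter> N"
    have A: "A \<in> opens X W" "A \<subseteq> U" "q \<in> A" "A \<inter> D \<subseteq> V'" using opens_Int(1)[OF opensD(1)[OF W] N(1)] opensD(2)[OF W] q qV N by (auto simp: A_def)
    have "L.ext_to V' f A (restrict h A)" unfolding L.ext_to_def
      using A opensD[OF A(1)] hol_restrict[OF opensD(1)[OF W] A(1) h] eq by auto
    then have "C V' f q (u A (restrict h A) q)" unfolding C_def using U A by blast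
    from wC[OF V' f qV this] show ?thesis using vf_res[OF Plog[OF U] W h A(1,3)] by simp
  qed
  have loc: "\<exists>U u W h. P U u \<and> q \<in> W \<and> W \<in> opens X U \<and> L.ext_to V' f W h"
    if V': "V' \<in> opens Y V" and f: "f \<in> hol Y V'" and q: "q \<in> V'" for V' f q
  proof -
    obtain U u where U: "P U u" "q \<in> U" using cover opens_mem[OF V' q] by blast
    obtain W h where "q \<in> W" "W \<subseteq> U" "L.ext_to V' f W h"
      using L.ex_ext[OF f opensD(1)[OF V'] q _ U(2)] P[OF U(1)] by metis
    then have W: "q \<in> W" "W \<subseteq> U" "L.ext_to V' f W h" by auto
    have "W \<in> opens X U" using L.ext_toD(1)[OF W(3)] W(2) by (simp add: opens_def)
    then show ?thesis using U(1) W by blast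
  qed
  have key': "w V' f x = u W h x" if U: "P U u" and W: "W \<in> opens X U" and e: "L.ext_to V' f W h"
    and V': "V' \<in> opens Y V" and f: "f \<in> hol Y V'" and x: "x \<in> W" "x \<in> D" for U u W h V' f x
  proof (rule key[OF U x W L.ext_toD(3)[OF e] V' f])
    show "x \<in> V'" using L.ext_toD(2)[OF e] x by blast
    show "f y = h y" if "y \<in> W" "y \<in> V'" for y
      using L.ext_toD(4)[OF e that(1)] that(2) L.openY_sub[OF opensD(1)[OF V']] by blast
  qed
  have w_hol: "w V' f \<in> hol Y V'" if V': "V' \<in> opens Y V" and f: "f \<in> hol Y V'" for V' f
  proof (rule L.holY_I[OF opensD(1)[OF V']])
    show "w V' f \<in> extensional V'" using V' f by (simp add: w_def)
    fix q assume q: "q \<in> V'"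
    obtain U u W h where U: "P U u" "q \<in> W" "W \<in> opens X U" "L.ext_to V' f W h" using loc[OF V' f q] by blast
    have "L.ext_to V' (w V' f) W (u W h)" unfolding L.ext_to_def
      using L.ext_toD[OF U(4)] vf_hol[OF Plog[OF U(1)] U(3) L.ext_toD(3)[OF U(4)]] key'[OF U(1,3,4) V' f] by auto
    then show "\<exists>W h. q \<in> W \<and> L.ext_to V' (w V' f) W h" using U(2) by blast
  qed
  have "w \<in> VY V"
  proof (rule Y.vfI[OF _ _ w_hol])
    show "w \<in> extensional (opens Y V)" by (simp add: w_def)
    fix V' assume V': "V' \<in> opens Y V"
    note oV' = opensD(1)[OF V']
    show "w V' \<in> extensional (hol Y V')" using V' by (simp add: w_def)
    fix f assume f: "f \<in> hol Y V'"
    show "w V' (\<lambda>x\<in>V'. c * f x) q = c * w V' f q" if q: "q \<in> V'" for c q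
    proof -
      obtain U u W h where U: "P U u" "q \<in> W" "W \<in> opens X U" "L.ext_to V' f W h" using loc[OF V' f q] by blast
      have u: "u \<in> VX U" using P[OF U(1)] logvf by blast
      have qD: "q \<in> D" using q L.openY_sub[OF oV'] by blast
      note e = L.ext_toD[OF U(4)]
      have "L.ext_to V' (\<lambda>x\<in>V'. c * f x) W (\<lambda>x\<in>W. c * h x)" unfolding L.ext_to_def using e hol_scale[OF e(1,3)] by auto
      from key'[OF U(1,3) this V' Y.hol_scale[OF oV' f] U(2) qD] key'[OF U(1,3,4) V' f U(2) qD]
      show ?thesis using vf_scale[OF u U(3) e(3) U(2)] by simp
    qed
    show "w V' f q = w V'' (restrict f V'') q" if V'': "V'' \<in> opens Y V'" and q: "q \<in> V''" for V'' q
    proof -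
      have qV: "q \<in> V'" using opens_mem[OF V'' q] .
      obtain U u W h where U: "P U u" "q \<in> W" "W \<in> opens X U" "L.ext_to V' f W h" using loc[OF V' f qV] by blast
      have qD: "q \<in> D" using q L.openY_sub[OF opensD(1)[OF V'']] by blast
      note e = L.ext_toD[OF U(4)]
      show ?thesis unfolding key'[OF U(1,3,4) V' f U(2) qD]
        by (rule key[symmetric, OF U(1,2) qD U(3) e(3) opens_trans[OF V'' V'] Y.hol_restrict[OF oV' V'' f] q])
          (use e(4) L.openY_sub[OF opensD(1)[OF V'']] in auto)
    qed
    fix g assume g: "g \<in> hol Y V'"
    have common: "\<exists>U u W h k. P U u \<and> u \<in> VX U \<and> q \<in> W \<and> W \<in> opens X U \<and> L.ext_to V' f W h \<and> L.ext_to V' g W k"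
      if q: "q \<in> V'" for q
    proof -
      obtain U u W h where U: "P U u" "q \<in> W" "W \<in> opens X U" "L.ext_to V' f W h" using loc[OF V' f q] by blast
      obtain W' k where W': "q \<in> W'" "W' \<subseteq> W" "L.ext_to V' g W' k" using L.ex_ext[OF g oV' q opensD(1)[OF U(3)] U(2)] by blast
      have o: "W' \<in> opens X W" using W' L.ext_toD(1) by (auto simp: opens_def)
      show ?thesis using U(1) W' L.ext_to_res[OF U(4) o] opens_trans[OF o U(3)] P[OF U(1)] logvf by blast
    qed
    show "w V' (\<lambda>x\<in>V'. f x + g x) q = w V' f q + w V' g q" if q: "q \<in> V'" for q
    proof -
      obtain U u W h k where U: "P U u" "u \<in> VX U" "q \<in> W" "W \<in> opens X U" "L.ext_to V' f W h" "L.ext_to V' g W k"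
        using common[OF q] by blast
      have qD: "q \<in> D" using q L.openY_sub[OF oV'] by blast
      show ?thesis using key'[OF U(1,4) L.ext_to_add[OF U(5,6)] V' Y.hol_add[OF oV' f g] U(3) qD]
        key'[OF U(1,4,5) V' f U(3) qD] key'[OF U(1,4,6) V' g U(3) qD]
        vf_add[OF U(2,4) L.ext_toD(3)[OF U(5)] L.ext_toD(3)[OF U(6)] U(3)] by simp
    qed
    show "w V' (\<lambda>x\<in>V'. f x * g x) q = f q * w V' g q + w V' f q * g q" if q: "q \<in> V'" for q
    proof -
      obtain U u W h k where U: "P U u" "u \<in> VX U" "q \<in> W" "W \<in> opens X U" "L.ext_to V' f W h" "L.ext_to V' g W k"
        using common[OF q] by blast
      have qD: "q \<in> D" using q L.openY_sub[OF oV'] by blast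
      show ?thesis using key'[OF U(1,4) L.ext_to_mult[OF U(5,6)] V' Y.hol_mult[OF oV' f g] U(3) qD]
        key'[OF U(1,4,5) V' f U(3) qD] key'[OF U(1,4,6) V' g U(3) qD]
        vf_mult[OF U(2,4) L.ext_toD(3)[OF U(5)] L.ext_toD(3)[OF U(6)] U(3)]
        L.ext_toD(4)[OF U(5,3) qD] L.ext_toD(4)[OF U(6,3) qD] by simp
    qed
  qed
  moreover have "restricts_to X D U u w" if U: "P U u" for U u
    unfolding restricts_to_def
  proof (intro ballI)
    fix W h assume W: "W \<in> opens X U" and h: "h \<in> hol X W"
    note o = opensD(1)[OF W]
    have WD: "W \<inter> D \<in> opens Y V" by (rule opens_Y_Int[OF o]) (use P[OF U] opensD(2)[OF W] in blast)
    have rh: "restrict h (W \<inter> D) \<in> hol Y (W \<inter> D)" by (rule L.hol_restrict_Y[OF o h])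
    show "restrict (u W h) (W \<inter> D) = w (W \<inter> D) (restrict h (W \<inter> D))"
    proof (rule extensionalityI[of _ "W \<inter> D"])
      show "w (W \<inter> D) (restrict h (W \<inter> D)) \<in> extensional (W \<inter> D)"
        by (rule Y.hol_ext[OF opensD(1)[OF WD] w_hol[OF WD rh]])
      fix q assume q: "q \<in> W \<inter> D"
      have "w (W \<inter> D) (restrict h (W \<inter> D)) q = u W h q"
        by (rule key[OF U _ _ W h WD rh q]) (use q in auto)
      then show "restrict (u W h) (W \<inter> D) q = w (W \<inter> D) (restrict h (W \<inter> D)) q" using q by simp
    qed simp
  qed
  ultimately show ?thesis by blast
qed

section \<open>The anchor\<close>

definition rho :: "'a set \<Rightarrow> ('a, 'a vfield) qsection \<Rightarrow> 'a vfield" where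
  "rho V t = (SOME w. w \<in> VY V \<and> (\<forall>U u. L.lft V t U u \<longrightarrow> restricts_to X D U u w))"

lemma lft_log: "L.lft V t U u \<Longrightarrow> u \<in> LogX U"
  using L.lftD(3) by (simp add: op_simps)

lemma top_at: "opY V \<Longrightarrow> p \<in> V \<Longrightarrow> p \<in> topspace (points X)"
  using L.openY_sub D_sub by blast

lemma L_lft: "t \<in> \<Gamma>L V \<Longrightarrow> opY V \<Longrightarrow> p \<in> V \<Longrightarrow> \<exists>U u. L.lft V t U u \<and> p \<in> U"
  using L.ex_lft[OF _ _ _ openin_topspace] top_at by meson

lemma rho_spec:
  assumes V: "opY V" and t: "t \<in> \<Gamma>L V"
  shows "rho V t \<in> VY V" "\<And>U u. L.lft V t U u \<Longrightarrow> restricts_to X D U u (rho V t)"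
proof -
  have "\<exists>w\<in>VY V. \<forall>U u. L.lft V t U u \<longrightarrow> restricts_to X D U u w"
  proof (rule descend[where P = "L.lft V t", OF V])
    show "u W f q = u' W f q" if "L.lft V t U u" "L.lft V t U' u'" "W \<in> opens X (U \<inter> U')" "f \<in> hol X W" "q \<in> W" "q \<in> D"
      for U u U' u' W f q by (rule L.lft_values[OF that])
    show "\<exists>U u. L.lft V t U u \<and> p \<in> U" if "p \<in> V" for p by (rule L_lft[OF t V that])
    fix U u assume l: "L.lft V t U u"
    show "opX U \<and> U \<inter> D \<subseteq> V \<and> u \<in> LogX U"
      using L.lftD(1,2)[OF l] lft_log[OF l] by blast
  qed
  then have "\<exists>w. w \<in> VY V \<and> (\<forall>U u. L.lft V t U u \<longrightarrow> restricts_to X D U u w)" by blast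
  from someI_ex[OF this] show "rho V t \<in> VY V" "\<And>U u. L.lft V t U u \<Longrightarrow> restricts_to X D U u (rho V t)"
    unfolding rho_def[symmetric] by blast+
qed

lemma rho_value:
  assumes V: "opY V" and t: "t \<in> \<Gamma>L V" and l: "L.lft V t U u"
    and V': "V' \<in> opens Y V" and f: "f \<in> hol Y V'" and e: "L.ext_to V' f W h" and W: "W \<in> opens X U" and q: "q \<in> W" "q \<in> D"
  shows "rho V t V' f q = u W h q"
proof (rule restricts_toD[OF rho_spec(2)[OF V t l] rho_spec(1)[OF V t] L.lftD(2)[OF l] W L.ext_toD(3)[OF e] V' f q(1)])
  show "q \<in> V'" using L.ext_toD(2)[OF e] q by blast
  show "f x = h x" if "x \<in> W" "x \<in> V'" for x using L.ext_toD(4)[OF e that(1)] that(2) L.openY_sub[OF opensD(1)[OF V']] by blast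
qed

lemma ex_lft_ext_at:
  assumes t: "t \<in> \<Gamma>L V" and V: "opY V" and V': "V' \<in> opens Y V" and f: "f \<in> hol Y V'" and q: "q \<in> V'"
  shows "\<exists>U u h. L.lft V t U u \<and> L.ext_to V' f U h \<and> q \<in> U \<and> q \<in> D \<and> U \<in> opens X U"
proof -
  obtain U u where U: "L.lft V t U u" "q \<in> U" using L_lft[OF t V opens_mem[OF V' q]] by blast
  obtain W h where W: "q \<in> W" "W \<subseteq> U" "L.ext_to V' f W h" using L.ex_ext[OF f opensD(1)[OF V'] q L.lftD(1)[OF U(1)] U(2)] by blast
  have o: "W \<in> opens X U" "W \<in> opens X W" using L.ext_toD(1)[OF W(3)] W(2) by (auto simp: opens_def)
  show ?thesis using L.lft_res[OF U(1) o(1)] W(1,3) o(2) q L.openY_sub[OF opensD(1)[OF V']] by blast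
qed

lemma anchor_rho: "anchor_by_restriction X D rho"
  unfolding anchor_by_restriction_def log_tangent_sheaf_eq op_simps
proof (intro allI impI ballI)
  fix U u assume U: "opX U" and u: "u \<in> LogX U"
  have u': "u \<in> sections L.FS U" using u by (simp add: op_simps)
  have "L.lft (U \<inter> D) (L.cls U u) U u" by (rule L.lft_cls[OF U u'])
  then show "restricts_to X D U u (rho (U \<inter> D) (restrict_section X D (operator_sheaf X (structure_sheaf X) (LogX)) U u))"
    using rho_spec(2)[OF L.openY_Int[OF U] L.cls_section[OF U u']] by (simp add: restrict_section_def L.cls_def)
qed

lemma ts_simps: "sections (tangent_sheaf Z) U = vector_fields Z U"
  "v \<oplus>\<^bsub>sect (tangent_sheaf Z) U\<^esub> w = vplus Z U v w" "h \<odot>\<^bsub>sect (tangent_sheaf Z) U\<^esub> v = vscale Z U h v"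
  "res (tangent_sheaf Z) U V v = restrict v (opens Z V)"
  by (simp_all add: tangent_sheaf_def op_simps)

lemma rho_hom: "sheaf_hom Y L.Q (tangent_sheaf Y) rho"
  unfolding sheaf_hom_def ts_simps L.Q_ops(4)
proof (intro allI impI conjI ballI)
  fix V assume V: "opY V"
  note rv = rho_spec(1)[OF V]
  fix t assume t: "t \<in> \<Gamma>L V"
  show "rho V t \<in> VY V" by (rule rv[OF t])
  show "rho V (t \<oplus>\<^bsub>sect L.Q V\<^esub> t') = vplus Y V (rho V t) (rho V t')" if t': "t' \<in> \<Gamma>L V" for t'
  proof (rule Y.vf_eqI[OF rv[OF L.Q_add_closed[OF V t t']] Y.vplus_vf[OF rv[OF t] rv[OF t']]])
    fix V' f q assume V': "V' \<in> opens Y V" and f: "f \<in> hol Y V'" and q: "q \<in> V'"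
    obtain U u where U: "L.lft V t' U u" "q \<in> U" using L_lft[OF t' V opens_mem[OF V' q]] by blast
    obtain U' u' h where U': "L.lft V t U' u'" "L.ext_to V' f U' h" "q \<in> U'" "q \<in> D" "U' \<in> opens X U'"
      using ex_lft_ext_at[OF t V V' f q] by blast
    define W where "W = U \<inter> U'"
    have W: "W \<in> opens X U" "W \<in> opens X U'" "W \<in> opens X W" "q \<in> W"
      using L.lftD(1)[OF U(1)] L.lftD(1)[OF U'(1)] U(2) U'(3) by (auto simp: W_def opens_def)
    note a = L.lft_res[OF U(1) W(1)] and b = L.lft_res[OF U'(1) W(2)] and e = L.ext_to_res[OF U'(2) W(2)]
    show "rho V (t \<oplus>\<^bsub>sect L.Q V\<^esub> t') V' f q = vplus Y V (rho V t) (rho V t') V' f q"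
      using rho_value[OF V t b V' f e W(3,4) U'(4)] rho_value[OF V t' a V' f e W(3,4) U'(4)]
        rho_value[OF V L.Q_add_closed[OF V t t'] L.lft_add[OF b a] V' f e W(3,4) U'(4)]
      by (simp add: vplus_apply[OF V' f q] op_simps vplus_apply[OF W(3) L.ext_toD(3)[OF e] W(4)])
  qed
  show "rho V (g \<odot>\<^bsub>sect L.Q V\<^esub> t) = vscale Y V g (rho V t)" if g: "g \<in> hol Y V" for g
  proof (rule Y.vf_eqI[OF rv[OF L.Q_smult_closed[OF V t g]] Y.vscale_vf[OF V g rv[OF t]]])
    fix V' f q assume V': "V' \<in> opens Y V" and f: "f \<in> hol Y V'" and q: "q \<in> V'"
    obtain U u h where U: "L.lft V t U u" "L.ext_to V' f U h" "q \<in> U" "q \<in> D" "U \<in> opens X U"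
      using ex_lft_ext_at[OF t V V' f q] by blast
    obtain W k where W: "q \<in> W" "W \<subseteq> U" "L.ext_to V g W k"
      using L.ex_ext[OF g V opens_mem[OF V' q] L.lftD(1)[OF U(1)] U(3)] by blast
    have o: "W \<in> opens X U" "W \<in> opens X W" using L.ext_toD(1)[OF W(3)] W(2) by (auto simp: opens_def)
    note a = L.lft_res[OF U(1) o(1)] and e = L.ext_to_res[OF U(2) o(1)]
    show "rho V (g \<odot>\<^bsub>sect L.Q V\<^esub> t) V' f q = vscale Y V g (rho V t) V' f q"
      using rho_value[OF V t a V' f e o(2) W(1) U(4)]
        rho_value[OF V L.Q_smult_closed[OF V t g] L.lft_smult[OF a W(3) V] V' f e o(2) W(1) U(4)] L.ext_toD(4)[OF W(3,1) U(4)]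
      by (simp add: vscale_apply[OF V' f q] op_simps vscale_apply[OF o(2) L.ext_toD(3)[OF e] W(1)])
  qed
  show "restrict (rho V t) (opens Y V1) = rho V1 (restrict t V1)" if V1: "V1 \<in> opens Y V" for V1
  proof (rule Y.vf_eqI[OF Y.vres_vf[OF rv[OF t] V1] rho_spec(1)[OF opensD(1)[OF V1] L.Q_restrict_closed[OF V V1 t]]])
    fix V' f q assume V': "V' \<in> opens Y V1" and f: "f \<in> hol Y V'" and q: "q \<in> V'"
    note VV = opens_trans[OF V' V1]
    obtain U u h where U: "L.lft V t U u" "L.ext_to V' f U h" "q \<in> U" "q \<in> D" "U \<in> opens X U"
      using ex_lft_ext_at[OF t V VV f q] by blast
    have "U \<inter> D \<subseteq> V1" using L.ext_toD(2)[OF U(2)] opensD(2)[OF V'] by blast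
    from L.lft_restrict[OF U(1) this]
    show "restrict (rho V t) (opens Y V1) V' f q = rho V1 (restrict t V1) V' f q"
      using rho_value[OF V t U(1) VV f U(2,5,3,4)]
        rho_value[OF opensD(1)[OF V1] L.Q_restrict_closed[OF V V1 t] _ V' f U(2,5,3,4)] V' by simp
  qed
qed

end

section \<open>Identities for brackets of vector fields\<close>

context ringed_space
begin

lemma vplus_fun: "V \<in> opens X U \<Longrightarrow> f \<in> hol X V \<Longrightarrow> vplus X U v w V f = (\<lambda>x\<in>V. v V f x + w V f x)"
  by (simp add: vplus_def)

lemma vscale_fun: "V \<in> opens X U \<Longrightarrow> f \<in> hol X V \<Longrightarrow> vscale X U h v V f = (\<lambda>x\<in>V. restrict h V x * v V f x)"
  by (simp add: vscale_def)

lemma bracket_fun: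
  assumes "v \<in> VX U" "w \<in> VX U" "V \<in> opens X U" "f \<in> hol X V"
  shows "brk U v w V f = (\<lambda>x\<in>V. v V (w V f) x - w V (v V f) x)"
  using structure_sheaf_minus[OF opensD(1)[OF assms(3)] vf_hol[OF assms(1,3) vf_hol[OF assms(2,3,4)]] vf_hol[OF assms(2,3) vf_hol[OF assms(1,3,4)]]] assms(3,4)
  by (simp add: commutator_def)

lemma bracket_add_left:
  assumes a: "a \<in> VX U" and b: "b \<in> VX U" and v: "v \<in> VX U"
  shows "brk U (vplus X U a b) v = vplus X U (brk U a v) (brk U b v)"
proof (rule vf_eqI[OF bracket_vf[OF vplus_vf[OF a b] v] vplus_vf[OF bracket_vf[OF a v] bracket_vf[OF b v]]])
  fix V f x assume V: "V \<in> opens X U" and f: "f \<in> hol X V" and x: "x \<in> V"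
  note vf = vf_hol[OF v V f]
  show "brk U (vplus X U a b) v V f x = vplus X U (brk U a v) (brk U b v) V f x"
    by (simp only: bracket_apply[OF vplus_vf[OF a b] v V f x] vplus_apply[OF V f x] vplus_apply[OF V vf x] vplus_fun[OF V f]
        vf_add[OF v V vf_hol[OF a V f] vf_hol[OF b V f] x]) (simp add: x bracket_apply[OF a v V f x] bracket_apply[OF b v V f x])
qed

lemma bracket_neg:
  assumes v: "v \<in> VX U" and w: "w \<in> VX U" and "V \<in> opens X U" "f \<in> hol X V" "x \<in> V"
  shows "brk U v w V f x = - brk U w v V f x"
  using bracket_apply[OF v w assms(3-5)] bracket_apply[OF w v assms(3-5)] by simp

lemma bracket_add_right:
  assumes a: "a \<in> VX U" and b: "b \<in> VX U" and v: "v \<in> VX U"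
  shows "brk U v (vplus X U a b) = vplus X U (brk U v a) (brk U v b)"
proof (rule vf_eqI[OF bracket_vf[OF v vplus_vf[OF a b]] vplus_vf[OF bracket_vf[OF v a] bracket_vf[OF v b]]])
  fix V f x assume V: "V \<in> opens X U" and f: "f \<in> hol X V" and x: "x \<in> V"
  show "brk U v (vplus X U a b) V f x = vplus X U (brk U v a) (brk U v b) V f x"
    by (simp only: bracket_neg[OF v vplus_vf[OF a b] V f x] bracket_add_left[OF a b v] vplus_apply[OF V f x]
        bracket_neg[OF v a V f x] bracket_neg[OF v b V f x]) simp
qed

lemma bracket_scale_right:
  assumes U: "opX U" and u: "u \<in> VX U" and v: "v \<in> VX U" and h: "h \<in> hol X U"
  shows "brk U u (vscale X U h v) = vplus X U (vscale X U h (brk U u v)) (vscale X U (u U h) v)"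
proof -
  have UU: "U \<in> opens X U" by (rule opens_refl[OF U])
  note uh = vf_hol[OF u UU h] and sv = vscale_vf[OF U h v]
  show ?thesis
  proof (rule vf_eqI[OF bracket_vf[OF u sv] vplus_vf[OF vscale_vf[OF U h bracket_vf[OF u v]] vscale_vf[OF U uh v]]])
    fix V f x assume V: "V \<in> opens X U" and f: "f \<in> hol X V" and x: "x \<in> V"
    note hV = hol_restrict[OF U V h]
    have k: "u V (\<lambda>x\<in>V. restrict h V x * v V f x) x = h x * u V (v V f) x + u U h x * v V f x"
      using vf_mult[OF u V hV vf_hol[OF v V f] x] vf_res[OF u UU h V x] x by simp
    show "brk U u (vscale X U h v) V f x = vplus X U (vscale X U h (brk U u v)) (vscale X U (u U h) v) V f x"
      by (simp only: bracket_apply[OF u sv V f x] vplus_apply[OF V f x] vscale_fun[OF V f] k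
          vscale_apply[OF V vf_hol[OF u V f] x]) (simp add: x bracket_apply[OF u v V f x] algebra_simps)
  qed
qed

lemma bracket_scale_left:
  assumes U: "opX U" and u: "u \<in> VX U" and v: "v \<in> VX U" and h: "h \<in> hol X U"
  shows "brk U (vscale X U h u) v = vplus X U (vscale X U h (brk U u v)) (vscale X U (\<lambda>x\<in>U. -1 * v U h x) u)"
proof -
  note UU = opens_refl[OF U]
  note vh = vf_hol[OF v UU h] and su = vscale_vf[OF U h u]
  show ?thesis
  proof (rule vf_eqI[OF bracket_vf[OF su v] vplus_vf[OF vscale_vf[OF U h bracket_vf[OF u v]] vscale_vf[OF U hol_scale[OF U vh] u]]])
    fix V f x assume V: "V \<in> opens X U" and f: "f \<in> hol X V" and x: "x \<in> V"
    have xU: "x \<in> U" by (rule opens_mem[OF V x])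
    show "brk U (vscale X U h u) v V f x = vplus X U (vscale X U h (brk U u v)) (vscale X U (\<lambda>x\<in>U. -1 * v U h x) u) V f x"
      using xU by (simp only: bracket_neg[OF su v V f x] bracket_scale_right[OF U v u h] vplus_apply[OF V f x] vscale_apply[OF V f x]
          bracket_neg[OF u v V f x]) simp
  qed
qed

text \<open>A double bracket is a sum of four words in the three derivations. In this form both the
  Jacobi identity and the compatibility of the action with brackets are cancellations of
  words.\<close>

lemma bracket_bracket_apply:
  assumes u: "u \<in> VX U" and v: "v \<in> VX U" and w: "w \<in> VX U"
    and V: "V \<in> opens X U" and f: "f \<in> hol X V" and x: "x \<in> V"
  shows "brk U u (brk U v w) V f x =
    u V (v V (w V f)) x - u V (w V (v V f)) x - v V (w V (u V f)) x + w V (v V (u V f)) x"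
proof -
  note h = vf_hol[OF v V vf_hol[OF w V f]] vf_hol[OF w V vf_hol[OF v V f]]
  show ?thesis
    using vf_diff[OF u V h x]
    by (simp only: bracket_apply[OF u bracket_vf[OF v w] V f x] bracket_fun[OF v w V f]
        bracket_apply[OF v w V vf_hol[OF u V f] x]) simp
qed

lemma bracket_jacobi:
  assumes u: "u \<in> VX U" and v: "v \<in> VX U" and w: "w \<in> VX U" and U: "opX U"
  shows "vplus X U (vplus X U (brk U u (brk U v w)) (brk U v (brk U w u)))
    (brk U w (brk U u v)) = vzero X U"
proof (rule vf_eqI[OF _ vzero_vf[OF U]])
  fix V f x assume V: "V \<in> opens X U" and f: "f \<in> hol X V" and x: "x \<in> V"
  show "vplus X U (vplus X U (brk U u (brk U v w)) (brk U v (brk U w u)))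
    (brk U w (brk U u v)) V f x = vzero X U V f x"
    by (simp add: vplus_apply[OF V f x] vzero_apply[OF V f x] bracket_bracket_apply[OF _ _ _ V f x] u v w)
qed (intro vplus_vf bracket_vf u v w)

lemma bracket_self:
  assumes u: "u \<in> VX U" and U: "opX U"
  shows "brk U u u = vzero X U"
  by (rule vf_eqI[OF bracket_vf[OF u u] vzero_vf[OF U]]) (simp add: bracket_apply[OF u u] vzero_apply)

lemma bracket_const_left:
  assumes U: "opX U" and u: "u \<in> VX U" and v: "v \<in> VX U"
  shows "brk U (vscale X U (\<lambda>x\<in>U. c) u) v = vscale X U (\<lambda>x\<in>U. c) (brk U u v)"
proof (rule vf_eqI[OF bracket_vf[OF vscale_vf[OF U hol_const[OF U] u] v] vscale_vf[OF U hol_const[OF U] bracket_vf[OF u v]]])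
  fix V f x assume V: "V \<in> opens X U" and f: "f \<in> hol X V" and x: "x \<in> V"
  have xU: "x \<in> U" by (rule opens_mem[OF V x])
  show "brk U (vscale X U (\<lambda>x\<in>U. c) u) v V f x = vscale X U (\<lambda>x\<in>U. c) (brk U u v) V f x"
    using vf_const[OF v opens_refl[OF U] xU, of c] xU
    by (simp add: bracket_scale_left[OF U u v hol_const[OF U]] vplus_apply[OF V f x] vscale_apply[OF V f x])
qed

lemma bracket_const_right:
  assumes U: "opX U" and u: "u \<in> VX U" and v: "v \<in> VX U"
  shows "brk U u (vscale X U (\<lambda>x\<in>U. c) v) = vscale X U (\<lambda>x\<in>U. c) (brk U u v)"
proof (rule vf_eqI[OF bracket_vf[OF u vscale_vf[OF U hol_const[OF U] v]] vscale_vf[OF U hol_const[OF U] bracket_vf[OF u v]]])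
  fix V f x assume V: "V \<in> opens X U" and f: "f \<in> hol X V" and x: "x \<in> V"
  have xU: "x \<in> U" by (rule opens_mem[OF V x])
  show "brk U u (vscale X U (\<lambda>x\<in>U. c) v) V f x = vscale X U (\<lambda>x\<in>U. c) (brk U u v) V f x"
    using vf_const[OF u opens_refl[OF U] xU, of c] xU
    by (simp add: bracket_scale_right[OF U u v hol_const[OF U]] vplus_apply[OF V f x] vscale_apply[OF V f x])
qed

end

section \<open>The bracket on the restricted logarithmic fields\<close>

context divisor
begin

abbreviation "IL \<equiv> ideal_times X D L.FS"

text \<open>Since \<open>[h s, v] = h [s, v] - v(h) s\<close>, terms of two kinds arise, treated in
  \<open>P1\<close> and \<open>P2\<close>. The property \<open>P\<close> will be membership in
  \<open>I\<^sub>D T\<^sub>X(-log D)\<close> when \<open>v\<close> is tangent to \<open>D\<close>,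
  and tangency to \<open>D\<close> when \<open>v\<close> is arbitrary.\<close>

lemma ideal_bracket_induct:
  assumes W: "opX W" and x: "x \<in> IL W" and v: "v \<in> VX W"
    and P0: "P (vzero X W)" and Pplus: "\<And>y z. P y \<Longrightarrow> P z \<Longrightarrow> P (vplus X W y z)"
    and P1: "\<And>h s. h \<in> ideal_sheaf X D W \<Longrightarrow> s \<in> LogX W \<Longrightarrow> P (vscale X W h (brk W s v))"
    and P2: "\<And>h s. h \<in> ideal_sheaf X D W \<Longrightarrow> s \<in> LogX W \<Longrightarrow> P (vscale X W (\<lambda>y\<in>W. -1 * v W h y) s)"
  shows "P (brk W x v)"
  using W x
proof (induction rule: L.ideal_times_induct)
  case zero
  note z = vzero_vf[OF W]
  have "brk W (vzero X W) v = vzero X W"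
  proof (rule vf_eqI[OF bracket_vf[OF z v] z])
    fix V f x assume V: "V \<in> opens X W" and f: "f \<in> hol X V" and x: "x \<in> V"
    have "vzero X W V f = (\<lambda>x\<in>V. 0)" using V f by (simp add: vzero_def)
    then show "brk W (vzero X W) v V f x = vzero X W V f x"
      using vf_const[OF v V x, of 0] vzero_apply[OF V vf_hol[OF v V f] x] x
      by (simp only: bracket_apply[OF z v V f x]) simp
  qed
  then show ?case using P0 by (simp add: op_simps)
next
  case (step x h s)
  have s: "s \<in> LogX W" and x: "x \<in> LogX W" and h: "h \<in> hol X W"
    using step(2,3,4) by (auto simp: op_simps ideal_sheaf_def)
  have "brk W (vplus X W x (vscale X W h s)) v =
      vplus X W (brk W x v) (vplus X W (vscale X W h (brk W s v)) (vscale X W (\<lambda>y\<in>W. -1 * v W h y) s))"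
    using bracket_add_left[OF logvf[OF x] vscale_vf[OF W h logvf[OF s]] v] bracket_scale_left[OF W logvf[OF s] v h] by simp
  then show ?case using Pplus[OF step(5) Pplus[OF P1[OF step(3) s] P2[OF step(3) s]]] by (simp add: op_simps)
qed

text \<open>For tangent \<open>v\<close> also \<open>v(h)\<close> lies in \<open>I\<^sub>D\<close>,
  so both kinds of terms stay in the submodule: it is a Lie ideal, and the bracket descends.\<close>

lemma ideal_bracket:
  assumes W: "opX W" and x: "x \<in> IL W" and v: "v \<in> LogX W"
  shows "brk W x v \<in> IL W"
proof (rule ideal_bracket_induct[OF W x logvf[OF v]])
  show "vzero X W \<in> IL W" using L.ideal_times_zero[OF W] by (simp add: op_simps)
  show "vplus X W y z \<in> IL W" if "y \<in> IL W" "z \<in> IL W" for y z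
    using L.ideal_times_add[OF W that] by (simp add: op_simps)
  fix h s assume h: "h \<in> ideal_sheaf X D W" and s: "s \<in> LogX W"
  have hh: "h \<in> hol X W" and h0: "\<And>y. y \<in> W \<Longrightarrow> y \<in> D \<Longrightarrow> h y = 0" using h by (auto simp: ideal_sheaf_def)
  note UU = opens_refl[OF W]
  have vh: "(\<lambda>y\<in>W. -1 * v W h y) \<in> ideal_sheaf X D W"
    using hol_scale[OF W vf_hol[OF logvf[OF v] UU hh], of "-1"] logD[OF v UU hh h0] by (simp add: ideal_sheaf_def)
  show "vscale X W h (brk W s v) \<in> IL W" "vscale X W (\<lambda>y\<in>W. -1 * v W h y) s \<in> IL W"
    using L.ideal_times_ideal[OF W h, of "brk W s v"] log_bracket[OF s v] L.ideal_times_ideal[OF W vh, of s] s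
    by (simp_all add: op_simps)
qed

text \<open>For arbitrary \<open>v\<close> the function \<open>v(h)\<close> need not vanish on
  \<open>D\<close>. What remains is tangency: \<open>h [s, v]\<close> vanishes along
  \<open>D\<close> and \<open>v(h) s\<close> is tangent since \<open>s\<close> is.\<close>

lemma ideal_bracket_vf:
  assumes W: "opX W" and x: "x \<in> IL W" and v: "v \<in> VX W"
  shows "brk W x v \<in> LogX W"
proof (rule ideal_bracket_induct[OF W x v L.S_zero[OF W] L.S_plus[OF W]])
  fix h s assume h: "h \<in> ideal_sheaf X D W" and s: "s \<in> LogX W"
  have hh: "h \<in> hol X W" and h0: "\<And>y. y \<in> W \<Longrightarrow> y \<in> D \<Longrightarrow> h y = 0" using h by (auto simp: ideal_sheaf_def)
  show "vscale X W (\<lambda>y\<in>W. -1 * v W h y) s \<in> LogX W"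
    by (rule L.S_scale[OF W hol_scale[OF W vf_hol[OF v opens_refl[OF W] hh]] s])
  show "vscale X W h (brk W s v) \<in> LogX W"
  proof (rule logI[OF vscale_vf[OF W hh bracket_vf[OF logvf[OF s] v]]])
    fix V f q assume V: "V \<in> opens X W" and f: "f \<in> hol X V" and q: "q \<in> V" "q \<in> D"
    show "vscale X W h (brk W s v) V f q = 0"
      using vscale_apply[OF V f q(1), of h "brk W s v"] h0[OF opens_mem[OF V q(1)] q(2)] by simp
  qed
qed

lemma ideal_bracket':
  assumes W: "opX W" and x: "x \<in> IL W" and v: "v \<in> LogX W"
  shows "brk W v x \<in> IL W"
proof -
  have xl: "x \<in> LogX W" using L.ideal_times_closed[OF W x] by (simp add: op_simps)
  have "brk W v x = vscale X W (\<lambda>x\<in>W. -1) (brk W x v)"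
    by (rule vf_eqI[OF bracket_vf[OF logvf[OF v] logvf[OF xl]] vscale_vf[OF W hol_const[OF W] bracket_vf[OF logvf[OF xl] logvf[OF v]]]])
      (auto simp: vscale_apply bracket_neg[OF logvf[OF v] logvf[OF xl]] dest: opens_mem)
  then show ?thesis using L.ideal_times_smult[OF W hol_const[OF W] ideal_bracket[OF W x v], of "-1"] by (simp add: op_simps)
qed

lemma log_minus:
  assumes W: "opX W" and u: "u \<in> LogX W" "v \<in> LogX W"
  shows "u \<ominus>\<^bsub>sect L.FS W\<^esub> v \<in> LogX W" "u = vplus X W (u \<ominus>\<^bsub>sect L.FS W\<^esub> v) v"
proof -
  interpret abelian_group "sect L.FS W" by (rule L.ag[OF W])
  show "u \<ominus>\<^bsub>sect L.FS W\<^esub> v \<in> LogX W" using minus_closed[of u v] u by (simp add: op_simps)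
  show "u = vplus X W (u \<ominus>\<^bsub>sect L.FS W\<^esub> v) v" using minus_plus_cancel[of u v] u by (simp add: op_simps)
qed

text \<open>Differences are formed in the sheaf of all fields, also for logarithmic ones, where
  \<open>L_minus_eq\<close> shows it to be the same. So \<open>bracket_difference\<close> serves the
  bracket on \<open>L.Q\<close> and the action on the normal bundle alike.\<close>

abbreviation vminus :: "'a set \<Rightarrow> 'a vfield \<Rightarrow> 'a vfield \<Rightarrow> 'a vfield" where
  "vminus U v w \<equiv> v \<ominus>\<^bsub>sect T.FS U\<^esub> w"

lemma vminus_vf:
  assumes U: "opX U" and v: "v \<in> VX U" "w \<in> VX U"
  shows "vminus U v w \<in> VX U" "vplus X U (vminus U v w) w = v"
proof -
  interpret abelian_group "sect T.FS U" by (rule T.ag[OF U])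
  show "vminus U v w \<in> VX U" using minus_closed[of v w] v by (simp add: op_simps)
  show "vplus X U (vminus U v w) w = v" using minus_plus_cancel[of v w] v by (simp add: op_simps)
qed

lemmas vminus_apply = T.minus_apply

lemma vminus_fun:
  assumes W: "opX W" and v: "v \<in> VX W" "w \<in> VX W" and V: "V \<in> opens X W" and f: "f \<in> hol X V"
  shows "vminus W v w V f = (\<lambda>x\<in>V. v V f x - w V f x)"
  using vminus_apply[OF W v V f] hol_ext[OF opensD(1)[OF V] vf_hol[OF vminus_vf(1)[OF W v] V f]]
  by (intro extensionalityI[of _ V]) auto

lemma vminus_res:
  assumes A: "A \<in> opens X (U \<inter> U')" and u: "u \<in> VX U" "u' \<in> VX U'" and W: "W \<in> opens X A"
  shows "restrict (vminus A (restrict u (opens X A)) (restrict u' (opens X A))) (opens X W)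
    = vminus W (restrict u (opens X W)) (restrict u' (opens X W))"
proof -
  have "A \<in> opens X U" "A \<in> opens X U'" using A by (auto simp: opens_def)
  then have "restrict u (opens X A) \<in> VX A" "restrict u' (opens X A) \<in> VX A"
    using vres_vf u by blast+
  moreover have "opens X A \<inter> opens X W = opens X W" using opensD(2)[OF W] by (auto simp: opens_def)
  ultimately show ?thesis using T.res_minus[OF W opensD(1)[OF A]] by (simp add: op_simps)
qed

text \<open>Changing one argument at a time: independence of lifts is thereby reduced to brackets
  with a single difference.\<close>

lemma bracket_difference:
  assumes W: "opX W" and a: "a \<in> VX W" "a' \<in> VX W"
    and b: "b \<in> VX W" "b' \<in> VX W"
  shows "vminus W (brk W a b) (brk W a' b')
    = vplus X W (brk W (vminus W a a') b) (brk W a' (vminus W b b'))"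
proof -
  note x = vminus_vf(1)[OF W a] and y = vminus_vf(1)[OF W b] and ab = bracket_vf[OF a(1) b(1)] bracket_vf[OF a(2) b(2)]
  show ?thesis
  proof (rule vf_eqI[OF vminus_vf(1)[OF W ab] vplus_vf[OF bracket_vf[OF x b(1)] bracket_vf[OF a(2) y]]])
    fix V f p assume V: "V \<in> opens X W" and f: "f \<in> hol X V" and p: "p \<in> V"
    note h = vf_hol[OF _ V f]
    show "vminus W (brk W a b) (brk W a' b') V f p
      = vplus X W (brk W (vminus W a a') b) (brk W a' (vminus W b b')) V f p"
      unfolding vminus_apply[OF W ab V f p] vplus_apply[OF V f p] bracket_apply[OF a(1) b(1) V f p] bracket_apply[OF a(2) b(2) V f p]
        bracket_apply[OF x b(1) V f p] bracket_apply[OF a(2) y V f p] vminus_fun[OF W a V f] vminus_fun[OF W b V f]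
        vminus_apply[OF W a V h[OF b(1)] p] vminus_apply[OF W b V h[OF a(2)] p]
        vf_diff[OF b(1) V h[OF a(1)] h[OF a(2)] p] vf_diff[OF a(2) V h[OF b(1)] h[OF b(2)] p] by simp
  qed
qed

lemma L_minus_eq:
  assumes W: "opX W" and u: "u \<in> LogX W" "v \<in> LogX W"
  shows "u \<ominus>\<^bsub>sect L.FS W\<^esub> v = vminus W u v"
  by (rule vf_eqI[OF logvf[OF log_minus(1)[OF W u]] vminus_vf(1)[OF W logvf[OF u(1)] logvf[OF u(2)]]])
    (simp only: L.minus_apply[OF W u] vminus_apply[OF W logvf[OF u(1)] logvf[OF u(2)]])

lemma L_lft_near:
  assumes t: "L.lft V t U u" "L.lft V t U' u'" and q: "q \<in> U" "q \<in> U'" "q \<in> D"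
  shows "\<exists>W\<in>opens X (U \<inter> U'). q \<in> W \<and> vminus W (restrict u (opens X W)) (restrict u' (opens X W)) \<in> IL W"
proof -
  obtain W where W: "W \<in> opens X (U \<inter> U')" "q \<in> W" "restrict u (opens X W) \<ominus>\<^bsub>sect L.FS W\<^esub> restrict u' (opens X W) \<in> IL W"
    using L.lft_unique[OF t q] unfolding L.grel_def op_simps by blast
  have "W \<in> opens X U" "W \<in> opens X U'" using W(1) by (auto simp: opens_def)
  then show ?thesis
    using W L_minus_eq[OF opensD(1)[OF W(1)] log_res[OF lft_log[OF t(1)]] log_res[OF lft_log[OF t(2)]]] by (intro bexI[OF _ W(1)]) simp
qed

lemma bracket_L: "u \<in> LogX U \<Longrightarrow> v \<in> LogX U \<Longrightarrow> brk U u v \<in> sections L.FS U"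
  by (simp add: op_simps log_bracket)

text \<open>Near \<open>q\<close> the lifts differ by elements of the Lie ideal \<open>IL\<close>,
  so by \<open>bracket_difference\<close> their brackets do too.\<close>

lemma bracket_gm_unique:
  assumes t: "L.lft V t U u" "L.lft V t U' u'" and t': "L.lft V t' U v" "L.lft V t' U' v'" and q: "q \<in> U" "q \<in> U'" "q \<in> D"
  shows "L.gm U (brk U u v) q = L.gm U' (brk U' u' v') q"
proof -
  note u = lft_log[OF t(1)] lft_log[OF t(2)] and v = lft_log[OF t'(1)] lft_log[OF t'(2)] and oU = L.lftD(1)[OF t(1)] L.lftD(1)[OF t(2)]
  obtain A where A: "A \<in> opens X (U \<inter> U')" "q \<in> A" "vminus A (restrict u (opens X A)) (restrict u' (opens X A)) \<in> IL A"
    using L_lft_near[OF t q] by blast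
  obtain B where B: "B \<in> opens X (U \<inter> U')" "q \<in> B" "vminus B (restrict v (opens X B)) (restrict v' (opens X B)) \<in> IL B"
    using L_lft_near[OF t' q] by blast
  define W where "W = A \<inter> B"
  note o = opensD(1)[OF A(1)] opensD(1)[OF B(1)]
  have i: "W \<in> opens X A" "W \<in> opens X B" "W \<in> opens X U" "W \<in> opens X U'" "q \<in> W" "opX W"
    using A(1,2) B(1,2) o by (auto simp: W_def opens_def)
  let ?u = "restrict u (opens X W)" and ?u' = "restrict u' (opens X W)" and ?v = "restrict v (opens X W)" and ?v' = "restrict v' (opens X W)"
  note lu = log_res[OF u(1) i(3)] log_res[OF u(2) i(4)] and lv = log_res[OF v(1) i(3)] log_res[OF v(2) i(4)]
  have x: "vminus W ?u ?u' \<in> IL W"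
    using L.ideal_times_res[OF o(1) i(1) A(3)] vminus_res[OF A(1) logvf[OF u(1)] logvf[OF u(2)] i(1)] by (simp add: op_simps)
  have y: "vminus W ?v ?v' \<in> IL W"
    using L.ideal_times_res[OF o(2) i(2) B(3)] vminus_res[OF B(1) logvf[OF v(1)] logvf[OF v(2)] i(2)] by (simp add: op_simps)
  note b = log_bracket[OF lu(1) lv(1)] log_bracket[OF lu(2) lv(2)] and s = bracket_L[OF lu(1) lv(1)] bracket_L[OF lu(2) lv(2)]
  have "brk W ?u ?v \<ominus>\<^bsub>sect L.FS W\<^esub> brk W ?u' ?v' \<in> IL W"
    using L.ideal_times_add[OF i(6) ideal_bracket[OF i(6) x lv(1)] ideal_bracket'[OF i(6) y lu(2)]]
    unfolding L_minus_eq[OF i(6) b] bracket_difference[OF i(6) logvf[OF lu(1)] logvf[OF lu(2)] logvf[OF lv(1)] logvf[OF lv(2)]]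
    by (simp only: op_simps)
  then have "L.grel W (brk W ?u ?v) W (brk W ?u' ?v') q"
    unfolding L.grel_def using i(5,6) L.res_self[OF i(6) s(1)] L.res_self[OF i(6) s(2)] by (intro bexI[of _ W]) (auto simp: opens_def)
  then have "L.gm W (brk W ?u ?v) q = L.gm W (brk W ?u' ?v') q" using L.gm_eq_iff[OF i(6,6) s i(5,5)] by simp
  then show ?thesis
    using L.gm_res[OF oU(1) bracket_L[OF u(1) v(1)] i(3,5)] L.gm_res[OF oU(2) bracket_L[OF u(2) v(2)] i(4,5)]
    by (simp only: op_simps bracket_res[OF logvf[OF u(1)] logvf[OF v(1)] i(3)] bracket_res[OF logvf[OF u(2)] logvf[OF v(2)] i(4)])
qed

definition beta :: "'a set \<Rightarrow> ('a, 'a vfield) qsection \<Rightarrow> ('a, 'a vfield) qsection \<Rightarrow> ('a, 'a vfield) qsection" where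
  "beta V t t' = (\<lambda>q\<in>V. THE c. \<exists>U u v. q \<in> U \<and> L.lft V t U u \<and> L.lft V t' U v \<and> c = L.gm U (brk U u v) q)"

lemma beta_lft:
  assumes t: "L.lft V t U u" "L.lft V t' U v"
  shows "L.lft V (beta V t t') U (brk U u v)"
proof -
  have "beta V t t' q = L.gm U (brk U u v) q" if q: "q \<in> U" "q \<in> D" for q
  proof -
    have "(THE c. \<exists>U u v. q \<in> U \<and> L.lft V t U u \<and> L.lft V t' U v \<and> c = L.gm U (brk U u v) q) = L.gm U (brk U u v) q"
    proof (rule the_equality)
      fix c assume "\<exists>U u v. q \<in> U \<and> L.lft V t U u \<and> L.lft V t' U v \<and> c = L.gm U (brk U u v) q"
      then obtain U' u' v' where "q \<in> U'" "L.lft V t U' u'" "L.lft V t' U' v'" "c = L.gm U' (brk U' u' v') q" by blast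
      then show "c = L.gm U (brk U u v) q" using bracket_gm_unique[OF _ t(1) _ t(2) _ q] by simp
    qed (use q t in blast)
    moreover have "q \<in> V" using L.lftD(2)[OF t(1)] q by blast
    ultimately show ?thesis by (simp add: beta_def)
  qed
  then show ?thesis unfolding L.lft_def using L.lftD(1,2)[OF t(1)] bracket_L[OF lft_log[OF t(1)] lft_log[OF t(2)]] by auto
qed

lemma beta_ext: "beta V t t' \<in> extensional V" by (simp add: beta_def)

lemma L_lft2: "t \<in> \<Gamma>L V \<Longrightarrow> t' \<in> \<Gamma>L V \<Longrightarrow> opY V \<Longrightarrow> p \<in> V \<Longrightarrow>
    \<exists>U u u'. p \<in> U \<and> L.lft V t U u \<and> L.lft V t' U u'"
  using L.ex_lft2[OF _ _ _ _ openin_topspace top_at] by metis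

lemma L_lft3: "t \<in> \<Gamma>L V \<Longrightarrow> t' \<in> \<Gamma>L V \<Longrightarrow> t'' \<in> \<Gamma>L V \<Longrightarrow> opY V \<Longrightarrow> p \<in> V \<Longrightarrow>
    \<exists>U u u' u''. p \<in> U \<and> L.lft V t U u \<and> L.lft V t' U u' \<and> L.lft V t'' U u''"
  using L.ex_lft3[OF _ _ _ _ _ openin_topspace top_at] by metis

lemma beta_closed:
  assumes V: "opY V" and t: "t \<in> \<Gamma>L V" "t' \<in> \<Gamma>L V"
  shows "beta V t t' \<in> \<Gamma>L V"
proof (rule L.Q_I[OF beta_ext _ V])
  fix p assume "p \<in> V"
  then obtain U u u' where "p \<in> U" "L.lft V t U u" "L.lft V t' U u'" using L_lft2[OF t V] by blast
  then show "\<exists>U s. p \<in> U \<and> L.lft V (beta V t t') U s" using beta_lft by blast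
qed

lemma bracket_lifting_beta: "bracket_by_lifting X D beta"
  unfolding bracket_by_lifting_def log_tangent_sheaf_eq op_simps
proof (intro allI impI ballI)
  fix U u v assume U: "opX U" and u: "u \<in> LogX U" and v: "v \<in> LogX U"
  have rs: "restrict_section X D (operator_sheaf X (structure_sheaf X) (LogX)) U w = L.cls U w" for w
    by (simp add: restrict_section_def L.cls_def)
  have s: "u \<in> sections L.FS U" "v \<in> sections L.FS U" using u v by (simp_all add: op_simps)
  show "beta (U \<inter> D) (restrict_section X D (operator_sheaf X (structure_sheaf X) (LogX)) U u)
         (restrict_section X D (operator_sheaf X (structure_sheaf X) (LogX)) U v) =
        restrict_section X D (operator_sheaf X (structure_sheaf X) (LogX)) U (brk U u v)"
    unfolding rs
    by (rule L.Q_eqI[OF beta_ext _ L.openY_Int[OF U]])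
      (use beta_lft[OF L.lft_cls[OF U s(1)] L.lft_cls[OF U s(2)]] L.lft_cls[OF U bracket_L[OF u v]] in \<open>auto simp: L.cls_def\<close>)
qed

lemma beta_restrict:
  assumes V: "opY V" and W: "W \<in> opens Y V" and t: "t \<in> \<Gamma>L V" "t' \<in> \<Gamma>L V"
  shows "restrict (beta V t t') W = beta W (restrict t W) (restrict t' W)"
proof (rule L.Q_eqI[OF _ beta_ext opensD(1)[OF W]])
  fix p assume p: "p \<in> W"
  obtain N where N: "opX N" "p \<in> N" "N \<inter> D \<subseteq> W" using L.openY_trans[OF W p] by blast
  obtain U u u' where U: "p \<in> U" "U \<subseteq> N" "L.lft V t U u" "L.lft V t' U u'"
    using L.ex_lft2[OF t V opens_mem[OF W p] N(1,2)] by blast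
  have uw: "U \<inter> D \<subseteq> W" using U N by blast
  show "\<exists>U s. p \<in> U \<and> L.lft W (restrict (beta V t t') W) U s \<and> L.lft W (beta W (restrict t W) (restrict t' W)) U s"
    using L.lft_restrict[OF beta_lft[OF U(3,4)] uw] beta_lft[OF L.lft_restrict[OF U(3) uw] L.lft_restrict[OF U(4) uw]] U(1) by blast
qed simp

lemma L_eqI:
  assumes "t \<in> \<Gamma>L V" "t' \<in> \<Gamma>L V" "w \<in> \<Gamma>L V" and V: "opY V"
    and "r \<in> extensional V" "r' \<in> extensional V"
    and "\<And>U a b c. L.lft V t U a \<Longrightarrow> L.lft V t' U b \<Longrightarrow> L.lft V w U c \<Longrightarrow> \<exists>s. L.lft V r U s \<and> L.lft V r' U s"
  shows "r = r'"
proof (rule L.Q_eqI[OF assms(5,6) V])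
  fix p assume "p \<in> V"
  then obtain U a b c where "p \<in> U" "L.lft V t U a" "L.lft V t' U b" "L.lft V w U c" using L_lft3[OF assms(1-4)] by blast
  then show "\<exists>U s. p \<in> U \<and> L.lft V r U s \<and> L.lft V r' U s" using assms(7) by blast
qed

text \<open>By \<open>beta_lft\<close>, \<open>lft_add\<close> and \<open>lft_smult\<close> each
  side has an explicit lift; the corresponding law for vector fields on \<open>X\<close> makes the
  two lifts equal.\<close>

lemma L_algebroid_laws:
  assumes V: "opY V" and t: "t \<in> \<Gamma>L V" and t': "t' \<in> \<Gamma>L V"
  shows "w \<in> \<Gamma>L V \<Longrightarrow> beta V (t \<oplus>\<^bsub>sect L.Q V\<^esub> t') w = beta V t w \<oplus>\<^bsub>sect L.Q V\<^esub> beta V t' w"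
    and "w \<in> \<Gamma>L V \<Longrightarrow> beta V w (t \<oplus>\<^bsub>sect L.Q V\<^esub> t') = beta V w t \<oplus>\<^bsub>sect L.Q V\<^esub> beta V w t'"
    and "w \<in> \<Gamma>L V \<Longrightarrow> beta V t (beta V t' w) \<oplus>\<^bsub>sect L.Q V\<^esub> beta V t' (beta V w t) \<oplus>\<^bsub>sect L.Q V\<^esub> beta V w (beta V t t') = \<zero>\<^bsub>sect L.Q V\<^esub>"
    and "beta V ((\<lambda>x\<in>V. c) \<odot>\<^bsub>sect L.Q V\<^esub> t) t' = (\<lambda>x\<in>V. c) \<odot>\<^bsub>sect L.Q V\<^esub> beta V t t'"
    and "beta V t ((\<lambda>x\<in>V. c) \<odot>\<^bsub>sect L.Q V\<^esub> t') = (\<lambda>x\<in>V. c) \<odot>\<^bsub>sect L.Q V\<^esub> beta V t t'"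
    and "beta V t t = \<zero>\<^bsub>sect L.Q V\<^esub>"
    and "f \<in> hol Y V \<Longrightarrow> beta V t (f \<odot>\<^bsub>sect L.Q V\<^esub> t') = f \<odot>\<^bsub>sect L.Q V\<^esub> beta V t t' \<oplus>\<^bsub>sect L.Q V\<^esub> rho V t V f \<odot>\<^bsub>sect L.Q V\<^esub> t'"
proof -
  note ext = L.Q_op_ext beta_ext and log = logvf[OF lft_log] and VV = opens_refl[OF V]
  note eqI = L_eqI[OF t t' _ V]
  { assume w: "w \<in> \<Gamma>L V"
    show "beta V (t \<oplus>\<^bsub>sect L.Q V\<^esub> t') w = beta V t w \<oplus>\<^bsub>sect L.Q V\<^esub> beta V t' w"
    proof (rule eqI[OF w ext(4,2)])
      fix U a b c assume U: "L.lft V t U a" "L.lft V t' U b" "L.lft V w U c"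
      show "\<exists>s. L.lft V (beta V (t \<oplus>\<^bsub>sect L.Q V\<^esub> t') w) U s \<and> L.lft V (beta V t w \<oplus>\<^bsub>sect L.Q V\<^esub> beta V t' w) U s"
        using beta_lft[OF L.lft_add[OF U(1,2)] U(3)] L.lft_add[OF beta_lft[OF U(1,3)] beta_lft[OF U(2,3)]]
        unfolding op_simps bracket_add_left[OF log[OF U(1)] log[OF U(2)] log[OF U(3)]] by blast
    qed
    show "beta V w (t \<oplus>\<^bsub>sect L.Q V\<^esub> t') = beta V w t \<oplus>\<^bsub>sect L.Q V\<^esub> beta V w t'"
    proof (rule eqI[OF w ext(4,2)])
      fix U a b c assume U: "L.lft V t U a" "L.lft V t' U b" "L.lft V w U c"
      show "\<exists>s. L.lft V (beta V w (t \<oplus>\<^bsub>sect L.Q V\<^esub> t')) U s \<and> L.lft V (beta V w t \<oplus>\<^bsub>sect L.Q V\<^esub> beta V w t') U s"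
        using beta_lft[OF U(3) L.lft_add[OF U(1,2)]] L.lft_add[OF beta_lft[OF U(3,1)] beta_lft[OF U(3,2)]]
        unfolding op_simps bracket_add_right[OF log[OF U(1)] log[OF U(2)] log[OF U(3)]] by blast
    qed
    show "beta V t (beta V t' w) \<oplus>\<^bsub>sect L.Q V\<^esub> beta V t' (beta V w t) \<oplus>\<^bsub>sect L.Q V\<^esub> beta V w (beta V t t') = \<zero>\<^bsub>sect L.Q V\<^esub>"
    proof (rule eqI[OF w ext(2,1)])
      fix U a b c assume U: "L.lft V t U a" "L.lft V t' U b" "L.lft V w U c"
      note oU = L.lftD(1,2)[OF U(1)]
      show "\<exists>s. L.lft V (beta V t (beta V t' w) \<oplus>\<^bsub>sect L.Q V\<^esub> beta V t' (beta V w t) \<oplus>\<^bsub>sect L.Q V\<^esub> beta V w (beta V t t')) U s \<and> L.lft V \<zero>\<^bsub>sect L.Q V\<^esub> U s"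
        using L.lft_add[OF L.lft_add[OF beta_lft[OF U(1) beta_lft[OF U(2,3)]] beta_lft[OF U(2) beta_lft[OF U(3,1)]]] beta_lft[OF U(3) beta_lft[OF U(1,2)]]]
          L.lft_zero[OF oU]
        unfolding op_simps bracket_jacobi[OF log[OF U(1)] log[OF U(2)] log[OF U(3)] oU(1)] by blast
    qed }
  show "beta V ((\<lambda>x\<in>V. c) \<odot>\<^bsub>sect L.Q V\<^esub> t) t' = (\<lambda>x\<in>V. c) \<odot>\<^bsub>sect L.Q V\<^esub> beta V t t'"
  proof (rule eqI[OF t ext(4,3)])
    fix U a b assume U: "L.lft V t U a" "L.lft V t' U b"
    note oU = L.lftD(1,2)[OF U(1)] and e = L.ext_to_const[OF L.lftD(1,2)[OF U(1)], of c]
    show "\<exists>s. L.lft V (beta V ((\<lambda>x\<in>V. c) \<odot>\<^bsub>sect L.Q V\<^esub> t) t') U s \<and> L.lft V ((\<lambda>x\<in>V. c) \<odot>\<^bsub>sect L.Q V\<^esub> beta V t t') U s"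
      using beta_lft[OF L.lft_smult[OF U(1) e V] U(2)] L.lft_smult[OF beta_lft[OF U(1,2)] e V]
      unfolding op_simps bracket_const_left[OF oU(1) log[OF U(1)] log[OF U(2)]] by blast
  qed
  show "beta V t ((\<lambda>x\<in>V. c) \<odot>\<^bsub>sect L.Q V\<^esub> t') = (\<lambda>x\<in>V. c) \<odot>\<^bsub>sect L.Q V\<^esub> beta V t t'"
  proof (rule eqI[OF t ext(4,3)])
    fix U a b assume U: "L.lft V t U a" "L.lft V t' U b"
    note oU = L.lftD(1,2)[OF U(1)] and e = L.ext_to_const[OF L.lftD(1,2)[OF U(1)], of c]
    show "\<exists>s. L.lft V (beta V t ((\<lambda>x\<in>V. c) \<odot>\<^bsub>sect L.Q V\<^esub> t')) U s \<and> L.lft V ((\<lambda>x\<in>V. c) \<odot>\<^bsub>sect L.Q V\<^esub> beta V t t') U s"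
      using beta_lft[OF U(1) L.lft_smult[OF U(2) e V]] L.lft_smult[OF beta_lft[OF U(1,2)] e V]
      unfolding op_simps bracket_const_right[OF oU(1) log[OF U(1)] log[OF U(2)]] by blast
  qed
  show "beta V t t = \<zero>\<^bsub>sect L.Q V\<^esub>"
  proof (rule eqI[OF t ext(4,1)])
    fix U a assume U: "L.lft V t U a"
    note oU = L.lftD(1,2)[OF U]
    show "\<exists>s. L.lft V (beta V t t) U s \<and> L.lft V \<zero>\<^bsub>sect L.Q V\<^esub> U s"
      using beta_lft[OF U U] L.lft_zero[OF oU] unfolding op_simps bracket_self[OF log[OF U] oU(1)] by blast
  qed
  show "beta V t (f \<odot>\<^bsub>sect L.Q V\<^esub> t') = f \<odot>\<^bsub>sect L.Q V\<^esub> beta V t t' \<oplus>\<^bsub>sect L.Q V\<^esub> rho V t V f \<odot>\<^bsub>sect L.Q V\<^esub> t'"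
    if f: "f \<in> hol Y V"
  proof (rule L.Q_eqI[OF ext(4,2) V])
    fix p assume p: "p \<in> V"
    obtain U a b h k where U: "p \<in> U" "L.lft V t U a" "L.lft V t' U b" "L.ext_to V f U h" "L.ext_to V f U k"
      using L.lft_ext_common[OF V t t' f f p openin_topspace top_at[OF V p]] by blast
    note l = lft_log[OF U(2)] lft_log[OF U(3)] and oU = L.lftD(1,2)[OF U(2)] and h = L.ext_toD(3)[OF U(4)]
    note UU = opens_refl[OF oU(1)]
    \<comment> \<open>The function \<open>a(h)\<close> extends \<open>rho V t V f\<close> from
      \<open>D\<close> to \<open>X\<close>, so the Leibniz rule for lifts descends to one with the
      anchor.\<close>
    have "L.ext_to V (rho V t V f) U (a U h)" unfolding L.ext_to_def
      using oU vf_hol[OF logvf[OF l(1)] UU h] rho_value[OF V t U(2) VV f U(4) UU] by auto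
    note g = L.lft_add[OF L.lft_smult[OF beta_lft[OF U(2,3)] U(4) V] L.lft_smult[OF U(3) this V]]
    show "\<exists>U s. p \<in> U \<and> L.lft V (beta V t (f \<odot>\<^bsub>sect L.Q V\<^esub> t')) U s \<and>
        L.lft V (f \<odot>\<^bsub>sect L.Q V\<^esub> beta V t t' \<oplus>\<^bsub>sect L.Q V\<^esub> rho V t V f \<odot>\<^bsub>sect L.Q V\<^esub> t') U s"
      using beta_lft[OF U(2) L.lft_smult[OF U(3,4) V]] g U(1)
      unfolding op_simps bracket_scale_right[OF oU(1) logvf[OF l(1)] logvf[OF l(2)] h] by blast
  qed
qed

lemma L_algebroid:
  assumes "vector_bundle Y L.Q"
  shows "lie_algebroid Y L.Q rho beta"
  unfolding lie_algebroid_def L.Q_ops(4)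
  by (intro conjI allI impI ballI mfd_Y assms rho_hom; (rule beta_closed beta_restrict L_algebroid_laws; assumption))

end

section \<open>Coordinates on the restricted logarithmic fields, which make them a vector
  bundle\<close>

lemma (in ringed_space) vf_res_fun:
  assumes v: "v \<in> VX U" and V: "V \<in> opens X U" and f: "f \<in> hol X V" and W: "W \<in> opens X V"
  shows "v W (restrict f W) = restrict (v V f) W"
proof (rule extensionalityI[of _ W])
  have WU: "W \<in> opens X U" by (rule opens_trans[OF W V])
  show "v W (restrict f W) \<in> extensional W"
    by (rule hol_ext[OF opensD(1)[OF W] vf_hol[OF v WU hol_restrict[OF opensD(1)[OF V] W f]]])
  show "v W (restrict f W) x = restrict (v V f) W x" if "x \<in> W" for x
    using vf_res[OF v V f W that] that by simp
qed simp

lemma (in vf_subsheaf) finsum_apply: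
  fixes k :: nat
  assumes U: "opX U" and c: "\<And>i. i < k \<Longrightarrow> c i \<in> hol X U" and s: "\<And>i. i < k \<Longrightarrow> s i \<in> S U"
    and V: "V \<in> opens X U" and f: "f \<in> hol X V" and x: "x \<in> V"
  shows "(\<Oplus>\<^bsub>sect FS U\<^esub>i\<in>{..<k}. c i \<odot>\<^bsub>sect FS U\<^esub> s i) V f x = (\<Sum>i<k. c i x * s i V f x)"
  using c s
proof (induction k)
  interpret module "hol_ring X U" "sect FS U" by (rule md[OF U])
  case 0
  show ?case by (simp add: op_simps vzero_apply[OF V f x])
next
  interpret module "hol_ring X U" "sect FS U" by (rule md[OF U])
  case (Suc k)
  have cl: "c i \<odot>\<^bsub>sect FS U\<^esub> s i \<in> sections FS U" if "i < Suc k" for i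
    using Suc.prems(1,2)[OF that] S_scale[OF U] by (simp add: op_simps)
  have "(\<Oplus>\<^bsub>sect FS U\<^esub>i\<in>{..<Suc k}. c i \<odot>\<^bsub>sect FS U\<^esub> s i) =
      c k \<odot>\<^bsub>sect FS U\<^esub> s k \<oplus>\<^bsub>sect FS U\<^esub> (\<Oplus>\<^bsub>sect FS U\<^esub>i\<in>{..<k}. c i \<odot>\<^bsub>sect FS U\<^esub> s i)"
    unfolding lessThan_Suc using cl by (subst M.finsum_insert) auto
  then show ?case using Suc.IH Suc.prems
    by (simp add: op_simps vplus_apply[OF V f x] vscale_apply[OF V f x])
qed

locale adapted_divisor = divisor X D + adapted_chart X n U \<phi> D for X :: "'a cspace" and D n U \<phi>
begin

lemma crd0_D: "W \<in> opens X U \<Longrightarrow> x \<in> W \<Longrightarrow> x \<in> D \<Longrightarrow> crd 0 W x = 0"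
  using in_D opens_mem[of W X U x] by (simp add: crd_apply)

lemma crd_restrict: "W' \<in> opens X W \<Longrightarrow> restrict (crd i W) W' = crd i W'"
  using opensD(2) by (fastforce simp: crd_def fun_eq_iff)

lemma log_crd0:
  assumes u: "u \<in> LogX W" and W: "W \<in> opens X U" and q: "q \<in> W" "q \<in> D"
  shows "u W (crd 0 W) q = 0"
  by (rule logD[OF u opens_refl[OF opensD(1)[OF W]] crd_hol[OF W n_pos] _ q]) (rule crd0_D[OF W])

text \<open>The coefficients, at points of \<open>D\<close>, in the frame
  \<open>x\<^sub>0 \<partial>\<^sub>0, \<partial>\<^sub>1, ...\<close>. If
  \<open>u x\<^sub>0 = c\<^sub>0 x\<^sub>0\<close>, then
  \<open>\<partial>\<^sub>0 (u x\<^sub>0) = c\<^sub>0\<close> where \<open>x\<^sub>0 = 0\<close>; a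
  derivative replaces the division by \<open>x\<^sub>0\<close>.\<close>

definition coef :: "nat \<Rightarrow> 'a set \<Rightarrow> 'a vfield \<Rightarrow> 'a \<Rightarrow> complex" where
  "coef i W u = (if i = 0 then pd 0 W (u W (crd 0 W)) else u W (crd i W))"

lemma vf_crd_hol:
  "u \<in> VX W \<Longrightarrow> W \<in> opens X U \<Longrightarrow> i < n \<Longrightarrow> u W (crd i W) \<in> hol X W"
  using vf_hol[OF _ opens_refl crd_hol] opensD(1) by blast

lemma coef_hol: "u \<in> VX W \<Longrightarrow> W \<in> opens X U \<Longrightarrow> i < n \<Longrightarrow> coef i W u \<in> hol X W"
  using vf_crd_hol pd_hol[OF _ n_pos] n_pos by (simp add: coef_def)

lemma coef_add:
  assumes u: "u \<in> VX W" and v: "v \<in> VX W" and W: "W \<in> opens X U" and i: "i < n" and q: "q \<in> W"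
  shows "coef i W (vplus X W u v) q = coef i W u q + coef i W v q"
  using pd_add[OF W n_pos vf_crd_hol[OF u W n_pos] vf_crd_hol[OF v W n_pos] q]
    vplus_fun[OF opens_refl[OF opensD(1)[OF W]] crd_hol[OF W n_pos], of u v]
    vplus_apply[OF opens_refl[OF opensD(1)[OF W]] crd_hol[OF W i] q, of u v]
  by (simp add: coef_def)

text \<open>Holds on \<open>D\<close> only: for \<open>i = 0\<close> the product rule adds
  \<open>\<partial>\<^sub>0 h * u x\<^sub>0\<close>, and \<open>u x\<^sub>0\<close> vanishes on
  \<open>D\<close> because \<open>u\<close> is tangent.\<close>

lemma coef_scale:
  assumes u: "u \<in> LogX W" and h: "h \<in> hol X W" and W: "W \<in> opens X U" and i: "i < n" and q: "q \<in> W" "q \<in> D"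
  shows "coef i W (vscale X W h u) q = h q * coef i W u q"
proof (cases "i = 0")
  case True
  note o = opensD(1)[OF W]
  have "vscale X W h u W (crd 0 W) = (\<lambda>x\<in>W. h x * u W (crd 0 W) x)"
    unfolding vscale_fun[OF opens_refl[OF o] crd_hol[OF W n_pos]] hol_restrict_self[OF o h] ..
  then show ?thesis
    using pd_mult[OF W n_pos h vf_crd_hol[OF logvf[OF u] W n_pos] q(1)] log_crd0[OF u W q] True by (simp add: coef_def)
next
  case False
  then show ?thesis using vscale_apply[OF opens_refl[OF opensD(1)[OF W]] crd_hol[OF W i] q(1), of h u] by (simp add: coef_def)
qed

lemma coef_zero:
  assumes W: "W \<in> opens X U" and i: "i < n" and q: "q \<in> W"
  shows "coef i W (vzero X W) q = 0"
proof -
  have "vzero X W W (crd j W) = (\<lambda>x\<in>W. 0)" if "j < n" for j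
    using opens_refl[OF opensD(1)[OF W]] crd_hol[OF W that] by (simp add: vzero_def)
  then show ?thesis using pd_const[OF W n_pos q, of 0] i q n_pos by (simp add: coef_def)
qed

lemma coef_res:
  assumes u: "u \<in> VX W" and W: "W \<in> opens X U" and W': "W' \<in> opens X W" and i: "i < n" and q: "q \<in> W'"
  shows "coef i W' (restrict u (opens X W')) q = coef i W u q"
proof -
  have e: "restrict u (opens X W') W' (crd j W') = restrict (u W (crd j W)) W'" if "j < n" for j
    using vf_res_fun[OF u opens_refl[OF opensD(1)[OF W]] crd_hol[OF W that] W'] opens_refl[OF opensD(1)[OF W']]
    by (simp add: crd_restrict[OF W'])
  show ?thesis using e[OF n_pos] e[OF i] pd_res[OF W n_pos W' q, of "u W (crd 0 W)"] q by (simp add: coef_def)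
qed

lemma coef_ideal:
  assumes W: "W \<in> opens X U" and x: "x \<in> IL W" and i: "i < n" and q: "q \<in> W" "q \<in> D"
  shows "coef i W x q = 0"
  using opensD(1)[OF W] x
proof (induction rule: L.ideal_times_induct)
  case zero
  show ?case using coef_zero[OF W i q(1)] by (simp add: op_simps)
next
  case (step x h s)
  have s: "s \<in> LogX W" and x: "x \<in> LogX W" and h: "h \<in> hol X W" and h0: "h q = 0"
    using step(2,3,4) q by (auto simp: op_simps ideal_sheaf_def)
  show ?case using step(5) coef_scale[OF s h W i q] h0
      coef_add[OF logvf[OF x] vscale_vf[OF opensD(1)[OF W] h logvf[OF s]] W i q(1)] by (simp add: op_simps)
qed

lemma coef_minus:
  assumes u: "u \<in> LogX W" "v \<in> LogX W" and W: "W \<in> opens X U" and i: "i < n" and q: "q \<in> W"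
  shows "coef i W (u \<ominus>\<^bsub>sect L.FS W\<^esub> v) q = coef i W u q - coef i W v q"
proof -
  note m = log_minus[OF opensD(1)[OF W] u]
  have "coef i W u q = coef i W (vplus X W (u \<ominus>\<^bsub>sect L.FS W\<^esub> v) v) q" by (rule arg_cong[OF m(2), of "\<lambda>z. coef i W z q"])
  then show ?thesis using coef_add[OF logvf[OF m(1)] logvf[OF u(2)] W i q] by simp
qed

text \<open>The coefficients depend on the germ only. A representative may be defined beyond the
  chart, hence the intersection of its domain with \<open>U\<close>.\<close>

lemma coef_grel:
  assumes W: "W \<in> opens X U" and A: "opX A" and u: "u \<in> LogX W" and a: "a \<in> LogX A"
    and r: "L.grel W u A a q" and q: "q \<in> A" "q \<in> D" and i: "i < n"
  shows "coef i (A \<inter> U) (restrict a (opens X (A \<inter> U))) q = coef i W u q"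
proof -
  obtain Z where Z: "Z \<in> opens X (W \<inter> A)" "q \<in> Z"
    "restrict u (opens X Z) \<ominus>\<^bsub>sect L.FS Z\<^esub> restrict a (opens X Z) \<in> IL Z"
    using r unfolding L.grel_def op_simps by blast
  have s: "Z \<in> opens X W" "Z \<in> opens X A" "Z \<in> opens X U" "Z \<in> opens X (A \<inter> U)" "A \<inter> U \<in> opens X A" "A \<inter> U \<in> opens X U"
    using Z(1) W A openU by (auto simp: opens_def)
  have rr: "restrict (restrict a (opens X (A \<inter> U))) (opens X Z) = restrict a (opens X Z)"
    using opens_trans[OF _ s(4)] by (auto simp: fun_eq_iff)
  note l = log_res[OF u s(1)] log_res[OF a s(2)] log_res[OF a s(5)]
  have "coef i Z (restrict u (opens X Z)) q - coef i Z (restrict a (opens X Z)) q = 0"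
    using coef_ideal[OF s(3) Z(3) i Z(2) q(2)] coef_minus[OF l(1,2) s(3) i Z(2)] by simp
  moreover have "coef i Z (restrict u (opens X Z)) q = coef i W u q" by (rule coef_res[OF logvf[OF u] W s(1) i Z(2)])
  moreover have "coef i Z (restrict a (opens X Z)) q = coef i (A \<inter> U) (restrict a (opens X (A \<inter> U))) q"
    using coef_res[OF logvf[OF l(3)] s(6,4) i Z(2)] rr by simp
  ultimately show ?thesis by simp
qed

definition efield :: "nat \<Rightarrow> 'a vfield" where
  "efield i = (if i = 0 then vscale X U (crd 0 U) (dd 0) else dd i)"

lemma UU: "U \<in> opens X U" by (rule opens_refl[OF openU])

lemma efield_apply:
  assumes V: "V \<in> opens X U" and f: "f \<in> hol X V" and x: "x \<in> V"
  shows "efield i V f x = (if i = 0 then \<phi> x 0 * pd 0 V f x else pd i V f x)"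
  using vscale_apply[OF V f x, of "crd 0 U" "dd 0"] dd_apply[OF V f] crd_apply[OF opens_mem[OF V x], of 0] by (simp add: efield_def)

lemma efield_log: assumes i: "i < n" shows "efield i \<in> LogX U"
proof (rule logI)
  show "efield i \<in> VX U"
    using dd_vf[OF i] vscale_vf[OF openU crd_hol[OF UU n_pos] dd_vf[OF n_pos]] by (simp add: efield_def)
  fix V f x assume V: "V \<in> opens X U" and f: "f \<in> hol X V" and z: "\<And>x. x \<in> V \<Longrightarrow> x \<in> D \<Longrightarrow> f x = 0" and x: "x \<in> V" "x \<in> D"
  have x0: "\<phi> x 0 = 0" using in_D opens_mem[OF V x(1)] x(2) by blast
  show "efield i V f x = 0"
  proof (cases "i = 0")
    case True then show ?thesis using efield_apply[OF V f x(1), of i] x0 by simp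
  next
    case False
    have z': "f y = 0" if "y \<in> V" "\<phi> y 0 = 0" for y using z that in_D opens_mem[OF V that(1)] by blast
    \<comment> \<open>A function vanishing on \<open>D\<close> is \<open>x\<^sub>0 g\<close>, and
      for \<open>i \<noteq> 0\<close> the field \<open>\<partial>\<^sub>i\<close> maps it to
      \<open>x\<^sub>0 \<partial>\<^sub>i g\<close>.\<close>
    obtain g where g: "g \<in> hol X V" "\<forall>y\<in>V. f y = (\<phi> y 0 - 0) * g y"
      using divide_crd[OF V n_pos f z'] by blast
    have "f = (\<lambda>y\<in>V. crd 0 V y * g y)"
      by (rule hol_eqI[OF opensD(1)[OF V] f hol_mult[OF opensD(1)[OF V] crd_hol[OF V n_pos] g(1)]]) (use g(2) in \<open>simp add: crd_apply\<close>)
    then show ?thesis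
      using efield_apply[OF V f x(1), of i] False pd_mult[OF V i crd_hol[OF V n_pos] g(1) x(1)] pd_crd[OF V i x(1), of 0] x0
      by (simp add: crd_apply[OF x(1)])
  qed
qed

lemma coef_efield:
  assumes i: "i < n" and j: "j < n" and q: "q \<in> U" "q \<in> D"
  shows "coef j U (efield i) q = (if i = j then 1 else 0)"
proof (cases "j = 0")
  case False
  then show ?thesis
    using efield_apply[OF UU crd_hol[OF UU j] q(1), of i] pd_crd[OF UU n_pos q(1), of j] pd_crd[OF UU i q(1), of j]
    by (auto simp: coef_def)
next
  case True
  note E = logvf[OF efield_log[OF i]]
  note eh = vf_crd_hol[OF E UU n_pos]
  show ?thesis
  proof (cases "i = 0")
    case i0: True
    have "efield i U (crd 0 U) = crd 0 U"
      by (rule hol_eqI[OF openU eh crd_hol[OF UU n_pos]])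
        (use efield_apply[OF UU crd_hol[OF UU n_pos], of _ i] i0 pd_crd[OF UU n_pos, of _ 0] in \<open>simp add: crd_apply\<close>)
    then show ?thesis using True i0 pd_crd[OF UU n_pos q(1), of 0] by (simp add: coef_def)
  next
    case i0: False
    have "efield i U (crd 0 U) = (\<lambda>x\<in>U. 0)"
      by (rule hol_eqI[OF openU eh hol_const[OF openU]])
        (use efield_apply[OF UU crd_hol[OF UU n_pos], of _ i] i0 pd_crd[OF UU i, of _ 0] in simp)
    then show ?thesis using True i0 pd_const[OF UU n_pos q(1), of 0] by (simp add: coef_def)
  qed
qed

text \<open>With \<open>g = u x\<^sub>0 / x\<^sub>0\<close> one has \<open>u = g x\<^sub>0
  \<partial>\<^sub>0 + \<Sum>\<^sub>i (u x\<^sub>i) \<partial>\<^sub>i\<close>. On \<open>D\<close>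
  the functions \<open>g\<close> and \<open>u x\<^sub>i\<close> are the coefficients of
  \<open>u\<close>; if these vanish, the expansion exhibits \<open>u\<close> as an element of
  \<open>I\<^sub>D T\<^sub>X(-log D)\<close>.\<close>

lemma coef_inj:
  assumes W: "W \<in> opens X U" and u: "u \<in> LogX W" and z: "\<And>i q. i < n \<Longrightarrow> q \<in> W \<Longrightarrow> q \<in> D \<Longrightarrow> coef i W u q = 0"
  shows "u \<in> IL W"
proof -
  note o = opensD(1)[OF W] and uv = logvf[OF u]
  have z0: "u W (crd 0 W) x = 0" if "x \<in> W" "\<phi> x 0 = 0" for x
    using log_crd0[OF u W that(1)] in_D[OF opens_mem[OF W that(1)]] that(2) by blast
  obtain g where g: "g \<in> hol X W" "\<forall>x\<in>W. u W (crd 0 W) x = (\<phi> x 0 - 0) * g x"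
    "\<forall>x\<in>W. \<phi> x 0 = 0 \<longrightarrow> g x = pd 0 W (u W (crd 0 W)) x"
    using divide_crd[OF W n_pos vf_crd_hol[OF uv W n_pos] z0] by blast
  define c where "c = (\<lambda>i. if i = 0 then g else u W (crd i W))"
  define s where "s = (\<lambda>i. restrict (efield i) (opens X W))"
  have c: "c i \<in> ideal_sheaf X D W" if i: "i < n" for i
  proof (cases "i = 0")
    case True
    have "g q = 0" if q: "q \<in> W" "q \<in> D" for q
      using g(3) q in_D[OF opens_mem[OF W q(1)]] z[OF n_pos q] by (simp add: coef_def)
    then show ?thesis using True g(1) by (simp add: c_def ideal_sheaf_def)
  next
    case False
    then show ?thesis using vf_crd_hol[OF uv W i] z[OF i] by (simp add: c_def ideal_sheaf_def coef_def)
  qed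
  have s: "s i \<in> LogX W" if "i < n" for i unfolding s_def by (rule log_res[OF efield_log[OF that] W])
  have ch: "c i \<in> hol X W" if "i < n" for i using c[OF that] by (simp add: ideal_sheaf_def)
  interpret module "hol_ring X W" "sect L.FS W" by (rule L.md[OF o])
  have cl: "(\<Oplus>\<^bsub>sect L.FS W\<^esub>i\<in>{..<n}. c i \<odot>\<^bsub>sect L.FS W\<^esub> s i) \<in> LogX W"
  proof -
    have "(\<Oplus>\<^bsub>sect L.FS W\<^esub>i\<in>{..<n}. c i \<odot>\<^bsub>sect L.FS W\<^esub> s i) \<in> sections L.FS W"
      by (rule M.finsum_closed) (use s ch L.S_scale[OF o] in \<open>auto simp: op_simps\<close>)
    then show ?thesis by (simp add: op_simps)
  qed
  have "u = (\<Oplus>\<^bsub>sect L.FS W\<^esub>i\<in>{..<n}. c i \<odot>\<^bsub>sect L.FS W\<^esub> s i)"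
  proof (rule vf_eqI[OF uv logvf[OF cl]])
    fix V f x assume V: "V \<in> opens X W" and f: "f \<in> hol X V" and x: "x \<in> V"
    note VU = opens_trans[OF V W]
    have "u V f x = (\<Sum>i<n. u V (crd i V) x * pd i V f x)" by (rule vf_coordinates[OF uv V VU f x])
    also have "\<dots> = (\<Sum>i<n. c i x * s i V f x)"
    proof (rule sum.cong[OF refl])
      fix i assume "i \<in> {..<n}"
      then have i: "i < n" by simp
      have "u V (crd i V) x = u W (crd i W) x"
        using vf_res[OF uv opens_refl[OF o] crd_hol[OF W i] V x] by (simp add: crd_restrict[OF V])
      moreover have "s i V f x = (if i = 0 then \<phi> x 0 * pd 0 V f x else pd i V f x)"
        using efield_apply[OF VU f x] V by (simp add: s_def)
      ultimately show "u V (crd i V) x * pd i V f x = c i x * s i V f x"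
        using g(2) opens_mem[OF V x] by (auto simp: c_def)
    qed
    also have "\<dots> = (\<Oplus>\<^bsub>sect L.FS W\<^esub>i\<in>{..<n}. c i \<odot>\<^bsub>sect L.FS W\<^esub> s i) V f x"
      by (rule L.finsum_apply[OF o ch s V f x, symmetric])
    finally show "u V f x = (\<Oplus>\<^bsub>sect L.FS W\<^esub>i\<in>{..<n}. c i \<odot>\<^bsub>sect L.FS W\<^esub> s i) V f x" .
  qed
  then show ?thesis unfolding ideal_times_def using c s
    by (intro CollectI exI[of _ n] exI[of _ c] exI[of _ s]) (auto simp: op_simps)
qed

text \<open>A representative is chosen at each point separately; since every lift yields the same
  value (\<open>kappa_lft\<close>), the outcome is nevertheless holomorphic on
  \<open>D\<close>.\<close>

definition kappa :: "nat \<Rightarrow> 'a set \<Rightarrow> ('a, 'a vfield) qsection \<Rightarrow> 'a \<Rightarrow> complex" where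
  "kappa i V t = (\<lambda>q\<in>V. case SOME r. r \<in> t q of (A, a) \<Rightarrow> coef i (A \<inter> U) (restrict a (opens X (A \<inter> U))) q)"

lemma kappa_lft:
  assumes t: "L.lft V t W u" and W: "W \<subseteq> U" and q: "q \<in> W" "q \<in> D" and i: "i < n"
  shows "kappa i V t q = coef i W u q"
proof -
  have WU: "W \<in> opens X U" using L.lftD(1)[OF t] W by (simp add: opens_def)
  obtain A a where A: "(SOME r. r \<in> t q) = (A, a)" "opX A" "q \<in> A" "a \<in> sections L.FS A" "L.grel W u A a q"
    by (rule L.some_rep[OF t q])
  have a: "a \<in> LogX A" using A(4) by (simp add: op_simps)
  have "q \<in> V" using L.lftD(2)[OF t] q by blast
  then show ?thesis using coef_grel[OF WU A(2) lft_log[OF t] a A(5,3) q(2) i] by (simp add: kappa_def A(1))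
qed

lemma kappa_hol:
  assumes V: "V \<in> opens Y (U \<inter> D)" and t: "t \<in> \<Gamma>L V" and i: "i < n"
  shows "kappa i V t \<in> hol Y V"
proof (rule L.holY_I[OF opensD(1)[OF V]])
  show "kappa i V t \<in> extensional V" by (simp add: kappa_def)
  fix p assume p: "p \<in> V"
  have pU: "p \<in> U" using opens_mem[OF V p] by blast
  obtain W u where W: "p \<in> W" "W \<subseteq> U" "L.lft V t W u" using L.ex_lft[OF t opensD(1)[OF V] p openU pU] by blast
  have WU: "W \<in> opens X U" using L.lftD(1)[OF W(3)] W(2) by (simp add: opens_def)
  have "L.ext_to V (kappa i V t) W (coef i W u)" unfolding L.ext_to_def
    using L.lftD(1,2)[OF W(3)] coef_hol[OF logvf[OF lft_log[OF W(3)]] WU i] kappa_lft[OF W(3,2) _ _ i] by auto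
  then show "\<exists>W h. p \<in> W \<and> L.ext_to V (kappa i V t) W h" using W(1) by blast
qed

lemma kappa_add:
  assumes V: "V \<in> opens Y (U \<inter> D)" and t: "t \<in> \<Gamma>L V" "t' \<in> \<Gamma>L V" and i: "i < n" and q: "q \<in> V"
  shows "kappa i V (t \<oplus>\<^bsub>sect L.Q V\<^esub> t') q = kappa i V t q + kappa i V t' q"
proof -
  have qU: "q \<in> U" "q \<in> D" using opens_mem[OF V q] by auto
  obtain W u u' where W: "q \<in> W" "W \<subseteq> U" "L.lft V t W u" "L.lft V t' W u'" using L.ex_lft2[OF t opensD(1)[OF V] q openU qU(1)] by blast
  have WU: "W \<in> opens X U" using L.lftD(1)[OF W(3)] W(2) by (simp add: opens_def)
  show ?thesis
    using kappa_lft[OF L.lft_add[OF W(3,4)] W(2,1) qU(2) i] kappa_lft[OF W(3,2,1) qU(2) i] kappa_lft[OF W(4,2,1) qU(2) i]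
      coef_add[OF logvf[OF lft_log[OF W(3)]] logvf[OF lft_log[OF W(4)]] WU i W(1)] by (simp add: op_simps)
qed

lemma kappa_smult:
  assumes V: "V \<in> opens Y (U \<inter> D)" and t: "t \<in> \<Gamma>L V" and f: "f \<in> hol Y V" and i: "i < n" and q: "q \<in> V"
  shows "kappa i V (f \<odot>\<^bsub>sect L.Q V\<^esub> t) q = f q * kappa i V t q"
proof -
  have qU: "q \<in> U" "q \<in> D" using opens_mem[OF V q] by auto
  obtain W u h where W: "q \<in> W" "W \<subseteq> U" "L.lft V t W u" "L.ext_to V f W h" using L.ex_lft_ext[OF t f opensD(1)[OF V] q openU qU(1)] by blast
  have WU: "W \<in> opens X U" using L.lftD(1)[OF W(3)] W(2) by (simp add: opens_def)
  show ?thesis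
    using kappa_lft[OF L.lft_smult[OF W(3,4) opensD(1)[OF V]] W(2,1) qU(2) i] kappa_lft[OF W(3,2,1) qU(2) i]
      coef_scale[OF lft_log[OF W(3)] L.ext_toD(3)[OF W(4)] WU i W(1) qU(2)] L.ext_toD(4)[OF W(4,1) qU(2)]
    by (simp add: op_simps)
qed

lemma kappa_zero:
  assumes V: "V \<in> opens Y (U \<inter> D)" and i: "i < n" and q: "q \<in> V"
  shows "kappa i V \<zero>\<^bsub>sect L.Q V\<^esub> q = 0"
proof -
  interpret abelian_group "sect L.Q V" by (rule L.Q_abelian_group[OF opensD(1)[OF V]])
  show ?thesis using kappa_add[OF V zero_closed zero_closed i q] by simp
qed

text \<open>Lifts with equal coefficients on \<open>D\<close> differ by a field to which
  \<open>coef_inj\<close> applies, so they have the same germs.\<close>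

lemma kappa_inj:
  assumes V: "V \<in> opens Y (U \<inter> D)" and t: "t \<in> \<Gamma>L V" "t' \<in> \<Gamma>L V"
    and eq: "\<And>i q. i < n \<Longrightarrow> q \<in> V \<Longrightarrow> kappa i V t q = kappa i V t' q"
  shows "t = t'"
proof (rule L.Q_eqI[OF L.Q_ext[OF t(1)] L.Q_ext[OF t(2)] opensD(1)[OF V]])
  fix p assume p: "p \<in> V"
  have pU: "p \<in> U" using opens_mem[OF V p] by blast
  obtain W u u' where W: "p \<in> W" "W \<subseteq> U" "L.lft V t W u" "L.lft V t' W u'" using L.ex_lft2[OF t opensD(1)[OF V] p openU pU] by blast
  note o = L.lftD(1)[OF W(3)] and u = lft_log[OF W(3)] and u' = lft_log[OF W(4)]
  have WU: "W \<in> opens X U" using o W(2) by (simp add: opens_def)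
  have I: "u \<ominus>\<^bsub>sect L.FS W\<^esub> u' \<in> IL W"
  proof (rule coef_inj[OF WU log_minus(1)[OF o u u']])
    fix i q assume i: "i < n" and q: "q \<in> W" "q \<in> D"
    have "q \<in> V" using q L.lftD(2)[OF W(3)] by blast
    then show "coef i W (u \<ominus>\<^bsub>sect L.FS W\<^esub> u') q = 0"
      using coef_minus[OF u u' WU i q(1)] eq[OF i] kappa_lft[OF W(3,2) q i] kappa_lft[OF W(4,2) q i] by simp
  qed
  have "L.gm W u q = L.gm W u' q" if q: "q \<in> W" for q
  proof -
    have "L.grel W u W u' q" unfolding L.grel_def
      using I q o L.res_self[OF o L.lftD(3)[OF W(3)]] L.res_self[OF o L.lftD(3)[OF W(4)]]
      by (intro bexI[of _ W]) (auto simp: opens_def)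
    then show ?thesis using L.gm_eq_iff[OF o o L.lftD(3)[OF W(3)] L.lftD(3)[OF W(4)] q q] by simp
  qed
  then have "L.lft V t' W u" using W(3,4) unfolding L.lft_def by auto
  then show "\<exists>W u. p \<in> W \<and> L.lft V t W u \<and> L.lft V t' W u" using W(1,3) by blast
qed

definition frame :: "nat \<Rightarrow> ('a, 'a vfield) qsection" where
  "frame i = L.cls U (efield i)"

lemma frame_lft: "i < n \<Longrightarrow> L.lft (U \<inter> D) (frame i) U (efield i)"
  unfolding frame_def using L.lft_cls[OF openU] efield_log by (simp add: op_simps)

lemma frame_section: "i < n \<Longrightarrow> frame i \<in> \<Gamma>L (U \<inter> D)"
  unfolding frame_def using L.cls_section[OF openU] efield_log by (simp add: op_simps)

lemma kappa_frame:
  assumes V: "V \<in> opens Y (U \<inter> D)" and i: "i < n" and j: "j < n" and q: "q \<in> V"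
  shows "kappa j V (restrict (frame i) V) q = (if i = j then 1 else 0)"
proof -
  have qU: "q \<in> U" "q \<in> D" using opens_mem[OF V q] by auto
  obtain N where N: "opX N" "q \<in> N" "N \<inter> D \<subseteq> V" using L.ex_zero[OF opensD(1)[OF V] q] by blast
  have W: "U \<inter> N \<in> opens X U" using opens_Int(1)[OF openU N(1)] .
  have "L.lft V (restrict (frame i) V) (U \<inter> N) (restrict (efield i) (opens X (U \<inter> N)))"
    using L.lft_restrict[OF L.lft_res[OF frame_lft[OF i] W], of V] N(3) by (auto simp: op_simps)
  from kappa_lft[OF this _ _ qU(2) j] show ?thesis
    using coef_res[OF logvf[OF efield_log[OF i]] UU W j, of q] coef_efield[OF i j qU] qU(1) N(2) by simp
qed

text \<open>Partial sums are needed for the induction; for \<open>k = n\<close> this says that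
  \<open>kappa\<close> is dual to \<open>frame\<close>.\<close>

lemma kappa_sum:
  fixes k :: nat
  assumes V: "V \<in> opens Y (U \<inter> D)" and c: "\<And>i. i < k \<Longrightarrow> c i \<in> hol Y V" and k: "k \<le> n" and j: "j < n" and q: "q \<in> V"
  shows "kappa j V (\<Oplus>\<^bsub>sect L.Q V\<^esub>i\<in>{..<k}. c i \<odot>\<^bsub>sect L.Q V\<^esub> restrict (frame i) V) q = (if j < k then c j q else 0)"
  using c k
proof (induction k)
  interpret module "hol_ring Y V" "sect L.Q V" by (rule L.Q_module[OF opensD(1)[OF V]])
  case 0
  show ?case using kappa_zero[OF V j q] by simp
next
  interpret module "hol_ring Y V" "sect L.Q V" by (rule L.Q_module[OF opensD(1)[OF V]])
  case (Suc k)
  have fr: "restrict (frame i) V \<in> \<Gamma>L V" if "i < Suc k" for i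
    using L.Q_restrict_closed[OF L.openY_Int[OF openU] V frame_section] Suc.prems(2) that by simp
  have cl: "c i \<odot>\<^bsub>sect L.Q V\<^esub> restrict (frame i) V \<in> \<Gamma>L V" if "i < Suc k" for i
    using L.Q_smult_closed[OF opensD(1)[OF V] fr[OF that] Suc.prems(1)[OF that]] .
  have S: "(\<Oplus>\<^bsub>sect L.Q V\<^esub>i\<in>{..<k}. c i \<odot>\<^bsub>sect L.Q V\<^esub> restrict (frame i) V) \<in> \<Gamma>L V"
    by (rule M.finsum_closed) (use cl in auto)
  have e: "(\<Oplus>\<^bsub>sect L.Q V\<^esub>i\<in>{..<Suc k}. c i \<odot>\<^bsub>sect L.Q V\<^esub> restrict (frame i) V) =
      c k \<odot>\<^bsub>sect L.Q V\<^esub> restrict (frame k) V \<oplus>\<^bsub>sect L.Q V\<^esub> (\<Oplus>\<^bsub>sect L.Q V\<^esub>i\<in>{..<k}. c i \<odot>\<^bsub>sect L.Q V\<^esub> restrict (frame i) V)"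
    unfolding lessThan_Suc using cl by (subst M.finsum_insert) auto
  have "kappa j V (c k \<odot>\<^bsub>sect L.Q V\<^esub> restrict (frame k) V) q = c k q * (if k = j then 1 else 0)"
    using kappa_smult[OF V fr[of k] Suc.prems(1)[of k] j q] kappa_frame[OF V _ j q, of k] Suc.prems(2) by simp
  moreover have "kappa j V (\<Oplus>\<^bsub>sect L.Q V\<^esub>i\<in>{..<k}. c i \<odot>\<^bsub>sect L.Q V\<^esub> restrict (frame i) V) q = (if j < k then c j q else 0)"
    by (rule Suc.IH) (use Suc.prems in auto)
  ultimately have "kappa j V (\<Oplus>\<^bsub>sect L.Q V\<^esub>i\<in>{..<Suc k}. c i \<odot>\<^bsub>sect L.Q V\<^esub> restrict (frame i) V) q
      = c k q * (if k = j then 1 else 0) + (if j < k then c j q else 0)"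
    by (simp only: e kappa_add[OF V cl[OF lessI] S j q])
  also have "\<dots> = (if j < Suc k then c j q else 0)" by (auto simp: less_Suc_eq)
  finally show ?case .
qed

text \<open>Duality computes the coefficients of any expansion, hence they are unique; injectivity
  of \<open>kappa\<close> shows that the expansion with these coefficients is the given
  section.\<close>

lemma L_frame: "local_frame Y L.Q (U \<inter> D) n frame"
  unfolding local_frame_def L.Q_ops(4)
proof (intro conjI allI impI ballI frame_section)
  fix V s assume V: "V \<in> opens Y (U \<inter> D)" and s: "s \<in> \<Gamma>L V"
  interpret module "hol_ring Y V" "sect L.Q V" by (rule L.Q_module[OF opensD(1)[OF V]])
  have fr: "restrict (frame i) V \<in> \<Gamma>L V" if "i < n" for i
    using L.Q_restrict_closed[OF L.openY_Int[OF openU] V frame_section] that by simp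
  let ?S = "\<lambda>c. \<Oplus>\<^bsub>sect L.Q V\<^esub>i\<in>{..<n}. c i \<odot>\<^bsub>sect L.Q V\<^esub> restrict (frame i) V"
  have S: "?S c \<in> \<Gamma>L V" if "\<And>i. i < n \<Longrightarrow> c i \<in> hol Y V" for c
    by (rule M.finsum_closed) (use L.Q_smult_closed[OF opensD(1)[OF V] fr that] in auto)
  show "\<exists>!c. c \<in> {..<n} \<rightarrow>\<^sub>E hol Y V \<and> s = ?S c"
  proof (rule ex1I)
    define C where "C = (\<lambda>i\<in>{..<n}. kappa i V s)"
    have Ck: "C i = kappa i V s" if "i < n" for i using that by (simp add: C_def)
    have c: "C i \<in> hol Y V" if "i < n" for i using kappa_hol[OF V s that] Ck[OF that] by simp
    have "s = ?S C"
    proof (rule kappa_inj[OF V s S[OF c]])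
      fix i q assume i: "i < n" and q: "q \<in> V"
      have "kappa i V (?S C) q = (if i < n then C i q else 0)"
        by (rule kappa_sum[OF V _ order_refl i q]) (rule c)
      moreover have "(if i < n then C i q else 0) = kappa i V s q" using i Ck by simp
      ultimately show "kappa i V s q = kappa i V (?S C) q" by (rule sym[OF trans])
    qed
    moreover have "C \<in> {..<n} \<rightarrow>\<^sub>E hol Y V" using c by (auto simp: C_def)
    ultimately show "C \<in> {..<n} \<rightarrow>\<^sub>E hol Y V \<and> s = ?S C" by blast
    fix d assume d: "d \<in> {..<n} \<rightarrow>\<^sub>E hol Y V \<and> s = ?S d"
    show "d = C"
    proof (rule extensionalityI[of _ "{..<n}"])
      show "d \<in> extensional {..<n}" using d by (auto simp: PiE_def)
      fix i assume "i \<in> {..<n}"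
      then have i: "i < n" by simp
      have dh: "d i \<in> hol Y V" if "i < n" for i using d that by auto
      have "d i = kappa i V s"
      proof (rule Y.hol_eqI[OF opensD(1)[OF V] dh[OF i] kappa_hol[OF V s i]])
        fix q assume q: "q \<in> V"
        have "kappa i V (?S d) q = (if i < n then d i q else 0)"
          by (rule kappa_sum[OF V _ order_refl i q]) (rule dh)
        also have "\<dots> = d i q" using i by simp
        finally have "kappa i V (?S d) q = d i q" .
        moreover have "kappa i V s q = kappa i V (?S d) q" by (rule arg_cong[OF conjunct2[OF d], of "\<lambda>z. kappa i V z q"])
        ultimately show "d i q = kappa i V s q" by (simp only:)
      qed
      then show "d i = C i" using Ck[OF i] by simp
    qed (simp add: C_def)
  qed
qed

end

context divisor
begin

lemma adapted_divisor_at: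
  assumes "p \<in> D" obtains n U \<phi> where "p \<in> U" "adapted_divisor X D n U \<phi>"
proof -
  obtain n U \<phi> where U: "p \<in> U" "adapted_chart X n U \<phi> D" by (rule adapted_at[OF assms])
  have "adapted_divisor X D n U \<phi>" by (intro adapted_divisor.intro divisor_axioms U(2)) 
  then show ?thesis using that U(1) by blast
qed

lemma L_vector_bundle: "vector_bundle Y L.Q"
  unfolding vector_bundle_def
proof (intro conjI ballI L.Q_sheaf)
  fix p assume "p \<in> topspace (points Y)"
  then have p: "p \<in> D" by (simp add: top_Y)
  obtain n U \<phi> where U: "p \<in> U" "adapted_divisor X D n U \<phi>" by (rule adapted_divisor_at[OF p])
  show "\<exists>U r e. opY U \<and> p \<in> U \<and> local_frame Y L.Q U r e"
    using adapted_divisor.L_frame[OF U(2)] L.openY_Int complex_chart.openU[OF mfd_chart.axioms(2)[OF adapted_chart.axioms(1)[OF adapted_divisor.axioms(2)[OF U(2)]]]] p U(1) by blast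
qed

end

section \<open>The normal bundle\<close>

context divisor
begin

abbreviation "TI \<equiv> tangent_image X D"

lemma T_lft_vf: "T.lft V t U v \<Longrightarrow> v \<in> VX U"
  using T.lftD(3) by (simp add: op_simps)

lemma T_sect: "v \<in> sections T.FS U \<longleftrightarrow> v \<in> VX U"
  by (simp add: op_simps)

text \<open>Tangency is a condition on values along \<open>D\<close>, and two lifts of one section
  of \<open>T.Q\<close> have the same values there.\<close>

lemma T_log_transfer:
  assumes t: "T.lft V t U v"
    and loc: "\<And>p. p \<in> U \<Longrightarrow> p \<in> D \<Longrightarrow> \<exists>U' v'. p \<in> U' \<and> T.lft V t U' v' \<and> v' \<in> LogX U'"
  shows "v \<in> LogX U"
proof (rule logI[OF T_lft_vf[OF t]])
  fix W f q assume W: "W \<in> opens X U" and f: "f \<in> hol X W" and z: "\<And>x. x \<in> W \<Longrightarrow> x \<in> D \<Longrightarrow> f x = 0" and q: "q \<in> W" "q \<in> D"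
  obtain U' v' where U': "q \<in> U'" "T.lft V t U' v'" "v' \<in> LogX U'" using loc[OF opens_mem[OF W q(1)] q(2)] by blast
  note o = opensD(1)[OF W] and o' = T.lftD(1)[OF U'(2)]
  have A: "W \<inter> U' \<in> opens X W" "W \<inter> U' \<in> opens X U'" "W \<inter> U' \<in> opens X (U \<inter> U')"
    using opens_Int[OF o o'] W by (auto simp: opens_def)
  have fA: "restrict f (W \<inter> U') \<in> hol X (W \<inter> U')" by (rule hol_restrict[OF o A(1) f])
  have "v W f q = v (W \<inter> U') (restrict f (W \<inter> U')) q" using vf_res[OF T_lft_vf[OF t] W f A(1), of q] q U'(1) by simp
  also have "\<dots> = v' (W \<inter> U') (restrict f (W \<inter> U')) q" by (rule T.lft_values[OF t U'(2) A(3) fA]) (use q U'(1) in auto)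
  also have "\<dots> = 0" by (rule logD[OF U'(3) A(2) fA]) (use z q U'(1) in auto)
  finally show "v W f q = 0" .
qed

lemma rs_T: "restrict_section X D (tangent_sheaf X) U v = T.cls U v"
  by (simp add: restrict_section_def T.cls_def tangent_sheaf_def)

lemma T_lft_at: "t \<in> sections T.Q V \<Longrightarrow> opY V \<Longrightarrow> p \<in> V \<Longrightarrow> \<exists>U u. p \<in> U \<and> T.lft V t U u"
  using T.ex_lft[OF _ _ _ openin_topspace] top_at by meson

text \<open>The image of \<open>T\<^sub>D\<close> consists of the classes of fields tangent to
  \<open>D\<close>. If \<open>v\<close> restricts to \<open>w\<close> and \<open>f\<close> vanishes
  on \<open>D\<close>, then \<open>v f\<close> on \<open>D\<close> is \<open>w\<close> applied to 0.
  Conversely, tangent lifts induce a field on \<open>D\<close> by \<open>descend\<close>.\<close>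

lemma TI_iff:
  assumes V: "opY V"
  shows "t \<in> TI V \<longleftrightarrow> t \<in> sections T.Q V \<and> (\<forall>p\<in>V. \<exists>U v. p \<in> U \<and> T.lft V t U v \<and> v \<in> LogX U)"
proof (intro iffI conjI ballI)
  assume "t \<in> TI V"
  then obtain w where t: "t \<in> sections T.Q V" and w: "w \<in> VY V"
    and r: "\<And>U v. opX U \<Longrightarrow> U \<inter> D \<subseteq> V \<Longrightarrow> v \<in> VX U \<Longrightarrow> restrict t (U \<inter> D) = T.cls U v \<Longrightarrow> restricts_to X D U v w"
    unfolding tangent_image_def T_restrict_eq rs_T by blast
  show "t \<in> sections T.Q V" by (rule t)
  fix p assume p: "p \<in> V"
  obtain U v where U: "p \<in> U" "T.lft V t U v" using T_lft_at[OF t V p] by blast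
  note o = T.lftD(1,2)[OF U(2)] and v = T_lft_vf[OF U(2)]
  have rt: "restricts_to X D U v w" by (rule r[OF o v T.lft_eq_cls[OF U(2)]])
  have "v \<in> LogX U"
  proof (rule logI[OF v])
    fix W f q assume W: "W \<in> opens X U" and f: "f \<in> hol X W" and z: "\<And>x. x \<in> W \<Longrightarrow> x \<in> D \<Longrightarrow> f x = 0" and q: "q \<in> W" "q \<in> D"
    have WD: "W \<inter> D \<in> opens Y V" by (rule opens_Y_Int[OF opensD(1)[OF W]]) (use o(2) opensD(2)[OF W] in blast)
    have e: "restrict (v W f) (W \<inter> D) = w (W \<inter> D) (restrict f (W \<inter> D))" using rt W f unfolding restricts_to_def by blast
    have "restrict f (W \<inter> D) = (\<lambda>x\<in>W \<inter> D. 0)" using z by (intro restrict_ext) auto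
    then have "w (W \<inter> D) (restrict f (W \<inter> D)) q = 0" using Y.vf_const[OF w WD, of q 0] q by simp
    then show "v W f q = 0" using fun_cong[OF e, of q] q by simp
  qed
  then show "\<exists>U v. p \<in> U \<and> T.lft V t U v \<and> v \<in> LogX U" using U by blast
next
  assume *: "t \<in> sections T.Q V \<and> (\<forall>p\<in>V. \<exists>U v. p \<in> U \<and> T.lft V t U v \<and> v \<in> LogX U)"
  define P where "P = (\<lambda>U v. T.lft V t U v \<and> v \<in> LogX U)"
  have "\<exists>w\<in>VY V. \<forall>U u. P U u \<longrightarrow> restricts_to X D U u w"
  proof (rule descend[OF V])
    show "\<exists>U u. P U u \<and> p \<in> U" if "p \<in> V" for p using * that unfolding P_def by blast
    show "opX U \<and> U \<inter> D \<subseteq> V \<and> u \<in> LogX U" if "P U u" for U u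
      using T.lftD(1,2)[of V t U u] that unfolding P_def by blast
    show "u W f q = u' W f q" if "P U u" "P U' u'" "W \<in> opens X (U \<inter> U')" "f \<in> hol X W" "q \<in> W" "q \<in> D" for U u U' u' W f q
      using that(1,2) T.lft_values[OF _ _ that(3-6)] unfolding P_def by blast
  qed
  then obtain w where w: "w \<in> VY V" "\<And>U u. P U u \<Longrightarrow> restricts_to X D U u w" by blast
  \<comment> \<open>\<open>tangent_image\<close> speaks of every lift of \<open>t\<close>, whereas
    \<open>w\<close> was obtained from the tangent ones; \<open>T_log_transfer\<close> shows that
    every lift is tangent.\<close>
  have "restricts_to X D U v w" if U: "opX U" "U \<inter> D \<subseteq> V" "v \<in> VX U" "restrict t (U \<inter> D) = T.cls U v" for U v
  proof (rule w(2))
    have l: "T.lft V t U v" by (rule T.lft_iff_cls[OF U(1,2) _ U(4)]) (use U(3) in \<open>simp add: T_sect\<close>)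
    have "v \<in> LogX U" by (rule T_log_transfer[OF l]) (use * U(2) in blast)
    then show "P U v" unfolding P_def using l by blast
  qed
  then show "t \<in> TI V" unfolding tangent_image_def T_restrict_eq rs_T using * w(1) by blast
qed

lemma TI_lft:
  assumes V: "opY V" and t: "t \<in> TI V" and l: "T.lft V t U v"
  shows "v \<in> LogX U"
  by (rule T_log_transfer[OF l]) (use t T.lftD(2)[OF l] in \<open>unfold TI_iff[OF V], blast\<close>)

lemma TI_cls:
  assumes U: "opX U" and v: "v \<in> LogX U"
  shows "T.cls U v \<in> TI (U \<inter> D)"
proof -
  have s: "v \<in> sections T.FS U" using logvf[OF v] by (simp add: T_sect)
  show ?thesis unfolding TI_iff[OF L.openY_Int[OF U]]
    using T.cls_section[OF U s] T.lft_cls[OF U s] v by blast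
qed

lemma N_quotient: "germ_quotient Y T.Q Y D TI"
proof (intro germ_quotient.intro germ_quotient_axioms.intro)
  show "module_presheaf Y T.Q" by (rule T.Q_presheaf)
  show "points Y = subtopology (points Y) D" by (simp add: points_subspace subtopology_subtopology)
  show "D \<subseteq> topspace (points Y)" by (simp add: top_Y)
  show "ringed_space Y" by (rule T.rY)
  fix V assume V: "opY V"
  show "f \<in> hol Y V \<longleftrightarrow> f \<in> extensional V \<and> (\<forall>p\<in>V. \<exists>U. opY U \<and> p \<in> U \<and> (\<exists>g\<in>hol Y U. \<forall>x\<in>U \<inter> V. f x = g x))" for f
  proof (intro iffI conjI ballI)
    assume f: "f \<in> hol Y V"
    then show "f \<in> extensional V" by (rule Y.hol_ext[OF V])
    show "\<exists>U. opY U \<and> p \<in> U \<and> (\<exists>g\<in>hol Y U. \<forall>x\<in>U \<inter> V. f x = g x)" if "p \<in> V" for p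
      using V f that by (intro exI[of _ V]) auto
  next
    assume *: "f \<in> extensional V \<and> (\<forall>p\<in>V. \<exists>U. opY U \<and> p \<in> U \<and> (\<exists>g\<in>hol Y U. \<forall>x\<in>U \<inter> V. f x = g x))"
    show "f \<in> hol Y V"
    proof (rule Y.hol_local[OF V])
      fix p assume p: "p \<in> V"
      obtain U g where U: "opY U" "p \<in> U" "g \<in> hol Y U" "\<forall>x\<in>U \<inter> V. f x = g x" using * p by blast
      have "restrict f (U \<inter> V) = restrict g (U \<inter> V)" using U(4) by (intro restrict_ext) auto
      then show "\<exists>W\<in>opens Y V. p \<in> W \<and> restrict f W \<in> hol Y W"
        using Y.hol_restrict[OF U(1) opens_Int(1)[OF U(1) V] U(3)] opens_Int(2)[OF U(1) V] p U(2) by (intro bexI[of _ "U \<inter> V"]) auto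
    qed (use * in blast)
  qed
  note TIV = TI_iff[OF V]
  show "TI V \<subseteq> sections T.Q V" by (rule subsetI) (simp add: TIV)
  show "\<zero>\<^bsub>sect T.Q V\<^esub> \<in> TI V" unfolding TIV
  proof (intro conjI ballI T.Q_zero_closed[OF V])
    fix p assume "p \<in> V"
    then obtain U where U: "opX U" "p \<in> U" "U \<inter> D \<subseteq> V" using L.ex_zero[OF V] by blast
    show "\<exists>U v. p \<in> U \<and> T.lft V \<zero>\<^bsub>sect T.Q V\<^esub> U v \<and> v \<in> LogX U"
      using T.lft_zero[OF U(1,3)] L.S_zero[OF U(1)] U(2) unfolding op_simps by blast
  qed
  fix s assume s: "s \<in> TI V"
  have sQ: "s \<in> sections T.Q V" and sl: "\<And>p. p \<in> V \<Longrightarrow> \<exists>U v. p \<in> U \<and> T.lft V s U v \<and> v \<in> LogX U" using s unfolding TIV by blast+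
  show "s \<oplus>\<^bsub>sect T.Q V\<^esub> t \<in> TI V" if t: "t \<in> TI V" for t
    unfolding TIV
  proof (intro conjI ballI T.Q_add_closed[OF V sQ])
    show tQ: "t \<in> sections T.Q V" using t unfolding TIV by blast
    fix p assume p: "p \<in> V"
    obtain U v v' where U: "p \<in> U" "T.lft V s U v" "T.lft V t U v'" using T.ex_lft2[OF sQ tQ V p openin_topspace top_at[OF V p]] by blast
    show "\<exists>U v. p \<in> U \<and> T.lft V (s \<oplus>\<^bsub>sect T.Q V\<^esub> t) U v \<and> v \<in> LogX U"
      using T.lft_add[OF U(2,3)] L.S_plus[OF T.lftD(1)[OF U(2)] TI_lft[OF V s U(2)] TI_lft[OF V t U(3)]] U(1)
      unfolding op_simps by blast
  qed
  show "f \<odot>\<^bsub>sect T.Q V\<^esub> s \<in> TI V" if f: "f \<in> hol Y V" for f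
    unfolding TIV
  proof (intro conjI ballI T.Q_smult_closed[OF V sQ f])
    fix p assume p: "p \<in> V"
    obtain U v h where U: "p \<in> U" "T.lft V s U v" "T.ext_to V f U h" using T.ex_lft_ext[OF sQ f V p openin_topspace top_at[OF V p]] by blast
    show "\<exists>U v. p \<in> U \<and> T.lft V (f \<odot>\<^bsub>sect T.Q V\<^esub> s) U v \<and> v \<in> LogX U"
      using T.lft_smult[OF U(2,3) V] L.S_scale[OF T.lftD(1)[OF U(2)] T.ext_toD(3)[OF U(3)] TI_lft[OF V s U(2)]] U(1)
      unfolding op_simps by blast
  qed
next
  fix V f s assume V: "opY V" and f: "f \<in> ideal_sheaf Y D V" and s: "s \<in> sections T.Q V"
  have fh: "f \<in> hol Y V" and f0: "\<And>x. x \<in> V \<Longrightarrow> x \<in> D \<Longrightarrow> f x = 0" using f by (auto simp: ideal_sheaf_def)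
  show "f \<odot>\<^bsub>sect T.Q V\<^esub> s \<in> TI V" unfolding TI_iff[OF V]
  proof (intro conjI ballI T.Q_smult_closed[OF V s fh])
    fix p assume p: "p \<in> V"
    obtain U v h where U: "p \<in> U" "T.lft V s U v" "T.ext_to V f U h" using T.ex_lft_ext[OF s fh V p openin_topspace top_at[OF V p]] by blast
    note o = T.lftD(1,2)[OF U(2)] and v = T_lft_vf[OF U(2)] and h = T.ext_toD(3)[OF U(3)]
    \<comment> \<open>As \<open>V\<close> is contained in \<open>D\<close>, the function
      \<open>f\<close> is zero on \<open>V\<close> and its extension \<open>h\<close> vanishes on
      \<open>D\<close>; a multiple of a field by such a function is tangent.\<close>
    have h0: "h x = 0" if "x \<in> U" "x \<in> D" for x using T.ext_toD(4)[OF U(3) that] f0[of x] o(2) that by auto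
    have "vscale X U h v \<in> LogX U"
    proof (rule logI[OF vscale_vf[OF o(1) h v]])
      fix W k x assume W: "W \<in> opens X U" and k: "k \<in> hol X W" and x: "x \<in> W" "x \<in> D"
      show "vscale X U h v W k x = 0" using vscale_apply[OF W k x(1), of h v] h0[OF opens_mem[OF W x(1)] x(2)] by simp
    qed
    then show "\<exists>U v. p \<in> U \<and> T.lft V (f \<odot>\<^bsub>sect T.Q V\<^esub> s) U v \<and> v \<in> LogX U"
      using T.lft_smult[OF U(2,3) V] U(1) unfolding op_simps by blast
  qed
next
  fix V W s assume V: "opY V" and W: "W \<in> opens Y V" and s: "s \<in> TI V"
  have sQ: "s \<in> sections T.Q V" using s unfolding TI_iff[OF V] by blast
  show "res T.Q V W s \<in> TI W" unfolding TI_iff[OF opensD(1)[OF W]] T.Q_ops(4)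
  proof (intro conjI ballI T.Q_restrict_closed[OF V W sQ])
    fix p assume p: "p \<in> W"
    obtain N where N: "opX N" "p \<in> N" "N \<inter> D \<subseteq> W" using L.openY_trans[OF W p] by blast
    obtain U v where U: "p \<in> U" "U \<subseteq> N" "T.lft V s U v" using T.ex_lft[OF sQ V opens_mem[OF W p] N(1,2)] by blast
    have uw: "U \<inter> D \<subseteq> W" using U N by blast
    show "\<exists>U v. p \<in> U \<and> T.lft W (restrict s W) U v \<and> v \<in> LogX U"
      using T.lft_restrict[OF U(3) uw] TI_lft[OF V s U(3)] U(1) by blast
  qed
qed

end

sublocale divisor \<subseteq> N: germ_quotient "subspace_of X D" T.Q "subspace_of X D" D "tangent_image X D"
  by (rule N_quotient)

context divisor
begin

abbreviation "\<Gamma>N \<equiv> sections N.Q"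

lemma normal_bundle_eq: "normal_bundle X D = N.Q"
  by (simp add: normal_bundle_def T_restrict_eq)

text \<open>Lifting twice, sections of the normal bundle are represented by vector fields on \<open>X\<close>.\<close>

definition nlft :: "'a set \<Rightarrow> ('a, ('a, 'a vfield) qsection) qsection \<Rightarrow> 'a set \<Rightarrow> 'a vfield \<Rightarrow> bool" where
  "nlft V s U v \<longleftrightarrow> opX U \<and> v \<in> VX U \<and> N.lft V s (U \<inter> D) (T.cls U v)"

lemma nlftD:
  assumes "nlft V s U v"
  shows "opX U" "v \<in> VX U" "N.lft V s (U \<inter> D) (T.cls U v)" "U \<inter> D \<subseteq> V"
  using assms N.lftD(2) unfolding nlft_def by (auto dest: N.lftD(2))

lemma nlft_res: "nlft V s U v \<Longrightarrow> W \<in> opens X U \<Longrightarrow> nlft V s W (restrict v (opens X W))"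
proof -
  assume l: "nlft V s U v" and W: "W \<in> opens X U"
  note d = nlftD[OF l]
  have "W \<inter> D \<in> opens Y (U \<inter> D)" by (rule opens_Y_Int[OF opensD(1)[OF W]]) (use opensD(2)[OF W] in blast)
  from N.lft_res[OF d(3) this] show ?thesis
    unfolding nlft_def using T.cls_restrict[OF d(1) _ W, of v] d(2) opensD(1)[OF W] vres_vf[OF d(2) W]
    by (simp add: op_simps T.Q_ops(4))
qed

lemma ex_nlft:
  assumes s: "s \<in> \<Gamma>N V" and V: "opY V" and p: "p \<in> V" and M: "opX M" "p \<in> M"
  shows "\<exists>U v. p \<in> U \<and> U \<subseteq> M \<and> nlft V s U v"
proof -
  have pD: "p \<in> D" using p L.openY_sub[OF V] by blast
  obtain A t where A: "p \<in> A" "A \<subseteq> M \<inter> D" "N.lft V s A t"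
    using N.ex_lft[OF s V p L.openY_Int[OF M(1)]] M(2) pD by blast
  note d = N.lftD[OF A(3)]
  obtain U v where U: "p \<in> U" "U \<subseteq> M" "T.lft A t U v" using T.ex_lft[OF d(3,1) A(1) M] by blast
  note e = T.lftD(1,2)[OF U(3)]
  have "U \<inter> D \<in> opens Y A" by (rule opens_Y_Int[OF e])
  from N.lft_res[OF A(3) this] have "nlft V s U v"
    unfolding nlft_def using T.lft_eq_cls[OF U(3)] e(1) T_lft_vf[OF U(3)] by (simp add: T.Q_ops(4))
  then show ?thesis using U by blast
qed

lemma nlft_add:
  assumes "nlft V s U v" "nlft V s' U v'"
  shows "nlft V (s \<oplus>\<^bsub>sect N.Q V\<^esub> s') U (vplus X U v v')"
proof -
  note d = nlftD[OF assms(1)] nlftD[OF assms(2)]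
  have "T.cls U (vplus X U v v') = T.cls U v \<oplus>\<^bsub>sect T.Q (U \<inter> D)\<^esub> T.cls U v'"
    using T.cls_add[OF d(1), of v v'] d by (simp add: op_simps)
  then show ?thesis unfolding nlft_def using N.lft_add[OF d(3,7)] d(1) vplus_vf[OF d(2,6)] by simp
qed

lemma nlft_smult:
  assumes l: "nlft V s U v" and f: "L.ext_to V f U h" and V: "opY V"
  shows "nlft V (f \<odot>\<^bsub>sect N.Q V\<^esub> s) U (vscale X U h v)"
proof -
  note d = nlftD[OF l] and e = L.ext_toD[OF f]
  have x: "N.ext_to V f (U \<inter> D) (restrict h (U \<inter> D))"
    unfolding N.ext_to_def using L.openY_Int[OF e(1)] e L.hol_restrict_Y[OF e(1,3)] by auto
  have "T.cls U (vscale X U h v) = restrict h (U \<inter> D) \<odot>\<^bsub>sect T.Q (U \<inter> D)\<^esub> T.cls U v"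
    using T.cls_smult[OF d(1) _ e(3), of v] d(2) by (simp add: op_simps)
  then show ?thesis unfolding nlft_def using N.lft_smult[OF d(3) x V] d(1) vscale_vf[OF e(1,3) d(2)] by simp
qed

lemma nlft_restrict:
  assumes l: "nlft V s U v" and W: "U \<inter> D \<subseteq> W"
  shows "nlft W (restrict s W) U v"
  unfolding nlft_def using nlftD[OF l] N.lft_restrict[OF nlftD(3)[OF l], of W] W by auto

lemma N_eqI:
  assumes s: "s \<in> extensional V" "s' \<in> extensional V" and V: "opY V"
    and eq: "\<And>p. p \<in> V \<Longrightarrow> \<exists>U v. p \<in> U \<and> nlft V s U v \<and> nlft V s' U v"
  shows "s = s'"
proof (rule N.Q_eqI[OF s V])
  fix p assume p: "p \<in> V"
  obtain U v where U: "p \<in> U" "nlft V s U v" "nlft V s' U v" using eq[OF p] by blast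
  have "p \<in> U \<inter> D" using U(1) p L.openY_sub[OF V] by blast
  then show "\<exists>U v. p \<in> U \<and> N.lft V s U v \<and> N.lft V s' U v" using nlftD(3)[OF U(2)] nlftD(3)[OF U(3)] by blast
qed

lemma N_I:
  assumes s: "s \<in> extensional V" and V: "opY V" and loc: "\<And>p. p \<in> V \<Longrightarrow> \<exists>U v. p \<in> U \<and> nlft V s U v"
  shows "s \<in> \<Gamma>N V"
proof (rule N.Q_I[OF s _ V])
  fix p assume p: "p \<in> V"
  obtain U v where U: "p \<in> U" "nlft V s U v" using loc[OF p] by blast
  have "p \<in> U \<inter> D" using U(1) p L.openY_sub[OF V] by blast
  then show "\<exists>U v. p \<in> U \<and> N.lft V s U v" using nlftD(3)[OF U(2)] by blast
qed

lemma T_cls_minus: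
  assumes U: "opX U" and v: "v \<in> VX U" "w \<in> VX U"
  shows "T.cls U v \<ominus>\<^bsub>sect T.Q (U \<inter> D)\<^esub> T.cls U w = T.cls U (vminus U v w)"
proof -
  interpret abelian_group "sect T.Q (U \<inter> D)" by (rule T.Q_abelian_group[OF L.openY_Int[OF U]])
  note m = vminus_vf[OF U v]
  have c: "T.cls U x \<in> sections T.Q (U \<inter> D)" if "x \<in> VX U" for x
    by (rule T.cls_section[OF U]) (use that in \<open>simp add: T_sect\<close>)
  have "T.cls U v = T.cls U (vminus U v w) \<oplus>\<^bsub>sect T.Q (U \<inter> D)\<^esub> T.cls U w"
    using T.cls_add[OF U, of "vminus U v w" w] m v by (simp add: op_simps)
  then show ?thesis using c[OF m(1)] c[OF v(2)] by (simp add: a_minus_def a_assoc r_neg)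
qed

text \<open>Tangent fields are zero in the normal bundle, so a lift may be altered by one. This
  removes the term \<open>v(h) u\<close> in \<open>phi_smult\<close>.\<close>

lemma nlft_change:
  assumes l: "nlft V s U v" and w: "w \<in> VX U" and vw: "vminus U v w \<in> LogX U"
  shows "nlft V s U w"
proof -
  note d = nlftD[OF l]
  have c: "T.cls U x \<in> sections T.Q (U \<inter> D)" if "x \<in> VX U" for x
    by (rule T.cls_section[OF d(1)]) (use that in \<open>simp add: T_sect\<close>)
  note oD = L.openY_Int[OF d(1)]
  have "N.gm (U \<inter> D) (T.cls U v) q = N.gm (U \<inter> D) (T.cls U w) q" if q: "q \<in> U \<inter> D" for q
  proof -
    have "N.grel (U \<inter> D) (T.cls U v) (U \<inter> D) (T.cls U w) q" unfolding N.grel_def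
      using oD q N.res_self[OF oD c[OF d(2)]] N.res_self[OF oD c[OF w]] T_cls_minus[OF d(1,2) w] TI_cls[OF d(1) vw]
      by (intro bexI[of _ "U \<inter> D"]) (auto simp: opens_def)
    then show ?thesis using N.gm_eq_iff[OF oD oD c[OF d(2)] c[OF w] q q] by simp
  qed
  then have "N.lft V s (U \<inter> D) (T.cls U w)" using N.lftD[OF d(3)] c[OF w] unfolding N.lft_def by auto
  then show ?thesis unfolding nlft_def using d(1) w by blast
qed

text \<open>The kernel of the map from \<open>T\<^sub>X\<close> to the normal bundle consists, near
  a point of \<open>D\<close>, of the fields tangent to \<open>D\<close>. Equality of germs in the
  outer quotient gives a class in the image of \<open>T\<^sub>D\<close>, and \<open>TI_lft\<close>
  then speaks about its lift to \<open>X\<close>.\<close>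

lemma nlft_unique:
  assumes l: "nlft V s U v" "nlft V s U' v'" and q: "q \<in> U" "q \<in> U'" "q \<in> D"
  shows "\<exists>W\<in>opens X (U \<inter> U'). q \<in> W \<and> vminus W (restrict v (opens X W)) (restrict v' (opens X W)) \<in> LogX W"
proof -
  note d = nlftD[OF l(1)] and d' = nlftD[OF l(2)]
  have "N.grel (U \<inter> D) (T.cls U v) (U' \<inter> D) (T.cls U' v') q"
    by (rule N.lft_unique[OF d(3) d'(3)]) (use q in auto)
  then obtain A where A: "A \<in> opens Y ((U \<inter> D) \<inter> (U' \<inter> D))" "q \<in> A"
    "restrict (T.cls U v) A \<ominus>\<^bsub>sect T.Q A\<^esub> restrict (T.cls U' v') A \<in> TI A"
    unfolding N.grel_def T.Q_ops(4) by blast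
  note oA = opensD(1)[OF A(1)]
  obtain M where M: "opX M" "A = M \<inter> D" using oA unfolding open_Y by blast
  define W where "W = M \<inter> U \<inter> U'"
  have W: "W \<in> opens X U" "W \<in> opens X U'" "W \<in> opens X (U \<inter> U')" "opX W" "q \<in> W"
    using M d(1) d'(1) q A(2) by (auto simp: W_def opens_def)
  have WD: "W \<inter> D \<in> opens Y A" by (rule opens_Y_Int[OF W(4)]) (use M(2) in \<open>auto simp: W_def\<close>)
  let ?v = "restrict v (opens X W)" and ?v' = "restrict v' (opens X W)"
  note vw = vres_vf[OF d(2) W(1)] vres_vf[OF d'(2) W(2)]
  have s: "T.cls U v \<in> sections T.Q (U \<inter> D)" "T.cls U' v' \<in> sections T.Q (U' \<inter> D)"
    using T.cls_section[OF d(1), of v] T.cls_section[OF d'(1), of v'] d(2) d'(2) by (simp_all add: T_sect)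
  have AU: "A \<in> opens Y (U \<inter> D)" "A \<in> opens Y (U' \<inter> D)" using A(1) by (auto simp: opens_def)
  have rr: "restrict (restrict z A) (W \<inter> D) = restrict z (W \<inter> D)" for z :: "('a, 'a vfield) qsection"
    using opensD(2)[OF WD] by (simp add: Int_absorb1)
  have "restrict (restrict (T.cls U v) A \<ominus>\<^bsub>sect T.Q A\<^esub> restrict (T.cls U' v') A) (W \<inter> D) \<in> TI (W \<inter> D)"
    using N.G_res[OF oA WD A(3)] by (simp add: T.Q_ops(4))
  moreover have "restrict (restrict (T.cls U v) A \<ominus>\<^bsub>sect T.Q A\<^esub> restrict (T.cls U' v') A) (W \<inter> D) = T.cls W (vminus W ?v ?v')"
    using N.res_minus[OF WD oA T.Q_restrict_closed[OF L.openY_Int[OF d(1)] AU(1) s(1)] T.Q_restrict_closed[OF L.openY_Int[OF d'(1)] AU(2) s(2)]]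
      T_cls_minus[OF W(4) vw] T.cls_restrict[OF d(1) _ W(1), of v] T.cls_restrict[OF d'(1) _ W(2), of v'] d(2) d'(2) rr
    by (simp add: T.Q_ops(4) op_simps)
  ultimately have TIW: "T.cls W (vminus W ?v ?v') \<in> TI (W \<inter> D)" by simp
  have "T.lft (W \<inter> D) (T.cls W (vminus W ?v ?v')) W (vminus W ?v ?v')"
    by (rule T.lft_cls[OF W(4)]) (use vminus_vf(1)[OF W(4) vw] in \<open>simp add: T_sect\<close>)
  from TI_lft[OF L.openY_Int[OF W(4)] TIW this] show ?thesis using W(3,5) by blast
qed

end

section \<open>The normal bundle in an adapted chart\<close>

context adapted_divisor
begin

text \<open>A function \<open>f\<close> vanishing on \<open>D\<close> is \<open>x\<^sub>0 g\<close>,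
  and on \<open>D\<close> the Leibniz rule leaves only \<open>v(x\<^sub>0) g\<close>. So tangency
  has to be tested on \<open>x\<^sub>0\<close> alone.\<close>

lemma log_from_crd0:
  assumes W: "W \<in> opens X U" and v: "v \<in> VX W" and z: "\<And>q. q \<in> W \<Longrightarrow> q \<in> D \<Longrightarrow> v W (crd 0 W) q = 0"
  shows "v \<in> LogX W"
proof (rule logI[OF v])
  fix V f q assume V: "V \<in> opens X W" and f: "f \<in> hol X V" and f0: "\<And>x. x \<in> V \<Longrightarrow> x \<in> D \<Longrightarrow> f x = 0" and q: "q \<in> V" "q \<in> D"
  note VU = opens_trans[OF V W] and o = opensD(1)[OF V]
  have f0': "f y = 0" if "y \<in> V" "\<phi> y 0 = 0" for y using f0 that in_D opens_mem[OF VU that(1)] by blast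
  obtain g where g: "g \<in> hol X V" "\<forall>y\<in>V. f y = (\<phi> y 0 - 0) * g y" using divide_crd[OF VU n_pos f f0'] by blast
  have "f = (\<lambda>y\<in>V. crd 0 V y * g y)"
    by (rule hol_eqI[OF o f hol_mult[OF o crd_hol[OF VU n_pos] g(1)]]) (use g(2) in \<open>simp add: crd_apply\<close>)
  moreover have "v V (crd 0 V) q = 0"
    using vf_res[OF v opens_refl[OF opensD(1)[OF W]] crd_hol[OF W n_pos] V q(1)] z[OF opens_mem[OF V q(1)] q(2)]
    by (simp add: crd_restrict[OF V])
  ultimately show "v V f q = 0"
    using vf_mult[OF v V crd_hol[OF VU n_pos] g(1) q(1)] crd0_D[OF VU q] by simp
qed

text \<open>The trivialisation of the normal bundle by \<open>dx\<^sub>0\<close>: a section with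
  lift \<open>v\<close> is sent to \<open>v(x\<^sub>0)\<close> on \<open>D\<close>, which does not
  change when a tangent field is added to \<open>v\<close>.\<close>

definition nu :: "'a set \<Rightarrow> ('a, ('a, 'a vfield) qsection) qsection \<Rightarrow> 'a \<Rightarrow> complex" where
  "nu V s = (\<lambda>q\<in>V. THE y. \<exists>W v. q \<in> W \<and> W \<subseteq> U \<and> nlft V s W v \<and> y = v W (crd 0 W) q)"

lemma nu_value_unique:
  assumes "nlft V s W v" "nlft V s W' v'" "W \<subseteq> U" "W' \<subseteq> U" "q \<in> W" "q \<in> W'" "q \<in> D"
  shows "v W (crd 0 W) q = v' W' (crd 0 W') q"
proof -
  note d = nlftD[OF assms(1)] and d' = nlftD[OF assms(2)]
  have WU: "W \<in> opens X U" "W' \<in> opens X U" using d(1) d'(1) assms(3,4) by (auto simp: opens_def)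
  obtain Z where Z: "Z \<in> opens X (W \<inter> W')" "q \<in> Z" "vminus Z (restrict v (opens X Z)) (restrict v' (opens X Z)) \<in> LogX Z"
    using nlft_unique[OF assms(1,2,5,6,7)] by blast
  have s: "Z \<in> opens X W" "Z \<in> opens X W'" "Z \<in> opens X U" using Z(1) WU by (auto simp: opens_def)
  note oZ = opensD(1)[OF s(1)] and ZZ = opens_refl[OF opensD(1)[OF s(1)]]
  have "restrict v (opens X Z) Z (crd 0 Z) q - restrict v' (opens X Z) Z (crd 0 Z) q = 0"
    using log_crd0[OF Z(3) s(3) Z(2) assms(7)]
      vminus_apply[OF oZ vres_vf[OF d(2) s(1)] vres_vf[OF d'(2) s(2)] ZZ crd_hol[OF s(3) n_pos] Z(2)] by simp
  then have "v Z (crd 0 Z) q = v' Z (crd 0 Z) q" using ZZ by simp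
  then show ?thesis
    using vf_res[OF d(2) opens_refl[OF d(1)] crd_hol[OF WU(1) n_pos] s(1) Z(2)] crd_restrict[OF s(1)]
      vf_res[OF d'(2) opens_refl[OF d'(1)] crd_hol[OF WU(2) n_pos] s(2) Z(2)] crd_restrict[OF s(2)] by simp
qed

lemma nu_lft:
  assumes l: "nlft V s W v" and W: "W \<subseteq> U" and q: "q \<in> W" "q \<in> D"
  shows "nu V s q = v W (crd 0 W) q"
proof -
  have "q \<in> V" using nlftD(4)[OF l] q by blast
  moreover have "(THE y. \<exists>W v. q \<in> W \<and> W \<subseteq> U \<and> nlft V s W v \<and> y = v W (crd 0 W) q) = v W (crd 0 W) q"
  proof (rule the_equality)
    show "\<exists>W' v'. q \<in> W' \<and> W' \<subseteq> U \<and> nlft V s W' v' \<and> v W (crd 0 W) q = v' W' (crd 0 W') q" using l W q by blast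
  qed (use nu_value_unique[OF _ l _ W _ q] in blast)
  ultimately show ?thesis by (simp add: nu_def)
qed

lemma nu_hol:
  assumes V: "V \<in> opens Y (U \<inter> D)" and s: "s \<in> \<Gamma>N V"
  shows "nu V s \<in> hol Y V"
proof (rule L.holY_I[OF opensD(1)[OF V]])
  show "nu V s \<in> extensional V" by (simp add: nu_def)
  fix p assume p: "p \<in> V"
  obtain W v where W: "p \<in> W" "W \<subseteq> U" "nlft V s W v" using ex_nlft[OF s opensD(1)[OF V] p openU] opens_mem[OF V p] by blast
  note d = nlftD[OF W(3)]
  have WU: "W \<in> opens X U" using d(1) W(2) by (simp add: opens_def)
  have "L.ext_to V (nu V s) W (v W (crd 0 W))" unfolding L.ext_to_def
    using d(1,4) vf_crd_hol[OF d(2) WU n_pos] nu_lft[OF W(3,2)] by auto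
  then show "\<exists>W h. p \<in> W \<and> L.ext_to V (nu V s) W h" using W(1) by blast
qed

lemma ex_nlft2:
  assumes s: "s \<in> \<Gamma>N V" "s' \<in> \<Gamma>N V" and V: "opY V" and p: "p \<in> V" and M: "opX M" "p \<in> M"
  shows "\<exists>U v v'. p \<in> U \<and> U \<subseteq> M \<and> nlft V s U v \<and> nlft V s' U v'"
proof -
  obtain U v where U: "p \<in> U" "U \<subseteq> M" "nlft V s U v" using ex_nlft[OF s(1) V p M] by blast
  obtain U' v' where U': "p \<in> U'" "U' \<subseteq> U" "nlft V s' U' v'" using ex_nlft[OF s(2) V p nlftD(1)[OF U(3)] U(1)] by blast
  have "U' \<in> opens X U" using U'(2) nlftD(1)[OF U'(3)] by (simp add: opens_def)
  then show ?thesis using nlft_res[OF U(3)] U U' by blast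
qed

lemma nu_add:
  assumes V: "V \<in> opens Y (U \<inter> D)" and s: "s \<in> \<Gamma>N V" "s' \<in> \<Gamma>N V" and q: "q \<in> V"
  shows "nu V (s \<oplus>\<^bsub>sect N.Q V\<^esub> s') q = nu V s q + nu V s' q"
proof -
  have qU: "q \<in> U" "q \<in> D" using opens_mem[OF V q] by auto
  obtain W v v' where W: "q \<in> W" "W \<subseteq> U" "nlft V s W v" "nlft V s' W v'" using ex_nlft2[OF s opensD(1)[OF V] q openU qU(1)] by blast
  note o = nlftD(1)[OF W(3)]
  have WU: "W \<in> opens X U" using o W(2) by (simp add: opens_def)
  show ?thesis using nu_lft[OF nlft_add[OF W(3,4)] W(2,1) qU(2)] nu_lft[OF W(3,2,1) qU(2)] nu_lft[OF W(4,2,1) qU(2)]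
      vplus_apply[OF opens_refl[OF o] crd_hol[OF WU n_pos] W(1)] by simp
qed

lemma nu_smult:
  assumes V: "V \<in> opens Y (U \<inter> D)" and s: "s \<in> \<Gamma>N V" and f: "f \<in> hol Y V" and q: "q \<in> V"
  shows "nu V (f \<odot>\<^bsub>sect N.Q V\<^esub> s) q = f q * nu V s q"
proof -
  have qU: "q \<in> U" "q \<in> D" using opens_mem[OF V q] by auto
  obtain W v where W: "q \<in> W" "W \<subseteq> U" "nlft V s W v" using ex_nlft[OF s opensD(1)[OF V] q openU qU(1)] by blast
  obtain Z h where Z: "q \<in> Z" "Z \<subseteq> W" "L.ext_to V f Z h" using L.ex_ext[OF f opensD(1)[OF V] q nlftD(1)[OF W(3)] W(1)] by blast
  note o = L.ext_toD(1)[OF Z(3)]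
  have ZW: "Z \<in> opens X W" "Z \<in> opens X U" "Z \<subseteq> U" using o W(2) Z(2) by (auto simp: opens_def)
  note l = nlft_res[OF W(3) ZW(1)]
  show ?thesis using nu_lft[OF nlft_smult[OF l Z(3) opensD(1)[OF V]] ZW(3) Z(1) qU(2)] nu_lft[OF l ZW(3) Z(1) qU(2)]
      vscale_apply[OF opens_refl[OF o] crd_hol[OF ZW(2) n_pos] Z(1)] L.ext_toD(4)[OF Z(3,1) qU(2)] by simp
qed

text \<open>If \<open>v(x\<^sub>0)\<close> and \<open>v'(x\<^sub>0)\<close> agree on
  \<open>D\<close>, then \<open>v - v'\<close> is tangent by \<open>log_from_crd0\<close>.\<close>

lemma nu_inj:
  assumes V: "V \<in> opens Y (U \<inter> D)" and s: "s \<in> \<Gamma>N V" "s' \<in> \<Gamma>N V" and eq: "\<And>q. q \<in> V \<Longrightarrow> nu V s q = nu V s' q"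
  shows "s = s'"
proof (rule N_eqI[OF N.Q_ext[OF s(1)] N.Q_ext[OF s(2)] opensD(1)[OF V]])
  fix p assume p: "p \<in> V"
  have pU: "p \<in> U" "p \<in> D" using opens_mem[OF V p] by auto
  obtain W v v' where W: "p \<in> W" "W \<subseteq> U" "nlft V s W v" "nlft V s' W v'" using ex_nlft2[OF s opensD(1)[OF V] p openU pU(1)] by blast
  note d = nlftD[OF W(3)] and d' = nlftD[OF W(4)]
  have WU: "W \<in> opens X U" using d(1) W(2) by (simp add: opens_def)
  have "vminus W v v' \<in> LogX W"
  proof (rule log_from_crd0[OF WU vminus_vf(1)[OF d(1,2) d'(2)]])
    fix q assume q: "q \<in> W" "q \<in> D"
    then have "q \<in> V" using d(4) by blast
    then show "vminus W v v' W (crd 0 W) q = 0"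
      using vminus_apply[OF d(1,2) d'(2) opens_refl[OF d(1)] crd_hol[OF WU n_pos] q(1)] eq nu_lft[OF W(3,2) q] nu_lft[OF W(4,2) q] by simp
  qed
  then have "nlft V s W v'" by (rule nlft_change[OF W(3) d'(2)])
  then show "\<exists>U v. p \<in> U \<and> nlft V s U v \<and> nlft V s' U v" using W(1,4) by blast
qed

text \<open>The generator of the normal bundle given by \<open>\<partial>\<^sub>0\<close>, dual to
  \<open>nu\<close>.\<close>

definition ngen :: "'a set \<Rightarrow> ('a, ('a, 'a vfield) qsection) qsection" where
  "ngen V = restrict (N.cls (U \<inter> D) (T.cls U (dd 0))) V"

lemma ngen_nlft0: "nlft (U \<inter> D) (N.cls (U \<inter> D) (T.cls U (dd 0))) U (dd 0)"
proof -
  have c: "T.cls U (dd 0) \<in> sections T.Q (U \<inter> D)" by (rule T.cls_section[OF openU]) (use dd_vf[OF n_pos] in \<open>simp add: T_sect\<close>)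
  have "N.lft (U \<inter> D) (N.cls (U \<inter> D) (T.cls U (dd 0))) (U \<inter> D) (T.cls U (dd 0))"
    using N.lft_cls[OF L.openY_Int[OF openU] c] by (simp add: Int_absorb2 Int_assoc)
  then show ?thesis unfolding nlft_def using openU dd_vf[OF n_pos] by blast
qed

lemma ngen_nlft:
  assumes V: "V \<in> opens Y (U \<inter> D)" and W: "W \<in> opens X U" "W \<inter> D \<subseteq> V"
  shows "nlft V (ngen V) W (restrict (dd 0) (opens X W))"
  unfolding ngen_def by (rule nlft_restrict[OF nlft_res[OF ngen_nlft0 W(1)] W(2)])

lemma ngen_section:
  assumes V: "V \<in> opens Y (U \<inter> D)" shows "ngen V \<in> \<Gamma>N V"
proof (rule N_I[OF _ opensD(1)[OF V]])
  show "ngen V \<in> extensional V" by (simp add: ngen_def)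
  fix p assume p: "p \<in> V"
  obtain M where M: "opX M" "p \<in> M" "M \<inter> D \<subseteq> V" using L.ex_zero[OF opensD(1)[OF V] p] by blast
  have "U \<inter> M \<in> opens X U" "U \<inter> M \<inter> D \<subseteq> V" "p \<in> U \<inter> M" using opens_Int(1)[OF openU M(1)] M opens_mem[OF V p] by auto
  then show "\<exists>W v. p \<in> W \<and> nlft V (ngen V) W v" using ngen_nlft[OF V] by blast
qed

lemma nu_ngen:
  assumes V: "V \<in> opens Y (U \<inter> D)" and q: "q \<in> V" shows "nu V (ngen V) q = 1"
proof -
  have qU: "q \<in> U" "q \<in> D" using opens_mem[OF V q] by auto
  obtain M where M: "opX M" "q \<in> M" "M \<inter> D \<subseteq> V" using L.ex_zero[OF opensD(1)[OF V] q] by blast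
  define W where "W = U \<inter> M"
  have W: "W \<in> opens X U" "W \<inter> D \<subseteq> V" "q \<in> W" "W \<subseteq> U" using opens_Int(1)[OF openU M(1)] M qU by (auto simp: W_def)
  show ?thesis
    using nu_lft[OF ngen_nlft[OF V W(1,2)] W(4,3) qU(2)] pd_crd[OF W(1) n_pos W(3), of 0] dd_apply[OF W(1) crd_hol[OF W(1) n_pos]]
      opens_refl[OF opensD(1)[OF W(1)]] by simp
qed

lemma nu_decomp:
  assumes V: "V \<in> opens Y (U \<inter> D)" and s: "s \<in> \<Gamma>N V"
  shows "s = nu V s \<odot>\<^bsub>sect N.Q V\<^esub> ngen V"
proof (rule nu_inj[OF V s N.Q_smult_closed[OF opensD(1)[OF V] ngen_section[OF V] nu_hol[OF V s]]])
  show "nu V s q = nu V (nu V s \<odot>\<^bsub>sect N.Q V\<^esub> ngen V) q" if "q \<in> V" for q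
    using nu_smult[OF V ngen_section[OF V] nu_hol[OF V s] that] nu_ngen[OF V that] by simp
qed

end

section \<open>The action on the normal bundle\<close>

context divisor
begin

text \<open>The germ in the normal bundle of a field on \<open>X\<close>, taken through both
  quotients at once.\<close>

definition ngm :: "'a set \<Rightarrow> 'a vfield \<Rightarrow> 'a \<Rightarrow> ('a set \<times> ('a, 'a vfield) qsection) set" where
  "ngm U v q = N.gm (U \<inter> D) (T.cls U v) q"

lemma T_cls_sect: "opX U \<Longrightarrow> v \<in> VX U \<Longrightarrow> T.cls U v \<in> sections T.Q (U \<inter> D)"
  by (rule T.cls_section) (simp_all add: T_sect)

lemma ngm_res:
  assumes U: "opX U" and v: "v \<in> VX U" and W: "W \<in> opens X U" and q: "q \<in> W" "q \<in> D"
  shows "ngm W (restrict v (opens X W)) q = ngm U v q"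
proof -
  have WD: "W \<inter> D \<in> opens Y (U \<inter> D)" by (rule opens_Y_Int[OF opensD(1)[OF W]]) (use opensD(2)[OF W] in blast)
  have "restrict (T.cls U v) (W \<inter> D) = T.cls W (restrict v (opens X W))"
    using T.cls_restrict[OF U _ W, of v] v by (simp add: op_simps)
  then show ?thesis unfolding ngm_def
    using N.gm_res[OF L.openY_Int[OF U] T_cls_sect[OF U v] WD, of q] q by (simp add: T.Q_ops(4))
qed

lemma ngm_cong:
  assumes U: "opX U" and v: "v \<in> VX U" "w \<in> VX U"
    and vw: "vminus U v w \<in> LogX U" and q: "q \<in> U" "q \<in> D"
  shows "ngm U v q = ngm U w q"
proof -
  note oD = L.openY_Int[OF U] and c = T_cls_sect[OF U v(1)] T_cls_sect[OF U v(2)]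
  have "N.grel (U \<inter> D) (T.cls U v) (U \<inter> D) (T.cls U w) q" unfolding N.grel_def
    using oD q N.res_self[OF oD c(1)] N.res_self[OF oD c(2)] T_cls_minus[OF U v] TI_cls[OF U vw]
    by (intro bexI[of _ "U \<inter> D"]) (auto simp: opens_def)
  then show ?thesis unfolding ngm_def using N.gm_eq_iff[OF oD oD c, of q] q by simp
qed

lemma nlftI:
  assumes "opX U" "U \<inter> D \<subseteq> V" "v \<in> VX U" "\<And>q. q \<in> U \<Longrightarrow> q \<in> D \<Longrightarrow> s q = ngm U v q"
  shows "nlft V s U v"
  unfolding nlft_def N.lft_def using assms L.openY_Int[OF assms(1)] T_cls_sect[OF assms(1,3)] by (auto simp: ngm_def)

text \<open>In \<open>bracket_difference\<close> the term \<open>[u - u', v]\<close> is tangent by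
  \<open>ideal_bracket_vf\<close>, and \<open>[u', v - v']\<close> is tangent because both of its
  arguments are.\<close>

lemma bracket_ngm_unique:
  assumes t: "L.lft V t U u" "L.lft V t U' u'" and s: "nlft V' s U v" "nlft V' s U' v'" and q: "q \<in> U" "q \<in> U'" "q \<in> D"
  shows "ngm U (brk U u v) q = ngm U' (brk U' u' v') q"
proof -
  note u = lft_log[OF t(1)] lft_log[OF t(2)] and v = nlftD(2)[OF s(1)] nlftD(2)[OF s(2)] and oU = nlftD(1)[OF s(1)] nlftD(1)[OF s(2)]
  note uv = logvf[OF u(1)] logvf[OF u(2)]
  obtain A where A: "A \<in> opens X (U \<inter> U')" "q \<in> A" "vminus A (restrict u (opens X A)) (restrict u' (opens X A)) \<in> IL A"
    using L_lft_near[OF t q] by blast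
  obtain B where B: "B \<in> opens X (U \<inter> U')" "q \<in> B" "vminus B (restrict v (opens X B)) (restrict v' (opens X B)) \<in> LogX B"
    using nlft_unique[OF s q] by blast
  define W where "W = A \<inter> B"
  note o = opensD(1)[OF A(1)] opensD(1)[OF B(1)]
  have i: "W \<in> opens X A" "W \<in> opens X B" "W \<in> opens X U" "W \<in> opens X U'" "q \<in> W" "opX W"
    using A(1,2) B(1,2) o by (auto simp: W_def opens_def)
  let ?u = "restrict u (opens X W)" and ?u' = "restrict u' (opens X W)" and ?v = "restrict v (opens X W)" and ?v' = "restrict v' (opens X W)"
  note lu = log_res[OF u(1) i(3)] log_res[OF u(2) i(4)] and vv = vres_vf[OF v(1) i(3)] vres_vf[OF v(2) i(4)]
  note b = bracket_vf[OF logvf[OF lu(1)] vv(1)] bracket_vf[OF logvf[OF lu(2)] vv(2)]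
  have x: "vminus W ?u ?u' \<in> IL W"
    using L.ideal_times_res[OF o(1) i(1) A(3)] vminus_res[OF A(1) uv i(1)] by (simp add: op_simps)
  have y: "vminus W ?v ?v' \<in> LogX W" using log_res[OF B(3) i(2)] vminus_res[OF B(1) v i(2)] by simp
  have "ngm W (brk W ?u ?v) q = ngm W (brk W ?u' ?v') q"
    by (rule ngm_cong[OF i(6) b _ i(5) q(3)])
      (simp only: bracket_difference[OF i(6) logvf[OF lu(1)] logvf[OF lu(2)] vv] L.S_plus[OF i(6) ideal_bracket_vf[OF i(6) x vv(1)] log_bracket[OF lu(2) y]])
  then show ?thesis
    using ngm_res[OF oU(1) bracket_vf[OF uv(1) v(1)] i(3,5) q(3)] ngm_res[OF oU(2) bracket_vf[OF uv(2) v(2)] i(4,5) q(3)]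
    by (simp only: bracket_res[OF uv(1) v(1) i(3)] bracket_res[OF uv(2) v(2) i(4)])
qed

definition phi :: "'a set \<Rightarrow> ('a, 'a vfield) qsection \<Rightarrow> ('a, ('a, ('a, 'a vfield) qsection) qsection) operator" where
  "phi V t = (\<lambda>V'\<in>opens Y V. \<lambda>s\<in>\<Gamma>N V'. \<lambda>q\<in>V'.
     THE c. \<exists>U u v. q \<in> U \<and> L.lft V t U u \<and> nlft V' s U v \<and> c = ngm U (brk U u v) q)"

lemma phi_lft:
  assumes V': "V' \<in> opens Y V" and s: "s \<in> \<Gamma>N V'" and t: "L.lft V t U u" and l: "nlft V' s U v"
  shows "nlft V' (phi V t V' s) U (brk U u v)"
proof (rule nlftI[OF nlftD(1,4)[OF l] bracket_vf[OF logvf[OF lft_log[OF t]] nlftD(2)[OF l]]])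
  fix q assume q: "q \<in> U" "q \<in> D"
  have "(THE c. \<exists>U u v. q \<in> U \<and> L.lft V t U u \<and> nlft V' s U v \<and> c = ngm U (brk U u v) q) = ngm U (brk U u v) q"
  proof (rule the_equality)
    fix c assume "\<exists>U u v. q \<in> U \<and> L.lft V t U u \<and> nlft V' s U v \<and> c = ngm U (brk U u v) q"
    then obtain U' u' v' where "q \<in> U'" "L.lft V t U' u'" "nlft V' s U' v'" "c = ngm U' (brk U' u' v') q" by blast
    then show "c = ngm U (brk U u v) q" using bracket_ngm_unique[OF _ t _ l _ q] by simp
  qed (use q t l in blast)
  moreover have "q \<in> V'" using nlftD(4)[OF l] q by blast
  ultimately show "phi V t V' s q = ngm U (brk U u v) q" using V' s by (simp add: phi_def)
qed

lemma ex_phi: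
  assumes V: "opY V" and t: "t \<in> \<Gamma>L V" and V': "V' \<in> opens Y V" and s: "s \<in> \<Gamma>N V'"
    and p: "p \<in> V'" and M: "opX M" "p \<in> M"
  shows "\<exists>U u v. p \<in> U \<and> U \<subseteq> M \<and> L.lft V t U u \<and> nlft V' s U v"
proof -
  obtain U u where U: "p \<in> U" "U \<subseteq> M" "L.lft V t U u" using L.ex_lft[OF t V opens_mem[OF V' p] M] by blast
  obtain W v where W: "p \<in> W" "W \<subseteq> U" "nlft V' s W v" using ex_nlft[OF s opensD(1)[OF V'] p L.lftD(1)[OF U(3)] U(1)] by blast
  have "W \<in> opens X U" using W(2) nlftD(1)[OF W(3)] by (simp add: opens_def)
  then show ?thesis using L.lft_res[OF U(3)] U W by blast
qed

lemma ex_phi_ext: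
  assumes V: "opY V" and t: "t \<in> \<Gamma>L V" and V': "V' \<in> opens Y V" and s: "s \<in> \<Gamma>N V'"
    and f: "f \<in> hol Y A" and A: "opY A" "p \<in> A" and p: "p \<in> V'"
  shows "\<exists>U u v h. p \<in> U \<and> L.lft V t U u \<and> nlft V' s U v \<and> L.ext_to A f U h"
proof -
  obtain U h where U: "p \<in> U" "L.ext_to A f U h" using L.ex_ext[OF f A openin_topspace top_at[OF A]] by blast
  obtain W u v where W: "p \<in> W" "W \<subseteq> U" "L.lft V t W u" "nlft V' s W v" using ex_phi[OF V t V' s p L.ext_toD(1)[OF U(2)] U(1)] by blast
  have "W \<in> opens X U" using W(2) nlftD(1)[OF W(4)] by (simp add: opens_def)
  then show ?thesis using L.ext_to_res[OF U(2)] W by blast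
qed

lemma ex_phi2:
  assumes V: "opY V" and t: "t \<in> \<Gamma>L V" "t' \<in> \<Gamma>L V" and V': "V' \<in> opens Y V"
    and s: "s \<in> \<Gamma>N V'" "s' \<in> \<Gamma>N V'" and p: "p \<in> V'"
  shows "\<exists>U u u' v v'. p \<in> U \<and> L.lft V t U u \<and> L.lft V t' U u' \<and> nlft V' s U v \<and> nlft V' s' U v'"
proof -
  have top: "p \<in> topspace (points X)" by (rule top_at[OF opensD(1)[OF V'] p])
  obtain U u v where U: "p \<in> U" "L.lft V t U u" "nlft V' s U v" using ex_phi[OF V t(1) V' s(1) p openin_topspace top] by blast
  obtain W u' v' where W: "p \<in> W" "W \<subseteq> U" "L.lft V t' W u'" "nlft V' s' W v'" using ex_phi[OF V t(2) V' s(2) p nlftD(1)[OF U(3)] U(1)] by blast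
  have "W \<in> opens X U" using W(2) nlftD(1)[OF W(4)] by (simp add: opens_def)
  then show ?thesis using L.lft_res[OF U(2)] nlft_res[OF U(3)] W by blast
qed

lemma phi_ext: "V' \<in> opens Y V \<Longrightarrow> s \<in> \<Gamma>N V' \<Longrightarrow> phi V t V' s \<in> extensional V'"
  by (simp add: phi_def)

lemma phi_closed:
  assumes V: "opY V" and t: "t \<in> \<Gamma>L V" and V': "V' \<in> opens Y V" and s: "s \<in> \<Gamma>N V'"
  shows "phi V t V' s \<in> \<Gamma>N V'"
proof (rule N_I[OF phi_ext[OF V' s] opensD(1)[OF V']])
  fix p assume p: "p \<in> V'"
  show "\<exists>U v. p \<in> U \<and> nlft V' (phi V t V' s) U v"
    using ex_phi[OF V t V' s p openin_topspace top_at[OF opensD(1)[OF V'] p]] phi_lft[OF V' s] by blast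
qed

lemma rho_ext:
  assumes V: "opY V" and t: "t \<in> \<Gamma>L V" and l: "L.lft V t U u"
    and V': "V' \<in> opens Y V" and f: "f \<in> hol Y V'" and e: "L.ext_to V' f U h"
  shows "L.ext_to V' (rho V t V' f) U (u U h)"
proof -
  note o = L.ext_toD[OF e] and UU = opens_refl[OF L.ext_toD(1)[OF e]]
  show ?thesis unfolding L.ext_to_def
    using o vf_hol[OF logvf[OF lft_log[OF l]] UU o(3)] rho_value[OF V t l V' f e UU] by auto
qed

lemma phi_leibniz:
  assumes V: "opY V" and t: "t \<in> \<Gamma>L V" and V': "V' \<in> opens Y V" and s: "s \<in> \<Gamma>N V'" and f: "f \<in> hol Y V'"
  shows "phi V t V' (f \<odot>\<^bsub>sect N.Q V'\<^esub> s) = f \<odot>\<^bsub>sect N.Q V'\<^esub> phi V t V' s \<oplus>\<^bsub>sect N.Q V'\<^esub> rho V t V' f \<odot>\<^bsub>sect N.Q V'\<^esub> s"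
proof -
  note oV' = opensD(1)[OF V']
  note fs = N.Q_smult_closed[OF oV' s f]
  show ?thesis
  proof (rule N_eqI[OF phi_ext[OF V' fs] N.Q_op_ext(2) oV'])
    fix p assume p: "p \<in> V'"
    obtain U u v h where U: "p \<in> U" "L.lft V t U u" "nlft V' s U v" "L.ext_to V' f U h" using ex_phi_ext[OF V t V' s f oV' p p] by blast
    note u = logvf[OF lft_log[OF U(2)]] and d = nlftD[OF U(3)] and e = L.ext_toD(3)[OF U(4)]
    show "\<exists>U v. p \<in> U \<and> nlft V' (phi V t V' (f \<odot>\<^bsub>sect N.Q V'\<^esub> s)) U v \<and>
        nlft V' (f \<odot>\<^bsub>sect N.Q V'\<^esub> phi V t V' s \<oplus>\<^bsub>sect N.Q V'\<^esub> rho V t V' f \<odot>\<^bsub>sect N.Q V'\<^esub> s) U v"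
      using phi_lft[OF V' fs U(2) nlft_smult[OF U(3,4) oV']] U(1)
        nlft_add[OF nlft_smult[OF phi_lft[OF V' s U(2,3)] U(4) oV'] nlft_smult[OF U(3) rho_ext[OF V t U(2) V' f U(4)] oV']]
      unfolding bracket_scale_right[OF d(1) u d(2) e] by blast
  qed
qed

lemma phi_add_right:
  assumes V: "opY V" and t: "t \<in> \<Gamma>L V" and V': "V' \<in> opens Y V" and s: "s \<in> \<Gamma>N V'" "s' \<in> \<Gamma>N V'"
  shows "phi V t V' (s \<oplus>\<^bsub>sect N.Q V'\<^esub> s') = phi V t V' s \<oplus>\<^bsub>sect N.Q V'\<^esub> phi V t V' s'"
proof -
  note oV' = opensD(1)[OF V']
  note ss = N.Q_add_closed[OF oV' s]
  show ?thesis
  proof (rule N_eqI[OF phi_ext[OF V' ss] N.Q_op_ext(2) oV'])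
    fix p assume p: "p \<in> V'"
    obtain U u v v' where U: "p \<in> U" "L.lft V t U u" "nlft V' s U v" "nlft V' s' U v'" using ex_phi2[OF V t t V' s p] by blast
    note u = logvf[OF lft_log[OF U(2)]]
    show "\<exists>U v. p \<in> U \<and> nlft V' (phi V t V' (s \<oplus>\<^bsub>sect N.Q V'\<^esub> s')) U v \<and> nlft V' (phi V t V' s \<oplus>\<^bsub>sect N.Q V'\<^esub> phi V t V' s') U v"
      using phi_lft[OF V' ss U(2) nlft_add[OF U(3,4)]] nlft_add[OF phi_lft[OF V' s(1) U(2,3)] phi_lft[OF V' s(2) U(2,4)]] U(1)
      unfolding bracket_add_right[OF nlftD(2)[OF U(3)] nlftD(2)[OF U(4)] u] by blast
  qed
qed

lemma phi_const:
  assumes V: "opY V" and t: "t \<in> \<Gamma>L V" and V': "V' \<in> opens Y V" and s: "s \<in> \<Gamma>N V'"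
  shows "phi V t V' ((\<lambda>x\<in>V'. c) \<odot>\<^bsub>sect N.Q V'\<^esub> s) = (\<lambda>x\<in>V'. c) \<odot>\<^bsub>sect N.Q V'\<^esub> phi V t V' s"
proof -
  note oV' = opensD(1)[OF V']
  note fs = N.Q_smult_closed[OF oV' s Y.hol_const[OF oV', of c]]
  show ?thesis
  proof (rule N_eqI[OF phi_ext[OF V' fs] N.Q_op_ext(3) oV'])
    fix p assume p: "p \<in> V'"
    obtain U u v where U: "p \<in> U" "L.lft V t U u" "nlft V' s U v" using ex_phi[OF V t V' s p openin_topspace top_at[OF oV' p]] by blast
    note u = logvf[OF lft_log[OF U(2)]] and d = nlftD[OF U(3)]
    note e = L.ext_to_const[OF d(1,4), of c]
    show "\<exists>U v. p \<in> U \<and> nlft V' (phi V t V' ((\<lambda>x\<in>V'. c) \<odot>\<^bsub>sect N.Q V'\<^esub> s)) U v \<and> nlft V' ((\<lambda>x\<in>V'. c) \<odot>\<^bsub>sect N.Q V'\<^esub> phi V t V' s) U v"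
      using phi_lft[OF V' fs U(2) nlft_smult[OF U(3) e oV']] nlft_smult[OF phi_lft[OF V' s U(2,3)] e oV'] U(1)
      unfolding bracket_const_right[OF d(1) u d(2)] by blast
  qed
qed

lemma phi_res:
  assumes V: "opY V" and t: "t \<in> \<Gamma>L V" and V': "V' \<in> opens Y V" and s: "s \<in> \<Gamma>N V'" and W: "W \<in> opens Y V'"
  shows "restrict (phi V t V' s) W = phi V t W (restrict s W)"
proof -
  note oW = opensD(1)[OF W] and WV = opens_trans[OF W V'] and sW = N.Q_restrict_closed[OF opensD(1)[OF V'] W s]
  show ?thesis
  proof (rule N_eqI[OF restrict_extensional phi_ext[OF WV sW] oW])
    fix p assume p: "p \<in> W"
    obtain M where M: "opX M" "p \<in> M" "M \<inter> D \<subseteq> W" using L.openY_trans[OF W p] by blast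
    obtain U u v where U: "p \<in> U" "U \<subseteq> M" "L.lft V t U u" "nlft V' s U v" using ex_phi[OF V t V' s opens_mem[OF W p] M(1,2)] by blast
    have UW: "U \<inter> D \<subseteq> W" using U(2) M(3) by blast
    show "\<exists>U v. p \<in> U \<and> nlft W (restrict (phi V t V' s) W) U v \<and> nlft W (phi V t W (restrict s W)) U v"
      using nlft_restrict[OF phi_lft[OF V' s U(3,4)] UW] phi_lft[OF WV sW U(3) nlft_restrict[OF U(4) UW]] U(1) by blast
  qed
qed

lemma phi_endos:
  assumes V: "opY V" and t: "t \<in> \<Gamma>L V"
  shows "phi V t \<in> sheaf_endos Y N.Q V"
  unfolding sheaf_endos_def N.Q_ops(4)
proof (intro CollectI conjI ballI allI)
  show "phi V t \<in> extensional (opens Y V)" by (simp add: phi_def)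
  fix V' assume V': "V' \<in> opens Y V"
  show "phi V t V' \<in> \<Gamma>N V' \<rightarrow>\<^sub>E \<Gamma>N V'"
  proof (rule PiE_I)
    show "phi V t V' s \<in> \<Gamma>N V'" if "s \<in> \<Gamma>N V'" for s by (rule phi_closed[OF V t V' that])
    show "phi V t V' s = undefined" if "s \<notin> \<Gamma>N V'" for s using V' that by (simp add: phi_def)
  qed
  show "phi V t V' (s \<oplus>\<^bsub>sect N.Q V'\<^esub> s') = phi V t V' s \<oplus>\<^bsub>sect N.Q V'\<^esub> phi V t V' s'"
    if "s \<in> \<Gamma>N V'" "s' \<in> \<Gamma>N V'" for s s' by (rule phi_add_right[OF V t V' that])
  show "phi V t V' ((\<lambda>x\<in>V'. c) \<odot>\<^bsub>sect N.Q V'\<^esub> s) = (\<lambda>x\<in>V'. c) \<odot>\<^bsub>sect N.Q V'\<^esub> phi V t V' s"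
    if "s \<in> \<Gamma>N V'" for s c by (rule phi_const[OF V t V' that])
  show "restrict (phi V t V' s) W = phi V t W (restrict s W)" if "W \<in> opens Y V'" "s \<in> \<Gamma>N V'" for s W
    by (rule phi_res[OF V t V' that(2,1)])
qed

lemma phi_symbol:
  assumes V: "opY V" and t: "t \<in> \<Gamma>L V"
  shows "is_symbol Y N.Q V (phi V t) (rho V t)"
  unfolding is_symbol_def using rho_spec(1)[OF V t] phi_leibniz[OF V t] by blast

section \<open>Linearity of the action and its compatibility with restriction and brackets\<close>

lemma endo_eqI:
  assumes "\<Delta> \<in> extensional (opens Y V)" "\<Delta>' \<in> extensional (opens Y V)"
    and "\<And>V'. V' \<in> opens Y V \<Longrightarrow> \<Delta> V' \<in> extensional (sections E V')" "\<And>V'. V' \<in> opens Y V \<Longrightarrow> \<Delta>' V' \<in> extensional (sections E V')"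
    and "\<And>V' s. V' \<in> opens Y V \<Longrightarrow> s \<in> sections E V' \<Longrightarrow> \<Delta> V' s = \<Delta>' V' s"
  shows "\<Delta> = \<Delta>'"
proof (rule extensionalityI[OF assms(1,2)])
  show "\<Delta> V' = \<Delta>' V'" if "V' \<in> opens Y V" for V'
    by (rule extensionalityI[OF assms(3,4)[OF that] assms(5)[OF that]])
qed

lemma phi_extensional:
  "phi V t \<in> extensional (opens Y V)" "V' \<in> opens Y V \<Longrightarrow> phi V t V' \<in> extensional (\<Gamma>N V')"
  by (simp_all add: phi_def)

lemma phi_add:
  assumes V: "opY V" and t: "t \<in> \<Gamma>L V" "t' \<in> \<Gamma>L V"
  shows "phi V (t \<oplus>\<^bsub>sect L.Q V\<^esub> t') = (\<lambda>V'\<in>opens Y V. \<lambda>s\<in>\<Gamma>N V'. phi V t V' s \<oplus>\<^bsub>sect N.Q V'\<^esub> phi V t' V' s)"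
proof (rule endo_eqI)
  fix V' s assume V': "V' \<in> opens Y V" and s: "s \<in> \<Gamma>N V'"
  have "phi V (t \<oplus>\<^bsub>sect L.Q V\<^esub> t') V' s = phi V t V' s \<oplus>\<^bsub>sect N.Q V'\<^esub> phi V t' V' s"
  proof (rule N_eqI[OF phi_ext[OF V' s] N.Q_op_ext(2) opensD(1)[OF V']])
    fix p assume p: "p \<in> V'"
    obtain U u u' v where U: "p \<in> U" "L.lft V t U u" "L.lft V t' U u'" "nlft V' s U v" using ex_phi2[OF V t V' s s p] by blast
    have "L.lft V (t \<oplus>\<^bsub>sect L.Q V\<^esub> t') U (vplus X U u u')" using L.lft_add[OF U(2,3)] by (simp only: op_simps)
    from phi_lft[OF V' s this U(4)] nlft_add[OF phi_lft[OF V' s U(2,4)] phi_lft[OF V' s U(3,4)]]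
    show "\<exists>U v. p \<in> U \<and> nlft V' (phi V (t \<oplus>\<^bsub>sect L.Q V\<^esub> t') V' s) U v \<and> nlft V' (phi V t V' s \<oplus>\<^bsub>sect N.Q V'\<^esub> phi V t' V' s) U v"
      using U(1) unfolding bracket_add_left[OF logvf[OF lft_log[OF U(2)]] logvf[OF lft_log[OF U(3)]] nlftD(2)[OF U(4)]] by blast
  qed
  then show "phi V (t \<oplus>\<^bsub>sect L.Q V\<^esub> t') V' s =
      (\<lambda>V'\<in>opens Y V. \<lambda>s\<in>\<Gamma>N V'. phi V t V' s \<oplus>\<^bsub>sect N.Q V'\<^esub> phi V t' V' s) V' s" using V' s by simp
qed (simp_all add: phi_extensional)

text \<open>The bracket itself is not linear over functions in its first argument, but the defect in
  \<open>[h u, v] = h [u, v] - v(h) u\<close> is a multiple of the tangent field \<open>u\<close>,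
  which is zero in the normal bundle.\<close>

lemma phi_smult:
  assumes V: "opY V" and t: "t \<in> \<Gamma>L V" and f: "f \<in> hol Y V"
  shows "phi V (f \<odot>\<^bsub>sect L.Q V\<^esub> t) = (\<lambda>V'\<in>opens Y V. \<lambda>s\<in>\<Gamma>N V'. restrict f V' \<odot>\<^bsub>sect N.Q V'\<^esub> phi V t V' s)"
proof (rule endo_eqI)
  fix V' s assume V': "V' \<in> opens Y V" and s: "s \<in> \<Gamma>N V'"
  have "phi V (f \<odot>\<^bsub>sect L.Q V\<^esub> t) V' s = restrict f V' \<odot>\<^bsub>sect N.Q V'\<^esub> phi V t V' s"
  proof (rule N_eqI[OF phi_ext[OF V' s] N.Q_op_ext(3) opensD(1)[OF V']])
    fix p assume p: "p \<in> V'"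
    obtain U u v h where U: "p \<in> U" "L.lft V t U u" "nlft V' s U v" "L.ext_to V f U h"
      using ex_phi_ext[OF V t V' s f V opens_mem[OF V' p] p] by blast
    note u = lft_log[OF U(2)] and v = nlftD(1,2,4)[OF U(3)] and h = L.ext_toD(3)[OF U(4)]
    note b = bracket_vf[OF logvf[OF u] v(2)]
    have "L.lft V (f \<odot>\<^bsub>sect L.Q V\<^esub> t) U (vscale X U h u)" using L.lft_smult[OF U(2,4) V] by (simp only: op_simps)
    note 1 = phi_lft[OF V' s this U(3)]
    have 2: "nlft V' (restrict f V' \<odot>\<^bsub>sect N.Q V'\<^esub> phi V t V' s) U (vscale X U h (brk U u v))"
      by (rule nlft_smult[OF phi_lft[OF V' s U(2,3)] L.ext_to_restrict[OF U(4) v(3)] opensD(1)[OF V']])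
    have k: "(\<lambda>y\<in>U. -1 * v U h y) \<in> hol X U" by (rule hol_scale[OF v(1) vf_hol[OF v(2) opens_refl[OF v(1)] h]])
    have c: "brk U (vscale X U h u) v \<in> VX U" "vscale X U h (brk U u v) \<in> VX U"
      by (intro bracket_vf vscale_vf v(1,2) h logvf[OF u])+
    have "vminus U (brk U (vscale X U h u) v) (vscale X U h (brk U u v)) = vscale X U (\<lambda>y\<in>U. -1 * v U h y) u"
    proof (rule vf_eqI[OF vminus_vf(1)[OF v(1) c] vscale_vf[OF v(1) k logvf[OF u]]])
      fix W g x assume W: "W \<in> opens X U" and g: "g \<in> hol X W" and x: "x \<in> W"
      show "vminus U (brk U (vscale X U h u) v) (vscale X U h (brk U u v)) W g x = vscale X U (\<lambda>y\<in>U. -1 * v U h y) u W g x"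
        by (simp only: vminus_apply[OF v(1) c W g x]) (simp only: bracket_scale_left[OF v(1) logvf[OF u] v(2) h] vplus_apply[OF W g x] add_diff_cancel_left')
    qed
    then have "nlft V' (phi V (f \<odot>\<^bsub>sect L.Q V\<^esub> t) V' s) U (vscale X U h (brk U u v))"
      by (intro nlft_change[OF 1 c(2)]) (simp only: L.S_scale[OF v(1) k u])
    then show "\<exists>U v. p \<in> U \<and> nlft V' (phi V (f \<odot>\<^bsub>sect L.Q V\<^esub> t) V' s) U v \<and> nlft V' (restrict f V' \<odot>\<^bsub>sect N.Q V'\<^esub> phi V t V' s) U v"
      using 2 U(1) by blast
  qed
  then show "phi V (f \<odot>\<^bsub>sect L.Q V\<^esub> t) V' s =
      (\<lambda>V'\<in>opens Y V. \<lambda>s\<in>\<Gamma>N V'. restrict f V' \<odot>\<^bsub>sect N.Q V'\<^esub> phi V t V' s) V' s" using V' s by simp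
qed (simp_all add: phi_extensional)

lemma phi_restrict:
  assumes V: "opY V" and t: "t \<in> \<Gamma>L V" and W: "W \<in> opens Y V"
  shows "restrict (phi V t) (opens Y W) = phi W (restrict t W)"
proof (rule endo_eqI)
  note tW = L.Q_restrict_closed[OF V W t]
  fix V' s assume V': "V' \<in> opens Y W" and s: "s \<in> \<Gamma>N V'"
  note V'V = opens_trans[OF V' W]
  have "phi V t V' s = phi W (restrict t W) V' s"
  proof (rule N_eqI[OF phi_ext[OF V'V s] phi_ext[OF V' s] opensD(1)[OF V']])
    fix p assume p: "p \<in> V'"
    obtain U u v where U: "p \<in> U" "L.lft V t U u" "nlft V' s U v"
      using ex_phi[OF V t V'V s p openin_topspace top_at[OF opensD(1)[OF V'] p]] by blast
    have "U \<inter> D \<subseteq> W" using nlftD(4)[OF U(3)] opensD(2)[OF V'] by blast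
    from phi_lft[OF V' s L.lft_restrict[OF U(2) this] U(3)] phi_lft[OF V'V s U(2,3)]
    show "\<exists>U v. p \<in> U \<and> nlft V' (phi V t V' s) U v \<and> nlft V' (phi W (restrict t W) V' s) U v" using U(1) by blast
  qed
  then show "restrict (phi V t) (opens Y W) V' s = phi W (restrict t W) V' s" using V' by simp
qed (simp_all add: phi_extensional opens_trans[OF _ W])

lemma phi_commutator:
  assumes V: "opY V" and t: "t \<in> \<Gamma>L V" "t' \<in> \<Gamma>L V"
  shows "phi V (beta V t t') = commutator Y N.Q V (phi V t) (phi V t')"
proof (rule endo_eqI)
  fix V' s assume V': "V' \<in> opens Y V" and s: "s \<in> \<Gamma>N V'"
  interpret abelian_group "sect N.Q V'" by (rule N.Q_abelian_group[OF opensD(1)[OF V']])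
  note c1 = phi_closed[OF V t(1) V' s] and c2 = phi_closed[OF V t(2) V' s]
  note c = phi_closed[OF V t(1) V' c2] phi_closed[OF V t(2) V' c1] phi_closed[OF V beta_closed[OF V t] V' s]
  \<comment> \<open>The Jacobi identity as
    \<open>[[u, u'], v] + [u', [u, v]] = [u, [u', v]]\<close>. Stated as a sum, it needs only lifts
    of sums; the difference in \<open>commutator\<close> is formed afterwards in the group of
    sections.\<close>
  have "phi V (beta V t t') V' s \<oplus>\<^bsub>sect N.Q V'\<^esub> phi V t' V' (phi V t V' s) = phi V t V' (phi V t' V' s)"
  proof (rule N_eqI[OF N.Q_op_ext(2) phi_ext[OF V' c2] opensD(1)[OF V']])
    fix p assume p: "p \<in> V'"
    obtain U u u' v where U: "p \<in> U" "L.lft V t U u" "L.lft V t' U u'" "nlft V' s U v" using ex_phi2[OF V t V' s s p] by blast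
    note w = logvf[OF lft_log[OF U(2)]] logvf[OF lft_log[OF U(3)]] nlftD(2)[OF U(4)]
    have "vplus X U (brk U (brk U u u') v) (brk U u' (brk U u v)) = brk U u (brk U u' v)"
    proof (rule vf_eqI)
      fix W f x assume W: "W \<in> opens X U" and f: "f \<in> hol X W" and x: "x \<in> W"
      show "vplus X U (brk U (brk U u u') v) (brk U u' (brk U u v)) W f x = brk U u (brk U u' v) W f x"
        unfolding vplus_apply[OF W f x] bracket_neg[OF bracket_vf[OF w(1,2)] w(3) W f x] bracket_bracket_apply[OF w(3,1,2) W f x]
          bracket_bracket_apply[OF w(2,1,3) W f x] bracket_bracket_apply[OF w(1,2,3) W f x] by simp
    qed (intro vplus_vf bracket_vf w)+
    then show "\<exists>U v. p \<in> U \<and> nlft V' (phi V (beta V t t') V' s \<oplus>\<^bsub>sect N.Q V'\<^esub> phi V t' V' (phi V t V' s)) U v \<and> nlft V' (phi V t V' (phi V t' V' s)) U v"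
      using U(1) nlft_add[OF phi_lft[OF V' s beta_lft[OF U(2,3)] U(4)] phi_lft[OF V' c1 U(3) phi_lft[OF V' s U(2,4)]]]
        phi_lft[OF V' c2 U(2) phi_lft[OF V' s U(3,4)]] by (simp only:) blast
  qed
  then have "phi V (beta V t t') V' s = phi V t V' (phi V t' V' s) \<ominus>\<^bsub>sect N.Q V'\<^esub> phi V t' V' (phi V t V' s)"
    using c(2,3) by (simp add: a_minus_def a_assoc r_neg flip: \<open>_ = phi V t V' (phi V t' V' s)\<close>)
  then show "phi V (beta V t t') V' s = commutator Y N.Q V (phi V t) (phi V t') V' s" using V' s by (simp add: commutator_def)
qed (simp_all add: phi_extensional commutator_def)

end

section \<open>Operators on the normal bundle and their coordinates in an adapted chart\<close>

lemma endosD: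
  assumes "\<Delta> \<in> sheaf_endos Y E V" "V' \<in> opens Y V"
  shows "s \<in> sections E V' \<Longrightarrow> \<Delta> V' s \<in> sections E V'"
    and "s \<in> sections E V' \<Longrightarrow> W \<in> opens Y V' \<Longrightarrow> res E V' W (\<Delta> V' s) = \<Delta> W (res E V' W s)"
    and "\<Delta> V' \<in> extensional (sections E V')"
  using assms unfolding sheaf_endos_def by (auto simp: PiE_def)

lemma endos_ext: "\<Delta> \<in> sheaf_endos Y E V \<Longrightarrow> \<Delta> \<in> extensional (opens Y V)"
  unfolding sheaf_endos_def by blast

lemma endos_restrict:
  assumes \<Delta>: "\<Delta> \<in> sheaf_endos Y E V" and W: "W \<in> opens Y V"
  shows "restrict \<Delta> (opens Y W) \<in> sheaf_endos Y E W"
proof -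
  have "opens Y V' \<subseteq> opens Y W" if "V' \<in> opens Y W" for V' using that opens_trans by blast
  then show ?thesis using assms opens_trans[OF _ W] unfolding sheaf_endos_def by (auto simp: subset_iff)
qed

lemma is_symbolD:
  "is_symbol Y E V \<Delta> \<sigma> \<Longrightarrow> \<sigma> \<in> vector_fields Y V"
  "is_symbol Y E V \<Delta> \<sigma> \<Longrightarrow> V' \<in> opens Y V \<Longrightarrow> f \<in> hol Y V' \<Longrightarrow> s \<in> sections E V' \<Longrightarrow>
     \<Delta> V' (f \<odot>\<^bsub>sect E V'\<^esub> s) = f \<odot>\<^bsub>sect E V'\<^esub> \<Delta> V' s \<oplus>\<^bsub>sect E V'\<^esub> \<sigma> V' f \<odot>\<^bsub>sect E V'\<^esub> s"
  unfolding is_symbol_def by blast+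

lemma (in ringed_space) symbol_restrict:
  assumes \<Delta>: "is_symbol X E V \<Delta> \<sigma>" and W: "W \<in> opens X V"
  shows "is_symbol X E W (restrict \<Delta> (opens X W)) (restrict \<sigma> (opens X W))"
  using is_symbolD[OF \<Delta>] vres_vf[OF _ W] opens_trans[OF _ W] unfolding is_symbol_def by auto

context adapted_divisor
begin

text \<open>Coordinates on \<open>D\<close> keep their index from \<open>X\<close>; coordinate
  \<open>i\<close> of the chart \<open>\<phi>D\<close> is \<open>ycrd (Suc i)\<close>.\<close>

definition ycrd :: "nat \<Rightarrow> 'a set \<Rightarrow> 'a \<Rightarrow> complex" where
  "ycrd i A = (\<lambda>x\<in>A. \<phi> x i)"

lemma ycrd_ext_to:
  assumes W: "W \<in> opens X U" "W \<inter> D \<subseteq> A" and i: "i < n"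
  shows "L.ext_to A (ycrd i A) W (crd i W)"
  unfolding L.ext_to_def using opensD(1)[OF W(1)] W(2) crd_hol[OF W(1) i] by (auto simp: ycrd_def crd_apply)

lemma ex_chart_lft:
  assumes A: "A \<in> opens Y (U \<inter> D)" and q: "q \<in> A" and t: "t \<in> \<Gamma>L A"
  obtains W u where "q \<in> W" "q \<in> D" "W \<subseteq> U" "W \<in> opens X U" "L.lft A t W u" "W \<inter> D \<subseteq> A"
proof -
  have qU: "q \<in> U" "q \<in> D" using opens_mem[OF A q] by auto
  obtain W u where W: "q \<in> W" "W \<subseteq> U" "L.lft A t W u" using L.ex_lft[OF t opensD(1)[OF A] q openU qU(1)] by blast
  have "W \<in> opens X U" using L.lftD(1)[OF W(3)] W(2) by (simp add: opens_def)
  then show thesis using that W L.lftD(2)[OF W(3)] qU by blast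
qed

lemma ycrd_hol:
  assumes A: "A \<in> opens Y (U \<inter> D)" and i: "i < n"
  shows "ycrd i A \<in> hol Y A"
proof (rule L.holY_I[OF opensD(1)[OF A]])
  show "ycrd i A \<in> extensional A" by (simp add: ycrd_def)
  fix q assume q: "q \<in> A"
  obtain M where M: "opX M" "q \<in> M" "M \<inter> D \<subseteq> A" using L.ex_zero[OF opensD(1)[OF A] q] by blast
  have "U \<inter> M \<in> opens X U" "U \<inter> M \<inter> D \<subseteq> A" "q \<in> U \<inter> M" using opens_Int(1)[OF openU M(1)] M opens_mem[OF A q] by auto
  then show "\<exists>W h. q \<in> W \<and> L.ext_to A (ycrd i A) W h" using ycrd_ext_to[OF _ _ i] by blast
qed

text \<open>For \<open>i \<noteq> 0\<close> the coefficient of a lift \<open>u\<close> is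
  \<open>u x\<^sub>i\<close>, and on \<open>D\<close> this is the anchor applied to the restricted
  coordinate.\<close>

lemma kappa_rho:
  assumes A: "A \<in> opens Y (U \<inter> D)" and t: "t \<in> \<Gamma>L A" and i: "i < n" "i \<noteq> 0" and q: "q \<in> A"
  shows "kappa i A t q = rho A t A (ycrd i A) q"
proof -
  obtain W u where W: "q \<in> W" "q \<in> D" "W \<subseteq> U" "W \<in> opens X U" "L.lft A t W u" "W \<inter> D \<subseteq> A" by (rule ex_chart_lft[OF A q t])
  note o = opensD(1)[OF A]
  show ?thesis
    using kappa_lft[OF W(5,3,1,2) i(1)] i(2)
      rho_value[OF o t W(5) opens_refl[OF o] ycrd_hol[OF A i(1)] ycrd_ext_to[OF W(4,6) i(1)] opens_refl[OF opensD(1)[OF W(4)]] W(1,2)]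
    by (simp add: coef_def)
qed

text \<open>In terms of a lift, \<open>[u, \<partial>\<^sub>0] x\<^sub>0 = u(1) - \<partial>\<^sub>0
  (u x\<^sub>0) = - c\<^sub>0\<close>; this is the origin of the sign.\<close>

lemma kappa_nu:
  assumes A: "A \<in> opens Y (U \<inter> D)" and t: "t \<in> \<Gamma>L A" and q: "q \<in> A"
  shows "kappa 0 A t q = - nu A (phi A t A (ngen A)) q"
proof -
  obtain W u where W: "q \<in> W" "q \<in> D" "W \<subseteq> U" "W \<in> opens X U" "L.lft A t W u" "W \<inter> D \<subseteq> A" by (rule ex_chart_lft[OF A q t])
  note o = opensD(1)[OF W(4)] and u = logvf[OF lft_log[OF W(5)]]
  note WW = opens_refl[OF o]
  let ?d = "restrict (dd 0) (opens X W)"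
  have d: "?d \<in> VX W" by (rule vres_vf[OF dd_vf[OF n_pos] W(4)])
  have dW: "?d W f = pd 0 W f" if "f \<in> hol X W" for f using dd_apply[OF W(4) that] WW by simp
  note c = crd_hol[OF W(4) n_pos]
  have uc: "u W (crd 0 W) \<in> hol X W" by (rule vf_hol[OF u WW c])
  have one: "pd 0 W (crd 0 W) = (\<lambda>x\<in>W. 1)"
    by (rule hol_eqI[OF o pd_hol[OF W(4) n_pos c] hol_const[OF o]]) (use pd_crd[OF W(4) n_pos, of _ 0] in simp)
  have "nu A (phi A t A (ngen A)) q = brk W u ?d W (crd 0 W) q"
    by (rule nu_lft[OF phi_lft[OF opens_refl[OF opensD(1)[OF A]] ngen_section[OF A] W(5) ngen_nlft[OF A W(4,6)]] W(3,1,2)])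
  also have "\<dots> = u W (\<lambda>x\<in>W. 1) q - pd 0 W (u W (crd 0 W)) q"
    using bracket_apply[OF u d WW c W(1)] dW[OF c] dW[OF uc] one by simp
  also have "\<dots> = - coef 0 W u q" using vf_const[OF u WW W(1), of 1] by (simp add: coef_def)
  finally show ?thesis using kappa_lft[OF W(5,3,1,2) n_pos] by simp
qed

text \<open>The coordinate expression \<open>vf_coordinates\<close>, applied to \<open>D\<close>
  with its own chart.\<close>

lemma Y_field_eqI:
  assumes A: "A \<in> opens Y (U \<inter> D)" and w: "w \<in> VY A" "w' \<in> VY A"
    and eq: "\<And>i q. i < n \<Longrightarrow> i \<noteq> 0 \<Longrightarrow> q \<in> A \<Longrightarrow> w A (ycrd i A) q = w' A (ycrd i A) q"
  shows "w = w'"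
proof (rule Y.vf_eqI[OF w])
  interpret C: mfd_chart Y "n - 1" "U \<inter> D" \<phi>D
    by (intro mfd_chart.intro Y.complex_mfd_axioms complex_chart.intro chart_D)
  fix V f q assume V: "V \<in> opens Y A" and f: "f \<in> hol Y V" and q: "q \<in> V"
  note VU = opens_trans[OF V A] and o = opensD(1)[OF A]
  \<comment> \<open>The index shifts by one between the chart of \<open>D\<close> and that of
    \<open>X\<close>.\<close>
  have e: "v V (C.crd i V) q = v A (ycrd (Suc i) A) q" if v: "v \<in> VY A" and i: "i < n - 1" for v i
  proof -
    have i': "Suc i < n" using i by simp
    have "C.crd i V = restrict (ycrd (Suc i) A) V"
      using i opensD(2)[OF V] by (auto simp: C.crd_def ycrd_def \<phi>D_def tail_def fun_eq_iff)
    then show ?thesis using Y.vf_res[OF v opens_refl[OF o] ycrd_hol[OF A i'] V q] by simp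
  qed
  show "w V f q = w' V f q"
    unfolding C.vf_coordinates[OF w(1) V VU f q] C.vf_coordinates[OF w(2) V VU f q]
  proof (rule sum.cong[OF refl])
    fix i assume "i \<in> {..<n - 1}"
    then have i: "i < n - 1" "Suc i < n" by auto
    show "w V (C.crd i V) q * C.pd i V f q = w' V (C.crd i V) q * C.pd i V f q"
      using e[OF w(1) i(1)] e[OF w(2) i(1)] eq[OF i(2) _ opens_mem[OF V q]] by simp
  qed
qed

lemma symbol_formula:
  assumes \<Delta>: "\<Delta> \<in> sheaf_endos Y N.Q V" and \<sigma>: "is_symbol Y N.Q V \<Delta> \<sigma>" and AV: "A \<in> opens Y V" and A: "A \<in> opens Y (U \<inter> D)"
    and f: "f \<in> hol Y A" and s: "s \<in> \<Gamma>N A" and q: "q \<in> A"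
  shows "nu A (\<Delta> A (f \<odot>\<^bsub>sect N.Q A\<^esub> s)) q = f q * nu A (\<Delta> A s) q + \<sigma> A f q * nu A s q"
proof -
  note o = opensD(1)[OF A] and d = endosD(1)[OF \<Delta> AV] and sf = Y.vf_hol[OF is_symbolD(1)[OF \<sigma>] AV f]
  show ?thesis unfolding is_symbolD(2)[OF \<sigma> AV f s]
    using nu_add[OF A N.Q_smult_closed[OF o d[OF s] f] N.Q_smult_closed[OF o s sf] q] nu_smult[OF A d[OF s] f q] nu_smult[OF A s sf q]
    by simp
qed

text \<open>The normal bundle is generated by \<open>ngen\<close>, so by the Leibniz rule the symbol
  and the value on the generator determine the operator.\<close>

lemma operator_eqI:
  assumes A: "A \<in> opens Y (U \<inter> D)" and \<Delta>: "\<Delta> \<in> sheaf_endos Y N.Q A" "\<Delta>' \<in> sheaf_endos Y N.Q A"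
    and \<sigma>: "is_symbol Y N.Q A \<Delta> \<sigma>" "is_symbol Y N.Q A \<Delta>' \<sigma>"
    and eq: "\<And>q. q \<in> A \<Longrightarrow> nu A (\<Delta> A (ngen A)) q = nu A (\<Delta>' A (ngen A)) q"
  shows "\<Delta> = \<Delta>'"
proof (rule endo_eqI[OF endos_ext[OF \<Delta>(1)] endos_ext[OF \<Delta>(2)] endosD(3)[OF \<Delta>(1)] endosD(3)[OF \<Delta>(2)]])
  fix B s assume B: "B \<in> opens Y A" and s: "s \<in> \<Gamma>N B"
  note BU = opens_trans[OF B A] and AA = opens_refl[OF opensD(1)[OF A]]
  note gA = ngen_section[OF A] and gB = ngen_section[OF BU] and h = nu_hol[OF BU s]
  have g: "restrict (ngen A) B = ngen B" using opensD(2)[OF B] by (simp add: ngen_def Int_absorb1)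
  have "\<Delta> A (ngen A) = \<Delta>' A (ngen A)" by (rule nu_inj[OF A endosD(1)[OF \<Delta>(1) AA gA] endosD(1)[OF \<Delta>(2) AA gA] eq])
  then have "\<Delta> B (ngen B) = \<Delta>' B (ngen B)"
    using endosD(2)[OF \<Delta>(1) AA gA B] endosD(2)[OF \<Delta>(2) AA gA B] g by (simp add: N.Q_ops(4))
  then have "\<Delta> B (nu B s \<odot>\<^bsub>sect N.Q B\<^esub> ngen B) = \<Delta>' B (nu B s \<odot>\<^bsub>sect N.Q B\<^esub> ngen B)"
    unfolding is_symbolD(2)[OF \<sigma>(1) B h gB] is_symbolD(2)[OF \<sigma>(2) B h gB] by simp
  then show "\<Delta> B s = \<Delta>' B s" using nu_decomp[OF BU s] by simp
qed

text \<open>Applied to \<open>f\<close> times the generator, whose coordinate is 1, the Leibniz rule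
  expresses the symbol in terms of the operator. That the normal bundle has rank one and not zero
  enters here.\<close>

lemma symbol_unique_local:
  assumes \<Delta>: "\<Delta> \<in> sheaf_endos Y N.Q V" and \<sigma>: "is_symbol Y N.Q V \<Delta> \<sigma>" "is_symbol Y N.Q V \<Delta> \<sigma>'"
    and A: "A \<in> opens Y V" "A \<in> opens Y (U \<inter> D)" and f: "f \<in> hol Y A" and q: "q \<in> A"
  shows "\<sigma> A f q = \<sigma>' A f q"
  using symbol_formula[OF \<Delta> \<sigma>(1) A f ngen_section[OF A(2)] q] symbol_formula[OF \<Delta> \<sigma>(2) A f ngen_section[OF A(2)] q] nu_ngen[OF A(2) q]
  by simp

lemma phi_local_inj:
  assumes A: "A \<in> opens Y (U \<inter> D)" and t: "t \<in> \<Gamma>L A" "t' \<in> \<Gamma>L A"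
    and p: "phi A t = phi A t'" and r: "rho A t = rho A t'"
  shows "t = t'"
proof (rule kappa_inj[OF A t])
  fix i q assume i: "i < n" and q: "q \<in> A"
  show "kappa i A t q = kappa i A t' q"
    using kappa_rho[OF A t(1) i _ q] kappa_rho[OF A t(2) i _ q] kappa_nu[OF A t(1) q] kappa_nu[OF A t(2) q] p r by (cases "i = 0") auto
qed

lemma phi_local_surj:
  assumes A: "A \<in> opens Y (U \<inter> D)" and \<Delta>: "\<Delta> \<in> sheaf_endos Y N.Q A" and \<sigma>: "is_symbol Y N.Q A \<Delta> \<sigma>"
  shows "\<exists>t\<in>\<Gamma>L A. phi A t = \<Delta>"
proof -
  note o = opensD(1)[OF A] and AA = opens_refl[OF opensD(1)[OF A]] and g = ngen_section[OF A]
  \<comment> \<open>The coefficients that \<open>kappa_nu\<close> and \<open>kappa_rho\<close> force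
    upon a preimage: minus the value of the operator on the generator, and the symbol applied to the
    other coordinates.\<close>
  define c where "c = (\<lambda>i. if i = 0 then (\<lambda>q\<in>A. -1 * nu A (\<Delta> A (ngen A)) q) else \<sigma> A (ycrd i A))"
  have c: "c i \<in> hol Y A" if "i < n" for i
    using Y.hol_scale[OF o nu_hol[OF A endosD(1)[OF \<Delta> AA g]], of "-1"] Y.vf_hol[OF is_symbolD(1)[OF \<sigma>] AA ycrd_hol[OF A that]]
    by (simp add: c_def)
  define t where "t = (\<Oplus>\<^bsub>sect L.Q A\<^esub>i\<in>{..<n}. c i \<odot>\<^bsub>sect L.Q A\<^esub> restrict (frame i) A)"
  interpret module "hol_ring Y A" "sect L.Q A" by (rule L.Q_module[OF o])
  have fr: "restrict (frame i) A \<in> \<Gamma>L A" if "i < n" for i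
    using L.Q_restrict_closed[OF L.openY_Int[OF openU] A frame_section] that by simp
  have t: "t \<in> \<Gamma>L A" unfolding t_def
    by (rule M.finsum_closed) (use L.Q_smult_closed[OF o fr c] in auto)
  have k: "kappa i A t q = c i q" if "i < n" "q \<in> A" for i q
  proof -
    have "kappa i A t q = (if i < n then c i q else 0)" unfolding t_def
      by (rule kappa_sum[OF A _ order_refl that]) (rule c)
    then show ?thesis using that(1) by simp
  qed
  have r: "rho A t = \<sigma>"
  proof (rule Y_field_eqI[OF A rho_spec(1)[OF o t] is_symbolD(1)[OF \<sigma>]])
    show "rho A t A (ycrd i A) q = \<sigma> A (ycrd i A) q" if "i < n" "i \<noteq> 0" "q \<in> A" for i q
      using kappa_rho[OF A t that] k[OF that(1,3)] that(2) by (simp add: c_def)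
  qed
  have "phi A t = \<Delta>"
  proof (rule operator_eqI[OF A phi_endos[OF o t] \<Delta> _ \<sigma>])
    show "is_symbol Y N.Q A (phi A t) \<sigma>" using phi_symbol[OF o t] r by simp
    show "nu A (phi A t A (ngen A)) q = nu A (\<Delta> A (ngen A)) q" if "q \<in> A" for q
      using kappa_nu[OF A t that] k[OF n_pos that] that by (simp add: c_def)
  qed
  then show ?thesis using t by blast
qed

end

section \<open>The action is bijective onto the Atiyah sheaf\<close>

context divisor
begin

lemma chart_cover:
  assumes V: "opY V" and p: "p \<in> V"
  obtains n U \<phi> A where "adapted_divisor X D n U \<phi>" "A \<in> opens Y V" "A \<in> opens Y (U \<inter> D)" "p \<in> A"
proof -
  have pD: "p \<in> D" using p L.openY_sub[OF V] by blast
  obtain n U \<phi> where U: "p \<in> U" "adapted_divisor X D n U \<phi>" by (rule adapted_divisor_at[OF pD])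
  interpret adapted_divisor X D n U \<phi> by (rule U(2))
  have "V \<inter> (U \<inter> D) \<in> opens Y V" "V \<inter> (U \<inter> D) \<in> opens Y (U \<inter> D)" "p \<in> V \<inter> (U \<inter> D)"
    using opens_Int[OF V L.openY_Int[OF openU]] p pD U(1) by auto
  then show thesis using that U(2) by blast
qed

lemma symbol_unique:
  assumes V: "opY V" and \<Delta>: "\<Delta> \<in> sheaf_endos Y N.Q V" and \<sigma>: "is_symbol Y N.Q V \<Delta> \<sigma>" "is_symbol Y N.Q V \<Delta> \<sigma>'"
  shows "\<sigma> = \<sigma>'"
proof (rule Y.vf_eqI[OF is_symbolD(1)[OF \<sigma>(1)] is_symbolD(1)[OF \<sigma>(2)]])
  fix V' f q assume V': "V' \<in> opens Y V" and f: "f \<in> hol Y V'" and q: "q \<in> V'"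
  obtain n U \<phi> A where U: "adapted_divisor X D n U \<phi>" and A: "A \<in> opens Y V'" "A \<in> opens Y (U \<inter> D)" "q \<in> A"
    by (rule chart_cover[OF opensD(1)[OF V'] q])
  have fA: "restrict f A \<in> hol Y A" by (rule Y.hol_restrict[OF opensD(1)[OF V'] A(1) f])
  show "\<sigma> V' f q = \<sigma>' V' f q"
    using adapted_divisor.symbol_unique_local[OF U \<Delta> \<sigma> opens_trans[OF A(1) V'] A(2) fA A(3)]
      Y.vf_res[OF is_symbolD(1)[OF \<sigma>(1)] V' f A(1,3)] Y.vf_res[OF is_symbolD(1)[OF \<sigma>(2)] V' f A(1,3)] by simp
qed

lemma anchor_phi:
  assumes V: "opY V" and t: "t \<in> \<Gamma>L V"
  shows "atiyah_anchor Y N.Q V (phi V t) = rho V t"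
  unfolding atiyah_anchor_def
  by (rule the_equality, rule phi_symbol[OF V t]) (rule symbol_unique[OF V phi_endos[OF V t] _ phi_symbol[OF V t]])

lemma phi_inj:
  assumes V: "opY V" and t: "t \<in> \<Gamma>L V" "t' \<in> \<Gamma>L V" and eq: "phi V t = phi V t'"
  shows "t = t'"
proof (rule extensionalityI[OF L.Q_ext[OF t(1)] L.Q_ext[OF t(2)]])
  fix p assume p: "p \<in> V"
  obtain n U \<phi> A where U: "adapted_divisor X D n U \<phi>" and A: "A \<in> opens Y V" "A \<in> opens Y (U \<inter> D)" "p \<in> A"
    by (rule chart_cover[OF V p])
  note o = opensD(1)[OF A(1)] and r = L.Q_restrict_closed[OF V A(1) t(1)] L.Q_restrict_closed[OF V A(1) t(2)]
  have e: "phi A (restrict t A) = phi A (restrict t' A)" using phi_restrict[OF V t(1) A(1)] phi_restrict[OF V t(2) A(1)] eq by simp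
  \<comment> \<open>The anchors agree because \<open>rho\<close> is recovered from the operator as
    its unique symbol. This yields the coefficients with \<open>i \<noteq> 0\<close>.\<close>
  then have "rho A (restrict t A) = rho A (restrict t' A)" using anchor_phi[OF o r(1)] anchor_phi[OF o r(2)] by simp
  from adapted_divisor.phi_local_inj[OF U A(2) r e this] have "restrict t A p = restrict t' A p" by simp
  then show "t p = t' p" using A(3) by simp
qed

text \<open>Local preimages exist in adapted charts; by injectivity they agree on overlaps, so they
  glue.\<close>

lemma phi_surj:
  assumes V: "opY V" and \<Delta>: "\<Delta> \<in> sheaf_endos Y N.Q V" and \<sigma>: "is_symbol Y N.Q V \<Delta> \<sigma>"
  shows "\<exists>t\<in>\<Gamma>L V. phi V t = \<Delta>"
proof -
  \<comment> \<open>All open sets over which a preimage exists, rather than a chosen family of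
    charts; \<open>cover\<close> shows that they exhaust \<open>V\<close>.\<close>
  define \<U> where "\<U> = {A \<in> opens Y V. \<exists>t\<in>\<Gamma>L A. phi A t = restrict \<Delta> (opens Y A)}"
  define s where "s = (\<lambda>A. SOME t. t \<in> \<Gamma>L A \<and> phi A t = restrict \<Delta> (opens Y A))"
  have s: "s A \<in> \<Gamma>L A" "phi A (s A) = restrict \<Delta> (opens Y A)" if "A \<in> \<U>" for A
  proof -
    have "\<exists>t. t \<in> \<Gamma>L A \<and> phi A t = restrict \<Delta> (opens Y A)" using that unfolding \<U>_def by blast
    from someI_ex[OF this] show "s A \<in> \<Gamma>L A" "phi A (s A) = restrict \<Delta> (opens Y A)" unfolding s_def by blast+
  qed
  have o: "A \<in> opens Y V" "opY A" if "A \<in> \<U>" for A using that opensD(1) unfolding \<U>_def by auto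
  have cover: "\<exists>A\<in>\<U>. p \<in> A" if p: "p \<in> V" for p
  proof -
    obtain n U \<phi> A where U: "adapted_divisor X D n U \<phi>" and A: "A \<in> opens Y V" "A \<in> opens Y (U \<inter> D)" "p \<in> A"
      by (rule chart_cover[OF V p])
    have "\<exists>t\<in>\<Gamma>L A. phi A t = restrict \<Delta> (opens Y A)"
      by (rule adapted_divisor.phi_local_surj[OF U A(2) endos_restrict[OF \<Delta> A(1)] Y.symbol_restrict[OF \<sigma> A(1)]])
    then show ?thesis using A unfolding \<U>_def by blast
  qed
  have un: "\<Union>\<U> = V" using cover opensD(2)[OF o(1)] by blast
  have "\<exists>!t. t \<in> \<Gamma>L (\<Union>\<U>) \<and> (\<forall>U\<in>\<U>. restrict t U = s U)"
  proof (rule L.Q_glue)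
    show "opY A \<and> s A \<in> \<Gamma>L A" if "A \<in> \<U>" for A using o s that by blast
    fix A B assume A: "A \<in> \<U>" and B: "B \<in> \<U>"
    note i = opens_Int[OF o(2)[OF A] o(2)[OF B]]
    have "opens Y (A \<inter> B) \<subseteq> opens Y A" "opens Y (A \<inter> B) \<subseteq> opens Y B" by (auto simp: opens_def)
    then have "restrict (restrict \<Delta> (opens Y A)) (opens Y (A \<inter> B)) = restrict (restrict \<Delta> (opens Y B)) (opens Y (A \<inter> B))"
      by (simp add: Int_absorb1)
    then have "phi (A \<inter> B) (restrict (s A) (A \<inter> B)) = phi (A \<inter> B) (restrict (s B) (A \<inter> B))"
      using phi_restrict[OF o(2)[OF A] s(1)[OF A] i(1)] phi_restrict[OF o(2)[OF B] s(1)[OF B] i(2)] s(2)[OF A] s(2)[OF B] by simp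
    then show "restrict (s A) (A \<inter> B) = restrict (s B) (A \<inter> B)"
      by (rule phi_inj[OF opensD(1)[OF i(1)] L.Q_restrict_closed[OF o(2)[OF A] i(1) s(1)[OF A]] L.Q_restrict_closed[OF o(2)[OF B] i(2) s(1)[OF B]]])
  qed
  then obtain t where t: "t \<in> \<Gamma>L V" "\<And>A. A \<in> \<U> \<Longrightarrow> restrict t A = s A" unfolding un by blast
  have "phi V t = \<Delta>"
  proof (rule endo_eqI[OF phi_extensional(1) endos_ext[OF \<Delta>] phi_extensional(2) endosD(3)[OF \<Delta>]])
    fix V' r assume V': "V' \<in> opens Y V" and r: "r \<in> \<Gamma>N V'"
    note c = phi_closed[OF V t(1) V' r] endosD(1)[OF \<Delta> V' r]
    show "phi V t V' r = \<Delta> V' r"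
    proof (rule extensionalityI[OF N.Q_ext[OF c(1)] N.Q_ext[OF c(2)]])
      fix p assume p: "p \<in> V'"
      obtain A where A: "A \<in> \<U>" "p \<in> A" using cover opens_mem[OF V' p] by blast
      define B where "B = V' \<inter> A"
      have B: "B \<in> opens Y V'" "B \<in> opens Y A" "p \<in> B" using opens_Int[OF opensD(1)[OF V'] o(2)[OF A(1)]] p A(2) by (auto simp: B_def)
      have "restrict (phi V t) (opens Y A) B = restrict \<Delta> (opens Y A) B"
        using phi_restrict[OF V t(1) o(1)[OF A(1)]] t(2)[OF A(1)] s(2)[OF A(1)] by simp
      then have "phi V t B = \<Delta> B" using B(2) by simp
      then have "restrict (phi V t V' r) B = restrict (\<Delta> V' r) B"
        using phi_res[OF V t(1) V' r B(1)] endosD(2)[OF \<Delta> V' r B(1)] by (simp add: N.Q_ops(4))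
      from fun_cong[OF this, of p] show "phi V t V' r p = \<Delta> V' r p" using B(3) by simp
    qed
  qed
  then show ?thesis using t(1) by blast
qed

text \<open>Additivity alone does not give this in the Atiyah sheaf, which is not yet known to be a
  group; the equation \<open>z = z + z\<close> is instead solved in the sections of the normal
  bundle.\<close>

lemma phi_zero:
  assumes V: "opY V"
  shows "phi V \<zero>\<^bsub>sect L.Q V\<^esub> = (\<lambda>V'\<in>opens Y V. \<lambda>s\<in>\<Gamma>N V'. \<zero>\<^bsub>sect N.Q V'\<^esub>)"
proof (rule endo_eqI)
  fix V' s assume V': "V' \<in> opens Y V" and s: "s \<in> \<Gamma>N V'"
  interpret A: abelian_group "sect L.Q V" by (rule L.Q_abelian_group[OF V])
  interpret B: abelian_group "sect N.Q V'" by (rule N.Q_abelian_group[OF opensD(1)[OF V']])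
  note z = A.zero_closed and c = phi_closed[OF V A.zero_closed V' s]
  have "phi V (\<zero>\<^bsub>sect L.Q V\<^esub> \<oplus>\<^bsub>sect L.Q V\<^esub> \<zero>\<^bsub>sect L.Q V\<^esub>) V' s = phi V \<zero>\<^bsub>sect L.Q V\<^esub> V' s \<oplus>\<^bsub>sect N.Q V'\<^esub> phi V \<zero>\<^bsub>sect L.Q V\<^esub> V' s"
    unfolding phi_add[OF V z z] using V' s by simp
  then have e: "phi V \<zero>\<^bsub>sect L.Q V\<^esub> V' s = phi V \<zero>\<^bsub>sect L.Q V\<^esub> V' s \<oplus>\<^bsub>sect N.Q V'\<^esub> phi V \<zero>\<^bsub>sect L.Q V\<^esub> V' s"
    unfolding A.l_zero[OF z] .
  have "phi V \<zero>\<^bsub>sect L.Q V\<^esub> V' s = \<zero>\<^bsub>sect N.Q V'\<^esub>"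
    by (rule iffD1[OF B.add.l_cancel_one'[OF c c] e])
  then show "phi V \<zero>\<^bsub>sect L.Q V\<^esub> V' s = (\<lambda>V'\<in>opens Y V. \<lambda>s\<in>\<Gamma>N V'. \<zero>\<^bsub>sect N.Q V'\<^esub>) V' s" using V' s by simp
qed (simp_all add: phi_extensional)

lemma phi_bij:
  assumes V: "opY V"
  shows "bij_betw (phi V) (\<Gamma>L V) {\<Delta> \<in> sheaf_endos Y N.Q V. \<exists>\<sigma>. is_symbol Y N.Q V \<Delta> \<sigma>}"
  unfolding bij_betw_def
proof
  show "inj_on (phi V) (\<Gamma>L V)" using phi_inj[OF V] by (auto simp: inj_on_def)
  show "phi V ` \<Gamma>L V = {\<Delta> \<in> sheaf_endos Y N.Q V. \<exists>\<sigma>. is_symbol Y N.Q V \<Delta> \<sigma>}"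
    using phi_endos[OF V] phi_symbol[OF V] phi_surj[OF V] by blast
qed

end

section \<open>Transport of structure\<close>

text \<open>At the outset \<open>M\<close> is a bare record of operations. A family of bijections
  that respects them makes \<open>M\<close> a sheaf of modules, and a bundle if \<open>L\<close> is
  one, with no computation in \<open>M\<close>. The condition on zero is listed separately because
  cancellation in \<open>M\<close> is only available afterwards.\<close>

locale sheaf_transport =
  fixes Y :: "'a cspace" and L :: "('a, 's) msheaf" and M :: "('a, 't) msheaf" and \<phi> :: "'a set \<Rightarrow> 's \<Rightarrow> 't"
  assumes fs: "function_sheaf Y"
    and sheaf: "sheaf_of_modules Y L"
    and bij: "openin (points Y) U \<Longrightarrow> bij_betw (\<phi> U) (sections L U) (sections M U)"
    and zero: "openin (points Y) U \<Longrightarrow> \<phi> U \<zero>\<^bsub>sect L U\<^esub> = \<zero>\<^bsub>sect M U\<^esub>"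
    and add: "openin (points Y) U \<Longrightarrow> s \<in> sections L U \<Longrightarrow> t \<in> sections L U \<Longrightarrow> \<phi> U (s \<oplus>\<^bsub>sect L U\<^esub> t) = \<phi> U s \<oplus>\<^bsub>sect M U\<^esub> \<phi> U t"
    and smult: "openin (points Y) U \<Longrightarrow> f \<in> hol Y U \<Longrightarrow> s \<in> sections L U \<Longrightarrow> \<phi> U (f \<odot>\<^bsub>sect L U\<^esub> s) = f \<odot>\<^bsub>sect M U\<^esub> \<phi> U s"
    and res: "openin (points Y) U \<Longrightarrow> V \<in> opens Y U \<Longrightarrow> s \<in> sections L U \<Longrightarrow> res M U V (\<phi> U s) = \<phi> V (res L U V s)"
begin

lemma im: "openin (points Y) U \<Longrightarrow> s \<in> sections L U \<Longrightarrow> \<phi> U s \<in> sections M U"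
  using bij bij_betwE by blast

lemma pre:
  assumes "openin (points Y) U" "x \<in> sections M U"
  obtains s where "s \<in> sections L U" "x = \<phi> U s"
  using bij_betw_imp_surj_on[OF bij[OF assms(1)]] assms(2) by blast

lemma inj: "openin (points Y) U \<Longrightarrow> s \<in> sections L U \<Longrightarrow> t \<in> sections L U \<Longrightarrow> \<phi> U s = \<phi> U t \<Longrightarrow> s = t"
  using bij_betw_imp_inj_on[OF bij] by (auto dest: inj_onD)

lemma L_module: "openin (points Y) U \<Longrightarrow> module (hol_ring Y U) (sect L U)"
  and L_res: "openin (points Y) U \<Longrightarrow> V \<in> opens Y U \<Longrightarrow> s \<in> sections L U \<Longrightarrow> res L U V s \<in> sections L V"
  and L_res_self: "openin (points Y) U \<Longrightarrow> s \<in> sections L U \<Longrightarrow> res L U U s = s"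
  and L_res_add: "openin (points Y) U \<Longrightarrow> V \<in> opens Y U \<Longrightarrow> s \<in> sections L U \<Longrightarrow> t \<in> sections L U \<Longrightarrow>
    res L U V (s \<oplus>\<^bsub>sect L U\<^esub> t) = res L U V s \<oplus>\<^bsub>sect L V\<^esub> res L U V t"
  and L_res_smult: "openin (points Y) U \<Longrightarrow> V \<in> opens Y U \<Longrightarrow> f \<in> hol Y U \<Longrightarrow> s \<in> sections L U \<Longrightarrow>
    res L U V (f \<odot>\<^bsub>sect L U\<^esub> s) = restrict f V \<odot>\<^bsub>sect L V\<^esub> res L U V s"
  and L_res_res: "openin (points Y) U \<Longrightarrow> V \<in> opens Y U \<Longrightarrow> W \<in> opens Y V \<Longrightarrow> s \<in> sections L U \<Longrightarrow>
    res L V W (res L U V s) = res L U W s"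
  using sheaf unfolding sheaf_of_modules_def by simp_all

lemma L_glue:
  assumes "\<And>U. U \<in> \<U> \<Longrightarrow> openin (points Y) U \<and> s U \<in> sections L U"
    and "\<And>U V. U \<in> \<U> \<Longrightarrow> V \<in> \<U> \<Longrightarrow> res L U (U \<inter> V) (s U) = res L V (U \<inter> V) (s V)"
  shows "\<exists>!t. t \<in> sections L (\<Union>\<U>) \<and> (\<forall>U\<in>\<U>. res L (\<Union>\<U>) U t = s U)"
  using assms conjunct2[OF sheaf[unfolded sheaf_of_modules_def], rule_format, of \<U> s] by blast

lemma M_module:
  assumes U: "openin (points Y) U"
  shows "module (hol_ring Y U) (sect M U)"
proof -
  interpret module "hol_ring Y U" "sect L U" by (rule L_module[OF U])
  note [simp] = add[OF U, symmetric] smult[OF U, symmetric] zero[OF U, symmetric] im[OF U]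
  have sc: "f \<odot>\<^bsub>sect L U\<^esub> s \<in> sections L U" if "f \<in> hol Y U" "s \<in> sections L U" for f s
    using smult_closed[of f s] that by simp
  show ?thesis
  proof (rule moduleI[OF R.is_cring])
    show "abelian_group (sect M U)"
    proof (rule abelian_groupI)
      show "\<zero>\<^bsub>sect M U\<^esub> \<in> sections M U" by simp
      fix x assume "x \<in> sections M U"
      then obtain s where s [simp]: "s \<in> sections L U" "x = \<phi> U s" by (rule pre[OF U])
      show "\<zero>\<^bsub>sect M U\<^esub> \<oplus>\<^bsub>sect M U\<^esub> x = x" by simp
      show "\<exists>y\<in>sections M U. y \<oplus>\<^bsub>sect M U\<^esub> x = \<zero>\<^bsub>sect M U\<^esub>"
        by (rule bexI[of _ "\<phi> U (\<ominus>\<^bsub>sect L U\<^esub> s)"]) (simp_all add: M.l_neg)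
      fix y assume "y \<in> sections M U"
      then obtain t where t [simp]: "t \<in> sections L U" "y = \<phi> U t" by (rule pre[OF U])
      show "x \<oplus>\<^bsub>sect M U\<^esub> y \<in> sections M U" by simp
      show "x \<oplus>\<^bsub>sect M U\<^esub> y = y \<oplus>\<^bsub>sect M U\<^esub> x" by (simp add: M.a_comm)
      fix z assume "z \<in> sections M U"
      then obtain r where r [simp]: "r \<in> sections L U" "z = \<phi> U r" by (rule pre[OF U])
      show "x \<oplus>\<^bsub>sect M U\<^esub> y \<oplus>\<^bsub>sect M U\<^esub> z = x \<oplus>\<^bsub>sect M U\<^esub> (y \<oplus>\<^bsub>sect M U\<^esub> z)" by (simp add: M.a_assoc)
    qed
    fix x assume "x \<in> sections M U"
    then obtain s where s [simp]: "s \<in> sections L U" "x = \<phi> U s" by (rule pre[OF U])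
    have one: "\<one>\<^bsub>hol_ring Y U\<^esub> \<in> hol Y U" using R.one_closed by (simp only: hol_ring_simps(1))
    show "\<one>\<^bsub>hol_ring Y U\<^esub> \<odot>\<^bsub>sect M U\<^esub> x = x"
      using smult[OF U one s(1)] smult_one[OF s(1)] by (simp only: s(2))
    fix f assume "f \<in> carrier (hol_ring Y U)"
    then have f: "f \<in> hol Y U" by simp
    show "f \<odot>\<^bsub>sect M U\<^esub> x \<in> sections M U" by (simp add: f sc)
    show "f \<odot>\<^bsub>sect M U\<^esub> (x \<oplus>\<^bsub>sect M U\<^esub> y) = f \<odot>\<^bsub>sect M U\<^esub> x \<oplus>\<^bsub>sect M U\<^esub> f \<odot>\<^bsub>sect M U\<^esub> y" if y: "y \<in> sections M U" for y
    proof -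
      obtain t where t [simp]: "t \<in> sections L U" "y = \<phi> U t" using y by (rule pre[OF U])
      show ?thesis using smult_r_distr[of f s t] by (simp add: f sc)
    qed
    fix g assume "g \<in> carrier (hol_ring Y U)"
    then have g: "g \<in> hol Y U" by simp
    have fg: "f \<oplus>\<^bsub>hol_ring Y U\<^esub> g \<in> hol Y U" "f \<otimes>\<^bsub>hol_ring Y U\<^esub> g \<in> hol Y U"
      using R.a_closed[of f g] R.m_closed[of f g] f g by (simp_all only: hol_ring_simps(1))
    show "(f \<oplus>\<^bsub>hol_ring Y U\<^esub> g) \<odot>\<^bsub>sect M U\<^esub> x = f \<odot>\<^bsub>sect M U\<^esub> x \<oplus>\<^bsub>sect M U\<^esub> g \<odot>\<^bsub>sect M U\<^esub> x"
      using smult_l_distr[of f g s] f g fg(1)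
      by (simp only: s hol_ring_simps(1) smult[OF U, symmetric] add[OF U, symmetric] sc)
    show "(f \<otimes>\<^bsub>hol_ring Y U\<^esub> g) \<odot>\<^bsub>sect M U\<^esub> x = f \<odot>\<^bsub>sect M U\<^esub> (g \<odot>\<^bsub>sect M U\<^esub> x)"
      using smult_assoc1[of f g s] f g fg(2)
      by (simp only: s hol_ring_simps(1) smult[OF U, symmetric] sc)
  qed
qed

lemma M_sheaf: "sheaf_of_modules Y M"
  unfolding sheaf_of_modules_def
proof (intro conjI allI impI ballI)
  fix U assume U: "openin (points Y) U"
  show "module (hol_ring Y U) (sect M U)" by (rule M_module[OF U])
  interpret L: module "hol_ring Y U" "sect L U" by (rule L_module[OF U])
  show "res M U U x = x" if "x \<in> sections M U" for x
    by (rule pre[OF U that]) (simp add: res[OF U opens_refl[OF U]] L_res_self[OF U])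
  fix V assume V: "V \<in> opens Y U"
  note oV = opensD(1)[OF V]
  interpret LV: module "hol_ring Y V" "sect L V" by (rule L_module[OF oV])
  fix x assume x: "x \<in> sections M U"
  then obtain s where s: "s \<in> sections L U" "x = \<phi> U s" by (rule pre[OF U])
  show "res M U V x \<in> sections M V" unfolding s(2) res[OF U V s(1)] by (rule im[OF oV L_res[OF U V s(1)]])
  show "res M U V (x \<oplus>\<^bsub>sect M U\<^esub> y) = res M U V x \<oplus>\<^bsub>sect M V\<^esub> res M U V y" if y: "y \<in> sections M U" for y
  proof -
    obtain t where t: "t \<in> sections L U" "y = \<phi> U t" using y by (rule pre[OF U])
    show ?thesis using res[OF U V L.M.a_closed[OF s(1) t(1)]] res[OF U V s(1)] res[OF U V t(1)] L_res_add[OF U V s(1) t(1)]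
        add[OF U s(1) t(1)] add[OF oV L_res[OF U V s(1)] L_res[OF U V t(1)]] by (simp only: s(2) t(2))
  qed
  show "res M U V (f \<odot>\<^bsub>sect M U\<^esub> x) = restrict f V \<odot>\<^bsub>sect M V\<^esub> res M U V x" if f: "f \<in> hol Y U" for f
    using function_sheaf_restrict[OF fs U V f] res[OF U V, of "f \<odot>\<^bsub>sect L U\<^esub> s"] L.smult_closed[of f s] res[OF U V s(1)] L_res_smult[OF U V f s(1)]
      smult[OF U f s(1)] smult[OF oV _ L_res[OF U V s(1)]] f s(1) by (simp add: s(2))
  show "res M V W (res M U V x) = res M U W x" if W: "W \<in> opens Y V" for W
    using res[OF oV W L_res[OF U V s(1)]] res[OF U V s(1)] res[OF U opens_trans[OF W V] s(1)] L_res_res[OF U V W s(1)]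
    by (simp only: s(2))
next
  fix \<U> x assume x: "\<forall>U\<in>\<U>. openin (points Y) U \<and> x U \<in> sections M U"
    and c: "\<forall>U\<in>\<U>. \<forall>V\<in>\<U>. res M U (U \<inter> V) (x U) = res M V (U \<inter> V) (x V)"
  define s where "s U = inv_into (sections L U) (\<phi> U) (x U)" for U
  have s: "s U \<in> sections L U" "\<phi> U (s U) = x U" if "U \<in> \<U>" for U
  proof -
    have "x U \<in> \<phi> U ` sections L U" using x that bij_betw_imp_surj_on[OF bij] by blast
    then show "s U \<in> sections L U" "\<phi> U (s U) = x U" unfolding s_def by (rule inv_into_into, rule f_inv_into_f)
  qed
  have o: "openin (points Y) U" if "U \<in> \<U>" for U using x that by blast
  have oU: "openin (points Y) (\<Union>\<U>)" using o by blast
  have sub: "U \<in> opens Y (\<Union>\<U>)" if "U \<in> \<U>" for U using o[OF that] that by (auto simp: opens_def)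
  have "\<exists>!t. t \<in> sections L (\<Union>\<U>) \<and> (\<forall>U\<in>\<U>. res L (\<Union>\<U>) U t = s U)"
  proof (rule L_glue)
    show "openin (points Y) U \<and> s U \<in> sections L U" if "U \<in> \<U>" for U using o s that by blast
    fix U V assume U: "U \<in> \<U>" and V: "V \<in> \<U>"
    note i = opens_Int[OF o[OF U] o[OF V]]
    show "res L U (U \<inter> V) (s U) = res L V (U \<inter> V) (s V)"
    proof (rule inj[OF opensD(1)[OF i(1)] L_res[OF o[OF U] i(1) s(1)[OF U]] L_res[OF o[OF V] i(2) s(1)[OF V]]])
      show "\<phi> (U \<inter> V) (res L U (U \<inter> V) (s U)) = \<phi> (U \<inter> V) (res L V (U \<inter> V) (s V))"
        unfolding res[OF o[OF U] i(1) s(1)[OF U], symmetric] res[OF o[OF V] i(2) s(1)[OF V], symmetric] s(2)[OF U] s(2)[OF V]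
        by (rule bspec[OF bspec[OF c U] V])
    qed
  qed
  then obtain t where t': "t \<in> sections L (\<Union>\<U>) \<and> (\<forall>U\<in>\<U>. res L (\<Union>\<U>) U t = s U)"
    and un': "\<forall>t'. t' \<in> sections L (\<Union>\<U>) \<and> (\<forall>U\<in>\<U>. res L (\<Union>\<U>) U t' = s U) \<longrightarrow> t' = t" by (rule ex1E)
  note t = conjunct1[OF t'] bspec[OF conjunct2[OF t']]
  have un: "r = t" if "r \<in> sections L (\<Union>\<U>)" "\<And>U. U \<in> \<U> \<Longrightarrow> res L (\<Union>\<U>) U r = s U" for r
    by (rule mp[OF spec[OF un']]) (intro conjI ballI that)
  show "\<exists>!y. y \<in> sections M (\<Union>\<U>) \<and> (\<forall>U\<in>\<U>. res M (\<Union>\<U>) U y = x U)"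
  proof (rule ex1I)
    show "\<phi> (\<Union>\<U>) t \<in> sections M (\<Union>\<U>) \<and> (\<forall>U\<in>\<U>. res M (\<Union>\<U>) U (\<phi> (\<Union>\<U>) t) = x U)"
      using im[OF oU t(1)] res[OF oU sub t(1)] t(2) s(2) by simp
    fix y assume y: "y \<in> sections M (\<Union>\<U>) \<and> (\<forall>U\<in>\<U>. res M (\<Union>\<U>) U y = x U)"
    obtain r where r: "r \<in> sections L (\<Union>\<U>)" "y = \<phi> (\<Union>\<U>) r" using y by (auto elim: pre[OF oU])
    have "r = t"
    proof (rule un[OF r(1)])
      fix U assume U: "U \<in> \<U>"
      show "res L (\<Union>\<U>) U r = s U"
        by (rule inj[OF o[OF U] L_res[OF oU sub[OF U] r(1)] s(1)[OF U]]) (use y U r(2) s(2)[OF U] res[OF oU sub[OF U] r(1)] in simp)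
    qed
    then show "y = \<phi> (\<Union>\<U>) t" using r(2) by simp
  qed
qed

lemma finsum:
  fixes k :: nat
  assumes U: "openin (points Y) U" and s: "\<And>i. i < k \<Longrightarrow> s i \<in> sections L U"
  shows "\<phi> U (\<Oplus>\<^bsub>sect L U\<^esub>i\<in>{..<k}. s i) = (\<Oplus>\<^bsub>sect M U\<^esub>i\<in>{..<k}. \<phi> U (s i))"
  using s
proof (induction k)
  interpret L: module "hol_ring Y U" "sect L U" by (rule L_module[OF U])
  interpret M: module "hol_ring Y U" "sect M U" by (rule M_module[OF U])
  case 0
  show ?case using zero[OF U] by simp
next
  interpret L: module "hol_ring Y U" "sect L U" by (rule L_module[OF U])
  interpret M: module "hol_ring Y U" "sect M U" by (rule M_module[OF U])
  case (Suc k)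
  have S: "(\<Oplus>\<^bsub>sect L U\<^esub>i\<in>{..<k}. s i) \<in> sections L U" by (rule L.M.finsum_closed) (use Suc.prems in auto)
  have "(\<Oplus>\<^bsub>sect L U\<^esub>i\<in>{..<Suc k}. s i) = s k \<oplus>\<^bsub>sect L U\<^esub> (\<Oplus>\<^bsub>sect L U\<^esub>i\<in>{..<k}. s i)"
    unfolding lessThan_Suc using Suc.prems by (subst L.M.finsum_insert) auto
  moreover have "(\<Oplus>\<^bsub>sect M U\<^esub>i\<in>{..<Suc k}. \<phi> U (s i)) = \<phi> U (s k) \<oplus>\<^bsub>sect M U\<^esub> (\<Oplus>\<^bsub>sect M U\<^esub>i\<in>{..<k}. \<phi> U (s i))"
    unfolding lessThan_Suc using Suc.prems im[OF U] by (subst M.M.finsum_insert) auto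
  ultimately show ?case using add[OF U Suc.prems[OF lessI] S] Suc.IH Suc.prems by simp
qed

text \<open>The coefficients of a section of \<open>M\<close> in the image frame are those of its
  preimage in \<open>L\<close>, so existence and uniqueness carry over together.\<close>

lemma M_frame:
  assumes U: "openin (points Y) U" and e: "local_frame Y L U r e"
  shows "local_frame Y M U r (\<lambda>i. \<phi> U (e i))"
  unfolding local_frame_def
proof (intro conjI allI impI ballI)
  have eL: "e i \<in> sections L U" if "i < r" for i using e that unfolding local_frame_def by blast
  show "\<phi> U (e i) \<in> sections M U" if "i < r" for i by (rule im[OF U eL[OF that]])
  fix V x assume V: "V \<in> opens Y U" and x: "x \<in> sections M V"
  note o = opensD(1)[OF V]
  interpret L: module "hol_ring Y V" "sect L V" by (rule L_module[OF o])
  interpret M: module "hol_ring Y V" "sect M V" by (rule M_module[OF o])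
  obtain s where s: "s \<in> sections L V" "x = \<phi> V s" using x by (rule pre[OF o])
  let ?S = "\<lambda>c. \<Oplus>\<^bsub>sect L V\<^esub>i\<in>{..<r}. c i \<odot>\<^bsub>sect L V\<^esub> res L U V (e i)"
  let ?S' = "\<lambda>c. \<Oplus>\<^bsub>sect M V\<^esub>i\<in>{..<r}. c i \<odot>\<^bsub>sect M V\<^esub> res M U V (\<phi> U (e i))"
  have cl: "c i \<odot>\<^bsub>sect L V\<^esub> res L U V (e i) \<in> sections L V" if "c \<in> {..<r} \<rightarrow>\<^sub>E hol Y V" "i < r" for c i
    using L.smult_closed[of "c i" "res L U V (e i)"] L_res[OF U V eL[OF that(2)]] PiE_mem[OF that(1), of i] that(2) by simp
  have eq: "\<phi> V (?S c) = ?S' c" if c: "c \<in> {..<r} \<rightarrow>\<^sub>E hol Y V" for c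
  proof -
    have "\<phi> V (?S c) = (\<Oplus>\<^bsub>sect M V\<^esub>i\<in>{..<r}. \<phi> V (c i \<odot>\<^bsub>sect L V\<^esub> res L U V (e i)))" by (rule finsum[OF o cl[OF c]])
    also have "\<dots> = ?S' c"
    proof (rule M.M.finsum_cong'[OF refl])
      show "(\<lambda>i. c i \<odot>\<^bsub>sect M V\<^esub> res M U V (\<phi> U (e i))) \<in> {..<r} \<rightarrow> sections M V"
      proof (rule Pi_I)
        fix i assume i: "i \<in> {..<r}"
        then show "c i \<odot>\<^bsub>sect M V\<^esub> res M U V (\<phi> U (e i)) \<in> sections M V"
          using M.smult_closed[of "c i" "res M U V (\<phi> U (e i))"] PiE_mem[OF c i] res[OF U V eL] im[OF o L_res[OF U V eL]] by simp
      qed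
      show "\<phi> V (c i \<odot>\<^bsub>sect L V\<^esub> res L U V (e i)) = c i \<odot>\<^bsub>sect M V\<^esub> res M U V (\<phi> U (e i))" if "i \<in> {..<r}" for i
        using smult[OF o _ L_res[OF U V eL], of "c i" i] res[OF U V eL, of i] PiE_mem[OF c that] that by simp
    qed
    finally show ?thesis .
  qed
  have iff: "x = ?S' c \<longleftrightarrow> s = ?S c" if c: "c \<in> {..<r} \<rightarrow>\<^sub>E hol Y V" for c
  proof -
    have S: "?S c \<in> sections L V" by (rule L.M.finsum_closed) (use cl[OF c] in auto)
    show ?thesis unfolding eq[OF c, symmetric] s(2)
    proof
      show "\<phi> V s = \<phi> V (?S c) \<Longrightarrow> s = ?S c" by (rule inj[OF o s(1) S])
      show "s = ?S c \<Longrightarrow> \<phi> V s = \<phi> V (?S c)" by (rule arg_cong)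
    qed
  qed
  have "\<exists>!c. c \<in> {..<r} \<rightarrow>\<^sub>E hol Y V \<and> s = ?S c" using e V s(1) unfolding local_frame_def by blast
  moreover have "(c \<in> {..<r} \<rightarrow>\<^sub>E hol Y V \<and> x = ?S' c) \<longleftrightarrow> (c \<in> {..<r} \<rightarrow>\<^sub>E hol Y V \<and> s = ?S c)" for c
    using iff by (rule conj_cong[OF refl])
  ultimately show "\<exists>!c. c \<in> {..<r} \<rightarrow>\<^sub>E hol Y V \<and> x = ?S' c" by simp
qed

lemma M_bundle: "vector_bundle Y L \<Longrightarrow> vector_bundle Y M"
  using M_sheaf M_frame unfolding vector_bundle_def by meson

end

text \<open>Every section of \<open>M\<close> is the image of a section of \<open>L\<close>, so each
  law for \<open>M\<close> is the image under \<open>\<phi>\<close> of the law for \<open>L\<close>.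
  The map \<open>\<phi>\<close> then also witnesses the isomorphism.\<close>

lemma lie_algebroid_transport:
  assumes L: "lie_algebroid Y L \<rho> \<beta>" and T: "sheaf_transport Y L M \<phi>"
    and anchor: "\<And>U s. openin (points Y) U \<Longrightarrow> s \<in> sections L U \<Longrightarrow> \<rho>' U (\<phi> U s) = \<rho> U s"
    and bracket: "\<And>U s t. openin (points Y) U \<Longrightarrow> s \<in> sections L U \<Longrightarrow> t \<in> sections L U \<Longrightarrow> \<beta>' U (\<phi> U s) (\<phi> U t) = \<phi> U (\<beta> U s t)"
  shows "lie_algebroid_isomorphic Y L \<rho> \<beta> M \<rho>' \<beta>'"
proof -
  interpret sheaf_transport Y L M \<phi> by (rule T)
  have mfd: "complex_manifold Y" and vb: "vector_bundle Y L" and hom: "sheaf_hom Y L (tangent_sheaf Y) \<rho>"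
    using L unfolding lie_algebroid_def by blast+
  note L4 = conjunct2[OF conjunct2[OF conjunct2[OF L[unfolded lie_algebroid_def]]], rule_format]
  have laws: "\<beta> U u v \<in> sections L U" "V \<in> opens Y U \<Longrightarrow> res L U V (\<beta> U u v) = \<beta> V (res L U V u) (res L U V v)"
    "w \<in> sections L U \<Longrightarrow> \<beta> U (u \<oplus>\<^bsub>sect L U\<^esub> v) w = \<beta> U u w \<oplus>\<^bsub>sect L U\<^esub> \<beta> U v w"
    "w \<in> sections L U \<Longrightarrow> \<beta> U w (u \<oplus>\<^bsub>sect L U\<^esub> v) = \<beta> U w u \<oplus>\<^bsub>sect L U\<^esub> \<beta> U w v"
    "w \<in> sections L U \<Longrightarrow> \<beta> U u (\<beta> U v w) \<oplus>\<^bsub>sect L U\<^esub> \<beta> U v (\<beta> U w u) \<oplus>\<^bsub>sect L U\<^esub> \<beta> U w (\<beta> U u v) = \<zero>\<^bsub>sect L U\<^esub>"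
    "\<beta> U ((\<lambda>x\<in>U. c) \<odot>\<^bsub>sect L U\<^esub> u) v = (\<lambda>x\<in>U. c) \<odot>\<^bsub>sect L U\<^esub> \<beta> U u v"
    "\<beta> U u ((\<lambda>x\<in>U. c) \<odot>\<^bsub>sect L U\<^esub> v) = (\<lambda>x\<in>U. c) \<odot>\<^bsub>sect L U\<^esub> \<beta> U u v"
    "\<beta> U u u = \<zero>\<^bsub>sect L U\<^esub>"
    "f \<in> hol Y U \<Longrightarrow> \<beta> U u (f \<odot>\<^bsub>sect L U\<^esub> v) = f \<odot>\<^bsub>sect L U\<^esub> \<beta> U u v \<oplus>\<^bsub>sect L U\<^esub> \<rho> U u U f \<odot>\<^bsub>sect L U\<^esub> v"
    if "openin (points Y) U" "u \<in> sections L U" "v \<in> sections L U" for U V u v w c f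
  proof -
    note K = L4[OF that]
    note K1 = conjunct2[OF K] and K2 = conjunct2[OF conjunct2[OF K]] and K3 = conjunct2[OF conjunct2[OF conjunct2[OF K]]]
    note K4 = bspec[OF conjunct1[OF K2]] and K5 = spec[OF conjunct1[OF K3]] and K6 = conjunct2[OF K3]
    show "\<beta> U u v \<in> sections L U" by (rule conjunct1[OF K])
    show "res L U V (\<beta> U u v) = \<beta> V (res L U V u) (res L U V v)" if "V \<in> opens Y U" by (rule bspec[OF conjunct1[OF K1] that])
    show "\<beta> U (u \<oplus>\<^bsub>sect L U\<^esub> v) w = \<beta> U u w \<oplus>\<^bsub>sect L U\<^esub> \<beta> U v w" if "w \<in> sections L U" by (rule conjunct1[OF K4[OF that]])
    show "\<beta> U w (u \<oplus>\<^bsub>sect L U\<^esub> v) = \<beta> U w u \<oplus>\<^bsub>sect L U\<^esub> \<beta> U w v" if "w \<in> sections L U" by (rule conjunct1[OF conjunct2[OF K4[OF that]]])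
    show "\<beta> U u (\<beta> U v w) \<oplus>\<^bsub>sect L U\<^esub> \<beta> U v (\<beta> U w u) \<oplus>\<^bsub>sect L U\<^esub> \<beta> U w (\<beta> U u v) = \<zero>\<^bsub>sect L U\<^esub>" if "w \<in> sections L U"
      by (rule conjunct2[OF conjunct2[OF K4[OF that]]])
    show "\<beta> U ((\<lambda>x\<in>U. c) \<odot>\<^bsub>sect L U\<^esub> u) v = (\<lambda>x\<in>U. c) \<odot>\<^bsub>sect L U\<^esub> \<beta> U u v" by (rule conjunct1[OF K5])
    show "\<beta> U u ((\<lambda>x\<in>U. c) \<odot>\<^bsub>sect L U\<^esub> v) = (\<lambda>x\<in>U. c) \<odot>\<^bsub>sect L U\<^esub> \<beta> U u v" by (rule conjunct2[OF K5])
    show "\<beta> U u u = \<zero>\<^bsub>sect L U\<^esub>" by (rule conjunct1[OF K6])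
    show "\<beta> U u (f \<odot>\<^bsub>sect L U\<^esub> v) = f \<odot>\<^bsub>sect L U\<^esub> \<beta> U u v \<oplus>\<^bsub>sect L U\<^esub> \<rho> U u U f \<odot>\<^bsub>sect L U\<^esub> v" if "f \<in> hol Y U"
      by (rule bspec[OF conjunct2[OF K6] that])
  qed
  note H = hom[unfolded sheaf_hom_def, rule_format]
  have hom_laws: "\<rho> U u \<in> sections (tangent_sheaf Y) U"
    "v \<in> sections L U \<Longrightarrow> \<rho> U (u \<oplus>\<^bsub>sect L U\<^esub> v) = \<rho> U u \<oplus>\<^bsub>sect (tangent_sheaf Y) U\<^esub> \<rho> U v"
    "f \<in> hol Y U \<Longrightarrow> \<rho> U (f \<odot>\<^bsub>sect L U\<^esub> u) = f \<odot>\<^bsub>sect (tangent_sheaf Y) U\<^esub> \<rho> U u"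
    "V \<in> opens Y U \<Longrightarrow> res (tangent_sheaf Y) U V (\<rho> U u) = \<rho> V (res L U V u)"
    if U: "openin (points Y) U" and u: "u \<in> sections L U" for U V u v f
  proof -
    note h = H[OF U]
    note h1 = conjunct2[OF h] and h2 = conjunct2[OF conjunct2[OF h]]
    show "\<rho> U u \<in> sections (tangent_sheaf Y) U" by (rule bspec[OF conjunct1[OF h] u])
    show "\<rho> U (u \<oplus>\<^bsub>sect L U\<^esub> v) = \<rho> U u \<oplus>\<^bsub>sect (tangent_sheaf Y) U\<^esub> \<rho> U v" if "v \<in> sections L U"
      by (rule bspec[OF bspec[OF conjunct1[OF h1] u] that])
    show "\<rho> U (f \<odot>\<^bsub>sect L U\<^esub> u) = f \<odot>\<^bsub>sect (tangent_sheaf Y) U\<^esub> \<rho> U u" if "f \<in> hol Y U"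
      by (rule bspec[OF bspec[OF conjunct1[OF h2] that] u])
    show "res (tangent_sheaf Y) U V (\<rho> U u) = \<rho> V (res L U V u)" if "V \<in> opens Y U"
      by (rule bspec[OF bspec[OF conjunct2[OF h2] that] u])
  qed
  have rh: "\<rho> U u \<in> vector_fields Y U" if "openin (points Y) U" "u \<in> sections L U" for U u
    using hom_laws(1)[OF that] by (simp add: tangent_sheaf_def op_simps)
  interpret Y: complex_mfd Y by (rule complex_mfd.intro[OF mfd])
  have M: "lie_algebroid Y M \<rho>' \<beta>'"
    unfolding lie_algebroid_def
  proof (intro conjI allI impI ballI mfd M_bundle[OF vb])
    show "sheaf_hom Y M (tangent_sheaf Y) \<rho>'"
      unfolding sheaf_hom_def
    proof (intro conjI allI impI ballI)
      fix U x assume U: "openin (points Y) U" and x: "x \<in> sections M U"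
      interpret L: module "hol_ring Y U" "sect L U" by (rule L_module[OF U])
      obtain s where s: "s \<in> sections L U" "x = \<phi> U s" using x by (rule pre[OF U])
      show "\<rho>' U x \<in> sections (tangent_sheaf Y) U" using hom_laws(1)[OF U s(1)] anchor[OF U s(1)] s(2) by simp
      show "\<rho>' U (x \<oplus>\<^bsub>sect M U\<^esub> y) = \<rho>' U x \<oplus>\<^bsub>sect (tangent_sheaf Y) U\<^esub> \<rho>' U y" if y: "y \<in> sections M U" for y
      proof -
        obtain t where t: "t \<in> sections L U" "y = \<phi> U t" using y by (rule pre[OF U])
        show ?thesis using hom_laws(2)[OF U s(1) t(1)] anchor[OF U s(1)] anchor[OF U t(1)] anchor[OF U L.M.a_closed[OF s(1) t(1)]] add[OF U s(1) t(1)] s(2) t(2) by simp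
      qed
      show "\<rho>' U (f \<odot>\<^bsub>sect M U\<^esub> x) = f \<odot>\<^bsub>sect (tangent_sheaf Y) U\<^esub> \<rho>' U x" if f: "f \<in> hol Y U" for f
      proof -
        have fs: "f \<odot>\<^bsub>sect L U\<^esub> s \<in> sections L U" using L.smult_closed[of f s] f s(1) by simp
        show ?thesis using hom_laws(3)[OF U s(1) f] anchor[OF U s(1)] anchor[OF U fs] smult[OF U f s(1)] s(2) by simp
      qed
      show "res (tangent_sheaf Y) U V (\<rho>' U x) = \<rho>' V (res M U V x)" if V: "V \<in> opens Y U" for V
        using hom_laws(4)[OF U s(1) V] anchor[OF U s(1)] anchor[OF opensD(1)[OF V] L_res[OF U V s(1)]] res[OF U V s(1)] s(2) by simp
    qed
    fix U x y assume U: "openin (points Y) U" and x: "x \<in> sections M U" and y: "y \<in> sections M U"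
    interpret L: module "hol_ring Y U" "sect L U" by (rule L_module[OF U])
    obtain s where s: "s \<in> sections L U" "x = \<phi> U s" using x by (rule pre[OF U])
    obtain t where t: "t \<in> sections L U" "y = \<phi> U t" using y by (rule pre[OF U])
    note st = laws[OF U s(1) t(1)] and b = bracket[OF U] and bc = laws(1)[OF U]
    have sm: "f \<odot>\<^bsub>sect L U\<^esub> r \<in> sections L U" if "f \<in> hol Y U" "r \<in> sections L U" for f r
      using L.smult_closed[of f r] that by simp
    note c = Y.hol_const[OF U]
    show "\<beta>' U x y \<in> sections M U" using im[OF U bc[OF s(1) t(1)]] b[OF s(1) t(1)] s(2) t(2) by simp
    show "res M U V (\<beta>' U x y) = \<beta>' V (res M U V x) (res M U V y)" if V: "V \<in> opens Y U" for V
      using res[OF U V bc[OF s(1) t(1)]] st(2)[OF V] b[OF s(1) t(1)] res[OF U V s(1)] res[OF U V t(1)]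
        bracket[OF opensD(1)[OF V] L_res[OF U V s(1)] L_res[OF U V t(1)]] s(2) t(2) by simp
    show "\<beta>' U ((\<lambda>x\<in>U. a) \<odot>\<^bsub>sect M U\<^esub> x) y = (\<lambda>x\<in>U. a) \<odot>\<^bsub>sect M U\<^esub> \<beta>' U x y" for a
      unfolding s(2) t(2) b[OF s(1) t(1)] smult[OF U c s(1), symmetric] smult[OF U c bc[OF s(1) t(1)], symmetric]
        b[OF sm[OF c s(1)] t(1)] st(6) ..
    show "\<beta>' U x ((\<lambda>x\<in>U. a) \<odot>\<^bsub>sect M U\<^esub> y) = (\<lambda>x\<in>U. a) \<odot>\<^bsub>sect M U\<^esub> \<beta>' U x y" for a
      unfolding s(2) t(2) b[OF s(1) t(1)] smult[OF U c t(1), symmetric] smult[OF U c bc[OF s(1) t(1)], symmetric]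
        b[OF s(1) sm[OF c t(1)]] st(7) ..
    show "\<beta>' U x x = \<zero>\<^bsub>sect M U\<^esub>" unfolding s(2) b[OF s(1) s(1)] st(8) by (rule zero[OF U])
    show "\<beta>' U x (f \<odot>\<^bsub>sect M U\<^esub> y) = f \<odot>\<^bsub>sect M U\<^esub> \<beta>' U x y \<oplus>\<^bsub>sect M U\<^esub> \<rho>' U x U f \<odot>\<^bsub>sect M U\<^esub> y" if f: "f \<in> hol Y U" for f
    proof -
      have r: "\<rho> U s U f \<in> hol Y U" by (rule Y.vf_hol[OF rh[OF U s(1)] opens_refl[OF U] f])
      show ?thesis
        unfolding s(2) t(2) b[OF s(1) t(1)] anchor[OF U s(1)] smult[OF U f t(1), symmetric] smult[OF U r t(1), symmetric]
          smult[OF U f bc[OF s(1) t(1)], symmetric] add[OF U sm[OF f bc[OF s(1) t(1)]] sm[OF r t(1)], symmetric]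
          b[OF s(1) sm[OF f t(1)]] st(9)[OF f] ..
    qed
    fix z assume z: "z \<in> sections M U"
    obtain r where r: "r \<in> sections L U" "z = \<phi> U r" using z by (rule pre[OF U])
    note a = L.M.a_closed
    show "\<beta>' U (x \<oplus>\<^bsub>sect M U\<^esub> y) z = \<beta>' U x z \<oplus>\<^bsub>sect M U\<^esub> \<beta>' U y z"
      unfolding s(2) t(2) r(2) add[OF U s(1) t(1), symmetric] b[OF a[OF s(1) t(1)] r(1)] b[OF s(1) r(1)] b[OF t(1) r(1)]
        add[OF U bc[OF s(1) r(1)] bc[OF t(1) r(1)], symmetric] st(3)[OF r(1)] ..
    show "\<beta>' U z (x \<oplus>\<^bsub>sect M U\<^esub> y) = \<beta>' U z x \<oplus>\<^bsub>sect M U\<^esub> \<beta>' U z y"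
      unfolding s(2) t(2) r(2) add[OF U s(1) t(1), symmetric] b[OF r(1) a[OF s(1) t(1)]] b[OF r(1) s(1)] b[OF r(1) t(1)]
        add[OF U bc[OF r(1) s(1)] bc[OF r(1) t(1)], symmetric] st(4)[OF r(1)] ..
    show "\<beta>' U x (\<beta>' U y z) \<oplus>\<^bsub>sect M U\<^esub> \<beta>' U y (\<beta>' U z x) \<oplus>\<^bsub>sect M U\<^esub> \<beta>' U z (\<beta>' U x y) = \<zero>\<^bsub>sect M U\<^esub>"
    proof -
      note i = bc[OF t(1) r(1)] bc[OF r(1) s(1)] bc[OF s(1) t(1)]
      note j = bc[OF s(1) i(1)] bc[OF t(1) i(2)] bc[OF r(1) i(3)]
      show ?thesis
        unfolding s(2) t(2) r(2) b[OF t(1) r(1)] b[OF r(1) s(1)] b[OF s(1) t(1)] b[OF s(1) i(1)] b[OF t(1) i(2)] b[OF r(1) i(3)]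
          add[OF U j(1,2), symmetric] add[OF U a[OF j(1,2)] j(3), symmetric] st(5)[OF r(1)] by (rule zero[OF U])
    qed
  qed
  have "sheaf_hom Y L M \<phi>"
    unfolding sheaf_hom_def by (intro allI impI conjI ballI im add smult res)
  then show ?thesis unfolding lie_algebroid_isomorphic_def
    by (intro conjI exI[of _ \<phi>] allI impI ballI L M bij anchor bracket[symmetric])
qed

lemma (in divisor) phi_transport: "sheaf_transport Y L.Q (atiyah_sheaf Y N.Q) phi"
proof unfold_locales
  show "function_sheaf Y" by (rule Y.fs)
  show "sheaf_of_modules Y L.Q" by (rule L.Q_sheaf)
  fix U assume U: "openin (points Y) U"
  show "bij_betw (phi U) (sections L.Q U) (sections (atiyah_sheaf Y N.Q) U)"
    using phi_bij[OF U] by (simp add: atiyah_sheaf_def operator_sheaf_def mk_module_def)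
  show "phi U \<zero>\<^bsub>sect L.Q U\<^esub> = \<zero>\<^bsub>sect (atiyah_sheaf Y N.Q) U\<^esub>"
    using phi_zero[OF U] by (simp add: atiyah_sheaf_def operator_sheaf_def mk_module_def)
  fix s assume s: "s \<in> sections L.Q U"
  show "phi U (s \<oplus>\<^bsub>sect L.Q U\<^esub> t) = phi U s \<oplus>\<^bsub>sect (atiyah_sheaf Y N.Q) U\<^esub> phi U t" if "t \<in> sections L.Q U" for t
    using phi_add[OF U s that] by (simp add: atiyah_sheaf_def operator_sheaf_def mk_module_def)
  show "phi U (f \<odot>\<^bsub>sect L.Q U\<^esub> s) = f \<odot>\<^bsub>sect (atiyah_sheaf Y N.Q) U\<^esub> phi U s" if "f \<in> hol Y U" for f
    using phi_smult[OF U s that] by (simp add: atiyah_sheaf_def operator_sheaf_def mk_module_def)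
  show "res (atiyah_sheaf Y N.Q) U V (phi U s) = phi V (res L.Q U V s)" if "V \<in> opens Y U" for V
  proof -
    have "res (atiyah_sheaf Y N.Q) U V (phi U s) = restrict (phi U s) (opens Y V)" by (simp add: atiyah_sheaf_def operator_sheaf_def)
    then show ?thesis using phi_restrict[OF U s that] by (simp only: L.Q_ops(4))
  qed
qed

theorem theorem3p4:
  fixes X :: "'a cspace" and D :: "'a set"
  assumes "complex_manifold X" and "smooth_divisor X D"
  shows "\<exists>\<rho> \<beta>. lie_algebroid (subspace_of X D) (log_restriction X D) \<rho> \<beta> \<and>
           anchor_by_restriction X D \<rho> \<and>
           bracket_by_lifting X D \<beta> \<and>
           lie_algebroid_isomorphic (subspace_of X D)
             (log_restriction X D) \<rho> \<beta>
             (atiyah_sheaf (subspace_of X D) (normal_bundle X D))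
             (atiyah_anchor (subspace_of X D) (normal_bundle X D))
             (commutator (subspace_of X D) (normal_bundle X D))"
proof -
  interpret divisor X D by (intro divisor.intro complex_mfd.intro divisor_axioms.intro assms)
  have L: "lie_algebroid (subspace_of X D) L.Q rho beta" by (rule L_algebroid[OF L_vector_bundle])
  have "lie_algebroid_isomorphic (subspace_of X D) L.Q rho beta (atiyah_sheaf (subspace_of X D) N.Q)
      (atiyah_anchor (subspace_of X D) N.Q) (commutator (subspace_of X D) N.Q)"
    by (rule lie_algebroid_transport[OF L phi_transport]) (simp_all add: anchor_phi phi_commutator)
  then show ?thesis unfolding log_restriction_eq normal_bundle_eq
    using L anchor_rho bracket_lifting_beta by blast
qed

end
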